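(* Let $n\geq 2$, let $c\in\mathbb{R}$, and let $(M^n,g)$ be an $n$-dimensional smooth compact connected oriented Einstein manifold with nonempty smooth boundary $\partial M$ and Einstein constant $\lambda=(n-1)c$, i.e. $\mathrm{Ric}=(n-1)c\,g$. Let $f:M\to\mathbb{R}$ be a smooth function such that its gradient $\overline{\nabla} f$ is a nonzero (i.e. not identically zero) conformal vector field on $M$. Suppose that $\overline{\Delta} f$ is nonconstant and that $\overline{\Delta} f=0$ on $\partial M$. Then $c>0$ and $(M,g)$ is isometric to a hemisphere $\mathbb{S}^n_+(c)$.
   Context: $\overline{\nabla}$ and $\overline{\Delta}$ (the trace of the Hessian $\overline{\nabla}^2$) denote the Riemannian connection/gradient and the Laplacian of $(M,g)$. A smooth vector field $\xi$ on $M$ is conformal if $\mathcal{L}_\xi g=2\rho g$ for some smooth function $\rho$ on $M$, where $\mathcal{L}_\xi$ is the Lie derivative. $\mathbb{S}^n(c)$ is the round $n$-sphere of constant sectional curvature $c$, and $\mathbb{S}^n_+(c)$ is a closed hemisphere of it (with totally geodesic boundary an equator). *)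

theory Defs
  imports "HOL-Analysis.Analysis"
begin

section \<open>Smooth maps on subsets of Euclidean spaces\<close>

primrec Ck_on :: "nat \<Rightarrow> 'e::euclidean_space set \<Rightarrow> ('e \<Rightarrow> 'f::real_normed_vector) \<Rightarrow> bool"
  where
    "Ck_on 0 = (\<lambda>W F. continuous_on W F)"
  | "Ck_on (Suc k) = (\<lambda>W F. F differentiable_on W \<and>
        (\<forall>v. Ck_on k W (\<lambda>x. frechet_derivative F (at x) v)))"

text \<open>A map on an arbitrary subset is smooth if near each point of the subset it is the
  restriction of a \<open>C\<^sup>\<infinity>\<close> map on an open set of the ambient space. This covers both relatively
  open subsets of a half-space and embedded submanifolds (with boundary).\<close>

definition smooth_on :: "'e::euclidean_space set \<Rightarrow> ('e \<Rightarrow> 'f::real_normed_vector) \<Rightarrow> bool"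
  where "smooth_on S u \<longleftrightarrow>
    (\<forall>x\<in>S. \<exists>W F. open W \<and> x \<in> W \<and> (\<forall>k. Ck_on k W F) \<and> (\<forall>y\<in>S \<inter> W. F y = u y))"

section \<open>The model half-space\<close>

text \<open>Which coordinate is used to cut out the half-space is immaterial; the index type \<open>'n\<close>
  carries no order, so one coordinate is fixed arbitrarily.\<close>

definition bdry_index :: "'n::finite"
  where "bdry_index = (SOME i. True)"

definition half_space :: "(real ^ 'n) set"
  where "half_space = {x. 0 \<le> x $ bdry_index}"

definition half_space_boundary :: "(real ^ 'n) set"
  where "half_space_boundary = {x. x $ bdry_index = 0}"

text \<open>Derivatives are taken within the half-space, so that they also make sense (and are
  uniquely determined) at boundary points, where they agree with the derivatives of any
  smooth extension.\<close>

definition pd :: "'n \<Rightarrow> (real ^ 'n \<Rightarrow> 'f::real_normed_vector) \<Rightarrow> real ^ 'n \<Rightarrow> 'f"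
  where "pd i u x = frechet_derivative u (at x within half_space) (axis i 1)"

section \<open>Riemannian geometry in coordinates\<close>

text \<open>Here \<open>G\<close> is the matrix-valued function \<open>(g\<^sub>i\<^sub>j)\<close> of components of a metric.
  \<open>christoffel G k i j\<close> is \<open>\<Gamma>\<^sup>k\<^sub>i\<^sub>j\<close>, that is, the \<open>k\<close>-th component of \<open>\<nabla>\<^sub>i \<partial>\<^sub>j\<close>
  for the Levi-Civita connection.\<close>

definition christoffel ::
  "(real ^ 'n \<Rightarrow> real ^ 'n ^ 'n) \<Rightarrow> 'n \<Rightarrow> 'n \<Rightarrow> 'n \<Rightarrow> real ^ 'n \<Rightarrow> real"
  where "christoffel G k i j x =
    (\<Sum>l\<in>UNIV. matrix_inv (G x) $ k $ l *
      (pd i (\<lambda>y. G y $ j $ l) x + pd j (\<lambda>y. G y $ i $ l) x - pd l (\<lambda>y. G y $ i $ j) x)) / 2"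

text \<open>\<open>riemann G l k i j\<close> is the \<open>l\<close>-th component of \<open>R(\<partial>\<^sub>i, \<partial>\<^sub>j) \<partial>\<^sub>k\<close>, where
  \<open>R(X, Y) Z = \<nabla>\<^sub>X \<nabla>\<^sub>Y Z - \<nabla>\<^sub>Y \<nabla>\<^sub>X Z - \<nabla>\<^sub>[\<^sub>X\<^sub>,\<^sub>Y\<^sub>] Z\<close>; the Ricci tensor \<open>Ric(Y, Z)\<close> is the
  trace of \<open>X \<mapsto> R(X, Y) Z\<close>, which is positive on round spheres.\<close>

definition riemann ::
  "(real ^ 'n \<Rightarrow> real ^ 'n ^ 'n) \<Rightarrow> 'n \<Rightarrow> 'n \<Rightarrow> 'n \<Rightarrow> 'n \<Rightarrow> real ^ 'n \<Rightarrow> real"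
  where "riemann G l k i j x =
    pd i (christoffel G l j k) x - pd j (christoffel G l i k) x
    + (\<Sum>m\<in>UNIV. christoffel G l i m x * christoffel G m j k x
                - christoffel G l j m x * christoffel G m i k x)"

definition ricci ::
  "(real ^ 'n \<Rightarrow> real ^ 'n ^ 'n) \<Rightarrow> 'n \<Rightarrow> 'n \<Rightarrow> real ^ 'n \<Rightarrow> real"
  where "ricci G j k x = (\<Sum>i\<in>UNIV. riemann G i k i j x)"

definition local_gradient ::
  "(real ^ 'n \<Rightarrow> real ^ 'n ^ 'n) \<Rightarrow> (real ^ 'n \<Rightarrow> real) \<Rightarrow> real ^ 'n \<Rightarrow> real ^ 'n"
  where "local_gradient G u x = matrix_inv (G x) *v (\<chi> j. pd j u x)"

definition local_hessian ::
  "(real ^ 'n \<Rightarrow> real ^ 'n ^ 'n) \<Rightarrow> (real ^ 'n \<Rightarrow> real) \<Rightarrow> 'n \<Rightarrow> 'n \<Rightarrow> real ^ 'n \<Rightarrow> real"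
  where "local_hessian G u i j x =
    pd i (pd j u) x - (\<Sum>k\<in>UNIV. christoffel G k i j x * pd k u x)"

definition local_laplacian ::
  "(real ^ 'n \<Rightarrow> real ^ 'n ^ 'n) \<Rightarrow> (real ^ 'n \<Rightarrow> real) \<Rightarrow> real ^ 'n \<Rightarrow> real"
  where "local_laplacian G u x =
    (\<Sum>i\<in>UNIV. \<Sum>j\<in>UNIV. matrix_inv (G x) $ i $ j * local_hessian G u i j x)"

text \<open>The \<open>(i, j)\<close> component of the Lie derivative \<open>\<L>\<^sub>X g\<close>.\<close>

definition lie_metric ::
  "(real ^ 'n \<Rightarrow> real ^ 'n) \<Rightarrow> (real ^ 'n \<Rightarrow> real ^ 'n ^ 'n) \<Rightarrow> 'n \<Rightarrow> 'n \<Rightarrow> real ^ 'n \<Rightarrow> real"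
  where "lie_metric X G i j x =
    (\<Sum>k\<in>UNIV. X x $ k * pd k (\<lambda>y. G y $ i $ j) x
             + G x $ k $ j * pd i (\<lambda>y. X y $ k) x
             + G x $ i $ k * pd j (\<lambda>y. X y $ k) x)"

section \<open>Riemannian manifolds with boundary\<close>

text \<open>A chart is a pair \<open>(U, \<phi>)\<close>; the values of \<open>\<phi>\<close> outside \<open>U\<close> are irrelevant.\<close>

type_synonym ('m, 'n) chart = "'m set \<times> ('m \<Rightarrow> real ^ 'n)"

definition image_of :: "('m, 'n) chart \<Rightarrow> (real ^ 'n) set"
  where "image_of c = snd c ` fst c"

definition param :: "('m, 'n) chart \<Rightarrow> real ^ 'n \<Rightarrow> 'm"
  where "param c = inv_into (fst c) (snd c)"

text \<open>The coordinate change \<open>\<psi> \<circ> \<phi>\<^sup>-\<^sup>1\<close> from \<open>c = (U, \<phi>)\<close> to \<open>d = (V, \<psi>)\<close>, meaningful on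
  \<open>\<phi>(U \<inter> V)\<close>, and its Jacobian matrix at (the coordinates of) a point \<open>p\<close>.\<close>

definition transition :: "('m, 'n) chart \<Rightarrow> ('m, 'n) chart \<Rightarrow> real ^ 'n \<Rightarrow> real ^ 'n"
  where "transition c d = snd d \<circ> param c"

definition transition_jacobian :: "('m, 'n) chart \<Rightarrow> ('m, 'n) chart \<Rightarrow> 'm \<Rightarrow> real ^ 'n ^ 'n"
  where "transition_jacobian c d p = jacobian (transition c d) (at (snd c p) within half_space)"

text \<open>Tensor fields are families of component functions, one for each chart of the atlas and
  defined on the image of that chart, obeying the tensorial transformation law.\<close>

record ('m, 'n) riemannian =
  space_top :: "'m topology"
  atlas :: "('m, 'n) chart set"
  metric_comp :: "('m, 'n) chart \<Rightarrow> real ^ 'n \<Rightarrow> real ^ 'n ^ 'n"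

definition manifold_with_boundary :: "('m, 'n::finite) riemannian \<Rightarrow> bool"
  where "manifold_with_boundary M \<longleftrightarrow>
    Hausdorff_space (space_top M) \<and> second_countable (space_top M) \<and>
    topspace (space_top M) = (\<Union>c\<in>atlas M. fst c) \<and>
    (\<forall>c\<in>atlas M. openin (space_top M) (fst c) \<and>
       openin (top_of_set half_space) (image_of c) \<and>
       homeomorphic_map (subtopology (space_top M) (fst c)) (top_of_set (image_of c)) (snd c)) \<and>
    (\<forall>c\<in>atlas M. \<forall>d\<in>atlas M. smooth_on (snd c ` (fst c \<inter> fst d)) (transition c d))"

text \<open>The atlas consists of positively oriented charts. (In dimension at least 2, every
  oriented manifold with boundary has such an atlas modelled on the half-space.)\<close>

definition oriented :: "('m, 'n::finite) riemannian \<Rightarrow> bool"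
  where "oriented M \<longleftrightarrow>
    (\<forall>c\<in>atlas M. \<forall>d\<in>atlas M. \<forall>p\<in>fst c \<inter> fst d. 0 < det (transition_jacobian c d p))"

definition manifold_boundary :: "('m, 'n::finite) riemannian \<Rightarrow> 'm set"
  where "manifold_boundary M =
    {p. \<exists>c\<in>atlas M. p \<in> fst c \<and> snd c p \<in> half_space_boundary}"

definition riemannian_manifold :: "('m, 'n::finite) riemannian \<Rightarrow> bool"
  where "riemannian_manifold M \<longleftrightarrow>
    manifold_with_boundary M \<and>
    (\<forall>c\<in>atlas M. smooth_on (image_of c) (metric_comp M c) \<and>
       (\<forall>x\<in>image_of c. transpose (metric_comp M c x) = metric_comp M c x \<and>
          (\<forall>v. v \<noteq> 0 \<longrightarrow> 0 < v \<bullet> (metric_comp M c x *v v)))) \<and>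
    (\<forall>c\<in>atlas M. \<forall>d\<in>atlas M. \<forall>p\<in>fst c \<inter> fst d.
       metric_comp M c (snd c p) =
         transpose (transition_jacobian c d p) ** metric_comp M d (snd d p)
           ** transition_jacobian c d p)"

definition einstein :: "('m, 'n::finite) riemannian \<Rightarrow> real \<Rightarrow> bool"
  where "einstein M lam \<longleftrightarrow>
    (\<forall>c\<in>atlas M. \<forall>x\<in>image_of c. \<forall>i j.
       ricci (metric_comp M c) i j x = lam * metric_comp M c x $ i $ j)"

definition smooth_function :: "('m, 'n::finite) riemannian \<Rightarrow> ('m \<Rightarrow> real) \<Rightarrow> bool"
  where "smooth_function M f \<longleftrightarrow> (\<forall>c\<in>atlas M. smooth_on (image_of c) (f \<circ> param c))"

type_synonym ('m, 'n) vector_field = "('m, 'n) chart \<Rightarrow> real ^ 'n \<Rightarrow> real ^ 'n"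

definition smooth_vector_field :: "('m, 'n::finite) riemannian \<Rightarrow> ('m, 'n) vector_field \<Rightarrow> bool"
  where "smooth_vector_field M X \<longleftrightarrow>
    (\<forall>c\<in>atlas M. smooth_on (image_of c) (X c)) \<and>
    (\<forall>c\<in>atlas M. \<forall>d\<in>atlas M. \<forall>p\<in>fst c \<inter> fst d.
       X d (snd d p) = transition_jacobian c d p *v X c (snd c p))"

definition nonzero_vector_field :: "('m, 'n::finite) riemannian \<Rightarrow> ('m, 'n) vector_field \<Rightarrow> bool"
  where "nonzero_vector_field M X \<longleftrightarrow> (\<exists>c\<in>atlas M. \<exists>x\<in>image_of c. X c x \<noteq> 0)"

definition conformal_vector_field :: "('m, 'n::finite) riemannian \<Rightarrow> ('m, 'n) vector_field \<Rightarrow> bool"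
  where "conformal_vector_field M X \<longleftrightarrow>
    smooth_vector_field M X \<and>
    (\<exists>\<rho>. smooth_function M \<rho> \<and>
      (\<forall>c\<in>atlas M. \<forall>x\<in>image_of c. \<forall>i j.
         lie_metric (X c) (metric_comp M c) i j x =
           2 * \<rho> (param c x) * metric_comp M c x $ i $ j))"

definition gradient :: "('m, 'n::finite) riemannian \<Rightarrow> ('m \<Rightarrow> real) \<Rightarrow> ('m, 'n) vector_field"
  where "gradient M f c = local_gradient (metric_comp M c) (f \<circ> param c)"

text \<open>On a Riemannian manifold the value does not depend on the chart chosen around \<open>p\<close>.\<close>

definition laplacian :: "('m, 'n::finite) riemannian \<Rightarrow> ('m \<Rightarrow> real) \<Rightarrow> 'm \<Rightarrow> real"
  where "laplacian M f p =
    (let c = (SOME c. c \<in> atlas M \<and> p \<in> fst c)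
     in local_laplacian (metric_comp M c) (f \<circ> param c) (snd c p))"

section \<open>Isometry with a round hemisphere\<close>

text \<open>\<open>M\<close> is isometric to the embedded submanifold (with boundary) \<open>S\<close> of a Euclidean space,
  with the induced Riemannian metric: there is a diffeomorphism \<open>F\<close> from \<open>M\<close> onto \<open>S\<close> which
  pulls back the Euclidean inner product to the metric of \<open>M\<close>. Smoothness of the inverse is that
  of maps on the subset \<open>S\<close> of the ambient space.\<close>

definition isometric_to_submanifold ::
  "('m, 'n::finite) riemannian \<Rightarrow> 'e::euclidean_space set \<Rightarrow> bool"
  where "isometric_to_submanifold M S \<longleftrightarrow>
    (\<exists>F. homeomorphic_map (space_top M) (top_of_set S) F \<and>
       (\<forall>c\<in>atlas M.
          smooth_on (image_of c) (F \<circ> param c) \<and>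
          smooth_on (F ` fst c) (snd c \<circ> inv_into (topspace (space_top M)) F) \<and>
          (\<forall>x\<in>image_of c. \<forall>i j.
             pd i (F \<circ> param c) x \<bullet> pd j (F \<circ> param c) x = metric_comp M c x $ i $ j)))"

text \<open>The closed hemisphere of the sphere of radius \<open>1 / sqrt c\<close> in the
  \<open>(n + 1)\<close>-dimensional space \<open>(real ^ 'n) \<times> real\<close>; only meaningful for \<open>c > 0\<close>.\<close>

definition hemisphere :: "real \<Rightarrow> ((real ^ 'n) \<times> real) set"
  where "hemisphere c = {z \<in> sphere 0 (1 / sqrt c). 0 \<le> snd z}"

end

theory Submission
  imports Defs
begin

text \<open>Write \<open>Hess f = \<rho> g\<close>, so that \<open>\<Delta>f = n \<rho>\<close>. Commuting covariant derivatives and contracting with the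
  Einstein condition gives \<open>d\<rho> = - c df\<close>, hence the Obata equation \<open>Hess \<rho> = - c \<rho> g\<close> and a constant
  energy \<open>|d\<rho>|\<^sup>2 + c \<rho>\<^sup>2\<close>. Comparing its value on the boundary, where \<open>\<rho> = 0\<close>, with that at an
  extremum of \<open>\<rho>\<close> shows \<open>c > 0\<close>. Normalise \<open>\<rho>\<close> to \<open>H\<close> with \<open>|dH|\<^sup>2 + c H\<^sup>2 = 1\<close>.

  The tensor \<open>W = R - c (g \<and> g)\<close> satisfies a linear differential inequality along the gradient flow of
  \<open>H\<close>, so \<open>W = 0\<close> near a maximum of \<open>H\<close>, and this propagates downwards through regular points. Where
  \<open>W = 0\<close>, the system \<open>Hess u = - c u g\<close> is completely integrable and its solutions form a local isometry
  into the sphere, determined by its 1-jet at one point. Starting from the maxima one obtains a map \<open>F\<close> on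
  \<open>{H > 0}\<close>, and then near its closure, whose last coordinate is \<open>H\<close>. No simple connectedness is needed, since
  every nonempty open and closed part of a set \<open>{H > a}\<close> contains a maximum of \<open>H\<close>. The part of the closure
  belonging to one maximum is mapped bijectively onto the closed hemisphere; as the equator is connected and
  part of it is boundary, all of it is, so this part is open and closed and exhausts \<open>M\<close>.\<close>


section \<open>Smooth maps\<close>

text \<open>No geodesic, exponential map or gradient flow is integrated. What happens along the
  gradient of \<open>H\<close> is read off from maximum principles on compact pieces of a chart, and
  every initial value problem is a linear system along straight segments of a chart.

  At a boundary point the coefficients are first extended smoothly beyond the half-space, where
  integrability is no longer available. Hence solutions are started at interior points, identities
  are proved in the interior and reach the boundary by continuity. The boundary condition itself
  enters as \<open>H = 0\<close>, which forces \<open>|dH| = 1\<close> there and so gives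
  \<open>H\<close> a sign on the inner side.

  The second obstacle is global: \<open>H\<close> may a priori have several maxima, and the regions
  belonging to them might touch at level 0. They are told apart by two developing maps whose germs
  are equal at one maximum and differ by a reflection at all the others; the set where two such maps
  have the same germ is open and, by unique continuation, relatively closed.\<close>

abbreviation derivative_at ("\<D>")
  where "\<D> F x \<equiv> frechet_derivative F (at x)"

lemma frechet_derivative_cong_open:
  assumes "open W" "x \<in> W" "\<And>y. y \<in> W \<Longrightarrow> F y = G y"
  shows "\<D> F x = \<D> G x"
proof -
  have "(F has_derivative D) (at x) \<longleftrightarrow> (G has_derivative D) (at x)" for D
    using assms by (metis has_derivative_transform_within_open)
  then show ?thesis by (simp add: frechet_derivative_def)
qed

lemma differentiable_on_cong_open:
  assumes "open W" "\<And>y. y \<in> W \<Longrightarrow> F y = G y" "F differentiable_on W"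
  shows "G differentiable_on W"
  using assms(2,3) differentiable_transform_within[of F _ W 1 G] unfolding differentiable_on_def by simp

lemma Ck_on_cong:
  assumes "open W" "\<And>y. y \<in> W \<Longrightarrow> F y = G y" "Ck_on k W F"
  shows "Ck_on k W G"
  using assms(2,3)
proof (induction k arbitrary: F G)
  case 0 then show ?case by (metis Ck_on.simps(1) continuous_on_cong)
next
  case (Suc k)
  have "Ck_on k W (\<lambda>x. \<D> G x v)" for v
  proof (rule Suc.IH)
    show "Ck_on k W (\<lambda>x. \<D> F x v)" using Suc.prems(2) by simp
    show "\<D> F y v = \<D> G y v" if "y \<in> W" for y
      using frechet_derivative_cong_open[OF assms(1) that, of F G] Suc.prems(1) by simp
  qed
  then show ?case using Suc.prems differentiable_on_cong_open[OF assms(1), of F G] by (auto simp: Ck_on.simps(2))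
qed

declare Ck_on.simps(2) [simp del]

lemma Ck_on_Suc_derivative: "Ck_on (Suc k) W F \<Longrightarrow> Ck_on k W (\<lambda>x. \<D> F x v)"
  by (simp add: Ck_on.simps(2))

text \<open>Lets the derivative be supplied by a formula, so that an induction on the order can
  apply its hypothesis to an explicit expression instead of to
  \<open>frechet_derivative\<close>.\<close>

lemma Ck_on_SucI:
  assumes "open W" "\<And>x. x \<in> W \<Longrightarrow> (F has_derivative F' x) (at x)"
    and "\<And>v. Ck_on k W (\<lambda>x. F' x v)"
  shows "Ck_on (Suc k) W F"
proof -
  have "F differentiable_on W"
    using assms(1,2) by (metis at_within_open differentiable_on_def differentiable_def)
  moreover have "Ck_on k W (\<lambda>x. \<D> F x v)" for v
    by (rule Ck_on_cong[OF assms(1) _ assms(3)[of v]])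
       (metis assms(2) frechet_derivative_at)
  ultimately show ?thesis by (simp add: Ck_on.simps(2))
qed

lemma Ck_on_SucD:
  assumes "open W" "Ck_on (Suc k) W F" "x \<in> W"
  shows "(F has_derivative \<D> F x) (at x)"
proof -
  have "F differentiable at x within W" using assms by (simp add: Ck_on.simps(2) differentiable_on_def)
  then show ?thesis unfolding at_within_open[OF assms(3,1)] using frechet_derivative_works by blast
qed

lemma Ck_on_Suc_imp:
  assumes "open W" "Ck_on (Suc k) W F" shows "Ck_on k W F"
  using assms(2)
proof (induction k arbitrary: F)
  case 0 then show ?case by (simp add: Ck_on.simps(2) differentiable_imp_continuous_on)
next
  case (Suc k)
  then show ?case by (subst Ck_on.simps(2)) (auto simp: Ck_on.simps(2)[of "Suc k"])
qed

section \<open>Closure properties of maps of class \<open>Ck_on\<close>\<close>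

lemma Ck_on_subset:
  assumes "Ck_on k W F" "V \<subseteq> W" shows "Ck_on k V F"
  using assms(1) by (induction k arbitrary: F)
    (use assms(2) in \<open>auto simp: Ck_on.simps(2) intro: continuous_on_subset differentiable_on_subset\<close>)

lemma Ck_on_const: "open W \<Longrightarrow> Ck_on k W (\<lambda>x. a)"
  by (induction k arbitrary: a) (auto simp: Ck_on.simps(2))

lemma Ck_on_add:
  assumes "open W" "Ck_on k W F" "Ck_on k W G" shows "Ck_on k W (\<lambda>x. F x + G x)"
  using assms(2,3)
proof (induction k arbitrary: F G)
  case 0 then show ?case by (auto intro: continuous_intros)
next
  case (Suc k)
  show ?case
    by (rule Ck_on_SucI[OF assms(1), where F' = "\<lambda>x v. \<D> F x v + \<D> G x v"])
       (use Suc in \<open>auto intro!: has_derivative_add Ck_on_SucD assms(1) dest: Ck_on_Suc_derivative\<close>)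
qed

lemma Ck_on_linear:
  assumes L: "bounded_linear L" and "open W" "Ck_on k W F" shows "Ck_on k W (\<lambda>x. L (F x))"
  using assms(3)
proof (induction k arbitrary: F)
  case 0 then show ?case by (auto intro: bounded_linear.continuous_on[OF L])
next
  case (Suc k)
  show ?case
    by (rule Ck_on_SucI[OF assms(2), where F' = "\<lambda>x v. L (\<D> F x v)"])
       (use Suc in \<open>auto intro!: bounded_linear.has_derivative[OF L] Ck_on_SucD assms(2) dest: Ck_on_Suc_derivative\<close>)
qed

lemma Ck_on_bounded_linear:
  assumes L: "bounded_linear L" and "open W" shows "Ck_on k W L"
proof (cases k)
  case 0 then show ?thesis using L by (simp add: linear_continuous_on)
next
  case (Suc m)
  show ?thesis unfolding Suc
    by (rule Ck_on_SucI[OF assms(2), where F' = "\<lambda>x. L"])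
       (auto intro: bounded_linear_imp_has_derivative L Ck_on_const assms)
qed

lemma Ck_on_sum:
  assumes "open W" "\<And>i. i \<in> I \<Longrightarrow> Ck_on k W (F i)" shows "Ck_on k W (\<lambda>x. \<Sum>i\<in>I. F i x)"
  using assms(2) by (induction I rule: infinite_finite_induct)
    (auto intro!: Ck_on_const Ck_on_add assms(1))

lemma Ck_on_bilinear:
  assumes B: "bounded_bilinear B" and "open W" "Ck_on k W F" "Ck_on k W G"
  shows "Ck_on k W (\<lambda>x. B (F x) (G x))"
  using assms(3,4)
proof (induction k arbitrary: F G)
  case 0 then show ?case by (auto intro: bounded_bilinear.continuous_on[OF B])
next
  case (Suc k)
  have FG: "Ck_on k W F" "Ck_on k W G" using Suc.prems Ck_on_Suc_imp assms(2) by blast+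
  have "Ck_on k W (\<lambda>x. B (F x) (\<D> G x v) + B (\<D> F x v) (G x))" for v
    by (rule Ck_on_add[OF assms(2)]; rule Suc.IH) (use Suc.prems FG Ck_on_Suc_derivative in auto)
  then show ?case
    by (intro Ck_on_SucI[OF assms(2), where F' = "\<lambda>x v. B (F x) (\<D> G x v) + B (\<D> F x v) (G x)"])
       (use Suc.prems in \<open>auto intro!: bounded_bilinear.FDERIV[OF B] Ck_on_SucD assms(2)\<close>)
qed

lemma Ck_on_inverse:
  fixes F :: "'a::euclidean_space \<Rightarrow> real"
  assumes "open W" "Ck_on k W F" and nz: "\<And>x. x \<in> W \<Longrightarrow> F x \<noteq> 0"
  shows "Ck_on k W (\<lambda>x. inverse (F x))"
  using assms(2)
proof (induction k)
  case 0 then show ?case using nz by (auto intro!: continuous_intros)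
next
  case (Suc k)
  have I: "Ck_on k W (\<lambda>x. inverse (F x))" using Suc Ck_on_Suc_imp assms(1) by blast
  have "Ck_on k W (\<lambda>x. - 1 * (inverse (F x) * \<D> F x v * inverse (F x)))" for v
    by (intro Ck_on_bilinear[OF bounded_bilinear_mult] assms(1) I Ck_on_const Ck_on_Suc_derivative Suc.prems)
  then show ?case
    by (intro Ck_on_SucI[OF assms(1), where F' = "\<lambda>x v. - 1 * (inverse (F x) * \<D> F x v * inverse (F x))"])
       (use Deriv.has_derivative_inverse[OF nz Ck_on_SucD[OF assms(1) Suc.prems]] in auto)
qed

lemma Ck_on_compose:
  fixes G :: "'a::euclidean_space \<Rightarrow> 'b::euclidean_space"
  assumes W: "open W" and V: "open V" and "Ck_on k V F" "Ck_on k W G" and GV: "\<And>x. x \<in> W \<Longrightarrow> G x \<in> V"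
  shows "Ck_on k W (\<lambda>x. F (G x))"
  using assms(3,4)
proof (induction k arbitrary: F)
  case 0 then show ?case using GV by (auto intro!: continuous_on_compose2[of V F W G])
next
  case (Suc k)
  \<comment> \<open>The derivative of \<open>F\<close> is expanded in the basis because the
    induction hypothesis covers \<open>\<D> F (G x) b\<close> for a fixed direction
    \<open>b\<close>, while the direction \<open>\<D> G x v\<close> varies with
    \<open>x\<close>.\<close>
  let ?D = "\<lambda>x v. \<Sum>b\<in>Basis. (\<D> G x v \<bullet> b) *\<^sub>R \<D> F (G x) b"
  have der: "((\<lambda>x. F (G x)) has_derivative ?D x) (at x)" if "x \<in> W" for x
  proof -
    have F: "(F has_derivative \<D> F (G x)) (at (G x))"
      using Suc.prems(1) V GV that Ck_on_SucD by blast
    have G: "(G has_derivative \<D> G x) (at x)"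
      using Suc.prems(2) W that Ck_on_SucD by blast
    have lin: "linear (\<D> F (G x))" using F has_derivative_linear by blast
    have "\<D> F (G x) (\<D> G x v) = ?D x v" for v
      by (subst euclidean_representation[symmetric, of "\<D> G x v"])
         (simp add: linear_sum[OF lin] linear_scale[OF lin])
    then show ?thesis using has_derivative_compose[OF G F] by simp
  qed
  have Gk: "Ck_on k W G" using Suc.prems(2) Ck_on_Suc_imp W by blast
  have "Ck_on k W (\<lambda>x. ?D x v)" for v
    by (intro Ck_on_sum W Ck_on_bilinear[OF bounded_bilinear_scaleR] Suc.IH Gk
          Ck_on_linear[OF bounded_linear_inner_left] Ck_on_Suc_derivative Suc.prems)
  with der show ?case by (intro Ck_on_SucI[OF W])
qed

text \<open>Openness of the domain is built in, so that a local extension as required by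
  \<open>smooth_on\<close> is a single fact that can be restricted, composed and
  differentiated.\<close>

definition Cinf_on :: "'e::euclidean_space set \<Rightarrow> ('e \<Rightarrow> 'f::real_normed_vector) \<Rightarrow> bool"
  where "Cinf_on W F \<longleftrightarrow> open W \<and> (\<forall>k. Ck_on k W F)"

lemma smooth_on_altdef:
  "smooth_on S u \<longleftrightarrow> (\<forall>x\<in>S. \<exists>W F. x \<in> W \<and> Cinf_on W F \<and> (\<forall>y\<in>S \<inter> W. F y = u y))"
  unfolding smooth_on_def Cinf_on_def by metis

lemma smooth_onE:
  assumes "smooth_on S u" "x \<in> S"
  obtains W F where "x \<in> W" "Cinf_on W F" "\<And>y. y \<in> S \<Longrightarrow> y \<in> W \<Longrightarrow> F y = u y"
  using assms unfolding smooth_on_altdef by (metis IntI)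

lemma Cinf_on_subset: "Cinf_on W F \<Longrightarrow> open V \<Longrightarrow> V \<subseteq> W \<Longrightarrow> Cinf_on V F"
  unfolding Cinf_on_def using Ck_on_subset by blast

lemma Cinf_on_open: "Cinf_on W F \<Longrightarrow> open W"
  unfolding Cinf_on_def by blast

lemma Cinf_on_Int:
  assumes "Cinf_on W F" "open V" shows "Cinf_on (W \<inter> V) F" "Cinf_on (V \<inter> W) F"
  using Cinf_on_subset[OF assms(1), of "W \<inter> V"] Cinf_on_open[OF assms(1)] assms(2)
  by (auto simp: Int_commute)

lemma Cinf_on_const: "open W \<Longrightarrow> Cinf_on W (\<lambda>x. a)"
  by (simp add: Cinf_on_def Ck_on_const)

lemma Cinf_on_add: "Cinf_on W F \<Longrightarrow> Cinf_on W G \<Longrightarrow> Cinf_on W (\<lambda>x. F x + G x)"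
  by (simp add: Cinf_on_def Ck_on_add)

lemma Cinf_on_linear: "bounded_linear L \<Longrightarrow> Cinf_on W F \<Longrightarrow> Cinf_on W (\<lambda>x. L (F x))"
  by (simp add: Cinf_on_def Ck_on_linear)

lemma Cinf_on_bilinear:
  "bounded_bilinear B \<Longrightarrow> Cinf_on W F \<Longrightarrow> Cinf_on W G \<Longrightarrow> Cinf_on W (\<lambda>x. B (F x) (G x))"
  by (simp add: Cinf_on_def Ck_on_bilinear)

lemma Cinf_on_derivative: "Cinf_on W F \<Longrightarrow> Cinf_on W (\<lambda>x. \<D> F x v)"
  unfolding Cinf_on_def using Ck_on_Suc_derivative by blast

lemma Cinf_on_has_derivative:
  "Cinf_on W F \<Longrightarrow> x \<in> W \<Longrightarrow> (F has_derivative \<D> F x) (at x)"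
  unfolding Cinf_on_def using Ck_on_SucD by blast

lemma Cinf_on_continuous: "Cinf_on W F \<Longrightarrow> continuous_on W F"
  unfolding Cinf_on_def by (metis Ck_on.simps(1))

lemma Cinf_on_compose:
  fixes G :: "'a::euclidean_space \<Rightarrow> 'b::euclidean_space"
  assumes "Cinf_on V F" "Cinf_on W G" "\<And>x. x \<in> W \<Longrightarrow> G x \<in> V"
  shows "Cinf_on W (\<lambda>x. F (G x))"
  using assms Ck_on_compose[of W V _ F G] by (simp add: Cinf_on_def)

section \<open>Smooth maps on arbitrary subsets\<close>

lemma Cinf_on_imp_smooth_on: "Cinf_on W F \<Longrightarrow> S \<subseteq> W \<Longrightarrow> smooth_on S F"
  unfolding smooth_on_altdef by blast

lemma smooth_on_subset: "smooth_on S u \<Longrightarrow> T \<subseteq> S \<Longrightarrow> smooth_on T u"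
  unfolding smooth_on_altdef
proof
  fix x assume S: "\<forall>x\<in>S. \<exists>W F. x \<in> W \<and> Cinf_on W F \<and> (\<forall>y\<in>S \<inter> W. F y = u y)" and T: "T \<subseteq> S" "x \<in> T"
  from S T obtain W F where "x \<in> W" "Cinf_on W F" "\<forall>y\<in>S \<inter> W. F y = u y" by (meson subsetD)
  with T show "\<exists>W F. x \<in> W \<and> Cinf_on W F \<and> (\<forall>y\<in>T \<inter> W. F y = u y)"
    by (intro exI[of _ W] exI[of _ F]) auto
qed

lemma smooth_on_cong: "smooth_on S u \<Longrightarrow> (\<And>x. x \<in> S \<Longrightarrow> u x = w x) \<Longrightarrow> smooth_on S w"
  unfolding smooth_on_altdef by (metis IntD1)

lemma smooth_on_local:
  assumes "\<And>x. x \<in> S \<Longrightarrow> \<exists>W. open W \<and> x \<in> W \<and> smooth_on (S \<inter> W) u"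
  shows "smooth_on S u"
  unfolding smooth_on_altdef
proof
  fix x assume x: "x \<in> S"
  then obtain W where W: "open W" "x \<in> W" "smooth_on (S \<inter> W) u" using assms by blast
  then obtain V F where V: "x \<in> V" "Cinf_on V F" "\<And>y. y \<in> S \<inter> W \<Longrightarrow> y \<in> V \<Longrightarrow> F y = u y"
    using smooth_onE[of "S \<inter> W" u x] x by blast
  have "Cinf_on (V \<inter> W) F" by (rule Cinf_on_Int[OF V(2) W(1)])
  then show "\<exists>W F. x \<in> W \<and> Cinf_on W F \<and> (\<forall>y\<in>S \<inter> W. F y = u y)"
    using V W by (intro exI[of _ "V \<inter> W"] exI[of _ F]) auto
qed

lemma smooth_on_const: "smooth_on S (\<lambda>x. a)"
  using Cinf_on_imp_smooth_on[OF Cinf_on_const[OF open_UNIV]] by blast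

lemma smooth_on_linear:
  assumes "bounded_linear L" "smooth_on S u" shows "smooth_on S (\<lambda>x. L (u x))"
  unfolding smooth_on_altdef
proof
  fix x assume "x \<in> S"
  then obtain W F where "x \<in> W" "Cinf_on W F" "\<And>y. y \<in> S \<Longrightarrow> y \<in> W \<Longrightarrow> F y = u y"
    using assms(2) smooth_onE by blast
  then show "\<exists>W F. x \<in> W \<and> Cinf_on W F \<and> (\<forall>y\<in>S \<inter> W. F y = L (u y))"
    using Cinf_on_linear[OF assms(1), of W F] by (intro exI[of _ W] exI[of _ "\<lambda>x. L (F x)"]) auto
qed

lemma smooth_on_bilinear:
  assumes "bounded_bilinear B" "smooth_on S u" "smooth_on S w"
  shows "smooth_on S (\<lambda>x. B (u x) (w x))"
  unfolding smooth_on_altdef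
proof
  fix x assume x: "x \<in> S"
  obtain W F where W: "x \<in> W" "Cinf_on W F" "\<And>y. y \<in> S \<Longrightarrow> y \<in> W \<Longrightarrow> F y = u y"
    using assms(2) smooth_onE x by blast
  obtain V G where V: "x \<in> V" "Cinf_on V G" "\<And>y. y \<in> S \<Longrightarrow> y \<in> V \<Longrightarrow> G y = w y"
    using assms(3) smooth_onE x by blast
  have "Cinf_on (W \<inter> V) F" "Cinf_on (W \<inter> V) G"
    using Cinf_on_Int V(2) W(2) Cinf_on_open by blast+
  then show "\<exists>W F. x \<in> W \<and> Cinf_on W F \<and> (\<forall>y\<in>S \<inter> W. F y = B (u y) (w y))"
    using Cinf_on_bilinear[OF assms(1), of "W \<inter> V" F G] V W
    by (intro exI[of _ "W \<inter> V"] exI[of _ "\<lambda>x. B (F x) (G x)"]) auto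
qed

lemma smooth_on_compose:
  fixes g :: "'a::euclidean_space \<Rightarrow> 'b::euclidean_space"
  assumes "smooth_on T u" "smooth_on S g" "\<And>x. x \<in> S \<Longrightarrow> g x \<in> T"
  shows "smooth_on S (\<lambda>x. u (g x))"
  unfolding smooth_on_altdef
proof
  fix x assume x: "x \<in> S"
  obtain W G where W: "x \<in> W" "Cinf_on W G" "\<And>y. y \<in> S \<Longrightarrow> y \<in> W \<Longrightarrow> G y = g y"
    using assms(2) smooth_onE x by blast
  obtain V F where V: "g x \<in> V" "Cinf_on V F" "\<And>y. y \<in> T \<Longrightarrow> y \<in> V \<Longrightarrow> F y = u y"
    using smooth_onE[OF assms(1) assms(3)[OF x]] by blast
  have "open (W \<inter> G -` V)"
    by (rule continuous_open_preimage[OF Cinf_on_continuous[OF W(2)] Cinf_on_open[OF W(2)] Cinf_on_open[OF V(2)]])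
  then have "Cinf_on (W \<inter> G -` V) G" using W(2) Cinf_on_subset by blast
  then have "Cinf_on (W \<inter> G -` V) (\<lambda>x. F (G x))"
    by (intro Cinf_on_compose[OF V(2)]) auto
  then show "\<exists>W F. x \<in> W \<and> Cinf_on W F \<and> (\<forall>y\<in>S \<inter> W. F y = u (g y))"
  proof (intro exI conjI ballI)
    show "x \<in> W \<inter> G -` V" using W V(1) x by auto
    show "F (G y) = u (g y)" if "y \<in> S \<inter> (W \<inter> G -` V)" for y
      using that W(3)[of y] V(3)[of "g y"] assms(3)[of y] by auto
  qed
qed

lemma smooth_on_add:
  assumes "smooth_on S u" "smooth_on S w" shows "smooth_on S (\<lambda>x. u x + w x)"
  unfolding smooth_on_altdef
proof
  fix x assume x: "x \<in> S"
  obtain W F where W: "x \<in> W" "Cinf_on W F" "\<And>y. y \<in> S \<Longrightarrow> y \<in> W \<Longrightarrow> F y = u y"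
    using assms(1) smooth_onE x by blast
  obtain V G where V: "x \<in> V" "Cinf_on V G" "\<And>y. y \<in> S \<Longrightarrow> y \<in> V \<Longrightarrow> G y = w y"
    using assms(2) smooth_onE x by blast
  have "Cinf_on (W \<inter> V) F" "Cinf_on (W \<inter> V) G"
    using Cinf_on_Int V(2) W(2) Cinf_on_open by blast+
  then show "\<exists>W F. x \<in> W \<and> Cinf_on W F \<and> (\<forall>y\<in>S \<inter> W. F y = u y + w y)"
    using Cinf_on_add[of "W \<inter> V" F G] V W
    by (intro exI[of _ "W \<inter> V"] exI[of _ "\<lambda>x. F x + G x"]) auto
qed

lemma smooth_on_sum:
  assumes "\<And>i. i \<in> I \<Longrightarrow> smooth_on S (u i)" shows "smooth_on S (\<lambda>x. \<Sum>i\<in>I. u i x)"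
  using assms by (induction I rule: infinite_finite_induct) (auto intro!: smooth_on_const smooth_on_add)

lemmas smooth_on_mult = smooth_on_bilinear[OF bounded_bilinear_mult]
lemmas smooth_on_scaleR = smooth_on_bilinear[OF bounded_bilinear_scaleR]
lemmas smooth_on_inner = smooth_on_bilinear[OF bounded_bilinear_inner]

lemma smooth_on_cmult:
  fixes u :: "'a::euclidean_space \<Rightarrow> real"
  shows "smooth_on S u \<Longrightarrow> smooth_on S (\<lambda>x. a * u x)"
  by (rule smooth_on_mult[OF smooth_on_const])

lemma smooth_on_uminus: "smooth_on S u \<Longrightarrow> smooth_on S (\<lambda>x. - u x)"
  by (rule smooth_on_linear[OF bounded_linear_minus[OF bounded_linear_ident]])

lemma smooth_on_diff: "smooth_on S u \<Longrightarrow> smooth_on S w \<Longrightarrow> smooth_on S (\<lambda>x. u x - w x)"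
  using smooth_on_add[OF _ smooth_on_uminus, of S u w] by simp

lemma smooth_on_prod:
  fixes u :: "'i \<Rightarrow> 'a::euclidean_space \<Rightarrow> real"
  assumes "\<And>i. i \<in> I \<Longrightarrow> smooth_on S (u i)" shows "smooth_on S (\<lambda>x. \<Prod>i\<in>I. u i x)"
  using assms by (induction I rule: infinite_finite_induct) (auto intro!: smooth_on_const smooth_on_mult)

lemma smooth_on_inverse:
  fixes u :: "'a::euclidean_space \<Rightarrow> real"
  assumes "smooth_on S u" "\<And>x. x \<in> S \<Longrightarrow> u x \<noteq> 0"
  shows "smooth_on S (\<lambda>x. inverse (u x))"
proof -
  have "Cinf_on (- {0}) (\<lambda>x::real. inverse x)"
    unfolding Cinf_on_def
    by (auto intro!: Ck_on_inverse[where F="\<lambda>x. x"] Ck_on_bounded_linear[where L="\<lambda>x. x"] bounded_linear_ident)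
  then have "smooth_on (- {0}) (\<lambda>x::real. inverse x)" using Cinf_on_imp_smooth_on by blast
  from smooth_on_compose[OF this assms(1)] assms(2) show ?thesis by auto
qed

lemma smooth_on_continuous: assumes "smooth_on S u" shows "continuous_on S u"
  unfolding continuous_on_eq_continuous_within
proof
  fix x assume x: "x \<in> S"
  then obtain W F where W: "x \<in> W" "Cinf_on W F" "\<And>y. y \<in> S \<Longrightarrow> y \<in> W \<Longrightarrow> F y = u y"
    using assms smooth_onE by blast
  have "isCont F x"
    using Cinf_on_continuous[OF W(2)] Cinf_on_open[OF W(2)] W(1) by (simp add: continuous_on_eq_continuous_at)
  then have "continuous (at x within S) F" by (rule continuous_at_imp_continuous_within)
  moreover obtain d where "d > 0" "ball x d \<subseteq> W" using Cinf_on_open[OF W(2)] W(1) openE by blast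
  ultimately show "continuous (at x within S) u"
    using continuous_transform_within[of x S F d u] W(3) x by (auto simp: subset_iff dist_commute)
qed

section \<open>Symmetry of second derivatives\<close>

lemma has_real_derivative_along_line:
  fixes u :: "'e::euclidean_space \<Rightarrow> real"
  assumes "(u has_derivative D) (at (p + s *\<^sub>R v))"
  shows "((\<lambda>s. u (p + s *\<^sub>R v)) has_real_derivative D v) (at s)"
proof -
  have "((\<lambda>s. p + s *\<^sub>R v) has_derivative (\<lambda>h. h *\<^sub>R v)) (at s)"
    by (auto intro!: derivative_eq_intros)
  from has_derivative_compose[OF this assms]
  have "((\<lambda>s. u (p + s *\<^sub>R v)) has_derivative (\<lambda>h. h * D v)) (at s)"
    using linear_scale[OF has_derivative_linear[OF assms]] by simp
  then show ?thesis by (simp add: has_field_derivative_def mult.commute[of _ "D v"])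
qed

text \<open>The mean value theorem in direction \<open>v\<close>, applied to the difference of
  \<open>u\<close> in direction \<open>w\<close>, and then once more in direction \<open>w\<close>.
  The second difference is symmetric in \<open>v\<close> and \<open>w\<close>, the mixed derivative
  on the right is not visibly so; comparing both orders gives the symmetry of second
  derivatives.\<close>

lemma second_difference_mean_value:
  fixes u :: "'e::euclidean_space \<Rightarrow> real"
  assumes u: "Cinf_on W u" and B: "ball x r \<subseteq> W" and t: "0 < t" "t * (norm v + norm w) < r"
  shows "\<exists>y. norm (y - x) \<le> t * (norm v + norm w) \<and>
     u (x + t *\<^sub>R v + t *\<^sub>R w) - u (x + t *\<^sub>R v) - u (x + t *\<^sub>R w) + u x =
     t * t * \<D> (\<lambda>y. \<D> u y v) y w"
proof -
  let ?a = "\<lambda>y. \<D> u y v"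
  have bound: "norm (a *\<^sub>R v + b *\<^sub>R w) \<le> t * (norm v + norm w)" if "0 \<le> a" "a \<le> t" "0 \<le> b" "b \<le> t" for a b
  proof -
    have "norm (a *\<^sub>R v + b *\<^sub>R w) \<le> a * norm v + b * norm w"
      using norm_triangle_ineq[of "a *\<^sub>R v" "b *\<^sub>R w"] that by simp
    also have "\<dots> \<le> t * norm v + t * norm w" using that by (intro add_mono mult_right_mono) auto
    finally show ?thesis by (simp add: distrib_left)
  qed
  have inW: "x + a *\<^sub>R v + b *\<^sub>R w \<in> W" if "0 \<le> a" "a \<le> t" "0 \<le> b" "b \<le> t" for a b
    using bound[OF that] t(2) B by (auto simp: subset_iff dist_norm norm_minus_commute add.assoc)
  have du: "(u has_derivative \<D> u y) (at y)" if "y \<in> W" for y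
    using u Cinf_on_has_derivative that by blast
  have da: "(?a has_derivative \<D> ?a y) (at y)" if "y \<in> W" for y
    using Cinf_on_derivative[OF u] Cinf_on_has_derivative that by blast
  have "\<exists>z>0. z < t \<and> (u ((x + t *\<^sub>R w) + t *\<^sub>R v) - u (x + t *\<^sub>R v)) - (u ((x + t *\<^sub>R w) + 0 *\<^sub>R v) - u (x + 0 *\<^sub>R v)) =
       (t - 0) * (?a ((x + t *\<^sub>R w) + z *\<^sub>R v) - ?a (x + z *\<^sub>R v))"
  proof (rule MVT2[OF t(1)])
    fix s assume s: "0 \<le> s" "s \<le> t"
    have "(x + t *\<^sub>R w) + s *\<^sub>R v \<in> W" "x + s *\<^sub>R v \<in> W"
      using inW[of s t] inW[of s 0] s t(1) by (auto simp: algebra_simps)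
    then show "((\<lambda>s. u ((x + t *\<^sub>R w) + s *\<^sub>R v) - u (x + s *\<^sub>R v)) has_real_derivative
        ?a ((x + t *\<^sub>R w) + s *\<^sub>R v) - ?a (x + s *\<^sub>R v)) (at s)"
      by (intro DERIV_diff has_real_derivative_along_line du)
  qed
  then obtain z where z: "0 < z" "z < t" and
    1: "u (x + t *\<^sub>R v + t *\<^sub>R w) - u (x + t *\<^sub>R v) - u (x + t *\<^sub>R w) + u x =
       t * (?a (x + z *\<^sub>R v + t *\<^sub>R w) - ?a (x + z *\<^sub>R v + 0 *\<^sub>R w))"
    by (auto simp: algebra_simps)
  have "\<exists>z'>0. z' < t \<and> ?a ((x + z *\<^sub>R v) + t *\<^sub>R w) - ?a ((x + z *\<^sub>R v) + 0 *\<^sub>R w) =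
       (t - 0) * \<D> ?a ((x + z *\<^sub>R v) + z' *\<^sub>R w) w"
    by (intro MVT2[OF t(1)] has_real_derivative_along_line da inW) (use z in auto)
  then obtain z' where z': "0 < z'" "z' < t" and
    2: "?a (x + z *\<^sub>R v + t *\<^sub>R w) - ?a (x + z *\<^sub>R v + 0 *\<^sub>R w) = t * \<D> ?a (x + z *\<^sub>R v + z' *\<^sub>R w) w"
    by auto
  show ?thesis
    by (intro exI[of _ "x + z *\<^sub>R v + z' *\<^sub>R w"])
       (use 1 2 z z' bound[of z z'] in \<open>auto simp: algebra_simps\<close>)
qed

lemma second_derivative_symmetric_Cinf:
  fixes u :: "'e::euclidean_space \<Rightarrow> real"
  assumes u: "Cinf_on W u" and x: "x \<in> W"
  shows "\<D> (\<lambda>y. \<D> u y v) x w =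
         \<D> (\<lambda>y. \<D> u y w) x v"
proof -
  define P where "P = (\<lambda>y. \<D> (\<lambda>y. \<D> u y v) y w)"
  define Q where "Q = (\<lambda>y. \<D> (\<lambda>y. \<D> u y w) y v)"
  have "continuous_on W P" "continuous_on W Q"
    unfolding P_def Q_def by (intro Cinf_on_continuous Cinf_on_derivative u)+
  then have cP: "continuous (at x) P" and cQ: "continuous (at x) Q"
    using Cinf_on_open[OF u] x continuous_on_eq_continuous_at by blast+
  obtain r where r: "r > 0" "ball x r \<subseteq> W" using Cinf_on_open[OF u] x openE by blast
  let ?N = "norm v + norm w"
  have "dist (P x) (Q x) \<le> 0 + e" if "e > 0" for e
  proof -
    obtain d1 where d1: "d1 > 0" "\<And>y. dist y x < d1 \<Longrightarrow> dist (P y) (P x) < e/2"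
      using cP \<open>e > 0\<close> unfolding continuous_at_eps_delta by (meson half_gt_zero)
    obtain d2 where d2: "d2 > 0" "\<And>y. dist y x < d2 \<Longrightarrow> dist (Q y) (Q x) < e/2"
      using cQ \<open>e > 0\<close> unfolding continuous_at_eps_delta by (meson half_gt_zero)
    define m where "m = min r (min d1 d2)"
    \<comment> \<open>Adding 1 to \<open>?N\<close> covers the case \<open>v = w = 0\<close> and
      makes \<open>t * ?N < m\<close> strict.\<close>
    define t where "t = m / (?N + 1)"
    have m: "m > 0" "m \<le> r" "m \<le> d1" "m \<le> d2" using r d1 d2 by (auto simp: m_def)
    have N: "0 \<le> ?N" by simp
    have "t > 0" using m(1) N by (simp add: t_def add_nonneg_pos)
    have tN: "t * ?N < m" using m(1) N \<open>t > 0\<close> by (simp add: t_def divide_less_eq add_nonneg_pos)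
    obtain y where y: "norm (y - x) \<le> t * ?N" "u (x + t *\<^sub>R v + t *\<^sub>R w) - u (x + t *\<^sub>R v) - u (x + t *\<^sub>R w) + u x = t * t * P y"
      using second_difference_mean_value[OF u r(2) \<open>t > 0\<close>, of v w] tN m unfolding P_def by auto
    obtain z where z: "norm (z - x) \<le> t * ?N" "u (x + t *\<^sub>R w + t *\<^sub>R v) - u (x + t *\<^sub>R w) - u (x + t *\<^sub>R v) + u x = t * t * Q z"
      using second_difference_mean_value[OF u r(2) \<open>t > 0\<close>, of w v] tN m unfolding Q_def by (auto simp: add.commute)
    have "x + t *\<^sub>R w + t *\<^sub>R v = x + t *\<^sub>R v + t *\<^sub>R w" by (simp add: algebra_simps)
    then have "t * t * P y = t * t * Q z" using y(2) z(2) by (metis (no_types, lifting) diff_diff_eq add.commute)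
    then have "P y = Q z" using \<open>t > 0\<close> unfolding mult_cancel_left by auto
    moreover have "dist (P y) (P x) < e/2" using d1(2)[of y] y(1) tN m by (simp add: dist_norm)
    moreover have "dist (Q z) (Q x) < e/2" using d2(2)[of z] z(1) tN m by (simp add: dist_norm)
    ultimately show ?thesis unfolding dist_real_def by linarith
  qed
  then have "dist (P x) (Q x) \<le> 0" by (rule field_le_epsilon)
  then show ?thesis by (simp add: P_def Q_def)
qed

section \<open>Partial derivatives on the half-space\<close>

abbreviation hopen :: "(real ^ 'n::finite) set \<Rightarrow> bool" where
  "hopen S \<equiv> openin (top_of_set half_space) S"

abbreviation hgt :: "real ^ 'n::finite \<Rightarrow> real" where
  "hgt x \<equiv> x $ bdry_index"

abbreviation dpd :: "(real ^ 'n::finite \<Rightarrow> 'f::real_normed_vector) \<Rightarrow> real ^ 'n \<Rightarrow> real ^ 'n \<Rightarrow> 'f" where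
  "dpd u x v \<equiv> \<Sum>i\<in>UNIV. (v $ i) *\<^sub>R pd i u x"

abbreviation half_ball :: "real ^ 'n::finite \<Rightarrow> real \<Rightarrow> (real ^ 'n) set" where
  "half_ball x r \<equiv> half_space \<inter> ball x r"

lemma hopen_subset: "hopen S \<Longrightarrow> S \<subseteq> half_space"
  using openin_imp_subset by blast

text \<open>From any point of the half-space, boundary points included, each coordinate direction
  can be followed in its positive sense without leaving the half-space. This already determines the
  derivative.\<close>

lemma half_space_unique_derivative:
  fixes u :: "real ^ 'n::finite \<Rightarrow> 'f::real_normed_vector"
  assumes "x \<in> half_space" "(u has_derivative D) (at x within half_space)" "(u has_derivative D') (at x within half_space)"
  shows "D = D'"
proof (rule frechet_derivative_unique_within[OF assms(2,3)])
  fix i :: "real ^ 'n" and e :: real assume i: "i \<in> Basis" and e: "e > 0"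
  have "0 \<le> hgt i" using i by (auto simp: Basis_vec_def axis_def)
  then show "\<exists>d. 0 < \<bar>d\<bar> \<and> \<bar>d\<bar> < e \<and> x + d *\<^sub>R i \<in> half_space"
    using assms(1) e by (intro exI[of _ "e/2"]) (auto simp: half_space_def)
qed

lemma pd_eqI:
  assumes "x \<in> half_space" "(u has_derivative D) (at x within half_space)"
  shows "pd i u x = D (axis i 1)"
  using half_space_unique_derivative[OF assms, of "frechet_derivative u (at x within half_space)"] assms(2)
  unfolding pd_def by (metis differentiable_def frechet_derivative_works)

lemma vec_axis_expansion: "(v :: real ^ 'n::finite) = (\<Sum>i\<in>UNIV. (v $ i) *\<^sub>R axis i 1)"
  using basis_expansion[of v] by (simp add: scalar_mult_eq_scaleR)

lemma linear_axis_expansion: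
  assumes "linear D" shows "D (v :: real ^ 'n::finite) = (\<Sum>i\<in>UNIV. (v $ i) *\<^sub>R D (axis i 1))"
proof -
  have "D (\<Sum>i\<in>UNIV. (v $ i) *\<^sub>R axis i 1) = (\<Sum>i\<in>UNIV. (v $ i) *\<^sub>R D (axis i 1))"
    by (simp add: linear_sum[OF assms] linear_scale[OF assms])
  then show ?thesis unfolding vec_axis_expansion[of v, symmetric] .
qed

lemma has_derivative_pd:
  assumes "x \<in> half_space" "(u has_derivative D) (at x within half_space)"
  shows "(u has_derivative (\<lambda>v. dpd u x v)) (at x within half_space)"
proof -
  have "D = (\<lambda>v. dpd u x v)"
  proof
    fix v show "D v = (dpd u x v)"
      unfolding pd_eqI[OF assms] by (rule linear_axis_expansion[OF has_derivative_linear[OF assms(2)]])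
  qed
  then show ?thesis using assms(2) by simp
qed

lemma at_within_hopen: assumes "hopen S" "x \<in> S" shows "at x within S = at x within half_space"
proof -
  obtain T where T: "open T" "S = half_space \<inter> T" using assms(1) by (auto simp: openin_open)
  then show ?thesis using assms(2) by (intro at_within_nhd[of x T]) auto
qed

lemma pd_cong:
  assumes "hopen S" "x \<in> S" "\<And>y. y \<in> S \<Longrightarrow> u y = w y"
  shows "pd i u x = pd i w x"
proof -
  have "(u has_derivative D) (at x within S) \<longleftrightarrow> (w has_derivative D) (at x within S)" for D
    using has_derivative_transform[of x S u w D] has_derivative_transform[of x S w u D] assms by auto
  then show ?thesis by (simp add: pd_def frechet_derivative_def at_within_hopen[OF assms(1,2)])
qed

text \<open>The neighbourhood is shrunk until all of its half-space part lies in \<open>S\<close>.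
  Then derivatives within the half-space are those of the extension, also at boundary
  points.\<close>

lemma smooth_on_hopenE:
  assumes "hopen S" "smooth_on S u" "x \<in> S"
  obtains W F where "x \<in> W" "Cinf_on W F" "half_space \<inter> W \<subseteq> S" "\<And>y. y \<in> half_space \<inter> W \<Longrightarrow> F y = u y"
proof -
  obtain W F where W: "x \<in> W" "Cinf_on W F" "\<And>y. y \<in> S \<Longrightarrow> y \<in> W \<Longrightarrow> F y = u y"
    using assms smooth_onE by blast
  obtain T where T: "open T" "S = half_space \<inter> T" using assms(1) by (auto simp: openin_open)
  show ?thesis
    by (rule that[of "W \<inter> T" F]) (use W T assms(3) Cinf_on_Int in auto)
qed

lemma has_derivative_smooth_ext:
  assumes "x \<in> half_space" "x \<in> W" "Cinf_on W F" "\<And>y. y \<in> half_space \<inter> W \<Longrightarrow> F y = u y"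
  shows "(u has_derivative \<D> F x) (at x within half_space)"
proof -
  have d: "(F has_derivative \<D> F x) (at x within half_space)"
    using Cinf_on_has_derivative[OF assms(3,2)] has_derivative_at_withinI by blast
  obtain r where "r > 0" "ball x r \<subseteq> W" using Cinf_on_open[OF assms(3)] assms(2) openE by blast
  then show ?thesis
    using has_derivative_transform_within[OF d \<open>r > 0\<close> assms(1), of u] assms(4) by (auto simp: subset_iff dist_commute)
qed

lemma pd_smooth_ext:
  assumes "x \<in> half_space" "x \<in> W" "Cinf_on W F" "\<And>y. y \<in> half_space \<inter> W \<Longrightarrow> F y = u y"
  shows "pd i u x = \<D> F x (axis i 1)"
  using pd_eqI[OF assms(1) has_derivative_smooth_ext[OF assms]] .

lemma smooth_has_derivative:
  assumes "hopen S" "smooth_on S u" "x \<in> S"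
  shows "(u has_derivative (\<lambda>v. dpd u x v)) (at x within half_space)"
proof -
  have x: "x \<in> half_space" using assms hopen_subset by blast
  obtain W F where "x \<in> W" "Cinf_on W F" "half_space \<inter> W \<subseteq> S" "\<And>y. y \<in> half_space \<inter> W \<Longrightarrow> F y = u y"
    using smooth_on_hopenE[OF assms] by blast
  from has_derivative_pd[OF x has_derivative_smooth_ext[OF x this(1,2,4)]] show ?thesis .
qed

lemma smooth_on_pd:
  assumes "hopen S" "smooth_on S u" shows "smooth_on S (pd i u)"
  unfolding smooth_on_altdef
proof
  fix x assume x: "x \<in> S"
  obtain W F where W: "x \<in> W" "Cinf_on W F" "half_space \<inter> W \<subseteq> S" "\<And>y. y \<in> half_space \<inter> W \<Longrightarrow> F y = u y"
    using smooth_on_hopenE[OF assms x] by blast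
  have "\<D> F y (axis i 1) = pd i u y" if "y \<in> S \<inter> W" for y
    using pd_smooth_ext[of y W F u i] W(2,4) that hopen_subset[OF assms(1)] by auto
  then show "\<exists>W F. x \<in> W \<and> Cinf_on W F \<and> (\<forall>y\<in>S \<inter> W. F y = pd i u y)"
    using W(1) Cinf_on_derivative[OF W(2)] by blast
qed

lemma pd_commute:
  fixes u :: "real ^ 'n::finite \<Rightarrow> real"
  assumes "hopen S" "smooth_on S u" "x \<in> S"
  shows "pd i (pd j u) x = pd j (pd i u) x"
proof -
  have x: "x \<in> half_space" using assms hopen_subset by blast
  obtain W F where W: "x \<in> W" "Cinf_on W F" "half_space \<inter> W \<subseteq> S" "\<And>y. y \<in> half_space \<inter> W \<Longrightarrow> F y = u y"
    using smooth_on_hopenE[OF assms] by blast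
  have *: "\<D> F y (axis k 1) = pd k u y" if "y \<in> half_space \<inter> W" for y k
    using pd_smooth_ext[of y W F u k] W(2,4) that by auto
  have "pd i (pd j u) x = \<D> (\<lambda>y. \<D> F y (axis j 1)) x (axis i 1)" for i j
    using pd_smooth_ext[OF x W(1) Cinf_on_derivative[OF W(2)], of "axis j 1" "pd j u" i] * by auto
  then show ?thesis using second_derivative_symmetric_Cinf[OF W(2,1)] by simp
qed

lemma pd_const: assumes "x \<in> half_space" shows "pd i (\<lambda>x. a) x = 0"
  by (subst pd_eqI[OF assms, where D = "\<lambda>x. 0"]) auto

section \<open>Rules of calculus for \<open>pd\<close>\<close>

context
  fixes S :: "(real ^ 'n::finite) set" and x
  assumes S: "hopen S" and x: "x \<in> S"
begin

private lemma xh: "x \<in> half_space" using S x hopen_subset by blast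

lemma pd_add:
  assumes "smooth_on S u" "smooth_on S w"
  shows "pd i (\<lambda>y. u y + w y) x = pd i u x + pd i w x"
  using pd_eqI[OF xh has_derivative_add[OF smooth_has_derivative[OF S assms(1) x] smooth_has_derivative[OF S assms(2) x]]]
  by (simp add: axis_def if_distrib[of "\<lambda>a. a *\<^sub>R _"] cong: if_cong)

lemma pd_diff:
  assumes "smooth_on S u" "smooth_on S w"
  shows "pd i (\<lambda>y. u y - w y) x = pd i u x - pd i w x"
  using pd_eqI[OF xh has_derivative_diff[OF smooth_has_derivative[OF S assms(1) x] smooth_has_derivative[OF S assms(2) x]]]
  by (simp add: axis_def if_distrib[of "\<lambda>a. a *\<^sub>R _"] cong: if_cong)

lemma pd_linear:
  assumes "bounded_linear L" "smooth_on S u"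
  shows "pd i (\<lambda>y. L (u y)) x = L (pd i u x)"
  using pd_eqI[OF xh bounded_linear.has_derivative[OF assms(1) smooth_has_derivative[OF S assms(2) x]]]
  by (simp add: axis_def if_distrib[of "\<lambda>a. a *\<^sub>R _"] cong: if_cong)

lemma pd_bilinear:
  assumes "bounded_bilinear B" "smooth_on S u" "smooth_on S w"
  shows "pd i (\<lambda>y. B (u y) (w y)) x = B (u x) (pd i w x) + B (pd i u x) (w x)"
  using pd_eqI[OF xh bounded_bilinear.FDERIV[OF assms(1) smooth_has_derivative[OF S assms(2) x] smooth_has_derivative[OF S assms(3) x]]]
  by (simp add: axis_def if_distrib[of "\<lambda>a. a *\<^sub>R _"] cong: if_cong)

lemma pd_sum:
  assumes "\<And>k. k \<in> I \<Longrightarrow> smooth_on S (u k)"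
  shows "pd i (\<lambda>y. \<Sum>k\<in>I. u k y) x = (\<Sum>k\<in>I. pd i (u k) x)"
  using assms by (induction I rule: infinite_finite_induct)
    (simp_all add: pd_const[OF xh] pd_add smooth_on_sum)

end

lemmas pd_mult = pd_bilinear[OF _ _ bounded_bilinear_mult]
lemmas pd_inner = pd_bilinear[OF _ _ bounded_bilinear_inner]
lemmas pd_vec_nth = pd_linear[OF _ _ bounded_linear_vec_nth]

lemma pd_cmult:
  fixes u :: "real ^ 'n::finite \<Rightarrow> real"
  assumes "hopen S" "x \<in> S" "smooth_on S u" shows "pd i (\<lambda>y. a * u y) x = a * pd i u x"
  using pd_linear[OF assms(1,2) bounded_linear_mult_right assms(3)] .

lemma smooth_on_vec_nth: "smooth_on S u \<Longrightarrow> smooth_on S (\<lambda>x. u x $ i)"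
  by (rule smooth_on_linear[OF bounded_linear_vec_nth])

section \<open>Matrix-valued maps, the chain rule and continuity up to the boundary\<close>

lemma smooth_on_vec:
  fixes f :: "'a::euclidean_space \<Rightarrow> 'b::real_normed_vector ^ 'n::finite"
  assumes "\<And>i. smooth_on S (\<lambda>x. f x $ i)" shows "smooth_on S f"
proof -
  have b: "bounded_linear (\<lambda>y::'b. axis i y :: 'b ^ 'n)" for i
  proof (rule bounded_linear_intro[where K=1])
    fix y :: 'b
    have "norm (axis i y :: 'b ^ 'n) \<le> (\<Sum>j\<in>UNIV. norm ((axis i y :: 'b ^ 'n) $ j))"
      unfolding norm_vec_def by (rule L2_set_le_sum) simp
    also have "\<dots> = norm y" by (simp add: axis_def if_distrib cong: if_cong)
    finally show "norm (axis i y :: 'b ^ 'n) \<le> norm y * 1" by simp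
  qed (auto simp: axis_def vec_eq_iff)
  have "f = (\<lambda>x. \<Sum>i\<in>UNIV. axis i (f x $ i))"
    by (auto simp: fun_eq_iff vec_eq_iff axis_def if_distrib cong: if_cong)
  moreover have "smooth_on S (\<lambda>x. \<Sum>i\<in>UNIV. axis i (f x $ i))"
    by (intro smooth_on_sum smooth_on_linear[OF b] assms)
  ultimately show ?thesis by simp
qed

lemma smooth_on_det:
  fixes A :: "'a::euclidean_space \<Rightarrow> real ^ 'n ^ 'n::finite"
  assumes "\<And>i j. smooth_on S (\<lambda>x. A x $ i $ j)" shows "smooth_on S (\<lambda>x. det (A x))"
  unfolding det_def by (intro smooth_on_sum smooth_on_cmult smooth_on_prod assms)

lemma matrix_inv_inverse:
  fixes A :: "real ^ 'n ^ 'n::finite"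
  assumes "invertible A" shows "A ** matrix_inv A = mat 1" "matrix_inv A ** A = mat 1"
  using someI_ex[OF assms[unfolded invertible_def]] unfolding matrix_inv_def by auto

text \<open>Cramer's rule. It exhibits the entries of the inverse as rational functions of the
  entries of \<open>A\<close>, which is how the inverse metric is seen to be smooth.\<close>

lemma matrix_inv_nth:
  fixes A :: "real ^ 'n ^ 'n::finite"
  assumes "det A \<noteq> 0"
  shows "matrix_inv A $ k $ l = det (\<chi> i j. if j = k then axis l 1 $ i else A $ i $ j) * inverse (det A)"
proof -
  have inv: "A ** matrix_inv A = mat 1"
    using assms matrix_inv_inverse by (auto simp: invertible_det_nz)
  have "A *v (matrix_inv A *v axis l 1) = axis l 1"
    by (simp add: matrix_vector_mul_assoc inv)
  then have "matrix_inv A *v axis l 1 = (\<chi> k. det (\<chi> i j. if j = k then axis l 1 $ i else A $ i $ j) / det A)"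
    using cramer[OF assms] by blast
  moreover have "(matrix_inv A *v axis l 1) $ k = matrix_inv A $ k $ l"
    by (simp add: matrix_vector_mult_basis column_def)
  ultimately show ?thesis by (simp add: divide_inverse)
qed

lemma smooth_on_matrix_inv:
  fixes A :: "'a::euclidean_space \<Rightarrow> real ^ 'n ^ 'n::finite"
  assumes A: "\<And>i j. smooth_on S (\<lambda>x. A x $ i $ j)" and "\<And>x. x \<in> S \<Longrightarrow> det (A x) \<noteq> 0"
  shows "smooth_on S (\<lambda>x. matrix_inv (A x) $ k $ l)"
proof (rule smooth_on_cong)
  show "smooth_on S (\<lambda>x. det (\<chi> i j. if j = k then axis l 1 $ i else A x $ i $ j) * inverse (det (A x)))"
  proof (intro smooth_on_mult smooth_on_inverse smooth_on_det assms)
    fix i j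
    show "smooth_on S (\<lambda>x. (\<chi> i j. if j = k then axis l 1 $ i else A x $ i $ j) $ i $ j)"
      by (cases "j = k") (simp_all add: smooth_on_const A)
  qed
qed (simp add: matrix_inv_nth assms)

lemma pd_chain:
  fixes T :: "real ^ 'n::finite \<Rightarrow> real ^ 'm::finite"
  assumes S: "hopen S" "smooth_on S T" and S': "hopen S'" "smooth_on S' u" and x: "x \<in> S"
    and T: "\<And>y. y \<in> S \<Longrightarrow> T y \<in> S'"
  shows "pd i (\<lambda>y. u (T y)) x = (\<Sum>a\<in>UNIV. (pd i T x $ a) *\<^sub>R pd a u (T x))"
proof -
  have dT: "(T has_derivative (\<lambda>v. dpd T x v)) (at x within S)"
    using smooth_has_derivative[OF S x] at_within_hopen[OF S(1) x] by simp
  have du: "(u has_derivative (\<lambda>v. dpd u (T x) v)) (at (T x) within T ` S)"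
    by (rule has_derivative_subset[OF smooth_has_derivative[OF S' T[OF x]]])
       (use T hopen_subset[OF S'(1)] in auto)
  have "((\<lambda>y. u (T y)) has_derivative (\<lambda>v. \<Sum>a\<in>UNIV. ((dpd T x v) $ a) *\<^sub>R pd a u (T x))) (at x within half_space)"
    using diff_chain_within[OF dT du] by (simp add: o_def at_within_hopen[OF S(1) x])
  from pd_eqI[OF _ this] show ?thesis using hopen_subset[OF S(1)] x
    by (auto simp: axis_def if_distrib[of "\<lambda>a. a *\<^sub>R _"] cong: if_cong)
qed

lemma hopen_interior_dense:
  assumes "hopen S" "x \<in> S" "open T" "x \<in> T"
  shows "\<exists>y. y \<in> S \<inter> T \<and> 0 < hgt y"
proof -
  obtain U where U: "open U" "S = half_space \<inter> U" using assms(1) by (auto simp: openin_open)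
  obtain e where e: "e > 0" "ball x e \<subseteq> U \<inter> T"
    using assms U openE[of "U \<inter> T" x] by auto
  have "dist x (x + (e/2) *\<^sub>R axis bdry_index 1) < e" using e(1) by (simp add: dist_norm norm_axis_1)
  then show ?thesis using e U assms(2)
    by (intro exI[of _ "x + (e/2) *\<^sub>R axis bdry_index 1"]) (auto simp: half_space_def subset_iff)
qed

text \<open>Carries identities that rest on ordinary derivatives, and hence on interior points, over
  to the boundary.\<close>

lemma eq_on_hopen_by_interior:
  fixes f g :: "real ^ 'n::finite \<Rightarrow> 'b::real_normed_vector"
  assumes S: "hopen S" and fg: "continuous_on S f" "continuous_on S g"
    and eq: "\<And>y. y \<in> S \<Longrightarrow> 0 < hgt y \<Longrightarrow> f y = g y" and x: "x \<in> S"
  shows "f x = g x"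
proof (rule ccontr)
  assume "f x \<noteq> g x"
  then have d: "norm (f x - g x) > 0" by simp
  have "continuous_on S (\<lambda>y. f y - g y)" by (intro continuous_intros fg)
  then obtain e where e: "e > 0" "\<And>y. y \<in> S \<Longrightarrow> dist y x < e \<Longrightarrow> dist (f y - g y) (f x - g x) < norm (f x - g x)"
    using x d unfolding continuous_on_iff by meson
  obtain y where "y \<in> S \<inter> ball x e" "0 < hgt y"
    using hopen_interior_dense[OF S x, of "ball x e"] e(1) by auto
  then show False using e(2)[of y] eq[of y] by (auto simp: dist_commute)
qed

section \<open>Curvature in a chart\<close>

locale metric_chart =
  fixes S :: "(real ^ 'n::finite) set" and G :: "real ^ 'n \<Rightarrow> real ^ 'n ^ 'n"
  assumes hopen_S: "hopen S" and smooth_G: "smooth_on S G"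
    and sym_G: "x \<in> S \<Longrightarrow> transpose (G x) = G x"
    and pos_G: "x \<in> S \<Longrightarrow> v \<noteq> 0 \<Longrightarrow> 0 < v \<bullet> (G x *v v)"
begin

abbreviation "g i j \<equiv> \<lambda>x. G x $ i $ j"
abbreviation "gi i j \<equiv> \<lambda>x. matrix_inv (G x) $ i $ j"
abbreviation "\<Gamma> \<equiv> christoffel G"

text \<open>Christoffel symbols of the first kind: \<open>C l i j\<close> is \<open>\<Gamma>\<^sub>l\<^sub>,\<^sub>i\<^sub>j\<close>.\<close>

definition C :: "'n \<Rightarrow> 'n \<Rightarrow> 'n \<Rightarrow> real ^ 'n \<Rightarrow> real" where
  "C l i j x = (pd i (g j l) x + pd j (g i l) x - pd l (g i j) x) / 2"

lemma in_half: "x \<in> S \<Longrightarrow> x \<in> half_space"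
  using hopen_S hopen_subset by blast

lemma smooth_g: "smooth_on S (g i j)"
  by (intro smooth_on_vec_nth smooth_G)

lemma det_G: assumes "x \<in> S" shows "det (G x) \<noteq> 0"
proof
  assume "det (G x) = 0"
  then have "\<not> invertible (G x)" by (simp add: invertible_det_nz)
  then obtain v where "G x *v v = 0" "v \<noteq> 0"
    using matrix_left_invertible_ker[of "G x"] unfolding invertible_left_inverse by auto
  then show False using pos_G[OF assms, of v] by simp
qed

lemma smooth_gi: "smooth_on S (gi i j)"
  by (rule smooth_on_matrix_inv[OF smooth_g det_G])

lemma smooth_pd_g: "smooth_on S (pd k (g i j))"
  by (rule smooth_on_pd[OF hopen_S smooth_g])

lemma smooth_C: "smooth_on S (C l i j)"
  unfolding C_def divide_inverse
  by (intro smooth_on_mult smooth_on_add smooth_on_diff smooth_pd_g smooth_on_const)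

lemma christoffel_C: "\<Gamma> k i j x = (\<Sum>l\<in>UNIV. gi k l x * C l i j x)"
  unfolding christoffel_def C_def by (simp add: sum_divide_distrib)

lemma smooth_christoffel: "smooth_on S (\<Gamma> k i j)"
  unfolding christoffel_C[abs_def] by (intro smooth_on_sum smooth_on_mult smooth_gi smooth_C)

lemma inv_mult: assumes "x \<in> S"
  shows "(\<Sum>l\<in>UNIV. gi i l x * g l j x) = (if i = j then 1 else 0)"
    "(\<Sum>l\<in>UNIV. g i l x * gi l j x) = (if i = j then 1 else 0)"
proof -
  have "invertible (G x)" using det_G[OF assms] by (simp add: invertible_det_nz)
  from matrix_inv_inverse[OF this]
  have "(matrix_inv (G x) ** G x) $ i $ j = mat 1 $ i $ j" "(G x ** matrix_inv (G x)) $ i $ j = mat 1 $ i $ j" by simp_all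
  then show "(\<Sum>l\<in>UNIV. gi i l x * g l j x) = (if i = j then 1 else 0)"
    "(\<Sum>l\<in>UNIV. g i l x * gi l j x) = (if i = j then 1 else 0)"
    by (simp_all add: matrix_matrix_mult_def mat_def)
qed

lemma lower_upper:
  assumes "x \<in> S"
  shows "(\<Sum>k\<in>UNIV. g i k x * (\<Sum>l\<in>UNIV. gi k l x * a l)) = a i"
    "(\<Sum>k\<in>UNIV. gi i k x * (\<Sum>l\<in>UNIV. g k l x * a l)) = a i"
proof -
  have "(\<Sum>k\<in>UNIV. g i k x * (\<Sum>l\<in>UNIV. gi k l x * a l)) = (\<Sum>l\<in>UNIV. (\<Sum>k\<in>UNIV. g i k x * gi k l x) * a l)"
    by (simp add: sum_distrib_left sum_distrib_right mult.assoc) (rule sum.swap)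
  also have "\<dots> = a i" by (simp add: inv_mult[OF assms] if_distrib[of "\<lambda>b. b * _"] cong: if_cong)
  finally show "(\<Sum>k\<in>UNIV. g i k x * (\<Sum>l\<in>UNIV. gi k l x * a l)) = a i" .
  have "(\<Sum>k\<in>UNIV. gi i k x * (\<Sum>l\<in>UNIV. g k l x * a l)) = (\<Sum>l\<in>UNIV. (\<Sum>k\<in>UNIV. gi i k x * g k l x) * a l)"
    by (simp add: sum_distrib_left sum_distrib_right mult.assoc) (rule sum.swap)
  also have "\<dots> = a i" by (simp add: inv_mult[OF assms] if_distrib[of "\<lambda>b. b * _"] cong: if_cong)
  finally show "(\<Sum>k\<in>UNIV. gi i k x * (\<Sum>l\<in>UNIV. g k l x * a l)) = a i" .
qed

lemma g_sym: "x \<in> S \<Longrightarrow> g i j x = g j i x"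
  by (drule sym_G) (simp add: transpose_def vec_eq_iff)

lemma gi_sym: assumes "x \<in> S" shows "gi i j x = gi j i x"
proof -
  let ?B = "matrix_inv (G x)"
  have "invertible (G x)" using det_G[OF assms] by (simp add: invertible_det_nz)
  note inv = matrix_inv_inverse[OF this]
  have "G x ** transpose ?B = mat 1"
    using arg_cong[OF inv(2), of transpose] by (simp add: matrix_transpose_mul sym_G[OF assms] transpose_mat)
  then have "?B ** (G x ** transpose ?B) = ?B" by simp
  then have "transpose ?B = ?B" by (simp only: matrix_mul_assoc inv matrix_mul_lid)
  then have "transpose ?B $ j $ i = ?B $ j $ i" by simp
  then show ?thesis by (simp add: transpose_def)
qed

lemma pd_g_sym: "x \<in> S \<Longrightarrow> pd k (g i j) x = pd k (g j i) x"
  using pd_cong[OF hopen_S, of x "g i j" "g j i" k] g_sym by auto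

lemma pd2_g_sym: "x \<in> S \<Longrightarrow> pd l (pd k (g i j)) x = pd l (pd k (g j i)) x"
  using pd_cong[OF hopen_S, of x "pd k (g i j)" "pd k (g j i)" l] pd_g_sym by auto

lemma pd2_g_commute: "x \<in> S \<Longrightarrow> pd l (pd k (g i j)) x = pd k (pd l (g i j)) x"
  using pd_commute[OF hopen_S smooth_g] .

lemma C_sym: "x \<in> S \<Longrightarrow> C l i j x = C l j i x"
  by (simp add: C_def pd_g_sym[of x l i j])

lemma christoffel_sym: "x \<in> S \<Longrightarrow> \<Gamma> k i j x = \<Gamma> k j i x"
  by (simp add: christoffel_C C_sym[of x _ i j])

lemma metric_compat: "x \<in> S \<Longrightarrow> pd i (g j k) x = C k i j x + C j i k x"
  by (simp add: C_def pd_g_sym[of x _ k j] pd_g_sym[of x _ i j] pd_g_sym[of x _ i k] field_simps)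

section \<open>The curvature tensor with all indices lowered, and its symmetries\<close>

lemma lower_christoffel: "x \<in> S \<Longrightarrow> (\<Sum>m\<in>UNIV. g l m x * \<Gamma> m i j x) = C l i j x"
  by (simp add: christoffel_C lower_upper)

text \<open>The inner product of the covariant derivative of the \<open>b\<close>-th coordinate
  field along the \<open>a\<close>-th with that of the \<open>d\<close>-th along the
  \<open>c\<close>-th.\<close>

definition Q where "Q a b c d x = (\<Sum>m\<in>UNIV. C m a b x * \<Gamma> m c d x)"

lemma Q_sym: assumes "x \<in> S" shows "Q a b c d x = Q c d a b x"
proof -
  have "Q a b c d x = (\<Sum>m\<in>UNIV. \<Sum>l\<in>UNIV. gi m l x * (C m a b x * C l c d x))"
    by (simp add: Q_def christoffel_C sum_distrib_left mult_ac)
  also have "\<dots> = (\<Sum>m\<in>UNIV. \<Sum>l\<in>UNIV. gi l m x * (C l a b x * C m c d x))"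
    by (rule sum.swap)
  also have "\<dots> = Q c d a b x"
    by (simp add: Q_def christoffel_C sum_distrib_left mult_ac gi_sym[OF assms])
  finally show ?thesis .
qed

text \<open>The curvature tensor \<open>g(R(i, j) k, l)\<close> on coordinate fields.\<close>

definition RL where "RL l k i j x = (\<Sum>m\<in>UNIV. g l m x * riemann G m k i j x)"

lemma lower_pd_christoffel:
  assumes "x \<in> S"
  shows "(\<Sum>m\<in>UNIV. g l m x * pd i (\<Gamma> m j k) x) = pd i (C l j k) x - Q i l j k x - (\<Sum>m\<in>UNIV. C l i m x * \<Gamma> m j k x)"
proof -
  have "pd i (C l j k) x = pd i (\<lambda>x. \<Sum>m\<in>UNIV. g l m x * \<Gamma> m j k x) x"
    by (rule pd_cong[OF hopen_S assms]) (simp add: lower_christoffel)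
  also have "\<dots> = (\<Sum>m\<in>UNIV. g l m x * pd i (\<Gamma> m j k) x + pd i (g l m) x * \<Gamma> m j k x)"
    using hopen_S assms by (simp add: pd_sum pd_mult smooth_on_mult smooth_g smooth_christoffel)
  finally show ?thesis
    by (simp add: metric_compat[OF assms] sum.distrib Q_def distrib_right)
qed

text \<open>Lowering the index under the derivative of a Christoffel symbol produces, by metric
  compatibility, terms that cancel the quadratic part of the curvature. Only second derivatives of
  the metric and the products \<open>Q\<close> remain, and from this form the symmetries can be read
  off.\<close>

lemma riemann_first_kind:
  assumes x: "x \<in> S"
  shows "RL l k i j x = pd i (C l j k) x - pd j (C l i k) x - Q i l j k x + Q j l i k x"
proof -
  have lower2: "(\<Sum>m\<in>UNIV. g l m x * (\<Sum>p\<in>UNIV. \<Gamma> m i p x * b p)) = (\<Sum>p\<in>UNIV. C l i p x * b p)" for b i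
  proof -
    have "(\<Sum>m\<in>UNIV. g l m x * (\<Sum>p\<in>UNIV. \<Gamma> m i p x * b p)) = (\<Sum>p\<in>UNIV. (\<Sum>m\<in>UNIV. g l m x * \<Gamma> m i p x) * b p)"
      by (simp add: sum_distrib_left sum_distrib_right mult.assoc) (rule sum.swap)
    then show ?thesis by (simp add: lower_christoffel[OF x])
  qed
  have "RL l k i j x = (\<Sum>m\<in>UNIV. g l m x * pd i (\<Gamma> m j k) x) - (\<Sum>m\<in>UNIV. g l m x * pd j (\<Gamma> m i k) x)
     + (\<Sum>m\<in>UNIV. g l m x * (\<Sum>p\<in>UNIV. \<Gamma> m i p x * \<Gamma> p j k x)) - (\<Sum>m\<in>UNIV. g l m x * (\<Sum>p\<in>UNIV. \<Gamma> m j p x * \<Gamma> p i k x))"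
    by (simp add: RL_def riemann_def sum.distrib sum_subtractf distrib_left right_diff_distrib)
  then show ?thesis by (simp add: lower2 lower_pd_christoffel[OF x])
qed

lemma pd_C: assumes "x \<in> S"
  shows "pd i (C l j k) x = (pd i (pd j (g k l)) x + pd i (pd k (g j l)) x - pd i (pd l (g j k)) x) / 2"
proof -
  have "pd i (C l j k) x = pd i (\<lambda>x. (1/2) * ((pd j (g k l) x + pd k (g j l) x) - pd l (g j k) x)) x"
    by (rule pd_cong[OF hopen_S assms]) (simp add: C_def)
  also have "\<dots> = (1/2) * pd i (\<lambda>x. (pd j (g k l) x + pd k (g j l) x) - pd l (g j k) x) x"
    by (intro pd_cmult[OF hopen_S assms] smooth_on_add smooth_on_diff smooth_pd_g)
  finally show ?thesis using hopen_S assms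
    by (simp add: pd_diff pd_add smooth_on_add smooth_pd_g)
qed

lemma RL_antisym: assumes x: "x \<in> S" shows "RL l k i j x = - RL k l i j x"
  unfolding riemann_first_kind[OF x] pd_C[OF x]
  using Q_sym[OF x, of i l j k] Q_sym[OF x, of j l i k]
    pd2_g_commute[OF x, of i j] pd2_g_sym[OF x] 
  by (simp add: C_sym field_simps)

lemma Q_sym12: "x \<in> S \<Longrightarrow> Q a b c d x = Q b a d c x"
  by (simp add: Q_def C_sym[of x _ a b] christoffel_sym[of x _ c d])

text \<open>Obtained from the explicit formula: second derivatives of the metric commute, and
  \<open>Q\<close> is symmetric under exchanging its two pairs as well as the entries within each
  pair.\<close>

lemma RL_pair: assumes x: "x \<in> S" shows "RL l k i j x = RL i j l k x"
  unfolding riemann_first_kind[OF x] pd_C[OF x]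
  using Q_sym12[OF x, of i l j k] Q_sym12[OF x, of j l i k] Q_sym[OF x, of l j k i]
  by (simp add: pd2_g_commute[OF x] pd2_g_sym[OF x] field_simps)

text \<open>Commuting covariant derivatives of a solution \<open>\<alpha>\<close> of \<open>\<nabla>\<alpha> = \<rho> g\<close>.\<close>

lemma conformal_commutator:
  assumes x: "x \<in> S" and f: "smooth_on S f" and r: "smooth_on S r"
    and hess: "\<And>i j y. y \<in> S \<Longrightarrow> pd i (pd j f) y = (\<Sum>k\<in>UNIV. \<Gamma> k i j y * pd k f y) + r y * g i j y"
  shows "(\<Sum>m\<in>UNIV. riemann G m j l i x * pd m f x) = pd i r x * g l j x - pd l r x * g i j x"
proof -
  have sm: "smooth_on S (pd k f)" for k by (rule smooth_on_pd[OF hopen_S f])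
  \<comment> \<open>The Hessian equation is used twice, before and after differentiating, so that
    third derivatives of \<open>f\<close> are expressed through its first derivatives.\<close>
  have d2: "pd l (pd i (pd j f)) x =
      (\<Sum>k\<in>UNIV. pd l (\<Gamma> k i j) x * pd k f x)
      + (\<Sum>k\<in>UNIV. \<Gamma> k i j x * (\<Sum>m\<in>UNIV. \<Gamma> m l k x * pd m f x))
      + r x * (\<Sum>k\<in>UNIV. g l k x * \<Gamma> k i j x) + pd l r x * g i j x + r x * pd l (g i j) x" for l i
  proof -
    have "pd l (pd i (pd j f)) x = pd l (\<lambda>y. (\<Sum>k\<in>UNIV. \<Gamma> k i j y * pd k f y) + r y * g i j y) x"
      by (rule pd_cong[OF hopen_S x]) (simp add: hess)
    also have "\<dots> = (\<Sum>k\<in>UNIV. \<Gamma> k i j x * pd l (pd k f) x + pd l (\<Gamma> k i j) x * pd k f x) + (r x * pd l (g i j) x + pd l r x * g i j x)"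
      using hopen_S x by (simp add: pd_add pd_sum pd_mult smooth_on_mult smooth_on_sum smooth_g smooth_christoffel sm r)
    finally show ?thesis
      by (simp add: hess[OF x] sum.distrib distrib_left sum_distrib_left mult_ac)
  qed
  have swap: "(\<Sum>k\<in>UNIV. \<Gamma> k i j x * (\<Sum>m\<in>UNIV. \<Gamma> m l k x * pd m f x)) =
      (\<Sum>m\<in>UNIV. (\<Sum>p\<in>UNIV. \<Gamma> m l p x * \<Gamma> p i j x) * pd m f x)" for l i
    unfolding sum_distrib_left sum_distrib_right by (subst sum.swap) (simp add: mult_ac)
  have R: "(\<Sum>m\<in>UNIV. riemann G m j l i x * pd m f x) =
     (\<Sum>k\<in>UNIV. pd l (\<Gamma> k i j) x * pd k f x) - (\<Sum>k\<in>UNIV. pd i (\<Gamma> k l j) x * pd k f x)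
     + (\<Sum>m\<in>UNIV. (\<Sum>p\<in>UNIV. \<Gamma> m l p x * \<Gamma> p i j x) * pd m f x)
     - (\<Sum>m\<in>UNIV. (\<Sum>p\<in>UNIV. \<Gamma> m i p x * \<Gamma> p l j x) * pd m f x)"
    by (simp add: riemann_def sum.distrib sum_subtractf distrib_right left_diff_distrib)
  have "pd l (pd i (pd j f)) x = pd i (pd l (pd j f)) x" by (rule pd_commute[OF hopen_S sm x])
  \<comment> \<open>The terms in which \<open>r\<close> itself is not differentiated cancel, because
    the connection is metric and torsion free.\<close>
  moreover have "r x * (C l i j x - C i l j x + pd l (g i j) x - pd i (g l j) x) = 0"
    by (simp add: C_def pd_g_sym[OF x, of _ j l] pd_g_sym[OF x, of _ j i] pd_g_sym[OF x, of _ i l] field_simps)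
  ultimately show ?thesis
    unfolding d2 lower_christoffel[OF x] swap R by (simp add: algebra_simps)
qed

text \<open>\<open>X f k\<close> is the \<open>k\<close>-th component of the gradient of \<open>f\<close>.\<close>

definition X :: "(real ^ 'n \<Rightarrow> real) \<Rightarrow> 'n \<Rightarrow> real ^ 'n \<Rightarrow> real"
  where "X f k x = (\<Sum>l\<in>UNIV. gi k l x * pd l f x)"

lemma lower_X: "x \<in> S \<Longrightarrow> (\<Sum>k\<in>UNIV. g i k x * X f k x) = pd i f x"
  by (simp add: X_def lower_upper)

lemma smooth_X: "smooth_on S f \<Longrightarrow> smooth_on S (X f k)"
  unfolding X_def by (intro smooth_on_sum smooth_on_mult smooth_gi smooth_on_pd hopen_S)

lemma conformal_commutator_lower:
  assumes x: "x \<in> S" and "smooth_on S f" "smooth_on S r"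
    and "\<And>i j y. y \<in> S \<Longrightarrow> pd i (pd j f) y = (\<Sum>k\<in>UNIV. \<Gamma> k i j y * pd k f y) + r y * g i j y"
  shows "(\<Sum>k\<in>UNIV. X f k x * RL k j l i x) = pd i r x * g l j x - pd l r x * g i j x"
proof -
  have "(\<Sum>k\<in>UNIV. X f k x * RL k j l i x) = (\<Sum>m\<in>UNIV. riemann G m j l i x * (\<Sum>k\<in>UNIV. g m k x * X f k x))"
    unfolding RL_def sum_distrib_left by (subst sum.swap) (simp add: mult_ac g_sym[OF x])
  then show ?thesis using conformal_commutator[OF assms, of j l i] by (simp add: lower_X[OF x])
qed

text \<open>Contract the commutator identity with the inverse metric over \<open>l\<close> and
  \<open>j\<close>. On the right, \<open>g l j\<close> contributes the dimension and the other term
  removes one, giving \<open>(n - 1) dr\<close>. On the left, antisymmetry of the curvature in its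
  first pair produces minus the Ricci tensor applied to the gradient of \<open>f\<close>. Cancelling
  \<open>n - 1\<close> is where \<open>2 <= n\<close> enters.\<close>

lemma einstein_conformal_factor:
  assumes x: "x \<in> S" and n: "2 \<le> CARD('n)" and f: "smooth_on S f" "smooth_on S r"
    and hess: "\<And>i j y. y \<in> S \<Longrightarrow> pd i (pd j f) y = (\<Sum>k\<in>UNIV. \<Gamma> k i j y * pd k f y) + r y * g i j y"
    and ein: "\<And>i j. ricci G i j x = (real CARD('n) - 1) * c * g i j x"
  shows "pd i r x = - c * pd i f x"
proof -
  have t1: "(\<Sum>l\<in>UNIV. \<Sum>j\<in>UNIV. gi l j x * (pd i r x * g l j x - pd l r x * g i j x)) = (real CARD('n) - 1) * pd i r x"
  proof -
    have a: "(\<Sum>j\<in>UNIV. gi l j x * (pd i r x * g l j x - pd l r x * g i j x)) = pd i r x - (if l = i then pd l r x else 0)" for l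
    proof -
      have "(\<Sum>j\<in>UNIV. gi l j x * (pd i r x * g l j x - pd l r x * g i j x)) =
         pd i r x * (\<Sum>j\<in>UNIV. gi l j x * g j l x) - pd l r x * (\<Sum>j\<in>UNIV. gi l j x * g j i x)"
        by (simp add: g_sym[OF x, of _ l] g_sym[OF x, of _ i] right_diff_distrib sum_subtractf sum_distrib_left mult_ac)
      then show ?thesis by (simp add: inv_mult[OF x])
    qed
    show ?thesis by (simp add: a sum_subtractf left_diff_distrib)
  qed
  have "(\<Sum>l\<in>UNIV. \<Sum>j\<in>UNIV. gi l j x * (\<Sum>k\<in>UNIV. X f k x * RL k j l i x)) =
     - (\<Sum>k\<in>UNIV. X f k x * (\<Sum>l\<in>UNIV. \<Sum>j\<in>UNIV. gi l j x * RL j k l i x))"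
  proof -
    have "(\<Sum>l\<in>UNIV. \<Sum>j\<in>UNIV. gi l j x * (\<Sum>k\<in>UNIV. X f k x * RL k j l i x)) =
      (\<Sum>l\<in>UNIV. \<Sum>k\<in>UNIV. \<Sum>j\<in>UNIV. gi l j x * (X f k x * RL k j l i x))"
      by (simp add: sum_distrib_left) (intro sum.cong refl sum.swap)
    also have "\<dots> = (\<Sum>k\<in>UNIV. \<Sum>l\<in>UNIV. \<Sum>j\<in>UNIV. gi l j x * (X f k x * RL k j l i x))" by (rule sum.swap)
    also have "\<dots> = - (\<Sum>k\<in>UNIV. X f k x * (\<Sum>l\<in>UNIV. \<Sum>j\<in>UNIV. gi l j x * RL j k l i x))"
    proof -
      have "gi l j x * (X f k x * RL k j l i x) = - (X f k x * (gi l j x * RL j k l i x))" for k l j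
        using RL_antisym[OF x, of k j l i] by simp
      then show ?thesis by (simp add: sum_negf sum_distrib_left)
    qed
    finally show ?thesis .
  qed
  also have "(\<lambda>k. \<Sum>l\<in>UNIV. \<Sum>j\<in>UNIV. gi l j x * RL j k l i x) = (\<lambda>k. ricci G i k x)"
    unfolding RL_def lower_upper(2)[OF x] ricci_def ..
  also have "- (\<Sum>k\<in>UNIV. X f k x * ricci G i k x) = - ((real CARD('n) - 1) * c * (\<Sum>k\<in>UNIV. g i k x * X f k x))"
    by (simp add: ein sum_distrib_left mult_ac)
  finally have "(real CARD('n) - 1) * pd i r x = (real CARD('n) - 1) * (- c * pd i f x)"
    using t1 by (simp add: conformal_commutator_lower[OF x f hess] lower_X[OF x])
  then show ?thesis using n by (subst (asm) mult_cancel_left) auto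
qed

text \<open>\<open>WW c i j\<close> is the matrix of the endomorphism
  \<open>R(\<partial>\<^sub>i, \<partial>\<^sub>j) - c (\<partial>\<^sub>i \<and> \<partial>\<^sub>j)\<close>, whose vanishing means constant curvature \<open>c\<close>.\<close>

definition NN :: "'n \<Rightarrow> real ^ 'n \<Rightarrow> real ^ 'n ^ 'n" where "NN i x = (\<chi> l k. \<Gamma> l i k x)"

definition RR :: "'n \<Rightarrow> 'n \<Rightarrow> real ^ 'n \<Rightarrow> real ^ 'n ^ 'n" where "RR i j x = (\<chi> l k. riemann G l k i j x)"

definition TT :: "'n \<Rightarrow> 'n \<Rightarrow> real ^ 'n \<Rightarrow> real ^ 'n ^ 'n"
  where "TT i j x = (\<chi> l k. (if l = i then 1 else 0) * g j k x - (if l = j then 1 else 0) * g i k x)"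

definition WW :: "real \<Rightarrow> 'n \<Rightarrow> 'n \<Rightarrow> real ^ 'n \<Rightarrow> real ^ 'n ^ 'n"
  where "WW c i j x = RR i j x - c *\<^sub>R TT i j x"

section \<open>Bianchi identities in matrix form\<close>

lemma smooth_NN: "smooth_on S (NN i)"
  by (intro smooth_on_vec) (simp add: NN_def smooth_christoffel)

lemma smooth_TT: "smooth_on S (TT i j)"
  by (intro smooth_on_vec) (simp add: TT_def smooth_on_diff smooth_on_mult smooth_on_const smooth_g)

lemma smooth_RR: "smooth_on S (RR i j)"
proof -
  have "smooth_on S (riemann G l k i j)" for l k
    unfolding riemann_def
    by (intro smooth_on_add smooth_on_diff smooth_on_sum smooth_on_mult smooth_on_pd hopen_S smooth_christoffel)
  then show ?thesis by (intro smooth_on_vec) (simp add: RR_def)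
qed

lemma smooth_WW: "smooth_on S (WW c i j)"
  unfolding WW_def by (intro smooth_on_diff smooth_on_scaleR smooth_on_const smooth_RR smooth_TT)

lemma pd_mat_nth: "x \<in> S \<Longrightarrow> smooth_on S A \<Longrightarrow> pd i A x $ l $ k = pd i (\<lambda>y. (A y :: real ^ 'n ^ 'n) $ l $ k) x"
  using pd_vec_nth[OF hopen_S, of x A i l] pd_vec_nth[OF hopen_S, of x "\<lambda>y. A y $ l" i k]
  by (simp add: smooth_on_vec_nth)

lemma pd_mat_commute: assumes x: "x \<in> S" and A: "smooth_on S A"
  shows "pd i (pd j A) x = pd j (pd i (A :: real ^ 'n \<Rightarrow> real ^ 'n ^ 'n)) x"
proof -
  have "pd i (pd j A) x $ l $ k = pd i (pd j (\<lambda>y. A y $ l $ k)) x" for i j l k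
    using pd_mat_nth[OF x smooth_on_pd[OF hopen_S A], of i j l k]
      pd_cong[OF hopen_S x, of "\<lambda>y. pd j A y $ l $ k" "pd j (\<lambda>y. A y $ l $ k)" i] pd_mat_nth[OF _ A] by simp
  then show ?thesis
    using pd_commute[OF hopen_S _ x, of "\<lambda>y. A y $ l $ k" i j for l k] A
    by (simp add: vec_eq_iff smooth_on_vec_nth)
qed

text \<open>Cartan's structure equation: the curvature is \<open>dN + N N\<close> for the connection
  matrices \<open>NN\<close>. In this form the second Bianchi identity is an identity between
  noncommuting matrices.\<close>

lemma RR_eq: assumes x: "x \<in> S"
  shows "RR i j x = pd i (NN j) x - pd j (NN i) x + NN i x ** NN j x - NN j x ** NN i x"
  by (simp add: vec_eq_iff RR_def riemann_def pd_mat_nth[OF x smooth_NN] matrix_matrix_mult_def sum_subtractf)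
     (simp add: NN_def)

lemma WW_antisym: "WW c i j x = - WW c j i x"
  by (simp add: vec_eq_iff WW_def RR_def TT_def riemann_def sum_subtractf algebra_simps)

lemma bounded_bilinear_matrix_mult: "bounded_bilinear ((**) :: real ^ 'n ^ 'n \<Rightarrow> real ^ 'n ^ 'n \<Rightarrow> real ^ 'n ^ 'n)"
  unfolding bilinear_conv_bounded_bilinear[symmetric] bilinear_def
  by (auto intro!: linearI simp: vec_eq_iff matrix_matrix_mult_def sum.distrib sum_distrib_left algebra_simps)

text \<open>Each bracket is a covariant derivative in which only the endomorphism indices are
  corrected, by a commutator with \<open>NN\<close>. The corrections for the form indices
  \<open>p\<close>, \<open>i\<close>, \<open>j\<close> would cancel in the cyclic sum. After
  inserting \<open>RR_eq\<close>, the second derivatives cancel in pairs and the cubic terms by the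
  Jacobi identity.\<close>

lemma second_bianchi_RR: assumes x: "x \<in> S"
  shows "(pd p (RR i j) x + NN p x ** RR i j x - RR i j x ** NN p x)
       + (pd i (RR j p) x + NN i x ** RR j p x - RR j p x ** NN i x)
       + (pd j (RR p i) x + NN j x ** RR p i x - RR p i x ** NN j x) = 0"
proof -
  note sm = smooth_NN smooth_on_pd[OF hopen_S smooth_NN] smooth_on_bilinear[OF bounded_bilinear_matrix_mult]
  have d: "pd p (RR i j) x = pd p (pd i (NN j)) x - pd p (pd j (NN i)) x
      + (NN i x ** pd p (NN j) x + pd p (NN i) x ** NN j x) - (NN j x ** pd p (NN i) x + pd p (NN j) x ** NN i x)" for p i j
  proof -
    have "pd p (RR i j) x = pd p (\<lambda>x. ((pd i (NN j) x - pd j (NN i) x) + NN i x ** NN j x) - NN j x ** NN i x) x"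
      by (rule pd_cong[OF hopen_S x]) (simp add: RR_eq)
    then show ?thesis
      using hopen_S x by (simp add: pd_diff pd_add pd_bilinear[OF _ _ bounded_bilinear_matrix_mult] sm smooth_on_add smooth_on_diff)
  qed
  show ?thesis
    unfolding d RR_eq[OF x] pd_mat_commute[OF x smooth_NN, of p i] pd_mat_commute[OF x smooth_NN, of p j] pd_mat_commute[OF x smooth_NN, of i j]
    by (simp add: matrix_mul_assoc
      bounded_bilinear.add_left[OF bounded_bilinear_matrix_mult] bounded_bilinear.add_right[OF bounded_bilinear_matrix_mult]
      bounded_bilinear.diff_left[OF bounded_bilinear_matrix_mult] bounded_bilinear.diff_right[OF bounded_bilinear_matrix_mult] algebra_simps)
qed

text \<open>The model tensor satisfies the same identity because the metric is parallel. Each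
  bracket reduces to Christoffel symbols that are symmetric in two of the cyclic indices, so they
  cancel in the sum. Therefore the difference \<open>WW\<close> inherits the identity from
  \<open>RR\<close>.\<close>

lemma second_bianchi_TT: assumes x: "x \<in> S"
  shows "(pd p (TT i j) x + NN p x ** TT i j x - TT i j x ** NN p x)
       + (pd i (TT j p) x + NN i x ** TT j p x - TT j p x ** NN i x)
       + (pd j (TT p i) x + NN j x ** TT p i x - TT p i x ** NN j x) = 0"
proof -
  have d: "(pd p (TT i j) x + NN p x ** TT i j x - TT i j x ** NN p x) $ l $ k =
     (if l = i then 1 else 0) * C k p j x - (if l = j then 1 else 0) * C k p i x + \<Gamma> l p i x * g j k x - \<Gamma> l p j x * g i k x" for p i j l k
  proof -
    have 1: "pd p (TT i j) x $ l $ k = (if l = i then 1 else 0) * pd p (g j k) x - (if l = j then 1 else 0) * pd p (g i k) x"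
    proof -
      have "pd p (\<lambda>y. a * g j k y - b * g i k y) x = a * pd p (g j k) x - b * pd p (g i k) x" for a b
        using hopen_S x by (simp add: pd_diff pd_cmult smooth_on_cmult smooth_g)
      then show ?thesis unfolding pd_mat_nth[OF x smooth_TT] by (simp only: TT_def vec_lambda_beta)
    qed
    have 2: "(NN p x ** TT i j x) $ l $ k = \<Gamma> l p i x * g j k x - \<Gamma> l p j x * g i k x"
      by (simp add: matrix_matrix_mult_def NN_def TT_def right_diff_distrib sum_subtractf if_distrib[of "\<lambda>b. b * _"] if_distrib[of "\<lambda>b. _ * b"] cong: if_cong)
    have 3: "(TT i j x ** NN p x) $ l $ k = (if l = i then 1 else 0) * C j p k x - (if l = j then 1 else 0) * C i p k x"
      by (simp add: matrix_matrix_mult_def NN_def TT_def left_diff_distrib sum_subtractf lower_christoffel[OF x, symmetric])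
    show ?thesis by (simp add: 1 2 3 metric_compat[OF x])
  qed
  show ?thesis
    by (simp only: vec_eq_iff vector_add_component d)
       (simp add: C_sym[OF x, of _ i p] C_sym[OF x, of _ j p] C_sym[OF x, of _ j i]
         christoffel_sym[OF x, of _ i p] christoffel_sym[OF x, of _ j p] christoffel_sym[OF x, of _ j i])
qed

lemma second_bianchi_WW: assumes x: "x \<in> S"
  shows "(pd p (WW c i j) x + NN p x ** WW c i j x - WW c i j x ** NN p x)
       + (pd i (WW c j p) x + NN i x ** WW c j p x - WW c j p x ** NN i x)
       + (pd j (WW c p i) x + NN j x ** WW c p i x - WW c p i x ** NN j x) = 0"
proof -
  have d: "pd p (WW c i j) x + NN p x ** WW c i j x - WW c i j x ** NN p x =
     (pd p (RR i j) x + NN p x ** RR i j x - RR i j x ** NN p x)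
     - c *\<^sub>R (pd p (TT i j) x + NN p x ** TT i j x - TT i j x ** NN p x)" for p i j
    unfolding WW_def using hopen_S x
    by (simp add: pd_diff smooth_RR smooth_TT smooth_on_scaleR smooth_on_const pd_linear[OF _ _ bounded_linear_scaleR_right]
       bounded_bilinear.diff_left[OF bounded_bilinear_matrix_mult] bounded_bilinear.diff_right[OF bounded_bilinear_matrix_mult]
       bounded_bilinear.scaleR_left[OF bounded_bilinear_matrix_mult] bounded_bilinear.scaleR_right[OF bounded_bilinear_matrix_mult] algebra_simps)
  show ?thesis
    unfolding d
  proof -
    have "r1 + r2 + r3 = 0 \<Longrightarrow> t1 + t2 + t3 = 0 \<Longrightarrow> (r1 - c *\<^sub>R t1) + (r2 - c *\<^sub>R t2) + (r3 - c *\<^sub>R t3) = 0"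
      for r1 r2 r3 t1 t2 t3 :: "real ^ 'n ^ 'n"
    proof -
      assume "r1 + r2 + r3 = 0" "t1 + t2 + t3 = 0"
      moreover have "(r1 - c *\<^sub>R t1) + (r2 - c *\<^sub>R t2) + (r3 - c *\<^sub>R t3) = (r1 + r2 + r3) - c *\<^sub>R (t1 + t2 + t3)"
        by (simp add: scaleR_add_right)
      ultimately show ?thesis by simp
    qed
    from this[OF second_bianchi_RR[OF x] second_bianchi_TT[OF x]]
    show "pd p (RR i j) x + NN p x ** RR i j x - RR i j x ** NN p x - c *\<^sub>R (pd p (TT i j) x + NN p x ** TT i j x - TT i j x ** NN p x) +
      (pd i (RR j p) x + NN i x ** RR j p x - RR j p x ** NN i x - c *\<^sub>R (pd i (TT j p) x + NN i x ** TT j p x - TT j p x ** NN i x)) +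
      (pd j (RR p i) x + NN j x ** RR p i x - RR p i x ** NN j x - c *\<^sub>R (pd j (TT p i) x + NN j x ** TT p i x - TT p i x ** NN j x)) = 0" .
  qed
qed

text \<open>Two of the three terms of the Bianchi identity contain \<open>V p\<close> times a
  derivative of a \<open>WW\<close> that carries the index \<open>p\<close>. Differentiating the
  relation \<open>VW\<close> moves that derivative onto \<open>V\<close>, so the derivative of
  \<open>WW\<close> along \<open>V\<close> becomes linear in \<open>WW\<close>.\<close>

lemma contracted_bianchi:
  assumes x: "x \<in> S" and V: "\<And>p. smooth_on S (V p)"
    and VW: "\<And>y j. y \<in> S \<Longrightarrow> (\<Sum>p\<in>UNIV. V p y *\<^sub>R WW c p j y) = 0"
  shows "(\<Sum>p\<in>UNIV. V p x *\<^sub>R pd p (WW c i j) x) =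
     (\<Sum>p\<in>UNIV. pd i (V p) x *\<^sub>R WW c j p x) + (\<Sum>p\<in>UNIV. pd j (V p) x *\<^sub>R WW c p i x)
     - (\<Sum>p\<in>UNIV. V p x *\<^sub>R (NN p x ** WW c i j x - WW c i j x ** NN p x))"
proof -
  have VW': "(\<Sum>p\<in>UNIV. V p y *\<^sub>R WW c j p y) = 0" if "y \<in> S" for y j
    using VW[OF that, of j] by (subst WW_antisym) (simp add: sum_negf)
  have dd: "(\<Sum>p\<in>UNIV. V p x *\<^sub>R pd i (A p) x) = - (\<Sum>p\<in>UNIV. pd i (V p) x *\<^sub>R A p x)"
    if A: "\<And>p. smooth_on S (A p)" and 0: "\<And>y. y \<in> S \<Longrightarrow> (\<Sum>p\<in>UNIV. V p y *\<^sub>R A p y) = (0 :: real ^ 'n ^ 'n)" for A i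
  proof -
    have "pd i (\<lambda>y. \<Sum>p\<in>UNIV. V p y *\<^sub>R A p y) x = pd i (\<lambda>y. 0) x"
      by (rule pd_cong[OF hopen_S x]) (rule 0)
    then have "(\<Sum>p\<in>UNIV. V p x *\<^sub>R pd i (A p) x + pd i (V p) x *\<^sub>R A p x) = 0"
      using hopen_S x in_half by (simp add: pd_sum pd_bilinear[OF _ _ bounded_bilinear_scaleR] pd_const smooth_on_scaleR V A)
    then show ?thesis by (simp add: sum.distrib eq_neg_iff_add_eq_0)
  qed
  have mul: "(\<Sum>p\<in>UNIV. V p x *\<^sub>R (B ** A p)) = B ** (\<Sum>p\<in>UNIV. V p x *\<^sub>R A p)"
    "(\<Sum>p\<in>UNIV. V p x *\<^sub>R (A p ** B)) = (\<Sum>p\<in>UNIV. V p x *\<^sub>R A p) ** B" for A :: "'n \<Rightarrow> real ^ 'n ^ 'n" and B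
    by (simp_all add: bounded_bilinear.sum_right[OF bounded_bilinear_matrix_mult] bounded_bilinear.sum_left[OF bounded_bilinear_matrix_mult]
       bounded_bilinear.scaleR_left[OF bounded_bilinear_matrix_mult] bounded_bilinear.scaleR_right[OF bounded_bilinear_matrix_mult])
  have "(\<Sum>p\<in>UNIV. V p x *\<^sub>R ((pd p (WW c i j) x + NN p x ** WW c i j x - WW c i j x ** NN p x)
       + (pd i (WW c j p) x + NN i x ** WW c j p x - WW c j p x ** NN i x)
       + (pd j (WW c p i) x + NN j x ** WW c p i x - WW c p i x ** NN j x))) = 0"
    by (simp add: second_bianchi_WW[OF x])
  then show ?thesis
    using dd[where A="\<lambda>p. WW c j p" and i=i, OF smooth_WW VW'] dd[where A="\<lambda>p. WW c p i" and i=j, OF smooth_WW VW]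
    by (simp add: sum.distrib sum_subtractf scaleR_add_right scaleR_diff_right mul VW[OF x] VW'[OF x]
        bounded_bilinear.zero_left[OF bounded_bilinear_matrix_mult] bounded_bilinear.zero_right[OF bounded_bilinear_matrix_mult])
       (simp add: algebra_simps)
qed

text \<open>The commutator identity with \<open>r = - c u\<close>: the right side it produces is
  exactly the contribution of \<open>TT\<close>.\<close>

lemma WW_solution:
  assumes x: "x \<in> S" and u: "smooth_on S u"
    and hess: "\<And>i j y. y \<in> S \<Longrightarrow> pd i (pd j u) y = (\<Sum>k\<in>UNIV. \<Gamma> k i j y * pd k u y) - c * u y * g i j y"
  shows "(\<Sum>m\<in>UNIV. WW c l i x $ m $ j * pd m u x) = 0"
proof -
  have "(\<Sum>m\<in>UNIV. riemann G m j l i x * pd m u x) = pd i (\<lambda>y. - c * u y) x * g l j x - pd l (\<lambda>y. - c * u y) x * g i j x"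
    by (rule conformal_commutator[OF x u smooth_on_cmult[OF u]]) (simp add: hess)
  also have "\<dots> = c * (pd l u x * g i j x - pd i u x * g l j x)"
    using hopen_S x u by (simp only: pd_cmult) (simp add: algebra_simps)
  finally show ?thesis
    by (simp add: WW_def RR_def TT_def left_diff_distrib right_diff_distrib sum_subtractf mult.assoc sum_distrib_left[symmetric] if_distrib[of "\<lambda>b. b * _"] cong: if_cong)
qed

text \<open>Pair symmetry of the curvature moves the gradient from the endomorphism slot, where the
  commutator identity handles it, into the first form slot.\<close>

lemma X_WW:
  assumes x: "x \<in> S" and u: "smooth_on S u"
    and hess: "\<And>i j y. y \<in> S \<Longrightarrow> pd i (pd j u) y = (\<Sum>k\<in>UNIV. \<Gamma> k i j y * pd k u y) - c * u y * g i j y"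
  shows "(\<Sum>p\<in>UNIV. X u p x *\<^sub>R WW c p j x) = 0"
proof -
  have low: "(\<Sum>m\<in>UNIV. g l m x * (\<Sum>p\<in>UNIV. X u p x * WW c p j x $ m $ k)) = 0" for l k
  proof -
    have "(\<Sum>m\<in>UNIV. g l m x * (\<Sum>p\<in>UNIV. X u p x * WW c p j x $ m $ k)) =
       (\<Sum>p\<in>UNIV. X u p x * (\<Sum>m\<in>UNIV. g l m x * WW c p j x $ m $ k))"
      unfolding sum_distrib_left by (subst sum.swap) (simp add: mult_ac)
    also have "(\<lambda>p. \<Sum>m\<in>UNIV. g l m x * WW c p j x $ m $ k) = (\<lambda>p. RL p j l k x - c * (g l p x * g j k x - g l j x * g p k x))"
    proof
      fix p
      have "(\<Sum>m\<in>UNIV. g l m x * WW c p j x $ m $ k) = RL l k p j x - c * (g l p x * g j k x - g l j x * g p k x)"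
        by (simp add: WW_def RR_def TT_def RL_def right_diff_distrib sum_subtractf sum_distrib_left[symmetric] mult.left_commute[of _ c]
            if_distrib[of "\<lambda>b. b * _"] if_distrib[of "\<lambda>b. _ * b"] cong: if_cong)
      then show "(\<Sum>m\<in>UNIV. g l m x * WW c p j x $ m $ k) = RL p j l k x - c * (g l p x * g j k x - g l j x * g p k x)"
        using RL_pair[OF x, of l k p j] by simp
    qed
    also have "(\<Sum>p\<in>UNIV. X u p x * (RL p j l k x - c * (g l p x * g j k x - g l j x * g p k x))) =
       (\<Sum>p\<in>UNIV. X u p x * RL p j l k x) - c * ((\<Sum>p\<in>UNIV. g l p x * X u p x) * g j k x - g l j x * (\<Sum>p\<in>UNIV. g k p x * X u p x))"
      by (simp add: right_diff_distrib sum_subtractf sum_distrib_left sum_distrib_right g_sym[OF x, of _ k] mult_ac)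
    also have "(\<Sum>p\<in>UNIV. X u p x * RL p j l k x) = pd k (\<lambda>y. - c * u y) x * g l j x - pd l (\<lambda>y. - c * u y) x * g k j x"
      by (rule conformal_commutator_lower[OF x u smooth_on_cmult[OF u]]) (simp add: hess)
    finally show ?thesis
      using hopen_S x u by (simp only: pd_cmult lower_X) (simp add: g_sym[OF x, of j k] algebra_simps)
  qed
  have "(\<Sum>p\<in>UNIV. X u p x * WW c p j x $ m $ k) = 0" for m k
    using lower_upper(2)[OF x, of m "\<lambda>m. \<Sum>p\<in>UNIV. X u p x * WW c p j x $ m $ k"] by (simp add: low)
  then show ?thesis by (simp add: vec_eq_iff)
qed

lemma X_pd_WW:
  assumes "x \<in> S" "smooth_on S u"
    "\<And>i j y. y \<in> S \<Longrightarrow> pd i (pd j u) y = (\<Sum>k\<in>UNIV. \<Gamma> k i j y * pd k u y) - c * u y * g i j y"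
  shows "(\<Sum>p\<in>UNIV. X u p x *\<^sub>R pd p (WW c i j) x) =
     (\<Sum>p\<in>UNIV. pd i (X u p) x *\<^sub>R WW c j p x) + (\<Sum>p\<in>UNIV. pd j (X u p) x *\<^sub>R WW c p i x)
     - (\<Sum>p\<in>UNIV. X u p x *\<^sub>R (NN p x ** WW c i j x - WW c i j x ** NN p x))"
  by (rule contracted_bianchi[OF assms(1) smooth_X[OF assms(2)] X_WW[OF _ assms(2,3)]])

end

section \<open>Linear systems along rays\<close>

lemma Ck_on_imp_continuous: "open W \<Longrightarrow> Ck_on k W F \<Longrightarrow> continuous_on W F"
  by (induction k) (auto dest: Ck_on_Suc_imp)

lemma Ck_on_Suc_imp_1: "open W \<Longrightarrow> Ck_on (Suc k) W F \<Longrightarrow> Ck_on (Suc 0) W F"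
  by (induction k) (auto dest: Ck_on_Suc_imp)

lemma parametric_integral_has_derivative:
  fixes H :: "'e::euclidean_space \<times> real \<Rightarrow> 'f::euclidean_space"
  assumes "open V" "Ck_on (Suc 0) V H" "open U" "U \<times> {0..1} \<subseteq> V" "x \<in> U"
  shows "((\<lambda>x. integral {0..1} (\<lambda>t. H (x, t))) has_derivative
      (\<lambda>v. integral {0..1} (\<lambda>t. \<D> H (x, t) (v, 0)))) (at x)"
proof -
  obtain r where r: "r > 0" "ball x r \<subseteq> U" using assms(3,5) openE by blast
  define fx where "fx y t = Blinfun (\<lambda>v. \<D> H (y, t) (v, 0))" for y t
  have inV: "(y, t) \<in> V" if "y \<in> ball x r" "t \<in> {0..1}" for y t
  proof -
    have "(y, t) \<in> U \<times> {0..1}" using r that by auto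
    then show ?thesis using assms(4) by blast
  qed
  have dH: "(H has_derivative \<D> H z) (at z)" if "z \<in> V" for z
    using Ck_on_SucD[OF assms(1,2) that] .
  have fx: "blinfun_apply (fx y t) = (\<lambda>v. \<D> H (y, t) (v, 0))" if "y \<in> ball x r" "t \<in> {0..1}" for y t
    unfolding fx_def
    by (rule bounded_linear_Blinfun_apply)
       (intro bounded_linear_compose[OF has_derivative_bounded_linear[OF dH[OF inV[OF that]]]] bounded_linear_intros)
  have cd: "continuous_on V (\<lambda>z. \<D> H z (v, 0))" for v
    using Ck_on_Suc_derivative[OF assms(2)] by simp
  have cfx: "continuous_on (ball x r \<times> cbox 0 1) (\<lambda>(y, t). fx y t)"
  proof (rule continuous_on_blinfun_componentwise)
    fix v :: 'e
    have "continuous_on (ball x r \<times> cbox 0 1) (\<lambda>z. \<D> H z (v, 0))"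
      by (rule continuous_on_subset[OF cd]) (use inV in auto)
    then show "continuous_on (ball x r \<times> cbox 0 1) (\<lambda>z. blinfun_apply (case z of (y, t) \<Rightarrow> fx y t) v)"
      by (rule continuous_on_eq) (auto simp: fx)
  qed
  have "((\<lambda>y. integral (cbox 0 1) (\<lambda>t. H (y, t))) has_derivative blinfun_apply (integral (cbox 0 1) (fx x))) (at x within ball x r)"
  proof (rule leibniz_rule[OF _ _ cfx])
    fix y t assume yt: "y \<in> ball x r" "t \<in> cbox 0 (1::real)"
    have "((\<lambda>y. (y, t)) has_derivative (\<lambda>v. (v, 0))) (at y)" by (auto intro!: derivative_eq_intros)
    from has_derivative_compose[OF this dH] yt inV
    show "((\<lambda>y. H (y, t)) has_derivative blinfun_apply (fx y t)) (at y within ball x r)"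
      by (auto simp: fx intro!: has_derivative_at_withinI)
  next
    fix y assume y: "y \<in> ball x r"
    have "continuous_on V H" using Ck_on_Suc_imp[OF assms(1,2)] by simp
    then have "continuous_on (cbox 0 1) (\<lambda>t. H (y, t))"
      by (rule continuous_on_compose2) (use inV y in \<open>auto intro!: continuous_intros\<close>)
    then show "(\<lambda>t. H (y, t)) integrable_on cbox 0 1" by (rule integrable_continuous)
  qed (use r in auto)
  moreover have "blinfun_apply (integral (cbox 0 1) (fx x)) = (\<lambda>v. integral {0..1} (\<lambda>t. \<D> H (x, t) (v, 0)))"
  proof
    fix v
    have "continuous_on (cbox 0 1) (fx x)"
    proof -
      have "continuous_on (cbox 0 1) (Pair x)" by (intro continuous_intros)
      moreover have "Pair x ` cbox 0 1 \<subseteq> ball x r \<times> cbox 0 1" using r by auto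
      ultimately have "continuous_on (cbox 0 1) (\<lambda>t. case (x, t) of (y, t) \<Rightarrow> fx y t)"
        by (rule continuous_on_compose2[OF cfx])
      then show ?thesis by simp
    qed
    then have "fx x integrable_on cbox 0 1" by (rule integrable_continuous)
    then have "blinfun_apply (integral (cbox 0 1) (fx x)) v = integral (cbox 0 1) (\<lambda>t. fx x t v)"
      by (rule blinfun_apply_integral)
    also have "\<dots> = integral (cbox 0 1) (\<lambda>t. \<D> H (x, t) (v, 0))"
      by (rule integral_cong) (use fx r in auto)
    finally show "blinfun_apply (integral (cbox 0 1) (fx x)) v = integral {0..1} (\<lambda>t. \<D> H (x, t) (v, 0))" by simp
  qed
  ultimately show ?thesis using r by (simp add: at_within_open[of x "ball x r"])
qed

lemma Ck_on_parametric_integral: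
  fixes H :: "'e::euclidean_space \<times> real \<Rightarrow> 'f::euclidean_space"
  assumes "open V" "open U" "U \<times> {0..1} \<subseteq> V" "Ck_on k V H"
  shows "Ck_on k U (\<lambda>x. integral {0..1} (\<lambda>t. H (x, t)))"
  using assms(4)
proof (induction k arbitrary: H)
  case 0
  have "continuous_on U (\<lambda>x. integral (cbox 0 1) (\<lambda>t. H (x, t)))"
    by (rule integral_continuous_on_param) (use 0 assms(3) in \<open>auto intro: continuous_on_subset\<close>)
  then show ?case by simp
next
  case (Suc k)
  have "Ck_on (Suc 0) V H" by (rule Ck_on_Suc_imp_1[OF assms(1) Suc.prems])
  note d = parametric_integral_has_derivative[OF assms(1) this assms(2,3)]
  show ?case
    by (rule Ck_on_SucI[OF assms(2) d]) (auto intro!: Suc.IH Ck_on_Suc_derivative Suc.prems)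
qed

section \<open>Volterra equations on star-shaped sets\<close>

lemma Ck_on_radial:
  fixes s :: "'e::euclidean_space \<Rightarrow> 'f::real_normed_vector"
  assumes "open U" "Ck_on k U s" "open V" "\<And>z. z \<in> V \<Longrightarrow> snd z *\<^sub>R fst z \<in> U"
  shows "Ck_on k V (\<lambda>z. s (snd z *\<^sub>R fst z))"
proof (rule Ck_on_compose[OF assms(3,1,2)])
  show "Ck_on k V (\<lambda>z. snd z *\<^sub>R fst z)"
    by (rule Ck_on_bilinear[OF bounded_bilinear_scaleR assms(3) Ck_on_bounded_linear[OF bounded_linear_snd assms(3)]
          Ck_on_bounded_linear[OF bounded_linear_fst assms(3)]])
qed (use assms in auto)

lemma open_radial: "open U \<Longrightarrow> open {z :: 'e::euclidean_space \<times> real. snd z *\<^sub>R fst z \<in> U}"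
  using open_vimage[of U "\<lambda>z::'e \<times> real. snd z *\<^sub>R fst z"]
  by (simp add: vimage_def continuous_intros)

text \<open>The integral form of an equation along rays. Rescaling each ray to the unit interval
  puts the unknown at \<open>t *\<^sub>R x\<close> and the point \<open>x\<close> into the kernel,
  so all rays are treated at once and smoothness in \<open>x\<close> can be studied.\<close>

abbreviation volterra_op ("\<V>")
  where "\<V> K s x \<equiv> integral {0..1} (\<lambda>t. blinfun_apply (K (x, t)) (s (t *\<^sub>R x)))"

lemma volterra_op_diff_bound:
  fixes K :: "'e::euclidean_space \<times> real \<Rightarrow> 'f::euclidean_space \<Rightarrow>\<^sub>L 'f"
  assumes c: "continuous_on {0..1} (\<lambda>t. K (x, t) (q (t *\<^sub>R x)))" "continuous_on {0..1} (\<lambda>t. K (x, t) (s (t *\<^sub>R x)))"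
    and L: "\<And>t. t \<in> {0..1} \<Longrightarrow> norm (K (x, t)) \<le> L"
    and M: "\<And>t. t \<in> {0..1} \<Longrightarrow> norm (q (t *\<^sub>R x) - s (t *\<^sub>R x)) \<le> M"
  shows "norm (\<V> K q x - \<V> K s x) \<le> L * M"
proof -
  have "0 \<le> L" using order_trans[OF norm_ge_zero L[of 0]] by simp
  have "\<V> K q x - \<V> K s x = integral {0..1} (\<lambda>t. K (x, t) (q (t *\<^sub>R x) - s (t *\<^sub>R x)))"
    using integral_diff[OF integrable_continuous_interval[OF c(1)] integrable_continuous_interval[OF c(2)]]
    by (simp add: blinfun.diff_right)
  also have "norm \<dots> \<le> (L * M) * (1 - 0)"
  proof (rule integral_bound)
    show "continuous_on {0..1} (\<lambda>t. K (x, t) (q (t *\<^sub>R x) - s (t *\<^sub>R x)))"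
      using continuous_on_diff[OF c] by (simp add: blinfun.diff_right)
    show "norm (K (x, t) (q (t *\<^sub>R x) - s (t *\<^sub>R x))) \<le> L * M" if "t \<in> {0..1}" for t
      by (rule order_trans[OF norm_blinfun]) (intro mult_mono L M that \<open>0 \<le> L\<close> norm_ge_zero)
  qed simp
  finally show ?thesis by simp
qed

text \<open>The bound 1/2 makes the operator halve supremum norms over \<open>D\<close>, so Picard
  iterates converge geometrically. Star-shapedness keeps the argument \<open>t *\<^sub>R x\<close>
  in \<open>D\<close>.\<close>

locale volterra =
  fixes D :: "'e::euclidean_space set" and K :: "'e \<times> real \<Rightarrow> 'f::euclidean_space \<Rightarrow>\<^sub>L 'f"
  assumes star: "\<And>x t. x \<in> D \<Longrightarrow> t \<in> {0..1} \<Longrightarrow> t *\<^sub>R x \<in> D"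
    and cont_K: "continuous_on (D \<times> {0..1}) K"
    and norm_K: "\<And>x t. x \<in> D \<Longrightarrow> t \<in> {0..1} \<Longrightarrow> norm (K (x, t)) \<le> 1/2"
begin

lemma cont_K_apply:
  assumes "continuous_on D s"
  shows "continuous_on (D \<times> {0..1}) (\<lambda>z. K z (s (snd z *\<^sub>R fst z)))"
  by (intro bounded_bilinear.continuous_on[OF bounded_bilinear_blinfun_apply cont_K]
      continuous_on_compose2[OF assms] continuous_intros) (use star in auto)

lemma cont_K_apply1:
  assumes "continuous_on D s" "x \<in> D"
  shows "continuous_on {0..1} (\<lambda>t. K (x, t) (s (t *\<^sub>R x)))"
proof -
  have "continuous_on {0..1} (\<lambda>t. (x, t))" by (intro continuous_intros)
  from continuous_on_compose2[OF cont_K_apply[OF assms(1)] this] assms(2) show ?thesis by auto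
qed

lemma cont_integral:
  assumes "continuous_on D s" shows "continuous_on D (\<lambda>x. \<V> K s x)"
proof -
  have "continuous_on D (\<lambda>x. integral (cbox 0 1) (\<lambda>t. K (x, t) (s (t *\<^sub>R x))))"
    by (rule integral_continuous_on_param) (use cont_K_apply[OF assms] in \<open>simp add: split_beta\<close>)
  then show ?thesis by simp
qed

lemma integral_diff_bound:
  assumes s: "continuous_on D s" "continuous_on D q" and x: "x \<in> D"
    and M: "\<And>t. t \<in> {0..1} \<Longrightarrow> norm (q (t *\<^sub>R x) - s (t *\<^sub>R x)) \<le> M"
  shows "norm (\<V> K q x - \<V> K s x) \<le> M / 2"
  using volterra_op_diff_bound[OF cont_K_apply1[OF s(2) x] cont_K_apply1[OF s(1) x] norm_K[OF x] M] by simp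

text \<open>Convergence of the iteration even when the inhomogeneous term changes from step to step.
  This is the situation of the derivatives of Picard iterates, whose inhomogeneous term contains the
  iterates themselves.\<close>

lemma limit:
  assumes D: "compact D" and s: "continuous_on D s" and p: "\<And>m. continuous_on D (p m)"
    and eq_s: "\<And>x. x \<in> D \<Longrightarrow> s x = b x + \<V> K s x"
    and eq_p: "\<And>m x. x \<in> D \<Longrightarrow> p (Suc m) x = b' m x + \<V> K (p m) x"
    and b: "uniform_limit D b' b sequentially"
  shows "uniform_limit D p s sequentially"
proof (rule uniform_limitI)
  fix e :: real assume e: "e > 0"
  then obtain N where N: "\<And>m x. m \<ge> N \<Longrightarrow> x \<in> D \<Longrightarrow> dist (b' m x) (b x) < e/4"
    using uniform_limitD[OF b, of "e/4"] unfolding eventually_sequentially by auto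
  have "compact ((\<lambda>x. p N x - s x) ` D)"
    by (intro compact_continuous_image continuous_intros s p D)
  from compact_imp_bounded[OF this] obtain M where "\<forall>z\<in>(\<lambda>x. p N x - s x) ` D. norm z \<le> M"
    unfolding bounded_iff by (elim exE)
  then have M: "\<And>x. x \<in> D \<Longrightarrow> norm (p N x - s x) \<le> M" by blast
  \<comment> \<open>The bound reproduces itself: a new error of \<open>e/4\<close> plus half of
    \<open>M / 2 ^ j + e/2\<close> is \<open>M / 2 ^ Suc j + e/2\<close>.\<close>
  have step: "norm (p (N + j) x - s x) \<le> M / 2 ^ j + e/2" if "x \<in> D" for j x
    using that
  proof (induction j arbitrary: x)
    case 0 then show ?case using M[of x] e by simp
  next
    case (Suc j)
    have 1: "norm (\<V> K (p (N + j)) x - \<V> K s x) \<le> (M / 2 ^ j + e/2) / 2"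
      by (rule integral_diff_bound[OF s p Suc.prems]) (use Suc star in auto)
    have 2: "norm (b' (N + j) x - b x) \<le> e/4" using N[of "N + j" x] Suc.prems by (simp add: dist_norm)
    have "p (N + Suc j) x - s x = (b' (N + j) x - b x) + (\<V> K (p (N + j)) x - \<V> K s x)"
      using eq_s[OF Suc.prems] eq_p[OF Suc.prems, of "N + j"] by simp
    then have "norm (p (N + Suc j) x - s x) \<le> e/4 + (M / 2 ^ j + e/2) / 2"
      using norm_triangle_mono[OF 2 1] by simp
    then show ?case by (simp add: field_simps)
  qed
  have "(\<lambda>j. M * (1/2) ^ j) \<longlonglongrightarrow> M * 0" by (intro tendsto_intros) auto
  from order_tendstoD(2)[OF this, of "e/2"] have "\<forall>\<^sub>F j in sequentially. M * (1/2) ^ j < e/2"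
    using e by simp
  then obtain J where "\<forall>j\<ge>J. M * (1/2) ^ j < e/2"
    unfolding eventually_sequentially by (elim exE)
  then have J: "\<And>j. j \<ge> J \<Longrightarrow> M / 2 ^ j < e/2" by (simp add: power_one_over)
  show "\<forall>\<^sub>F m in sequentially. \<forall>x\<in>D. dist (p m x) (s x) < e"
    unfolding eventually_sequentially
  proof (intro exI[of _ "N + J"] allI impI ballI)
    fix m x assume "N + J \<le> m" "x \<in> D"
    then have "J \<le> m - N" "N + (m - N) = m" by simp_all
    then have "norm (p m x - s x) \<le> M / 2 ^ (m - N) + e/2" "M / 2 ^ (m - N) < e/2"
      using step[OF \<open>x \<in> D\<close>, of "m - N"] J[of "m - N"] by simp_all
    then show "dist (p m x) (s x) < e" unfolding dist_norm by linarith
  qed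
qed

primrec picard :: "('e \<Rightarrow> 'f) \<Rightarrow> nat \<Rightarrow> 'e \<Rightarrow> 'f" where
  "picard b 0 = (\<lambda>x. 0)"
| "picard b (Suc m) = (\<lambda>x. b x + \<V> K (picard b m) x)"

lemma cont_picard: "continuous_on D b \<Longrightarrow> continuous_on D (picard b m)"
  by (induction m) (auto intro!: continuous_intros cont_integral)

lemma picard_increment:
  assumes b: "continuous_on D b" and M: "\<And>y. y \<in> D \<Longrightarrow> norm (b y) \<le> M" and x: "x \<in> D"
  shows "norm (picard b (Suc m) x - picard b m x) \<le> M * (1/2) ^ m"
  using x
proof (induction m arbitrary: x)
  case 0 then show ?case using M by simp
next
  case (Suc m)
  have "norm (\<V> K (picard b (Suc m)) x - \<V> K (picard b m) x) \<le> (M * (1/2) ^ m) / 2"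
    by (rule integral_diff_bound[OF cont_picard[OF b] cont_picard[OF b] Suc.prems]) (rule Suc.IH, rule star[OF Suc.prems])
  then show ?case by simp
qed

lemma solution_exists:
  assumes D: "compact D" and b: "continuous_on D b"
  shows "\<exists>s. continuous_on D s \<and> uniform_limit D (picard b) s sequentially \<and>
    (\<forall>x\<in>D. s x = b x + \<V> K s x)"
proof -
  from compact_imp_bounded[OF compact_continuous_image[OF b D]] obtain M where "\<forall>z\<in>b ` D. norm z \<le> M"
    unfolding bounded_iff by (elim exE)
  then have M: "\<And>y. y \<in> D \<Longrightarrow> norm (b y) \<le> M" by blast
  define s where "s x = (\<Sum>m. picard b (Suc m) x - picard b m x)" for x
  have "uniform_limit D (\<lambda>n x. \<Sum>m<n. picard b (Suc m) x - picard b m x) s sequentially"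
    unfolding s_def
    by (rule Weierstrass_m_test[where M = "\<lambda>m. M * (1/2) ^ m"])
       (use picard_increment[OF b M] in \<open>auto intro!: summable_mult summable_geometric simp del: picard.simps\<close>)
  moreover have "(\<Sum>m<n. picard b (Suc m) x - picard b m x) = picard b n x" for n x
    using sum_lessThan_telescope[of "\<lambda>n. picard b n x" n] by (simp del: picard.simps(2))
  ultimately have ul: "uniform_limit D (picard b) s sequentially" by simp
  have cs: "continuous_on D s"
    by (rule uniform_limit_theorem[OF _ ul]) (use cont_picard[OF b] in auto)
  have "s x = b x + \<V> K s x" if x: "x \<in> D" for x
  proof (rule LIMSEQ_unique)
    show "(\<lambda>n. picard b (Suc n) x) \<longlonglongrightarrow> s x"
      using tendsto_uniform_limitI[OF ul x] by (rule LIMSEQ_Suc)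
    show "(\<lambda>n. picard b (Suc n) x) \<longlonglongrightarrow> b x + \<V> K s x"
    proof (rule metric_LIMSEQ_I)
      fix e :: real assume "e > 0"
      then obtain N where N: "\<And>n y. n \<ge> N \<Longrightarrow> y \<in> D \<Longrightarrow> dist (picard b n y) (s y) < e"
        using uniform_limitD[OF ul, of e] unfolding eventually_sequentially by auto
      have "dist (picard b (Suc n) x) (b x + \<V> K s x) \<le> e / 2" if "n \<ge> N" for n
      proof -
        have "norm (\<V> K (picard b n) x - \<V> K s x) \<le> e / 2"
          by (rule integral_diff_bound[OF cs cont_picard[OF b] x]) (use N[OF that] star[OF x] in \<open>auto simp: dist_norm intro: less_imp_le\<close>)
        then show ?thesis by (simp add: dist_norm)
      qed
      then show "\<exists>N. \<forall>n\<ge>N. dist (picard b (Suc n) x) (b x + \<V> K s x) < e"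
        using \<open>e > 0\<close> by (intro exI[of _ N]) (fastforce simp del: picard.simps)
    qed
  qed
  with ul cs show ?thesis by blast
qed

end

lemma volterra_subset: "volterra D K \<Longrightarrow> D' \<subseteq> D \<Longrightarrow> (\<And>x t. x \<in> D' \<Longrightarrow> t \<in> {0..1} \<Longrightarrow> t *\<^sub>R x \<in> D') \<Longrightarrow> volterra D' K"
  unfolding volterra_def by (meson continuous_on_subset Sigma_mono order_refl subsetD)

lemma volterra_solution_ball:
  fixes K :: "'e::euclidean_space \<times> real \<Rightarrow> 'f::euclidean_space \<Rightarrow>\<^sub>L 'f"
  assumes K: "volterra (ball 0 R) K" and b: "continuous_on (ball 0 R) b"
  shows "\<exists>s. continuous_on (ball 0 R) s \<and>
    (\<forall>x\<in>ball 0 R. s x = b x + \<V> K s x)"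
proof -
  \<comment> \<open>The limit of one Picard sequence, so the solutions found on the closed balls of
    radius below \<open>R\<close> agree without a separate uniqueness argument.\<close>
  define s where "s x = lim (\<lambda>m. volterra.picard K b m x)" for x
  have loc: "continuous_on (cball 0 r) s \<and> (\<forall>x\<in>cball 0 r. s x = b x + \<V> K s x)"
    if r: "r < R" for r
  proof -
    have cs: "cball 0 r \<subseteq> ball (0::'e) R" using r by auto
    have st: "t *\<^sub>R x \<in> cball 0 r" if "x \<in> cball 0 r" "t \<in> {0..1}" for x :: 'e and t
      using that mult_left_le_one_le[of "norm x" t] by auto
    interpret V: volterra "cball 0 r" K by (rule volterra_subset[OF K cs st])
    obtain s' where s': "continuous_on (cball 0 r) s'" "uniform_limit (cball 0 r) (V.picard b) s' sequentially"
      "\<forall>x\<in>cball 0 r. s' x = b x + \<V> K s' x"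
      using V.solution_exists[OF compact_cball continuous_on_subset[OF b cs]] by blast
    have eq: "s x = s' x" if "x \<in> cball 0 r" for x
      unfolding s_def using tendsto_uniform_limitI[OF s'(2) that] by (rule limI)
    have "continuous_on (cball 0 r) s" using s'(1) by (rule continuous_on_eq) (simp add: eq)
    moreover have "s x = b x + \<V> K s x" if x: "x \<in> cball 0 r" for x
    proof -
      have "\<V> K s x = \<V> K s' x"
        by (rule integral_cong) (simp add: eq[OF st[OF x]])
      then show ?thesis using s'(3) x by (simp add: eq)
    qed
    ultimately show ?thesis by blast
  qed
  have "continuous_on (ball 0 R) s"
    unfolding continuous_on_eq_continuous_at[OF open_ball]
  proof
    fix x :: 'e assume x: "x \<in> ball 0 R"
    then obtain r where r: "norm x < r" "r < R" using dense by auto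
    then have "continuous_on (ball 0 r) s" using loc[of r] continuous_on_subset ball_subset_cball by blast
    then show "isCont s x" using r by (simp add: continuous_on_eq_continuous_at)
  qed
  moreover have "s x = b x + \<V> K s x" if "x \<in> ball 0 R" for x
    using loc[of "norm x"] that by simp
  ultimately show ?thesis by blast
qed

lemma radial_ball: "x \<in> ball 0 R \<Longrightarrow> t \<in> {0..1} \<Longrightarrow> t *\<^sub>R x \<in> ball (0::'e::euclidean_space) R"
  using mult_left_le_one_le[of "norm x" t] by auto

lemma radial_Times: "ball 0 R \<times> {0..1} \<subseteq> {z :: 'e::euclidean_space \<times> real. snd z *\<^sub>R fst z \<in> ball 0 R}"
proof clarify
  fix x :: 'e and t :: real assume "x \<in> ball 0 R" "t \<in> {0..1}"
  from radial_ball[OF this] show "snd (x, t) *\<^sub>R fst (x, t) \<in> ball 0 R" by simp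
qed

lemma radial_cball: "x \<in> cball 0 R \<Longrightarrow> t \<in> {0..1} \<Longrightarrow> t *\<^sub>R x \<in> cball (0::'e::euclidean_space) R"
  using mult_left_le_one_le[of "norm x" t] by auto

text \<open>Differentiating the equation formally in direction \<open>v\<close> gives another
  Volterra equation, solved by \<open>\<sigma> v\<close>. The derivatives of the Picard iterates run
  through the perturbed iteration for it and converge uniformly to \<open>\<sigma> v\<close> on
  smaller balls; a uniform limit of derivatives is the derivative of the limit.\<close>

lemma volterra_solution_derivative:
  fixes K :: "'e::euclidean_space \<times> real \<Rightarrow> 'f::euclidean_space \<Rightarrow>\<^sub>L 'f"
  assumes V: "open V" "ball 0 R \<times> {0..1} \<subseteq> V" and K: "Ck_on (Suc 0) V K"
    and nK: "\<And>x t. x \<in> ball 0 R \<Longrightarrow> t \<in> {0..1} \<Longrightarrow> norm (K (x, t)) \<le> 1/2"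
    and s: "continuous_on (ball 0 R) s"
    and eq: "\<And>x. x \<in> ball 0 R \<Longrightarrow> s x = b x + \<V> K s x"
    and b: "Ck_on (Suc 0) (ball 0 R) b"
    and sg: "\<And>v. v \<in> Basis \<Longrightarrow> continuous_on (ball 0 R) (\<sigma> v)"
    and sg_eq: "\<And>v x. v \<in> Basis \<Longrightarrow> x \<in> ball 0 R \<Longrightarrow> \<sigma> v x = (\<D> b x v
        + integral {0..1} (\<lambda>t. \<D> K (x, t) (v, 0) (s (t *\<^sub>R x))))
        + integral {0..1} (\<lambda>t. (t *\<^sub>R K (x, t)) (\<sigma> v (t *\<^sub>R x)))"
    and x0: "x0 \<in> ball 0 R"
  shows "(s has_derivative (\<lambda>h. \<Sum>v\<in>Basis. (h \<bullet> v) *\<^sub>R \<sigma> v x0)) (at x0)"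
proof -
  let ?U = "ball (0::'e) R"
  let ?I = "\<lambda>v q x. integral {0..1} (\<lambda>t. \<D> K (x, t) (v, 0) (q (t *\<^sub>R x)))"
  have oU: "open ?U" by simp
  define V' where "V' = V \<inter> {z. snd z *\<^sub>R fst z \<in> ?U}"
  have V': "open V'" "V' \<subseteq> V" unfolding V'_def by (intro open_Int V open_radial oU) blast
  have V'U: "?U \<times> {0..1} \<subseteq> V'"
    using V(2) radial_Times unfolding V'_def by (rule Int_greatest)
  have cK: "continuous_on V K" using Ck_on_Suc_imp[OF V(1) K] by simp
  have volt: "volterra ?U K"
    by (unfold_locales) (use radial_ball nK continuous_on_subset[OF cK V(2)] in auto)
  define p where "p = volterra.picard K b"
  define dp where "dp m v x = \<D> (p m) x v" for m v x
  have p0: "p 0 = (\<lambda>x. 0)" and pS: "p (Suc m) = (\<lambda>x. b x + \<V> K (p m) x)" for m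
    unfolding p_def using volterra.picard.simps[OF volt] by auto
  let ?H = "\<lambda>m z. K z (p m (snd z *\<^sub>R fst z))"
  have HC: "Ck_on (Suc 0) V' (?H m)" if "Ck_on (Suc 0) ?U (p m)" for m
    by (intro Ck_on_bilinear[OF bounded_bilinear_blinfun_apply V'(1)] Ck_on_subset[OF K V'(2)] Ck_on_radial[OF oU that V'(1)])
       (simp add: V'_def)
  have pC: "Ck_on (Suc 0) ?U (p m)" for m
  proof (induction m)
    case 0 then show ?case unfolding p0 by (rule Ck_on_const[OF oU])
  next
    case (Suc m)
    have "Ck_on (Suc 0) ?U (\<lambda>x. integral {0..1} (\<lambda>t. ?H m (x, t)))"
      by (rule Ck_on_parametric_integral[OF V'(1) oU V'U HC[OF Suc]])
    then show ?case unfolding pS by (intro Ck_on_add[OF oU b]) simp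
  qed
  have pcont: "continuous_on ?U (p m)" for m using Ck_on_Suc_imp[OF oU pC] by simp
  have dpcont: "continuous_on ?U (dp m v)" for m v
    using Ck_on_Suc_derivative[OF pC] unfolding dp_def by simp
  have dK: "continuous_on V (\<lambda>z. \<D> K z w)" for w
    using Ck_on_Suc_derivative[OF K] by simp
  have dH: "\<D> (?H m) (x, t) (v, 0) =
      (t *\<^sub>R K (x, t)) (dp m v (t *\<^sub>R x)) + \<D> K (x, t) (v, 0) (p m (t *\<^sub>R x))"
    if "x \<in> ?U" "t \<in> {0..1}" for m x t v
  proof -
    have xt: "(x, t) \<in> V" using that V(2) by blast
    have dp': "(p m has_derivative \<D> (p m) (t *\<^sub>R x)) (at (t *\<^sub>R x))"
      by (rule Ck_on_SucD[OF oU pC radial_ball[OF that]])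
    have "((\<lambda>z. snd z *\<^sub>R fst z) has_derivative (\<lambda>h. snd (x, t) *\<^sub>R fst h + snd h *\<^sub>R fst (x, t))) (at (x, t))"
      by (rule bounded_bilinear.FDERIV[OF bounded_bilinear_scaleR]) (auto intro!: derivative_eq_intros)
    from has_derivative_compose[OF this, of "p m"] dp'
    have "((\<lambda>z. p m (snd z *\<^sub>R fst z)) has_derivative (\<lambda>h. \<D> (p m) (t *\<^sub>R x) (t *\<^sub>R fst h + snd h *\<^sub>R x))) (at (x, t))"
      by simp
    from bounded_bilinear.FDERIV[OF bounded_bilinear_blinfun_apply Ck_on_SucD[OF V(1) K xt] this]
    have "(?H m has_derivative (\<lambda>h. K (x, t) (\<D> (p m) (t *\<^sub>R x) (t *\<^sub>R fst h + snd h *\<^sub>R x))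
        + \<D> K (x, t) h (p m (t *\<^sub>R x)))) (at (x, t))" by simp
    from frechet_derivative_at[OF this, symmetric] show ?thesis
      by (simp add: dp_def linear_scale[OF has_derivative_linear[OF dp']] blinfun.scaleR_left blinfun.scaleR_right)
  qed
  have c1: "continuous_on {0..1} (\<lambda>t. \<D> K (x, t) w (q (t *\<^sub>R x)))"
    if "x \<in> ?U" "continuous_on ?U q" for x q w
  proof (rule bounded_bilinear.continuous_on[OF bounded_bilinear_blinfun_apply])
    show "continuous_on {0..1} (\<lambda>t. \<D> K (x, t) w)"
      by (rule continuous_on_compose2[OF dK, of _ "\<lambda>t. (x, t)"]) (use V(2) that(1) in \<open>auto intro!: continuous_intros\<close>)
    show "continuous_on {0..1} (\<lambda>t. q (t *\<^sub>R x))"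
      by (rule continuous_on_compose2[OF that(2)]) (use radial_ball[OF that(1)] in \<open>auto intro!: continuous_intros\<close>)
  qed
  have nKt: "norm (t *\<^sub>R K (x, t)) \<le> 1/2" if "x \<in> ?U" "t \<in> {0..1}" for x t
    using nK[OF that] that(2) mult_left_le_one_le[of "norm (K (x, t))" t] by simp
  \<comment> \<open>The chain rule puts a factor \<open>t\<close> in front of the kernel, which can
    only improve the contraction bound.\<close>
  have voltt: "volterra ?U (\<lambda>z. snd z *\<^sub>R K z)"
    by (unfold_locales) (use radial_ball nKt continuous_on_subset[OF cK V(2)] in \<open>auto intro!: continuous_intros\<close>)
  have dpS: "dp (Suc m) v x = (\<D> b x v
        + ?I v (p m) x)
        + integral {0..1} (\<lambda>t. (t *\<^sub>R K (x, t)) (dp m v (t *\<^sub>R x)))" if x: "x \<in> ?U" for m v x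
  proof -
    have "(p (Suc m) has_derivative (\<lambda>v. \<D> b x v + integral {0..1} (\<lambda>t. \<D> (?H m) (x, t) (v, 0)))) (at x)"
      unfolding pS
      using has_derivative_add[OF Ck_on_SucD[OF oU b x] parametric_integral_has_derivative[OF V'(1) HC[OF pC] oU V'U x]] by simp
    from frechet_derivative_at[OF this, symmetric]
    have "dp (Suc m) v x = \<D> b x v + integral {0..1} (\<lambda>t. \<D> (?H m) (x, t) (v, 0))"
      by (simp add: dp_def)
    also have "integral {0..1} (\<lambda>t. \<D> (?H m) (x, t) (v, 0)) =
       integral {0..1} (\<lambda>t. (t *\<^sub>R K (x, t)) (dp m v (t *\<^sub>R x)) + \<D> K (x, t) (v, 0) (p m (t *\<^sub>R x)))"
      by (rule integral_cong) (rule dH[OF x])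
    also have "\<dots> = integral {0..1} (\<lambda>t. (t *\<^sub>R K (x, t)) (dp m v (t *\<^sub>R x))) + ?I v (p m) x"
      using volterra.cont_K_apply1[OF voltt dpcont x] c1[OF x pcont]
      by (intro integral_add integrable_continuous_interval) auto
    finally show ?thesis by simp
  qed
  obtain r where r: "norm x0 < r" "r < R" using x0 dense by auto
  have sub: "cball 0 r \<subseteq> ?U" using r by auto
  note sub' = volterra_subset[OF _ sub radial_cball]
  have bC: "continuous_on ?U b" using Ck_on_Suc_imp[OF oU b] by simp
  have ulp: "uniform_limit (cball 0 r) p s sequentially"
    by (rule volterra.limit[OF sub'[OF volt], where b = b and b' = "\<lambda>m. b"])
       (use continuous_on_subset[OF s sub] continuous_on_subset[OF pcont sub] eq sub pS in \<open>auto intro: uniform_limit_const\<close>)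
  have uldp: "uniform_limit (cball 0 r) (\<lambda>m. dp m v) (\<sigma> v) sequentially" if v: "v \<in> Basis" for v
  proof (rule volterra.limit[OF sub'[OF voltt], where
        b = "\<lambda>x. \<D> b x v + ?I v s x" and
        b' = "\<lambda>m x. \<D> b x v + ?I v (p m) x"])
    have "continuous_on (cball 0 r \<times> {0..1}) (\<lambda>z. \<D> K z (v, 0))"
      by (rule continuous_on_subset[OF dK]) (use sub V(2) in auto)
    then have "compact ((\<lambda>z. \<D> K z (v, 0)) ` (cball 0 r \<times> {0..1}))"
      by (rule compact_continuous_image) (intro compact_Times compact_cball compact_Icc)
    from compact_imp_bounded[OF this] obtain L where L: "L > 0"
      "\<And>z. z \<in> (\<lambda>z. \<D> K z (v, 0)) ` (cball 0 r \<times> {0..1}) \<Longrightarrow> norm z \<le> L"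
      unfolding bounded_pos by blast
    show "uniform_limit (cball 0 r) (\<lambda>m x. \<D> b x v + ?I v (p m) x) (\<lambda>x. \<D> b x v + ?I v s x) sequentially"
    proof (rule uniform_limitI)
      fix e :: real assume e: "e > 0"
      have "\<forall>\<^sub>F m in sequentially. \<forall>x\<in>cball 0 r. dist (p m x) (s x) < e / (2 * L)"
        using uniform_limitD[OF ulp, of "e / (2 * L)"] e L(1) by simp
      then show "\<forall>\<^sub>F m in sequentially. \<forall>x\<in>cball 0 r. dist (\<D> b x v + ?I v (p m) x) (\<D> b x v + ?I v s x) < e"
      proof (rule eventually_mono, intro ballI)
        fix m and x :: "'e" assume close: "\<forall>x\<in>cball 0 r. dist (p m x) (s x) < e / (2 * L)" and x: "x \<in> cball 0 r"
        have xU: "x \<in> ?U" using x sub by blast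
        have "norm (?I v (p m) x - ?I v s x) \<le> L * (e / (2 * L))"
          by (rule volterra_op_diff_bound[where K = "\<lambda>z. \<D> K z (v, 0)", OF c1[OF xU pcont] c1[OF xU s]])
             (use L(2) close radial_cball[OF x] x in \<open>auto simp: dist_norm intro!: less_imp_le\<close>)
        then show "dist (\<D> b x v + ?I v (p m) x) (\<D> b x v + ?I v s x) < e"
          using e L(1) by (simp add: dist_norm)
      qed
    qed
  qed (use sub continuous_on_subset[OF sg[OF v] sub] continuous_on_subset[OF dpcont sub] sg_eq[OF v] dpS in auto)
  have cvx: "convex (ball (0::'e) r)" by simp
  have "\<exists>g. \<forall>x\<in>ball 0 r. (\<lambda>n. p n x) \<longlonglongrightarrow> g x \<and> (g has_derivative (\<lambda>h. \<Sum>v\<in>Basis. (h \<bullet> v) *\<^sub>R \<sigma> v x)) (at x within ball 0 r)"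
  proof (rule has_derivative_sequence[OF cvx])
    show "(p n has_derivative \<D> (p n) x) (at x within ball 0 r)" if "x \<in> ball 0 r" for n x
      using Ck_on_SucD[OF oU pC, of x n] that r has_derivative_at_withinI by auto
    show "x0 \<in> ball 0 r" using r by simp
    show "(\<lambda>n. p n x0) \<longlonglongrightarrow> s x0" by (rule tendsto_uniform_limitI[OF ulp]) (use r in auto)
    fix e :: real assume e: "e > 0"
    let ?N = "real DIM('e)"
    have N: "?N > 0" by simp
    have "\<forall>\<^sub>F n in sequentially. \<forall>v\<in>Basis. \<forall>x\<in>cball 0 r. dist (dp n v x) (\<sigma> v x) < e / ?N"
      using uniform_limitD[OF uldp, of _ "e / ?N"] e N by (intro eventually_ball_finite) auto
    then show "\<forall>\<^sub>F n in sequentially. \<forall>x\<in>ball 0 r. \<forall>h. norm (\<D> (p n) x h - (\<Sum>v\<in>Basis. (h \<bullet> v) *\<^sub>R \<sigma> v x)) \<le> e * norm h"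
    proof (rule eventually_mono, intro ballI allI)
      fix n and x h :: 'e
      assume close: "\<forall>v\<in>Basis. \<forall>x\<in>cball 0 r. dist (dp n v x) (\<sigma> v x) < e / ?N" and x: "x \<in> ball 0 r"
      have lin: "linear (\<D> (p n) x)"
        using Ck_on_SucD[OF oU pC, of x n] x r by (auto intro: has_derivative_linear)
      have "\<D> (p n) x h = \<D> (p n) x (\<Sum>v\<in>Basis. (h \<bullet> v) *\<^sub>R v)"
        by (simp only: euclidean_representation)
      also have "\<dots> = (\<Sum>v\<in>Basis. (h \<bullet> v) *\<^sub>R dp n v x)"
        by (simp add: dp_def linear_sum[OF lin] linear_scale[OF lin])
      finally have "\<D> (p n) x h - (\<Sum>v\<in>Basis. (h \<bullet> v) *\<^sub>R \<sigma> v x) = (\<Sum>v\<in>Basis. (h \<bullet> v) *\<^sub>R (dp n v x - \<sigma> v x))"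
        by (simp add: scaleR_diff_right sum_subtractf)
      also have "norm \<dots> \<le> (\<Sum>v\<in>(Basis::'e set). norm h * (e / ?N))"
      proof (intro sum_norm_le)
        fix v :: 'e assume v: "v \<in> Basis"
        have "norm (dp n v x - \<sigma> v x) \<le> e / ?N" using close v x by (auto simp: dist_norm intro: less_imp_le)
        then show "norm ((h \<bullet> v) *\<^sub>R (dp n v x - \<sigma> v x)) \<le> norm h * (e / ?N)"
          by (simp only: norm_scaleR) (intro mult_mono Basis_le_norm[OF v], auto)
      qed
      also have "\<dots> = e * norm h" using N by simp
      finally show "norm (\<D> (p n) x h - (\<Sum>v\<in>Basis. (h \<bullet> v) *\<^sub>R \<sigma> v x)) \<le> e * norm h" .
    qed
  qed
  then obtain g where g: "\<And>x. x \<in> ball 0 r \<Longrightarrow> (\<lambda>n. p n x) \<longlonglongrightarrow> g x"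
    "\<And>x. x \<in> ball 0 r \<Longrightarrow> (g has_derivative (\<lambda>h. \<Sum>v\<in>Basis. (h \<bullet> v) *\<^sub>R \<sigma> v x)) (at x within ball 0 r)" by blast
  have gs: "g x = s x" if "x \<in> ball 0 r" for x
    using LIMSEQ_unique[OF g(1)[OF that] tendsto_uniform_limitI[OF ulp]] that by simp
  have x0r: "x0 \<in> ball 0 r" using r by simp
  have "(g has_derivative (\<lambda>h. \<Sum>v\<in>Basis. (h \<bullet> v) *\<^sub>R \<sigma> v x0)) (at x0)"
    using g(2)[OF x0r] x0r by (simp add: at_within_open[OF x0r open_ball])
  then show ?thesis by (rule has_derivative_transform_within_open[OF _ open_ball x0r]) (rule gs)
qed

text \<open>The induction runs over all kernels and data. By hypothesis the solution
  \<open>s\<close> is of class \<open>k\<close>, which makes the data \<open>\<beta> v\<close> of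
  the differentiated equation of class \<open>k\<close>. The hypothesis applied to that equation,
  with kernel multiplied by \<open>t\<close>, then shows that the derivatives
  \<open>\<sigma> v\<close> are of class \<open>k\<close>. Smoothness of \<open>K\<close> to every
  order keeps the kernel admissible throughout.\<close>

lemma volterra_solution_Ck:
  fixes K :: "'e::euclidean_space \<times> real \<Rightarrow> 'f::euclidean_space \<Rightarrow>\<^sub>L 'f"
  assumes V: "open V" "ball 0 R \<times> {0..1} \<subseteq> V" and K: "\<And>k. Ck_on k V K"
    and nK: "\<And>x t. x \<in> ball 0 R \<Longrightarrow> t \<in> {0..1} \<Longrightarrow> norm (K (x, t)) \<le> 1/2"
    and s: "continuous_on (ball 0 R) s"
    and eq: "\<And>x. x \<in> ball 0 R \<Longrightarrow> s x = b x + \<V> K s x"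
    and b: "Ck_on k (ball 0 R) b"
  shows "Ck_on k (ball 0 R) s"
  using K nK s eq b
proof (induction k arbitrary: K s b)
  case 0 then show ?case by simp
next
  case (Suc k)
  let ?U = "ball (0::'e) R"
  have oU: "open ?U" by simp
  define V' where "V' = V \<inter> {z. snd z *\<^sub>R fst z \<in> ?U}"
  have V': "open V'" "V' \<subseteq> V" unfolding V'_def by (intro open_Int V open_radial oU) blast
  have V'U: "?U \<times> {0..1} \<subseteq> V'"
    using V(2) radial_Times unfolding V'_def by (rule Int_greatest)
  have cK: "continuous_on V K" using Suc.prems(1)[of 0] by simp
  let ?Kt = "\<lambda>z. snd z *\<^sub>R K z"
  have nKt: "norm (?Kt (x, t)) \<le> 1/2" if "x \<in> ?U" "t \<in> {0..1}" for x t
    using Suc.prems(2)[OF that] that(2) mult_left_le_one_le[of "norm (K (x, t))" t] by simp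
  have Kt: "Ck_on j V ?Kt" for j
    by (intro Ck_on_bilinear[OF bounded_bilinear_scaleR V(1)] Ck_on_bounded_linear bounded_linear_snd V(1) Suc.prems(1))
  have voltt: "volterra ?U ?Kt"
    by (unfold_locales) (use radial_ball nKt continuous_on_subset[OF cK V(2)] in \<open>auto intro!: continuous_intros\<close>)
  define \<beta> where "\<beta> v x = \<D> b x v
        + integral {0..1} (\<lambda>t. \<D> K (x, t) (v, 0) (s (t *\<^sub>R x)))" for v x
  have sk: "Ck_on k ?U s" using Suc.IH[OF Suc.prems(1-4) Ck_on_Suc_imp[OF oU Suc.prems(5)]] .
  have \<beta>: "Ck_on k ?U (\<beta> v)" for v
  proof -
    have "Ck_on k V' (\<lambda>z. \<D> K z (v, 0) (s (snd z *\<^sub>R fst z)))"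
      by (intro Ck_on_bilinear[OF bounded_bilinear_blinfun_apply V'(1)] Ck_on_subset[OF Ck_on_Suc_derivative[OF Suc.prems(1)] V'(2)]
          Ck_on_radial[OF oU sk V'(1)]) (simp add: V'_def)
    from Ck_on_parametric_integral[OF V'(1) oU V'U this]
    show ?thesis unfolding \<beta>_def
      by (intro Ck_on_add[OF oU] Ck_on_Suc_derivative[OF Suc.prems(5)]) simp
  qed
  have ex: "\<exists>\<sigma>. continuous_on ?U \<sigma> \<and> (\<forall>x\<in>?U. \<sigma> x = \<beta> v x + integral {0..1} (\<lambda>t. ?Kt (x, t) (\<sigma> (t *\<^sub>R x))))" for v
  proof (rule volterra_solution_ball[OF voltt])
    show "continuous_on ?U (\<beta> v)" by (rule Ck_on_imp_continuous[OF oU \<beta>])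
  qed
  define \<sigma> where "\<sigma> v = (SOME \<sigma>. continuous_on ?U \<sigma> \<and> (\<forall>x\<in>?U. \<sigma> x = \<beta> v x + integral {0..1} (\<lambda>t. ?Kt (x, t) (\<sigma> (t *\<^sub>R x)))))" for v
  have \<sigma>: "continuous_on ?U (\<sigma> v)"
    "x \<in> ?U \<Longrightarrow> \<sigma> v x = \<beta> v x + integral {0..1} (\<lambda>t. ?Kt (x, t) (\<sigma> v (t *\<^sub>R x)))" for v x
    using someI_ex[OF ex[of v]] unfolding \<sigma>_def[symmetric] by auto
  have \<sigma>k: "Ck_on k ?U (\<sigma> v)" for v by (rule Suc.IH[OF Kt nKt \<sigma> \<beta>])
  have b1: "Ck_on (Suc 0) ?U b" by (rule Ck_on_Suc_imp_1[OF oU Suc.prems(5)])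
  have "(s has_derivative (\<lambda>h. \<Sum>v\<in>Basis. (h \<bullet> v) *\<^sub>R \<sigma> v x)) (at x)" if "x \<in> ?U" for x :: 'e
    by (rule volterra_solution_derivative[OF V Suc.prems(1-4) b1 \<sigma>(1) _ that])
       (use \<sigma>(2) in \<open>simp_all add: \<beta>_def\<close>)
  then show ?case
    by (rule Ck_on_SucI[OF oU]) (auto intro!: Ck_on_sum Ck_on_bilinear[OF bounded_bilinear_scaleR] Ck_on_const \<sigma>k)
qed

text \<open>Gronwall's argument: the weight \<open>exp (- 2 * L * t)\<close> makes the square of the
  norm nonincreasing.\<close>

lemma linear_ode_zero:
  fixes \<phi> :: "real \<Rightarrow> 'f::euclidean_space"
  assumes d: "\<And>t. 0 < t \<Longrightarrow> t < 1 \<Longrightarrow> (\<phi> has_vector_derivative \<psi> t) (at t)"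
    and c: "continuous_on {0..1} \<phi>"
    and le: "\<And>t. 0 < t \<Longrightarrow> t < 1 \<Longrightarrow> norm (\<psi> t) \<le> L * norm (\<phi> t)" and 0: "\<phi> 0 = 0"
  shows "\<phi> 1 = 0"
proof -
  define q where "q t = (\<phi> t \<bullet> \<phi> t) * exp (- 2 * L * t)" for t
  have "q 1 \<le> q 0"
  proof (rule DERIV_nonpos_imp_decreasing_open[where f = q and a = 0 and b = 1])
    show "continuous_on {0..1} q" unfolding q_def by (intro continuous_intros c)
    fix t :: real assume t: "0 < t" "t < 1"
    have "((\<lambda>t. \<phi> t \<bullet> \<phi> t) has_real_derivative 2 * (\<phi> t \<bullet> \<psi> t)) (at t)"
      using bounded_bilinear.has_vector_derivative[OF bounded_bilinear_inner d[OF t] d[OF t]]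
      by (simp add: has_real_derivative_iff_has_vector_derivative inner_commute)
    then have "(q has_real_derivative (2 * (\<phi> t \<bullet> \<psi> t) * exp (- 2 * L * t) + (\<phi> t \<bullet> \<phi> t) * (exp (- 2 * L * t) * (- 2 * L)))) (at t)"
      unfolding q_def by (auto intro!: derivative_eq_intros)
    moreover have "2 * (\<phi> t \<bullet> \<psi> t) * exp (- 2 * L * t) + (\<phi> t \<bullet> \<phi> t) * (exp (- 2 * L * t) * (- 2 * L)) \<le> 0"
    proof -
      have "\<phi> t \<bullet> \<psi> t \<le> norm (\<phi> t) * (L * norm (\<phi> t))"
        by (rule order_trans[OF norm_cauchy_schwarz]) (intro mult_left_mono le t norm_ge_zero)
      also have "\<dots> = L * (\<phi> t \<bullet> \<phi> t)" by (simp add: dot_square_norm power2_eq_square)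
      finally have "2 * (\<phi> t \<bullet> \<psi> t - L * (\<phi> t \<bullet> \<phi> t)) * exp (- 2 * L * t) \<le> 0"
        by (simp add: mult_le_0_iff)
      then show ?thesis by (simp add: algebra_simps)
    qed
    ultimately show "\<exists>y. (q has_real_derivative y) (at t) \<and> y \<le> 0" by blast
  qed simp
  then have "(\<phi> 1 \<bullet> \<phi> 1) * exp (- 2 * L) \<le> 0" by (simp add: q_def 0)
  then have "\<phi> 1 \<bullet> \<phi> 1 \<le> 0" by (simp add: mult_le_0_iff not_le)
  then show ?thesis by (metis inner_gt_zero_iff not_le)
qed

text \<open>Prescribes the derivative of \<open>s\<close> only in the radial direction, where a
  solution exists for arbitrary coefficients. Integrability is what later upgrades it to all
  directions.\<close>

lemma radial_system:
  fixes B :: "'e::euclidean_space \<Rightarrow> 'e \<Rightarrow>\<^sub>L ('f::euclidean_space \<Rightarrow>\<^sub>L 'f)"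
  assumes B: "Cinf_on W B" and W: "ball 0 R \<subseteq> W" and R: "R > 0"
    and nB: "\<And>x. x \<in> ball 0 R \<Longrightarrow> norm (B x) * R \<le> 1/2"
  obtains s where "Cinf_on (ball 0 R) s" "s 0 = s0"
    "\<And>x. x \<in> ball 0 R \<Longrightarrow> \<D> s x x = B x x (s x)"
proof -
  let ?U = "ball (0::'e) R"
  have oU: "open ?U" by simp
  define V where "V = {z. snd z *\<^sub>R fst z \<in> W}"
  define K where "K z = B (snd z *\<^sub>R fst z) (fst z)" for z
  have oW: "open W" using B Cinf_on_open by blast
  have V: "open V" unfolding V_def by (rule open_radial[OF oW])
  have VU: "?U \<times> {0..1} \<subseteq> V"
    using W radial_Times[of R] unfolding V_def by blast
  have KC: "Ck_on k V K" for k
  proof -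
    have "Ck_on k V (\<lambda>z. B (snd z *\<^sub>R fst z))"
      by (rule Ck_on_radial[OF oW _ V]) (use B in \<open>auto simp: Cinf_on_def V_def\<close>)
    then show ?thesis unfolding K_def
      by (rule Ck_on_bilinear[OF bounded_bilinear_blinfun_apply V _ Ck_on_bounded_linear[OF bounded_linear_fst V]])
  qed
  have nK: "norm (K (x, t)) \<le> 1/2" if "x \<in> ?U" "t \<in> {0..1}" for x t
  proof -
    have "norm (K (x, t)) \<le> norm (B (t *\<^sub>R x)) * norm x" unfolding K_def by (simp add: norm_blinfun)
    also have "\<dots> \<le> norm (B (t *\<^sub>R x)) * R" using that by (intro mult_left_mono) auto
    also have "\<dots> \<le> 1/2" by (rule nB[OF radial_ball[OF that]])
    finally show ?thesis .
  qed
  have cK: "continuous_on V K" using KC[of 0] by simp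
  have volt: "volterra ?U K"
    by (unfold_locales) (use radial_ball nK continuous_on_subset[OF cK VU] in auto)
  obtain s where s: "continuous_on ?U s" "\<And>x. x \<in> ?U \<Longrightarrow> s x = s0 + \<V> K s x"
    using volterra_solution_ball[OF volt, of "\<lambda>x. s0"] by auto
  have Cs: "Cinf_on ?U s" unfolding Cinf_on_def
    using volterra_solution_Ck[OF V VU KC nK s Ck_on_const[OF oU]] by simp
  moreover have "s 0 = s0" using s(2)[of 0] R by (simp add: K_def blinfun.zero_right)
  moreover have "\<D> s x x = B x x (s x)" if x: "x \<in> ?U" for x
  proof -
    define g where "g u = B (u *\<^sub>R x) x (s (u *\<^sub>R x))" for u
    have "continuous_on {0..1} (\<lambda>t. K (x, t) (s (t *\<^sub>R x)))" by (rule volterra.cont_K_apply1[OF volt s(1) x])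
    then have cg: "continuous_on {0..1} g" by (simp add: K_def g_def)
    define P where "P u = integral {0..u} g" for u
    have P: "(P has_vector_derivative g u) (at u within {0..1})" if "u \<in> {0..1}" for u
      unfolding P_def by (rule integral_has_vector_derivative[OF cg that])
    \<comment> \<open>On the ray through \<open>x\<close> the fixed point equation at
      \<open>\<tau> *\<^sub>R x\<close> becomes an ordinary integral from 0 to
      \<open>\<tau>\<close>. Its derivative at \<open>\<tau> = 1\<close> is the radial equation at
      \<open>x\<close>.\<close>
    have sP: "s (\<tau> *\<^sub>R x) = s0 + P \<tau>" if \<tau>: "\<tau> \<in> {0..1}" for \<tau>
    proof -
      have "((\<lambda>t. K (\<tau> *\<^sub>R x, t) (s (t *\<^sub>R (\<tau> *\<^sub>R x)))) has_integral P (1 * \<tau>) - P (0 * \<tau>)) {0..1}"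
      proof (rule fundamental_theorem_of_calculus)
        fix t :: real assume t: "t \<in> {0..1}"
        have sub: "(\<lambda>t. t * \<tau>) ` {0..1} \<subseteq> {0..1}" using \<tau> by (auto intro: mult_nonneg_nonneg mult_le_one)
        have tt: "t * \<tau> \<in> {0..1}" using t \<tau> by (auto intro: mult_nonneg_nonneg mult_le_one)
        have "((\<lambda>t. t * \<tau>) has_vector_derivative \<tau>) (at t within {0..1})"
          by (auto intro!: derivative_eq_intros simp: has_vector_derivative_def)
        from vector_diff_chain_within[OF this has_vector_derivative_within_subset[OF P[OF tt] sub]]
        show "((\<lambda>t. P (t * \<tau>)) has_vector_derivative K (\<tau> *\<^sub>R x, t) (s (t *\<^sub>R (\<tau> *\<^sub>R x)))) (at t within {0..1})"
          by (simp add: o_def g_def K_def blinfun.scaleR_right blinfun.scaleR_left)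
      qed simp
      then have "integral {0..1} (\<lambda>t. K (\<tau> *\<^sub>R x, t) (s (t *\<^sub>R (\<tau> *\<^sub>R x)))) = P \<tau> - P 0"
        by (simp add: integral_unique)
      then show ?thesis using s(2)[OF radial_ball[OF x \<tau>]] by (simp add: P_def)
    qed
    have "(s has_derivative \<D> s x) (at x)" using Cinf_on_has_derivative[OF Cs x] .
    then have "(s has_derivative \<D> s x) (at (1 *\<^sub>R x))" by simp
    moreover have "((\<lambda>\<tau>. \<tau> *\<^sub>R x) has_derivative (\<lambda>h. h *\<^sub>R x)) (at 1 within {0..1})"
      by (auto intro!: derivative_eq_intros)
    ultimately have "((\<lambda>\<tau>. s (\<tau> *\<^sub>R x)) has_derivative (\<lambda>h. \<D> s x (h *\<^sub>R x))) (at 1 within {0..1})"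
      using has_derivative_compose by blast
    then have 1: "((\<lambda>\<tau>. s (\<tau> *\<^sub>R x)) has_vector_derivative \<D> s x x) (at 1 within {0..1})"
      unfolding has_vector_derivative_def
      using Cinf_on_has_derivative[OF Cs x] by (simp add: linear_scale[OF has_derivative_linear])
    have "((\<lambda>\<tau>. s0 + P \<tau>) has_vector_derivative 0 + g 1) (at 1 within {0..1})"
      by (intro has_vector_derivative_add has_vector_derivative_const P) simp
    then have 2: "((\<lambda>\<tau>. s (\<tau> *\<^sub>R x)) has_vector_derivative g 1) (at 1 within {0..1})"
      using has_vector_derivative_transform[of 1 "{0..1}" "\<lambda>\<tau>. s (\<tau> *\<^sub>R x)" "\<lambda>\<tau>. s0 + P \<tau>"] sP by simp
    have "\<D> s x x = g 1"
      by (rule vector_derivative_unique_within[OF _ 1 2]) (simp add: trivial_limit_within islimpt_Icc)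
    then show ?thesis by (simp add: g_def)
  qed
  ultimately show ?thesis using that by blast
qed

section \<open>Integrability: from radial derivatives to all derivatives\<close>

lemma second_derivative_symmetric:
  fixes u :: "'e::euclidean_space \<Rightarrow> 'f::euclidean_space"
  assumes u: "Cinf_on W u" and x: "x \<in> W"
  shows "\<D> (\<lambda>y. \<D> u y v) x w =
         \<D> (\<lambda>y. \<D> u y w) x v"
proof (rule euclidean_eqI)
  fix c :: 'f
  have 1: "\<D> (\<lambda>y. q y \<bullet> c) z v = \<D> q z v \<bullet> c"
    if "Cinf_on W q" "z \<in> W" for q :: "'e \<Rightarrow> 'f" and z v
    using frechet_derivative_at[OF bounded_linear.has_derivative[OF bounded_linear_inner_left Cinf_on_has_derivative[OF that]], of c]
    by metis
  have "\<D> (\<lambda>y. \<D> u y v) x w \<bullet> c =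
     \<D> (\<lambda>y. \<D> (\<lambda>y. u y \<bullet> c) y v) x w" for v w
  proof -
    have "\<D> (\<lambda>y. \<D> (\<lambda>y. u y \<bullet> c) y v) x = \<D> (\<lambda>y. \<D> u y v \<bullet> c) x"
      by (rule frechet_derivative_cong_open[OF Cinf_on_open[OF u] x]) (rule 1[OF u])
    then show ?thesis using 1[OF Cinf_on_derivative[OF u] x] by simp
  qed
  then show "\<D> (\<lambda>y. \<D> u y v) x w \<bullet> c =
         \<D> (\<lambda>y. \<D> u y w) x v \<bullet> c"
    using second_derivative_symmetric_Cinf[OF Cinf_on_linear[OF bounded_linear_inner_left u] x] by simp
qed

text \<open>Frobenius' theorem. The defect \<open>\<tau>\<close> of the equation in direction
  \<open>w\<close> satisfies a homogeneous linear equation along the ray precisely because of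
  \<open>flat\<close>, and so it vanishes. Integrability is demanded only on a star-shaped part
  \<open>D\<close>, since \<open>B\<close> may be an arbitrary extension elsewhere.\<close>

lemma flat_radial_solution:
  fixes B :: "'e::euclidean_space \<Rightarrow> 'e \<Rightarrow>\<^sub>L ('f::euclidean_space \<Rightarrow>\<^sub>L 'f)"
  assumes B: "Cinf_on W B" and W: "ball 0 R \<subseteq> W"
    and nB: "\<And>x. x \<in> ball 0 R \<Longrightarrow> norm (B x) * R \<le> 1/2"
    and s: "Cinf_on (ball 0 R) s" and rad: "\<And>x. x \<in> ball 0 R \<Longrightarrow> \<D> s x x = B x x (s x)"
    and D: "D \<subseteq> ball 0 R" "\<And>x t. x \<in> D \<Longrightarrow> t \<in> {0..1} \<Longrightarrow> t *\<^sub>R x \<in> D"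
    and flat: "\<And>x v w \<sigma>. x \<in> D \<Longrightarrow> \<D> B x v w \<sigma> + B x w (B x v \<sigma>) =
        \<D> B x w v \<sigma> + B x v (B x w \<sigma>)"
    and x: "x \<in> D"
  shows "\<D> s x w = B x w (s x)"
proof -
  define Ds where "Ds w y = \<D> s y w" for w y
  define DB where "DB y w = \<D> B y w" for y w
  define \<tau> where "\<tau> y = Ds w y - B y w (s y)" for y
  have ballW: "y \<in> W" if "y \<in> ball 0 R" for y using that W by blast
  have ds: "(s has_derivative (\<lambda>v. Ds v y)) (at y)" if "y \<in> ball 0 R" for y
    using Cinf_on_has_derivative[OF s that] by (simp add: Ds_def)
  have dB: "(B has_derivative DB y) (at y)" if "y \<in> ball 0 R" for y
    using Cinf_on_has_derivative[OF B ballW[OF that]] by (simp add: DB_def[abs_def])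
  have CDs: "Cinf_on (ball 0 R) (Ds v)" for v using Cinf_on_derivative[OF s] by (simp add: Ds_def[abs_def])
  have lin: "linear (\<lambda>v. Ds v y)" if "y \<in> ball 0 R" for y using ds[OF that] has_derivative_linear by blast
  have along: "((\<lambda>t. q (t *\<^sub>R x)) has_vector_derivative q' x) (at t)"
    if "(q has_derivative q') (at (t *\<^sub>R x))" for q :: "'e \<Rightarrow> 'g::real_normed_vector" and q' t
  proof -
    have "((\<lambda>t. t *\<^sub>R x) has_derivative (\<lambda>h. h *\<^sub>R x)) (at t)" by (auto intro!: derivative_eq_intros)
    from has_derivative_compose[OF this that] show ?thesis
      unfolding has_vector_derivative_def by (simp add: linear_scale[OF has_derivative_linear[OF that]])
  qed
  \<comment> \<open>The radial equation differentiated in direction \<open>w\<close>. The term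
    \<open>Ds w y\<close> arises because the direction \<open>y\<close> of differentiation depends
    on the point.\<close>
  have radial': "Ds w y + \<D> (Ds w) y y = DB y w y (s y) + B y w (s y) + B y y (Ds w y)"
    if y: "y \<in> ball 0 R" for y
  proof -
    have d0: "((\<lambda>z. \<Sum>b\<in>Basis. (z \<bullet> b) *\<^sub>R Ds b z) has_derivative
        (\<lambda>h. \<Sum>b\<in>Basis. (y \<bullet> b) *\<^sub>R \<D> (Ds b) y h + (h \<bullet> b) *\<^sub>R Ds b y)) (at y)"
      by (intro has_derivative_sum bounded_bilinear.FDERIV[OF bounded_bilinear_scaleR]
         bounded_linear_imp_has_derivative bounded_linear_inner_left Cinf_on_has_derivative[OF CDs y])
    have e0: "(\<Sum>b\<in>Basis. (z \<bullet> b) *\<^sub>R Ds b z) = B z z (s z)" if z: "z \<in> ball 0 R" for z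
    proof -
      have "(\<Sum>b\<in>Basis. (z \<bullet> b) *\<^sub>R Ds b z) = Ds (\<Sum>b\<in>Basis. (z \<bullet> b) *\<^sub>R b) z"
        by (simp add: linear_sum[OF lin[OF z]] linear_scale[OF lin[OF z]])
      then show ?thesis using rad[OF z] by (simp add: euclidean_representation Ds_def)
    qed
    have 1: "((\<lambda>z. B z z (s z)) has_derivative
        (\<lambda>h. \<Sum>b\<in>Basis. (y \<bullet> b) *\<^sub>R \<D> (Ds b) y h + (h \<bullet> b) *\<^sub>R Ds b y)) (at y)"
      by (rule has_derivative_transform_within_open[OF d0 open_ball y e0])
    have "((\<lambda>z. B z z) has_derivative (\<lambda>h. B y h + DB y h y)) (at y)"
      by (rule bounded_bilinear.FDERIV[OF bounded_bilinear_blinfun_apply dB[OF y]]) (rule has_derivative_ident)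
    from bounded_bilinear.FDERIV[OF bounded_bilinear_blinfun_apply this ds[OF y]]
    have 2: "((\<lambda>z. B z z (s z)) has_derivative (\<lambda>h. B y y (Ds h y) + (B y h + DB y h y) (s y))) (at y)" .
    have lin2: "linear (\<D> (Ds w) y)"
      using Cinf_on_has_derivative[OF CDs y] has_derivative_linear by blast
    have "(\<Sum>b\<in>Basis. (y \<bullet> b) *\<^sub>R \<D> (Ds b) y w + (w \<bullet> b) *\<^sub>R Ds b y) = B y y (Ds w y) + (B y w + DB y w y) (s y)"
      using has_derivative_unique[OF 1 2] by meson
    moreover have "\<D> (Ds b) y w = \<D> (Ds w) y b" for b
      using second_derivative_symmetric[OF s y, of b w] by (simp add: Ds_def[abs_def])
    moreover have "(\<Sum>b\<in>Basis. (y \<bullet> b) *\<^sub>R \<D> (Ds w) y b) = \<D> (Ds w) y (\<Sum>b\<in>Basis. (y \<bullet> b) *\<^sub>R b)"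
      by (simp add: linear_sum[OF lin2] linear_scale[OF lin2])
    moreover have "(\<Sum>b\<in>Basis. (w \<bullet> b) *\<^sub>R Ds b y) = Ds (\<Sum>b\<in>Basis. (w \<bullet> b) *\<^sub>R b) y"
      by (simp add: linear_sum[OF lin[OF y]] linear_scale[OF lin[OF y]])
    ultimately show ?thesis
      by (simp add: sum.distrib euclidean_representation blinfun.add_left algebra_simps)
  qed
  \<comment> \<open>The factor \<open>t\<close> absorbs that extra first-order term, turning the
    equation for the defect into a homogeneous one, and supplies the initial value zero.\<close>
  define \<phi> where "\<phi> t = t *\<^sub>R \<tau> (t *\<^sub>R x)" for t
  have xt: "t *\<^sub>R x \<in> D" "t *\<^sub>R x \<in> ball 0 R" if "0 \<le> t" "t \<le> 1" for t
  proof -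
    show "t *\<^sub>R x \<in> D" using D(2)[OF x, of t] that by simp
    then show "t *\<^sub>R x \<in> ball 0 R" using D(1) by blast
  qed
  have d\<phi>: "(\<phi> has_vector_derivative B (t *\<^sub>R x) x (\<phi> t)) (at t)" if t: "0 \<le> t" "t \<le> 1" for t
  proof -
    let ?y = "t *\<^sub>R x"
    have y: "?y \<in> ball 0 R" "?y \<in> D" using xt[OF t] by auto
    have "((\<lambda>z. B z w) has_derivative (\<lambda>h. DB ?y h w)) (at ?y)"
      using bounded_linear.has_derivative[OF blinfun.bounded_linear_left dB[OF y(1)]] .
    from bounded_bilinear.FDERIV[OF bounded_bilinear_blinfun_apply this ds[OF y(1)]]
    have "((\<lambda>z. B z w (s z)) has_derivative (\<lambda>h. B ?y w (Ds h ?y) + DB ?y h w (s ?y))) (at ?y)" .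
    from has_derivative_diff[OF Cinf_on_has_derivative[OF CDs y(1), of w] this]
    have "(\<tau> has_derivative (\<lambda>h. \<D> (Ds w) ?y h - (B ?y w (Ds h ?y) + DB ?y h w (s ?y)))) (at ?y)"
      by (simp add: \<tau>_def[abs_def])
    note d1 = along[OF this]
    have "(\<phi> has_vector_derivative (t *\<^sub>R (\<D> (Ds w) ?y x - (B ?y w (Ds x ?y) + DB ?y x w (s ?y))) + 1 *\<^sub>R \<tau> ?y)) (at t)"
      unfolding \<phi>_def by (rule has_vector_derivative_scaleR[OF _ d1]) (auto intro!: derivative_eq_intros)
    moreover have "t *\<^sub>R (\<D> (Ds w) ?y x - (B ?y w (Ds x ?y) + DB ?y x w (s ?y))) + 1 *\<^sub>R \<tau> ?y = B ?y x (\<phi> t)"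
    proof -
      have lin2: "linear (\<D> (Ds w) ?y)"
        using Cinf_on_has_derivative[OF CDs y(1)] has_derivative_linear by blast
      have a: "t *\<^sub>R \<D> (Ds w) ?y x = \<D> (Ds w) ?y ?y"
        by (simp add: linear_scale[OF lin2])
      have b: "t *\<^sub>R B ?y w (Ds x ?y) = B ?y w (B ?y ?y (s ?y))"
        using rad[OF y(1)] linear_scale[OF lin[OF y(1)], of t x] by (simp add: Ds_def blinfun.scaleR_right)
      have linDB: "linear (DB ?y)" using dB[OF y(1)] has_derivative_linear by blast
      have c: "t *\<^sub>R DB ?y x w (s ?y) = DB ?y ?y w (s ?y)"
        by (simp add: linear_scale[OF linDB] blinfun.scaleR_left)
      have d: "B ?y x (\<phi> t) = B ?y ?y (\<tau> ?y)" by (simp add: \<phi>_def blinfun.scaleR_right blinfun.scaleR_left)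
      have f: "DB ?y w ?y (s ?y) + B ?y ?y (B ?y w (s ?y)) = DB ?y ?y w (s ?y) + B ?y w (B ?y ?y (s ?y))"
        using flat[OF y(2), of w ?y "s ?y"] by (simp add: DB_def)
      have "t *\<^sub>R (\<D> (Ds w) ?y x - (B ?y w (Ds x ?y) + DB ?y x w (s ?y))) + 1 *\<^sub>R \<tau> ?y
         = (Ds w ?y + \<D> (Ds w) ?y ?y) - B ?y w (B ?y ?y (s ?y)) - DB ?y ?y w (s ?y) - B ?y w (s ?y)"
        by (simp only: scaleR_diff_right scaleR_add_right a b c) (simp add: \<tau>_def)
      also have "\<dots> = B ?y ?y (\<tau> ?y)"
        unfolding radial'[OF y(1)] using f by (simp add: \<tau>_def blinfun.diff_right algebra_simps)
      finally show ?thesis unfolding d .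
    qed
    ultimately show ?thesis by simp
  qed
  have "\<phi> 1 = 0"
  proof (rule linear_ode_zero[where L = "1/2"])
    show "(\<phi> has_vector_derivative B (t *\<^sub>R x) x (\<phi> t)) (at t)" if "0 < t" "t < 1" for t
      using d\<phi>[of t] that by simp
    show "continuous_on {0..1} \<phi>"
      using d\<phi> by (intro continuous_at_imp_continuous_on ballI) (auto intro: has_vector_derivative_continuous)
    show "norm (B (t *\<^sub>R x) x (\<phi> t)) \<le> 1/2 * norm (\<phi> t)" if "0 < t" "t < 1" for t
    proof -
      have "norm (B (t *\<^sub>R x) x (\<phi> t)) \<le> norm (B (t *\<^sub>R x) x) * norm (\<phi> t)" by (rule norm_blinfun)
      also have "norm (B (t *\<^sub>R x) x) \<le> norm (B (t *\<^sub>R x)) * norm x" by (rule norm_blinfun)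
      also have "\<dots> \<le> norm (B (t *\<^sub>R x)) * R" using x D(1) by (intro mult_left_mono) auto
      also have "\<dots> \<le> 1/2" using nB[OF xt(2)[of t]] that by simp
      finally show ?thesis by (simp add: mult_right_mono)
    qed
  qed (simp add: \<phi>_def)
  then show ?thesis by (simp add: \<phi>_def \<tau>_def Ds_def)
qed

section \<open>The Obata equation and isometric immersions in a chart\<close>

lemma has_derivative_interior:
  fixes x :: "real ^ 'n::finite"
  assumes "hopen S" "x \<in> S" "0 < hgt x" shows "at x within half_space = at x"
proof -
  have "open {x :: real ^ 'n. 0 < hgt x}"
    by (intro open_Collect_less continuous_intros)
  moreover have "{x :: real ^ 'n. 0 < hgt x} \<subseteq> half_space" by (auto simp: half_space_def)
  ultimately have "x \<in> interior (half_space :: (real ^ 'n) set)" using assms(3) interiorI by blast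
  then show ?thesis by (rule at_within_interior)
qed

definition bilin_fun :: "('a::euclidean_space \<Rightarrow> 'b::euclidean_space \<Rightarrow> 'f::euclidean_space) \<Rightarrow> 'a \<Rightarrow>\<^sub>L ('b \<Rightarrow>\<^sub>L 'f)"
  where "bilin_fun b = Blinfun (\<lambda>v. Blinfun (b v))"

lemma bilin_fun_apply:
  assumes b: "bounded_bilinear b" shows "bilin_fun b v w = b v w"
proof -
  have 1: "blinfun_apply (Blinfun (b v)) = b v" for v
    by (rule bounded_linear_Blinfun_apply[OF bounded_bilinear.bounded_linear_right[OF b]])
  have "linear (\<lambda>v. Blinfun (b v))"
    by (rule linearI) (auto intro!: blinfun_eqI simp: 1 blinfun.add_left blinfun.scaleR_left
        bounded_bilinear.add_left[OF b] bounded_bilinear.scaleR_left[OF b])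
  then have "bounded_linear (\<lambda>v. Blinfun (b v))" by (simp add: linear_conv_bounded_linear)
  then show ?thesis unfolding bilin_fun_def by (simp add: bounded_linear_Blinfun_apply 1)
qed

definition jet :: "(real ^ 'n::finite \<Rightarrow> real) \<Rightarrow> real ^ 'n \<Rightarrow> real \<times> (real ^ 'n)"
  where "jet u y = (u y, \<chi> i. pd i u y)"

lemma smooth_on_Pair:
  fixes u :: "'a::euclidean_space \<Rightarrow> 'b::real_normed_vector" and w :: "'a \<Rightarrow> 'c::real_normed_vector"
  assumes "smooth_on S u" "smooth_on S w" shows "smooth_on S (\<lambda>x. (u x, w x))"
proof -
  have 1: "bounded_linear (\<lambda>a::'b. (a, 0::'c))" and 2: "bounded_linear (\<lambda>a::'c. (0::'b, a))"
    by (intro bounded_linear_Pair bounded_linear_ident bounded_linear_zero)+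
  have "smooth_on S (\<lambda>x. (u x, 0) + (0, w x))"
    by (rule smooth_on_add[OF smooth_on_linear[OF 1 assms(1)] smooth_on_linear[OF 2 assms(2)]])
  then show ?thesis by simp
qed

context metric_chart
begin

section \<open>Solutions of the Obata equation: gradients, energies and jets\<close>

definition solves :: "real \<Rightarrow> (real ^ 'n) set \<Rightarrow> (real ^ 'n \<Rightarrow> real) \<Rightarrow> bool" where
  "solves c T u \<longleftrightarrow> smooth_on T u \<and>
    (\<forall>y\<in>T. \<forall>i j. pd i (pd j u) y = (\<Sum>k\<in>UNIV. \<Gamma> k i j y * pd k u y) - c * u y * g i j y)"

lemma solvesD: "solves c T u \<Longrightarrow> smooth_on T u"
  "solves c T u \<Longrightarrow> y \<in> T \<Longrightarrow> pd i (pd j u) y = (\<Sum>k\<in>UNIV. \<Gamma> k i j y * pd k u y) - c * u y * g i j y"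
  by (auto simp: solves_def)

lemma solves_subset: "solves c T u \<Longrightarrow> T' \<subseteq> T \<Longrightarrow> solves c T' u"
  unfolding solves_def using smooth_on_subset by blast

lemma metric_chart_subset: assumes "hopen T" "T \<subseteq> S" shows "metric_chart T G"
  using assms by unfold_locales (auto intro: smooth_on_subset[OF smooth_G] sym_G pos_G)

lemma solves_lincomb:
  assumes T: "hopen T" and u: "\<And>z. z \<in> I \<Longrightarrow> solves c T (u z)" and "finite I"
  shows "solves c T (\<lambda>x. \<Sum>z\<in>I. a z * u z x)"
proof -
  have sm: "smooth_on T (u z)" if "z \<in> I" for z using u[OF that] by (rule solvesD)
  have 1: "pd j (\<lambda>x. \<Sum>z\<in>I. a z * u z x) y = (\<Sum>z\<in>I. a z * pd j (u z) y)" if "y \<in> T" for j y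
    using T that by (simp add: pd_sum pd_cmult smooth_on_cmult sm)
  have 2: "pd i (pd j (\<lambda>x. \<Sum>z\<in>I. a z * u z x)) y = (\<Sum>z\<in>I. a z * pd i (pd j (u z)) y)" if "y \<in> T" for i j y
    using pd_cong[OF T that 1] T that by (simp add: pd_sum pd_cmult smooth_on_cmult smooth_on_pd sm)
  show ?thesis
    unfolding solves_def
  proof (intro conjI ballI allI)
    show "smooth_on T (\<lambda>x. \<Sum>z\<in>I. a z * u z x)" by (intro smooth_on_sum smooth_on_cmult sm)
    fix y i j assume y: "y \<in> T"
    have "(\<Sum>z\<in>I. a z * pd i (pd j (u z)) y) = (\<Sum>z\<in>I. a z * ((\<Sum>k\<in>UNIV. \<Gamma> k i j y * pd k (u z) y) - c * u z y * g i j y))"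
      by (intro sum.cong refl arg_cong[where f = "\<lambda>b. _ * b"] solvesD(2)[OF u y])
    also have "\<dots> = (\<Sum>k\<in>UNIV. \<Gamma> k i j y * (\<Sum>z\<in>I. a z * pd k (u z) y)) - c * (\<Sum>z\<in>I. a z * u z y) * g i j y"
      unfolding sum_distrib_left right_diff_distrib sum_subtractf sum_distrib_right
      by (subst sum.swap) (simp add: mult_ac)
    finally show "pd i (pd j (\<lambda>x. \<Sum>z\<in>I. a z * u z x)) y =
       (\<Sum>k\<in>UNIV. \<Gamma> k i j y * pd k (\<lambda>x. \<Sum>z\<in>I. a z * u z x) y) - c * (\<Sum>z\<in>I. a z * u z y) * g i j y"
      using 1[OF y] 2[OF y] by simp
  qed
qed

text \<open>The Obata equation with an index raised: the covariant derivative of the gradient is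
  \<open>- c u\<close> times the identity. Both sides are compared after lowering, so the inverse
  metric never has to be differentiated.\<close>

lemma pd_X:
  assumes x: "x \<in> S" and u: "solves c S u"
  shows "pd k (X u l) x = - c * u x * (if l = k then 1 else 0) - (\<Sum>m\<in>UNIV. \<Gamma> l k m x * X u m x)"
proof -
  have su: "smooth_on S u" using u by (rule solvesD)
  have low: "(\<Sum>i\<in>UNIV. g j i x * pd k (X u i) x) = (\<Sum>i\<in>UNIV. g j i x * (- c * u x * (if i = k then 1 else 0) - (\<Sum>m\<in>UNIV. \<Gamma> i k m x * X u m x)))" for j
  proof -
    have "pd k (pd j u) x = pd k (\<lambda>y. \<Sum>i\<in>UNIV. g j i y * X u i y) x"
      by (rule pd_cong[OF hopen_S x]) (simp add: lower_X)
    also have "\<dots> = (\<Sum>i\<in>UNIV. g j i x * pd k (X u i) x + pd k (g j i) x * X u i x)"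
      using hopen_S x by (simp add: pd_sum pd_mult smooth_on_mult smooth_g smooth_X su)
    finally have "(\<Sum>i\<in>UNIV. g j i x * pd k (X u i) x) = pd k (pd j u) x - (\<Sum>i\<in>UNIV. (C i k j x + C j k i x) * X u i x)"
      by (simp add: sum.distrib metric_compat[OF x])
    also have "pd k (pd j u) x = (\<Sum>m\<in>UNIV. \<Gamma> m k j x * (\<Sum>i\<in>UNIV. g m i x * X u i x)) - c * u x * g k j x"
      by (simp add: solvesD(2)[OF u x] lower_X[OF x])
    also have "(\<Sum>m\<in>UNIV. \<Gamma> m k j x * (\<Sum>i\<in>UNIV. g m i x * X u i x)) = (\<Sum>i\<in>UNIV. C i k j x * X u i x)"
      unfolding lower_christoffel[OF x, symmetric] sum_distrib_left sum_distrib_right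
      by (subst sum.swap) (simp add: g_sym[OF x] mult_ac)
    finally have "(\<Sum>i\<in>UNIV. g j i x * pd k (X u i) x) = - c * u x * g j k x - (\<Sum>i\<in>UNIV. C j k i x * X u i x)"
      by (simp add: distrib_right sum.distrib g_sym[OF x, of k j])
    also have "(\<Sum>i\<in>UNIV. C j k i x * X u i x) = (\<Sum>i\<in>UNIV. g j i x * (\<Sum>m\<in>UNIV. \<Gamma> i k m x * X u m x))"
      unfolding lower_christoffel[OF x, symmetric] sum_distrib_left sum_distrib_right
      by (subst sum.swap) (simp add: mult_ac)
    finally show ?thesis
      by (simp add: right_diff_distrib sum_subtractf sum_negf if_distrib[of "\<lambda>b. _ * b"] cong: if_cong)
  qed
  have "pd k (X u l) x = (\<Sum>j\<in>UNIV. gi l j x * (\<Sum>i\<in>UNIV. g j i x * pd k (X u i) x))"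
    by (simp add: lower_upper[OF x])
  then show ?thesis unfolding low by (simp add: lower_upper(2)[OF x])
qed

text \<open>The polarised form of \<open>|du|^2 + c u^2\<close>. For coordinate functions of a map
  into the sphere, the mixed energies express the product of \<open>frameA\<close> and
  \<open>frameK\<close>, so their constancy carries a frame from one point to the next.\<close>

definition energy :: "real \<Rightarrow> (real ^ 'n \<Rightarrow> real) \<Rightarrow> (real ^ 'n \<Rightarrow> real) \<Rightarrow> real ^ 'n \<Rightarrow> real"
  where "energy c u w x = (\<Sum>i\<in>UNIV. X u i x * pd i w x) + c * (u x * w x)"

lemma smooth_energy: "smooth_on S u \<Longrightarrow> smooth_on S w \<Longrightarrow> smooth_on S (energy c u w)"
  unfolding energy_def[abs_def]
  by (intro smooth_on_add smooth_on_sum smooth_on_mult smooth_X smooth_on_pd hopen_S smooth_on_const)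

lemma pd_energy:
  assumes x: "x \<in> S" and u: "solves c S u" and w: "solves c S w"
  shows "pd k (energy c u w) x = 0"
proof -
  have su: "smooth_on S u" "smooth_on S w" using u w by (simp_all add: solvesD)
  have "pd k (energy c u w) x = (\<Sum>i\<in>UNIV. X u i x * pd k (pd i w) x + pd k (X u i) x * pd i w x) + c * (u x * pd k w x + pd k u x * w x)"
    unfolding energy_def[abs_def] using hopen_S x
    by (simp add: pd_add pd_sum pd_mult pd_cmult smooth_on_sum smooth_on_mult smooth_on_cmult smooth_X smooth_on_pd su)
  also have "(\<Sum>i\<in>UNIV. X u i x * pd k (pd i w) x) = (\<Sum>i\<in>UNIV. X u i x * (\<Sum>m\<in>UNIV. \<Gamma> m k i x * pd m w x)) - c * w x * pd k u x"
  proof -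
    have "(\<Sum>i\<in>UNIV. X u i x * pd k (pd i w) x) = (\<Sum>i\<in>UNIV. X u i x * (\<Sum>m\<in>UNIV. \<Gamma> m k i x * pd m w x)) - c * w x * (\<Sum>i\<in>UNIV. g k i x * X u i x)"
      unfolding solvesD(2)[OF w x] right_diff_distrib sum_subtractf sum_distrib_left[of "c * w x"] by (simp only: mult_ac)
    then show ?thesis by (simp only: lower_X[OF x])
  qed
  then have "(\<Sum>i\<in>UNIV. X u i x * pd k (pd i w) x + pd k (X u i) x * pd i w x) =
     (\<Sum>i\<in>UNIV. X u i x * (\<Sum>m\<in>UNIV. \<Gamma> m k i x * pd m w x)) - c * w x * pd k u x + (\<Sum>i\<in>UNIV. pd k (X u i) x * pd i w x)"
    by (simp add: sum.distrib)
  also have "(\<Sum>i\<in>UNIV. pd k (X u i) x * pd i w x) = - c * u x * pd k w x - (\<Sum>i\<in>UNIV. (\<Sum>m\<in>UNIV. \<Gamma> i k m x * X u m x) * pd i w x)"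
    by (simp add: pd_X[OF x u] left_diff_distrib sum_subtractf sum_negf if_distrib[of "\<lambda>b. _ * b"] if_distrib[of "\<lambda>b. b * _"] cong: if_cong)
  also have "(\<Sum>i\<in>UNIV. (\<Sum>m\<in>UNIV. \<Gamma> i k m x * X u m x) * pd i w x) = (\<Sum>i\<in>UNIV. X u i x * (\<Sum>m\<in>UNIV. \<Gamma> m k i x * pd m w x))"
    unfolding sum_distrib_left sum_distrib_right by (subst sum.swap) (simp add: mult_ac)
  finally show ?thesis by (simp add: algebra_simps)
qed

text \<open>The 1-jet of a solution of \<open>Hess u = - c u g\<close> satisfies the linear system
  \<open>dJ(v) = sys c v J\<close>, which is integrable exactly when \<open>WW c\<close> vanishes.\<close>

definition sys :: "real \<Rightarrow> real ^ 'n \<Rightarrow> (real ^ 'n) \<Rightarrow>\<^sub>L ((real \<times> (real ^ 'n)) \<Rightarrow>\<^sub>L (real \<times> (real ^ 'n)))"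
  where "sys c x = bilin_fun (\<lambda>v s. (v \<bullet> snd s, 0))
    + (\<Sum>k\<in>UNIV. \<Sum>i\<in>UNIV. \<Sum>j\<in>UNIV. \<Gamma> k i j x *\<^sub>R bilin_fun (\<lambda>v s. (0, (v $ i * snd s $ k) *\<^sub>R axis j 1)))
    - (\<Sum>i\<in>UNIV. \<Sum>j\<in>UNIV. (c * g i j x) *\<^sub>R bilin_fun (\<lambda>v s. (0, (v $ i * fst s) *\<^sub>R axis j 1)))"

lemma bilinear_sys:
  "bounded_bilinear (\<lambda>(v :: real ^ 'n) (s :: real \<times> (real ^ 'n)). (v \<bullet> snd s, 0 :: real ^ 'n))"
  "bounded_bilinear (\<lambda>(v :: real ^ 'n) (s :: real \<times> (real ^ 'n)). (0 :: real, (v $ i * snd s $ k) *\<^sub>R axis j 1 :: real ^ 'n))"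
  "bounded_bilinear (\<lambda>(v :: real ^ 'n) (s :: real \<times> (real ^ 'n)). (0 :: real, (v $ i * fst s) *\<^sub>R axis j 1 :: real ^ 'n))"
  unfolding bilinear_conv_bounded_bilinear[symmetric] bilinear_def
  by (auto intro!: linearI simp: inner_add_left inner_add_right algebra_simps)

lemma sys_apply:
  "sys c x v s = (v \<bullet> snd s, \<Sum>i\<in>UNIV. v $ i *\<^sub>R (\<chi> j. (\<Sum>k\<in>UNIV. \<Gamma> k i j x * snd s $ k) - c * fst s * g i j x))"
proof -
  have a: "axis k (1::real) $ m = (if k = m then 1 else 0)" for k m :: 'n by (simp add: axis_def)
  have vj: "(\<Sum>k\<in>UNIV. \<Sum>i\<in>UNIV. \<Sum>j\<in>UNIV. \<Gamma> k i j x * (v $ i * snd s $ k) * axis j 1 $ m) =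
     (\<Sum>i\<in>UNIV. v $ i * (\<Sum>k\<in>UNIV. \<Gamma> k i m x * snd s $ k))"
    "(\<Sum>i\<in>UNIV. \<Sum>j\<in>UNIV. c * g i j x * (v $ i * fst s) * axis j 1 $ m) = (\<Sum>i\<in>UNIV. v $ i * (c * fst s * g i m x))" for m
  proof -
    have "(\<Sum>k\<in>UNIV. \<Sum>i\<in>UNIV. \<Sum>j\<in>UNIV. \<Gamma> k i j x * (v $ i * snd s $ k) * axis j 1 $ m) =
      (\<Sum>k\<in>UNIV. \<Sum>i\<in>UNIV. v $ i * (\<Gamma> k i m x * snd s $ k))"
      by (simp add: a if_distrib[of "\<lambda>b. _ * b"] mult_ac cong: if_cong)
    then show "(\<Sum>k\<in>UNIV. \<Sum>i\<in>UNIV. \<Sum>j\<in>UNIV. \<Gamma> k i j x * (v $ i * snd s $ k) * axis j 1 $ m) =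
     (\<Sum>i\<in>UNIV. v $ i * (\<Sum>k\<in>UNIV. \<Gamma> k i m x * snd s $ k))"
      unfolding sum_distrib_left by (subst sum.swap)
    show "(\<Sum>i\<in>UNIV. \<Sum>j\<in>UNIV. c * g i j x * (v $ i * fst s) * axis j 1 $ m) = (\<Sum>i\<in>UNIV. v $ i * (c * fst s * g i m x))"
      by (simp add: a if_distrib[of "\<lambda>b. _ * b"] mult_ac cong: if_cong)
  qed
  show ?thesis
    by (simp add: sys_def blinfun.add_left blinfun.diff_left blinfun.sum_left blinfun.scaleR_left bilin_fun_apply[OF bilinear_sys(1)]
      bilin_fun_apply[OF bilinear_sys(2)] bilin_fun_apply[OF bilinear_sys(3)] prod_eq_iff fst_sum snd_sum vec_eq_iff right_diff_distrib sum_subtractf)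
      (simp only: vj, simp)
qed

lemma smooth_sys: "smooth_on S (sys c)"
  unfolding sys_def[abs_def]
  by (intro smooth_on_add smooth_on_diff smooth_on_sum smooth_on_scaleR smooth_on_const smooth_christoffel smooth_on_cmult smooth_g)

lemma smooth_jet: "smooth_on S u \<Longrightarrow> smooth_on S (jet u)"
  unfolding jet_def[abs_def] by (intro smooth_on_Pair smooth_on_vec) (simp_all add: smooth_on_pd hopen_S)

lemma pd_jet:
  assumes x: "x \<in> S" and u: "solves c S u"
  shows "pd i (jet u) x = sys c x (axis i 1) (jet u x)"
proof -
  have su: "smooth_on S u" using u by (rule solvesD)
  have 1: "fst (pd i (jet u) x) = pd i u x"
    using pd_linear[OF hopen_S x bounded_linear_fst smooth_jet[OF su], of i] by (simp add: jet_def)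
  have 2: "snd (pd i (jet u) x) $ j = pd i (pd j u) x" for j
    using pd_linear[OF hopen_S x bounded_linear_snd smooth_jet[OF su], of i]
      pd_vec_nth[OF hopen_S x smooth_on_linear[OF bounded_linear_snd smooth_jet[OF su]], of i j] by (simp add: jet_def)
  show ?thesis
    by (simp add: prod_eq_iff vec_eq_iff 1 2 sys_apply solvesD(2)[OF u x] axis_def if_distrib[of "\<lambda>b. b * _"] inner_vec_def cong: if_cong)
       (simp add: jet_def)
qed

lemma jet_has_derivative:
  assumes x: "x \<in> S" and u: "solves c S u"
  shows "(jet u has_derivative (\<lambda>v. sys c x v (jet u x))) (at x within half_space)"
proof -
  have "(dpd (jet u) x v) = sys c x v (jet u x)" for v
    using linear_axis_expansion[of "\<lambda>v. sys c x v (jet u x)" v]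
    by (simp add: pd_jet[OF x u] linear_iff blinfun.add_right blinfun.add_left blinfun.scaleR_left blinfun.scaleR_right)
  then show ?thesis using smooth_has_derivative[OF hopen_S smooth_jet[OF solvesD(1)[OF u]] x] by simp
qed

text \<open>The difference of the two jets satisfies a homogeneous linear equation along the
  segment. The segment runs through interior points, where derivatives within the half-space are
  ordinary ones.\<close>

lemma jet_unique_segment:
  assumes u: "solves c S u" and w: "solves c S w"
    and l: "\<And>t. t \<in> {0..1} \<Longrightarrow> y0 + t *\<^sub>R (x - y0) \<in> S" "\<And>t. t \<in> {0..1} \<Longrightarrow> 0 < hgt (y0 + t *\<^sub>R (x - y0))"
    and jet0: "jet u y0 = jet w y0"
  shows "jet u x = jet w x"
proof -
  define l where "l t = y0 + t *\<^sub>R (x - y0)" for t :: real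
  note l = l[folded l_def]
  define \<phi> where "\<phi> t = jet u (l t) - jet w (l t)" for t
  have d: "(\<phi> has_vector_derivative sys c (l t) (x - y0) (\<phi> t)) (at t)" if t: "t \<in> {0..1}" for t
  proof -
    have dj: "((\<lambda>y. jet u y - jet w y) has_derivative (\<lambda>v. sys c (l t) v (jet u (l t)) - sys c (l t) v (jet w (l t)))) (at (l t))"
      using has_derivative_diff[OF jet_has_derivative[OF l(1)[OF t] u] jet_has_derivative[OF l(1)[OF t] w]]
      unfolding has_derivative_interior[OF hopen_S l[OF t]] .
    have "(l has_derivative (\<lambda>h. h *\<^sub>R (x - y0))) (at t)"
      unfolding l_def by (auto intro!: derivative_eq_intros)
    from has_derivative_compose[OF this dj] 
    have "(\<phi> has_derivative (\<lambda>h. sys c (l t) (h *\<^sub>R (x - y0)) (jet u (l t)) - sys c (l t) (h *\<^sub>R (x - y0)) (jet w (l t)))) (at t)"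
      by (simp only: \<phi>_def[abs_def])
    moreover have "(\<lambda>h. A (h *\<^sub>R d) a - A (h *\<^sub>R d) b) = (\<lambda>h. h *\<^sub>R A d (a - b))"
      for A :: "(real ^ 'n) \<Rightarrow>\<^sub>L ((real \<times> (real ^ 'n)) \<Rightarrow>\<^sub>L (real \<times> (real ^ 'n)))" and d a b
      by (simp add: fun_eq_iff blinfun.scaleR_left blinfun.scaleR_right blinfun.diff_right scaleR_diff_right)
    ultimately show ?thesis unfolding has_vector_derivative_def by (simp only: \<phi>_def)
  qed
  have "continuous_on {0..1} (\<lambda>t. sys c (l t))"
    by (rule continuous_on_compose2[OF smooth_on_continuous[OF smooth_sys]]) (use l in \<open>auto simp: l_def intro!: continuous_intros\<close>)
  from compact_imp_bounded[OF compact_continuous_image[OF this compact_Icc]]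
  obtain M where M: "\<And>t. t \<in> {0..1} \<Longrightarrow> norm (sys c (l t)) \<le> M" unfolding bounded_iff by blast
  have "\<phi> 1 = 0"
  proof (rule linear_ode_zero[where L = "M * norm (x - y0)"])
    show "continuous_on {0..1} \<phi>"
      using d by (intro continuous_at_imp_continuous_on ballI) (auto intro: has_vector_derivative_continuous)
    fix t :: real assume t: "0 < t" "t < 1"
    show "(\<phi> has_vector_derivative sys c (l t) (x - y0) (\<phi> t)) (at t)" using d t by simp
    have "norm (sys c (l t) (x - y0) (\<phi> t)) \<le> norm (sys c (l t) (x - y0)) * norm (\<phi> t)" by (rule norm_blinfun)
    also have "\<dots> \<le> (norm (sys c (l t)) * norm (x - y0)) * norm (\<phi> t)" by (intro mult_right_mono norm_blinfun norm_ge_zero)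
    also have "\<dots> \<le> (M * norm (x - y0)) * norm (\<phi> t)" using M t by (intro mult_right_mono) auto
    finally show "norm (sys c (l t) (x - y0) (\<phi> t)) \<le> M * norm (x - y0) * norm (\<phi> t)" .
  next
    show "\<phi> 0 = 0" by (simp add: \<phi>_def l_def jet0)
  qed
  then show "jet u x = jet w x" by (simp add: \<phi>_def l_def)
qed

text \<open>A segment joining two interior points of a convex set stays in the interior; boundary
  points follow by continuity.\<close>

lemma solution_unique:
  assumes u: "solves c S u" and w: "solves c S w" and cvx: "convex S"
    and y0: "y0 \<in> S" "0 < hgt y0" and jet0: "jet u y0 = jet w y0" and x: "x \<in> S"
  shows "u x = w x"
proof (rule eq_on_hopen_by_interior[OF hopen_S _ _ _ x])
  have su: "smooth_on S u" "smooth_on S w" using u w by (simp_all add: solvesD)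
  then show "continuous_on S u" "continuous_on S w" by (simp_all add: smooth_on_continuous)
  fix x assume x: "x \<in> S" "0 < hgt x"
  have "jet u x = jet w x"
  proof (rule jet_unique_segment[OF u w _ _ jet0])
    fix t :: real assume t: "t \<in> {0..1}"
    have "y0 + t *\<^sub>R (x - y0) = (1 - t) *\<^sub>R y0 + t *\<^sub>R x" by (simp add: algebra_simps)
    then show "y0 + t *\<^sub>R (x - y0) \<in> S" using cvx y0(1) x(1) t by (simp add: convexD)
    have "0 < (1 - t) * hgt y0 + t * hgt x"
      using t x(2) y0(2) by (cases "t = 0") (auto intro!: add_nonneg_pos mult_nonneg_nonneg)
    then show "0 < hgt (y0 + t *\<^sub>R (x - y0))" by (simp add: algebra_simps)
  qed
  then show "u x = w x" by (simp add: jet_def)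
qed

lemma energy_constant:
  assumes u: "solves c S u" and w: "solves c S w" and cvx: "convex S" and y0: "y0 \<in> S" and x: "x \<in> S"
  shows "energy c u w x = energy c u w y0"
proof -
  have su: "smooth_on S u" "smooth_on S w" using u w by (simp_all add: solvesD)
  have "(energy c u w has_derivative (\<lambda>h. 0)) (at y within S)" if y: "y \<in> S" for y
    using smooth_has_derivative[OF hopen_S smooth_energy[OF su, of c] y]
    by (simp add: pd_energy[OF y u w] at_within_hopen[OF hopen_S y])
  from has_derivative_zero_constant[OF cvx this] show ?thesis using x y0 by metis
qed

text \<open>The linear map from tangent space plus normal line to the ambient space:
  \<open>P k\<close> is the image of the \<open>k\<close>-th coordinate vector and \<open>F0\<close>
  the position vector, which is normal to the sphere.\<close>

definition frameA :: "('n \<Rightarrow> (real ^ 'n) \<times> real) \<Rightarrow> (real ^ 'n) \<times> real \<Rightarrow> (real ^ 'n) \<times> real \<Rightarrow> (real ^ 'n) \<times> real"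
  where "frameA P F0 b = (\<Sum>k\<in>UNIV. fst b $ k *\<^sub>R P k) + snd b *\<^sub>R F0"

text \<open>The inverse that \<open>frameA\<close> would have if its vectors had the Gram matrix of
  a frame: tangential components are raised with the inverse metric, and the normal one is divided
  by \<open>1 / c\<close>.\<close>

definition frameK :: "real \<Rightarrow> real ^ 'n \<Rightarrow> ('n \<Rightarrow> (real ^ 'n) \<times> real) \<Rightarrow> (real ^ 'n) \<times> real \<Rightarrow> (real ^ 'n) \<times> real \<Rightarrow> (real ^ 'n) \<times> real"
  where "frameK c x P F0 z = (\<chi> k. \<Sum>j\<in>UNIV. gi k j x * (P j \<bullet> z), c * (F0 \<bullet> z))"

definition frame :: "real \<Rightarrow> real ^ 'n \<Rightarrow> ('n \<Rightarrow> (real ^ 'n) \<times> real) \<Rightarrow> (real ^ 'n) \<times> real \<Rightarrow> bool"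
  where "frame c x P F0 \<longleftrightarrow> (\<forall>i j. P i \<bullet> P j = g i j x) \<and> (\<forall>i. F0 \<bullet> P i = 0) \<and> F0 \<bullet> F0 = 1 / c"

lemma frameD:
  assumes "frame c x P F0"
  shows "P i \<bullet> P j = g i j x" "F0 \<bullet> P i = 0" "P i \<bullet> F0 = 0" "F0 \<bullet> F0 = 1 / c"
  using assms by (simp_all add: frame_def inner_commute[of "P i" F0])

lemma linear_frameA: "linear (frameA P F0)"
  by (rule linearI) (simp_all add: frameA_def scaleR_add_left sum.distrib scaleR_sum_right scaleR_add_right)

lemma linear_frameK: "linear (frameK c x P F0)"
  by (rule linearI) (simp_all add: frameK_def vec_eq_iff inner_add_right sum.distrib sum_distrib_left algebra_simps)

text \<open>A frame is orthonormal by rows iff it is orthonormal by columns: \<open>frameK\<close> is a left inverse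
  of \<open>frameA\<close> iff it is a right inverse.\<close>

lemma frame_iff:
  assumes x: "x \<in> S" and c: "c \<noteq> 0"
  shows "frame c x P F0 \<longleftrightarrow> (\<forall>z. frameA P F0 (frameK c x P F0 z) = z)"
proof -
  have "frame c x P F0 \<longleftrightarrow> (\<forall>b. frameK c x P F0 (frameA P F0 b) = b)"
  proof
    assume f: "frame c x P F0"
    show "\<forall>b. frameK c x P F0 (frameA P F0 b) = b"
    proof
      fix b
      have 1: "P j \<bullet> frameA P F0 b = (\<Sum>k\<in>UNIV. g j k x * fst b $ k)" for j
        by (simp add: frameA_def inner_add_right inner_sum_right frameD[OF f] mult.commute)
      have "F0 \<bullet> frameA P F0 b = snd b / c"
        by (simp add: frameA_def inner_add_right inner_sum_right frameD[OF f])
      then show "frameK c x P F0 (frameA P F0 b) = b"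
        using c by (simp add: frameK_def 1 lower_upper(2)[OF x] prod_eq_iff vec_eq_iff)
    qed
  next
    assume i: "\<forall>b. frameK c x P F0 (frameA P F0 b) = b"
    have Pi: "frameK c x P F0 (P i) = (axis i 1, 0)" for i
      using i[rule_format, of "(axis i 1, 0)"] by (simp add: frameA_def axis_def if_distrib[of "\<lambda>b. b *\<^sub>R _"] cong: if_cong)
    have F: "frameK c x P F0 F0 = (0, 1)"
      using i[rule_format, of "(0, 1)"] by (simp add: frameA_def)
    have "P j \<bullet> z = (\<Sum>k\<in>UNIV. g j k x * fst (frameK c x P F0 z) $ k)" for j z
      by (simp add: frameK_def lower_upper(1)[OF x])
    then have "P j \<bullet> P i = g j i x" for i j
      by (simp add: Pi axis_def if_distrib[of "\<lambda>b. _ * b"] cong: if_cong)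
    moreover have "F0 \<bullet> P i = 0" for i using arg_cong[OF Pi[of i], of snd] c by (simp add: frameK_def)
    moreover have "F0 \<bullet> F0 = 1 / c" using arg_cong[OF F, of snd] c by (simp add: frameK_def field_simps)
    ultimately show "frame c x P F0" by (simp add: frame_def)
  qed
  also have "\<dots> \<longleftrightarrow> (frameK c x P F0 \<circ> frameA P F0 = id)" by (simp add: fun_eq_iff)
  also have "\<dots> \<longleftrightarrow> (frameA P F0 \<circ> frameK c x P F0 = id)"
    by (rule linear_inverse_left[OF linear_frameK linear_frameA])
  finally show ?thesis by (simp add: fun_eq_iff)
qed

section \<open>Isometric immersions into the sphere\<close>

definition iso_map :: "real \<Rightarrow> (real ^ 'n) set \<Rightarrow> (real ^ 'n \<Rightarrow> (real ^ 'n) \<times> real) \<Rightarrow> bool"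
  where "iso_map c T F \<longleftrightarrow> smooth_on T F \<and>
    (\<forall>x\<in>T. (\<forall>i j. pd i F x \<bullet> pd j F x = g i j x) \<and> F x \<bullet> F x = 1 / c)"

lemma pd_inner_const:
  assumes "x \<in> S" "smooth_on S F" shows "pd i (\<lambda>y. F y \<bullet> z) x = pd i F x \<bullet> z"
  using pd_linear[OF hopen_S assms(1) bounded_linear_inner_left assms(2)] .

lemma iso_map_frame:
  assumes F: "iso_map c S F" and x: "x \<in> S" shows "frame c x (\<lambda>i. pd i F x) (F x)"
proof -
  have sF: "smooth_on S F" using F by (simp add: iso_map_def)
  have "pd i (\<lambda>y. F y \<bullet> F y) x = pd i (\<lambda>y. 1 / c) x" for i
    by (rule pd_cong[OF hopen_S x]) (use F in \<open>simp add: iso_map_def\<close>)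
  then have "F x \<bullet> pd i F x = 0" for i
    using pd_inner[OF hopen_S x sF sF, of i] pd_const[OF in_half[OF x], of i "1/c"] by (simp add: inner_commute)
  then show ?thesis using F x by (simp add: frame_def iso_map_def)
qed

lemma energy_frame:
  assumes x: "x \<in> S" and F: "smooth_on S F"
  shows "energy c (\<lambda>y. F y \<bullet> z) (\<lambda>y. F y \<bullet> w) x = frameA (\<lambda>i. pd i F x) (F x) (frameK c x (\<lambda>i. pd i F x) (F x) z) \<bullet> w"
  by (simp add: energy_def X_def frameA_def frameK_def pd_inner_const[OF x F] inner_add_left inner_sum_left mult.assoc)

text \<open>The Gauss formula of the round sphere: the covariant Hessian of the position vector is
  \<open>- c g F\<close>.\<close>

lemma iso_map_solves:
  assumes c: "c \<noteq> 0" and F: "iso_map c S F" shows "solves c S (\<lambda>x. F x \<bullet> z)"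
proof -
  have sF: "smooth_on S F" using F by (simp add: iso_map_def)
  have sp: "smooth_on S (pd j F)" for j by (rule smooth_on_pd[OF hopen_S sF])
  have "pd i (pd j F) x = (\<Sum>k\<in>UNIV. \<Gamma> k i j x *\<^sub>R pd k F x) - (c * g i j x) *\<^sub>R F x" if x: "x \<in> S" for i j x
  proof -
    note fr = iso_map_frame[OF F x]
    \<comment> \<open>The failure of the Gauss formula. Its tangential part is zero since the
      Christoffel symbols are determined by the metric, its normal part by differentiating the
      orthogonality of \<open>F\<close> and \<open>pd j F\<close>. A vector orthogonal to the whole
      frame vanishes.\<close>
    define Z where "Z = pd i (pd j F) x - (\<Sum>k\<in>UNIV. \<Gamma> k i j x *\<^sub>R pd k F x) + (c * g i j x) *\<^sub>R F x"
    have dg: "pd k (g a b) x = pd a F x \<bullet> pd k (pd b F) x + pd k (pd a F) x \<bullet> pd b F x" for a b k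
      using pd_cong[OF hopen_S x, of "g a b" "\<lambda>y. pd a F y \<bullet> pd b F y" k] pd_inner[OF hopen_S x sp sp, of k a b] F
      by (simp add: iso_map_def)
    have comm: "pd a (pd b F) x = pd b (pd a F) x" for a b
    proof (rule euclidean_eqI)
      fix z :: "(real ^ 'n) \<times> real"
      have "pd a (pd b F) x \<bullet> z = pd a (pd b (\<lambda>y. F y \<bullet> z)) x" for a b
        using pd_cong[OF hopen_S x, of "pd b (\<lambda>y. F y \<bullet> z)" "\<lambda>y. pd b F y \<bullet> z" a] pd_inner_const[OF _ sF]
          pd_inner_const[OF x sp] by simp
      then show "pd a (pd b F) x \<bullet> z = pd b (pd a F) x \<bullet> z"
        using pd_commute[OF hopen_S smooth_on_linear[OF bounded_linear_inner_left sF] x] by simp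
    qed
    have Zl: "Z \<bullet> pd l F x = 0" for l
    proof -
      have "pd i (pd j F) x \<bullet> pd l F x = C l i j x"
        unfolding C_def dg by (simp add: comm[of l] comm[of j i] inner_commute)
      moreover have "(\<Sum>k\<in>UNIV. \<Gamma> k i j x * (pd k F x \<bullet> pd l F x)) = C l i j x"
        by (simp add: frameD(1)[OF fr] lower_christoffel[OF x, symmetric] g_sym[OF x, of _ l] mult.commute)
      ultimately show ?thesis by (simp add: Z_def inner_add_left inner_diff_left inner_sum_left frameD(2)[OF fr])
    qed
    have ZF: "Z \<bullet> F x = 0"
    proof -
      have "pd i (\<lambda>y. F y \<bullet> pd j F y) x = pd i (\<lambda>y. 0) x"
        by (rule pd_cong[OF hopen_S x]) (use iso_map_frame[OF F] in \<open>simp add: frame_def\<close>)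
      then have "F x \<bullet> pd i (pd j F) x = - g i j x"
        using pd_inner[OF hopen_S x sF sp, of i j] fr pd_const[OF in_half[OF x], of i "0::real"] by (simp add: frame_def)
      then have "pd i (pd j F) x \<bullet> F x = - g i j x" by (simp add: inner_commute)
      then show ?thesis using c
        by (simp add: Z_def inner_add_left inner_diff_left inner_sum_left frameD[OF fr])
    qed
    have "frameK c x (\<lambda>i. pd i F x) (F x) Z = 0"
      using Zl ZF by (simp add: frameK_def inner_commute vec_eq_iff prod_eq_iff)
    then have "Z = 0"
      using fr[unfolded frame_iff[OF x c]] linear_0[OF linear_frameA, of "\<lambda>i. pd i F x" "F x"] by metis
    then show ?thesis by (simp add: Z_def algebra_simps)
  qed
  note main = this
  show ?thesis
    unfolding solves_def
  proof (intro conjI ballI allI)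
    show "smooth_on S (\<lambda>x. F x \<bullet> z)" by (rule smooth_on_linear[OF bounded_linear_inner_left sF])
    fix x i j assume x: "x \<in> S"
    have "pd i (pd j (\<lambda>y. F y \<bullet> z)) x = pd i (pd j F) x \<bullet> z"
      using pd_cong[OF hopen_S x, of "pd j (\<lambda>y. F y \<bullet> z)" "\<lambda>y. pd j F y \<bullet> z" i] pd_inner_const[OF _ sF]
        pd_inner_const[OF x sp] by simp
    then show "pd i (pd j (\<lambda>y. F y \<bullet> z)) x = (\<Sum>k\<in>UNIV. \<Gamma> k i j x * pd k (\<lambda>y. F y \<bullet> z) x) - c * (F x \<bullet> z) * g i j x"
      by (simp add: main[OF x] pd_inner_const[OF x sF] inner_diff_left inner_sum_left mult_ac)
  qed
qed

text \<open>By \<open>WW_solution\<close> every coordinate function has its differential annihilated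
  by \<open>WW\<close>, and these differentials determine a tangent vector because
  \<open>frameA\<close> is injective.\<close>

lemma iso_map_flat:
  assumes c: "c \<noteq> 0" and F: "iso_map c S F" and x: "x \<in> S" shows "WW c i j x = 0"
proof -
  have sF: "smooth_on S F" using F by (simp add: iso_map_def)
  have "(\<Sum>m\<in>UNIV. WW c i j x $ m $ k *\<^sub>R pd m F x) = 0" for k
  proof (rule euclidean_eqI)
    fix z :: "(real ^ 'n) \<times> real"
    have u: "solves c S (\<lambda>x. F x \<bullet> z)" by (rule iso_map_solves[OF c F])
    from WW_solution[OF x solvesD(1)[OF u] solvesD(2)[OF u], of i j k]
    show "(\<Sum>m\<in>UNIV. WW c i j x $ m $ k *\<^sub>R pd m F x) \<bullet> z = 0 \<bullet> z"
      by (simp add: inner_sum_left pd_inner_const[OF x sF])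
  qed
  then have 0: "frameA (\<lambda>i. pd i F x) (F x) (\<chi> m. WW c i j x $ m $ k, 0) = 0" for k
    by (simp add: frameA_def)
  have inv: "frameA (\<lambda>i. pd i F x) (F x) \<circ> frameK c x (\<lambda>i. pd i F x) (F x) = id"
    using iso_map_frame[OF F x] frame_iff[OF x c] by (auto simp: fun_eq_iff)
  then have "frameK c x (\<lambda>i. pd i F x) (F x) \<circ> frameA (\<lambda>i. pd i F x) (F x) = id"
    using linear_inverse_left[OF linear_frameA linear_frameK] by blast
  then have "frameK c x (\<lambda>i. pd i F x) (F x) 0 = (\<chi> m. WW c i j x $ m $ k, 0)" for k
    using 0[of k] by (metis comp_apply id_apply)
  then have "(\<chi> m. WW c i j x $ m $ k, 0::real) = 0" for k using linear_0[OF linear_frameK] by metis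
  then show ?thesis by (simp add: vec_eq_iff prod_eq_iff)
qed

end

section \<open>Local solutions in constant curvature\<close>

lemma Cinf_on_translate:
  fixes B :: "'a::euclidean_space \<Rightarrow> 'b::real_normed_vector"
  assumes "Cinf_on W B" "open V" "\<And>z. z \<in> V \<Longrightarrow> z + a \<in> W"
  shows "Cinf_on V (\<lambda>z. B (z + a))"
proof (rule Cinf_on_compose[OF assms(1) _ assms(3)])
  have "Cinf_on V (\<lambda>z. z)" unfolding Cinf_on_def using assms(2) Ck_on_bounded_linear[OF bounded_linear_ident] by auto
  then show "Cinf_on V (\<lambda>z. z + a)" by (rule Cinf_on_add[OF _ Cinf_on_const[OF assms(2)]])
qed

lemma frechet_derivative_translate:
  assumes "(B has_derivative D) (at (z + a))"
  shows "\<D> (\<lambda>z. B (z + a)) z = D"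
proof -
  have "((\<lambda>z. z + a) has_derivative (\<lambda>h. h)) (at z)" by (auto intro!: derivative_eq_intros)
  from has_derivative_compose[OF this assms] show ?thesis by (rule frechet_derivative_at[symmetric])
qed

context metric_chart
begin

text \<open>The curvature of the connection on 1-jets whose parallel sections are the solutions. Its
  gradient component is \<open>WW\<close> applied to the gradient part of \<open>s\<close>;
  everything else cancels since the connection is torsion free and metric.\<close>

lemma flat_sys_axis:
  assumes x: "x \<in> S" and flat: "\<And>i j. WW c i j x = 0"
  shows "pd p (sys c) x (axis q 1) s + sys c x (axis q 1) (sys c x (axis p 1) s) =
    pd q (sys c) x (axis p 1) s + sys c x (axis p 1) (sys c x (axis q 1) s)"
proof -
  define u where "u = fst s"
  define \<alpha> where "\<alpha> k = snd s $ k" for k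
  have ax: "sys c x (axis q 1) s = (snd s $ q, \<chi> j. (\<Sum>k\<in>UNIV. \<Gamma> k q j x * snd s $ k) - c * fst s * g q j x)" for q x s
    by (simp add: sys_apply prod_eq_iff vec_eq_iff axis_def inner_vec_def if_distrib[of "\<lambda>b. b * _"] cong: if_cong)
  have dax: "pd p (sys c) x (axis q 1) s = (0, \<chi> j. (\<Sum>k\<in>UNIV. pd p (\<Gamma> k q j) x * \<alpha> k) - c * u * pd p (g q j) x)" for p q
  proof -
    have L: "bounded_linear (\<lambda>A. blinfun_apply (blinfun_apply A (axis q 1)) s)"
      for s :: "real \<times> (real ^ 'n)"
      by (rule bounded_linear_compose[OF blinfun.bounded_linear_left blinfun.bounded_linear_left])
    have "pd p (sys c) x (axis q 1) s = pd p (\<lambda>x. sys c x (axis q 1) s) x"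
      by (rule pd_linear[OF hopen_S x L smooth_sys, symmetric])
    moreover have sm: "smooth_on S (\<lambda>x. sys c x (axis q 1) s)" by (rule smooth_on_linear[OF L smooth_sys])
    have "fst (pd p (\<lambda>x. sys c x (axis q 1) s) x) = pd p (\<lambda>x. snd s $ q) x"
      using pd_linear[OF hopen_S x bounded_linear_fst sm, of p] by (simp add: ax)
    moreover have "snd (pd p (\<lambda>x. sys c x (axis q 1) s) x) $ j = (\<Sum>k\<in>UNIV. pd p (\<Gamma> k q j) x * \<alpha> k) - c * u * pd p (g q j) x" for j
    proof -
      have "snd (pd p (\<lambda>x. sys c x (axis q 1) s) x) $ j = pd p (\<lambda>x. (\<Sum>k\<in>UNIV. \<alpha> k * \<Gamma> k q j x) - c * u * g q j x) x"
        using pd_linear[OF hopen_S x bounded_linear_snd sm, of p]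
          pd_vec_nth[OF hopen_S x smooth_on_linear[OF bounded_linear_snd sm], of p j] by (simp add: ax \<alpha>_def u_def mult.commute)
      then show ?thesis using hopen_S x
        by (simp add: pd_diff pd_sum pd_cmult smooth_on_sum smooth_on_cmult smooth_christoffel smooth_g mult.commute)
    qed
    ultimately show ?thesis using pd_const[OF in_half[OF x]] by (simp add: prod_eq_iff vec_eq_iff)
  qed
  have ss: "snd (sys c x (axis q 1) (sys c x (axis p 1) s)) $ j =
     (\<Sum>m\<in>UNIV. (\<Sum>k\<in>UNIV. \<Gamma> m p k x * \<Gamma> k q j x) * \<alpha> m) - c * u * C p q j x - c * \<alpha> p * g q j x" for p q j
  proof -
    have "snd (sys c x (axis q 1) (sys c x (axis p 1) s)) $ j =
      (\<Sum>k\<in>UNIV. \<Gamma> k q j x * (\<Sum>m\<in>UNIV. \<Gamma> m p k x * \<alpha> m)) - c * u * (\<Sum>k\<in>UNIV. g p k x * \<Gamma> k q j x) - c * \<alpha> p * g q j x"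
      by (simp add: ax u_def \<alpha>_def right_diff_distrib sum_subtractf sum_distrib_left mult_ac)
    also have "(\<Sum>k\<in>UNIV. \<Gamma> k q j x * (\<Sum>m\<in>UNIV. \<Gamma> m p k x * \<alpha> m)) = (\<Sum>m\<in>UNIV. (\<Sum>k\<in>UNIV. \<Gamma> m p k x * \<Gamma> k q j x) * \<alpha> m)"
      unfolding sum_distrib_left sum_distrib_right by (subst sum.swap) (simp add: mult_ac)
    finally show ?thesis by (simp add: lower_christoffel[OF x])
  qed
  have W0: "(\<Sum>m\<in>UNIV. WW c p q x $ m $ j * \<alpha> m) = 0" for j by (simp add: flat)
  have Wex: "(\<Sum>m\<in>UNIV. WW c p q x $ m $ j * \<alpha> m) =
     (\<Sum>m\<in>UNIV. pd p (\<Gamma> m q j) x * \<alpha> m) - (\<Sum>m\<in>UNIV. pd q (\<Gamma> m p j) x * \<alpha> m)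
     + (\<Sum>m\<in>UNIV. (\<Sum>k\<in>UNIV. \<Gamma> m p k x * \<Gamma> k q j x) * \<alpha> m) - (\<Sum>m\<in>UNIV. (\<Sum>k\<in>UNIV. \<Gamma> m q k x * \<Gamma> k p j x) * \<alpha> m)
     - c * (\<alpha> p * g q j x - \<alpha> q * g p j x)" for j
    by (simp add: WW_def RR_def TT_def riemann_def sum.distrib sum_subtractf left_diff_distrib right_diff_distrib distrib_right
       sum_distrib_left[symmetric] mult.assoc if_distrib[of "\<lambda>b. b * _"] if_distrib[of "\<lambda>b. _ * b"] cong: if_cong)
  have Cd: "pd p (g q j) x + C p q j x = pd q (g p j) x + C q p j x" for j
    by (simp add: C_def pd_g_sym[OF x, of _ j] field_simps pd_g_sym[OF x, of _ q p])
  have "snd (pd p (sys c) x (axis q 1) s + sys c x (axis q 1) (sys c x (axis p 1) s)) $ j =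
    snd (pd q (sys c) x (axis p 1) s + sys c x (axis p 1) (sys c x (axis q 1) s)) $ j" for j
    using W0[of j, unfolded Wex] arg_cong[OF Cd[of j], of "\<lambda>b. c * u * b"]
    by (simp add: dax ss distrib_left right_diff_distrib)
  moreover have "fst (pd p (sys c) x (axis q 1) s + sys c x (axis q 1) (sys c x (axis p 1) s)) =
    fst (pd q (sys c) x (axis p 1) s + sys c x (axis p 1) (sys c x (axis q 1) s))"
    by (simp add: dax ax christoffel_sym[OF x, of _ p q] g_sym[OF x, of p q])
  ultimately show ?thesis by (simp add: prod_eq_iff vec_eq_iff)
qed

text \<open>The radius is uniform in the base point and the initial jet. The centre
  \<open>x0\<close> may lie on the boundary, but the base point \<open>y0\<close> is interior, so
  that the solution is started where integrability holds on all sides.\<close>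

lemma local_solution:
  assumes x0: "x0 \<in> S" and flat: "\<And>y i j. y \<in> S \<Longrightarrow> WW c i j y = 0"
  shows "\<exists>R>0. half_ball x0 R \<subseteq> S \<and> (\<forall>y0\<in>ball x0 R. 0 < hgt y0 \<longrightarrow>
    (\<forall>s0. \<exists>u. Cinf_on (ball x0 R) u \<and> solves c (half_ball x0 R) u \<and> jet u y0 = s0))"
proof -
  obtain W B where W: "x0 \<in> W" "Cinf_on W B" "half_space \<inter> W \<subseteq> S" "\<And>y. y \<in> half_space \<inter> W \<Longrightarrow> B y = sys c y"
    using smooth_on_hopenE[OF hopen_S smooth_sys x0] by blast
  have oW: "open W" using W(2) Cinf_on_open by blast
  obtain \<rho> where \<rho>: "\<rho> > 0" "ball x0 \<rho> \<subseteq> W" using oW W(1) openE by blast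
  have "isCont B x0" using Cinf_on_continuous[OF W(2)] oW W(1) by (simp add: continuous_on_eq_continuous_at)
  then obtain d where d: "d > 0" "\<And>y. dist y x0 < d \<Longrightarrow> dist (B y) (B x0) < 1"
    unfolding continuous_at_eps_delta by (meson zero_less_one)
  define M where "M = norm (B x0) + 1"
  have M: "M > 0" unfolding M_def by (simp add: add_nonneg_pos)
  \<comment> \<open>For \<open>y0\<close> within \<open>R\<close> of \<open>x0\<close>, the ball of
    radius \<open>2 * R\<close> around \<open>y0\<close> covers \<open>ball x0 R\<close> and stays
    in \<open>ball x0 (3 * R)\<close>, where \<open>B\<close> is bounded by \<open>M\<close>. The
    last bound gives \<open>M * (2 * R) \<le> 1/2\<close>, as the Volterra kernel requires.\<close>
  define R where "R = min (min \<rho> d / 3) (1 / (4 * M))"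
  have R: "R > 0" "3 * R \<le> \<rho>" "3 * R \<le> d" "R \<le> 1 / (4 * M)" using \<rho>(1) d(1) M by (auto simp: R_def)
  have nB: "norm (B y) * (2 * R) \<le> 1/2" if "y \<in> ball x0 (3 * R)" for y
  proof -
    have "norm (B y) \<le> M"
    proof -
      have "dist (B y) (B x0) < 1" using d(2)[of y] that R(3) by (simp add: dist_commute)
      then show ?thesis unfolding M_def dist_norm using norm_triangle_ineq2[of "B y" "B x0"] by linarith
    qed
    then have "norm (B y) * (2 * R) \<le> M * (2 * (1 / (4 * M)))"
      using R M by (intro mult_mono) auto
    then show ?thesis using M by simp
  qed
  have b3: "ball x0 (3 * R) \<subseteq> W" using \<rho>(2) R(2) by auto
  have sub: "half_ball x0 R \<subseteq> S" using b3 W(3) subset_ball[of R "3 * R" x0] R(1) by auto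
  have ex: "\<exists>u. Cinf_on (ball x0 R) u \<and> solves c (half_ball x0 R) u \<and> jet u y0 = s0"
    if y0: "y0 \<in> ball x0 R" "0 < hgt y0" for y0 s0
  proof -
    define B' where "B' z = B (z + y0)" for z
    have in3: "z + y0 \<in> ball x0 (3 * R)" if "z \<in> ball 0 (2 * R)" for z
    proof -
      have "dist x0 (z + y0) \<le> dist x0 y0 + norm z"
        using dist_triangle[of x0 "z + y0" y0] by (simp add: dist_norm)
      then show ?thesis using that y0(1) by simp
    qed
    have B': "Cinf_on (ball 0 (2 * R)) B'" unfolding B'_def
      by (rule Cinf_on_translate[OF W(2) open_ball]) (use in3 b3 in blast)
    have nB': "norm (B' z) * (2 * R) \<le> 1/2" if "z \<in> ball 0 (2 * R)" for z
      unfolding B'_def by (rule nB[OF in3[OF that]])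
    obtain s where s: "Cinf_on (ball 0 (2 * R)) s" "s 0 = s0"
      "\<And>z. z \<in> ball 0 (2 * R) \<Longrightarrow> \<D> s z z = B' z z (s z)"
    proof -
      have "2 * R > 0" using R(1) by simp
      from radial_system[OF B' order_refl this nB', of s0] that show ?thesis by blast
    qed
    \<comment> \<open>The translated interior of the half-space: here \<open>B\<close> coincides
      with \<open>sys c\<close> and is integrable, and convexity makes this part star-shaped about
      the base point.\<close>
    define D where "D = {z \<in> ball 0 (2 * R). 0 < hgt (z + y0)}"
    have inS: "z + y0 \<in> S" "B (z + y0) = sys c (z + y0)" if "z \<in> D" for z
      using that in3[of z] b3 W(3,4) by (auto simp: D_def half_space_def subset_iff)
    have ds: "\<D> s z w = B' z w (s z)" if z: "z \<in> D" for z w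
    proof (rule flat_radial_solution[OF B' order_refl nB' s(1,3) _ _ _ z])
      show "D \<subseteq> ball 0 (2 * R)" by (auto simp: D_def)
      fix z t assume z: "z \<in> D" and t: "t \<in> {0..1::real}"
      have "0 < t * hgt (z + y0) + (1 - t) * hgt y0"
        using z t y0(2) by (cases "t = 1") (auto simp: D_def intro!: add_nonneg_pos)
      then show "t *\<^sub>R z \<in> D" using z t radial_ball[of z "2 * R" t] by (simp add: D_def algebra_simps)
    next
      fix z v w \<sigma> assume z: "z \<in> D"
      let ?y = "z + y0"
      have yb: "0 < hgt ?y" using z by (simp add: D_def)
      have yW: "?y \<in> W" using z in3[of z] b3 by (auto simp: D_def)
      have "(sys c has_derivative \<D> B ?y) (at ?y within half_space)"
        using has_derivative_smooth_ext[OF in_half[OF inS(1)[OF z]] yW W(2,4)] .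
      note pdB = pd_eqI[OF in_half[OF inS(1)[OF z]] this]
      have DB: "\<D> B' z = \<D> B ?y"
        unfolding B'_def[abs_def] by (rule frechet_derivative_translate[OF Cinf_on_has_derivative[OF W(2) yW]])
      have lin: "linear (\<D> B ?y)" using Cinf_on_has_derivative[OF W(2) yW] has_derivative_linear by blast
      define A where "A v w = \<D> B ?y v w \<sigma> + B ?y w (B ?y v \<sigma>)" for v w
      have Aax: "A (axis p 1) (axis q 1) = A (axis q 1) (axis p 1)" for p q
        using flat_sys_axis[OF inS(1)[OF z] flat[OF inS(1)[OF z]], of p q \<sigma>]
        unfolding A_def pdB[symmetric] inS(2)[OF z] .
      have A1: "linear (\<lambda>v. A v w)" for w
        by (rule linearI) (simp_all add: A_def linear_add[OF lin] linear_scale[OF lin] blinfun.add_left blinfun.add_right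
            blinfun.scaleR_left blinfun.scaleR_right scaleR_add_right)
      have A2: "linear (\<lambda>w. A v w)" for v
        by (rule linearI) (simp_all add: A_def blinfun.add_left blinfun.add_right
            blinfun.scaleR_left blinfun.scaleR_right scaleR_add_right)
      have "bilinear A" "bilinear (\<lambda>v w. A w v)" using A1 A2 by (simp_all add: bilinear_def)
      then have "A = (\<lambda>v w. A w v)" by (rule bilinear_eq_stdbasis) (auto simp: Basis_vec_def intro: Aax)
      then have "A v w = A w v" by (rule fun_cong[THEN fun_cong])
      then show "\<D> B' z v w \<sigma> + B' z w (B' z v \<sigma>) = \<D> B' z w v \<sigma> + B' z v (B' z w \<sigma>)"
        unfolding DB by (simp add: A_def B'_def)
    qed
    define \<sigma> where "\<sigma> y = s (y + - y0)" for y
    let ?T = "half_ball x0 R"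
    have in2: "y + - y0 \<in> ball 0 (2 * R)" if "y \<in> ball x0 R" for y
      using that y0(1) dist_triangle[of y y0 x0] by (simp add: dist_norm norm_minus_commute)
    have C\<sigma>: "Cinf_on (ball x0 R) \<sigma>" unfolding \<sigma>_def by (rule Cinf_on_translate[OF s(1) open_ball in2])
    have hT: "hopen ?T" by (simp add: openin_open_Int)
    have sm\<sigma>: "smooth_on ?T \<sigma>" by (rule Cinf_on_imp_smooth_on[OF C\<sigma>]) auto
    have smsys: "smooth_on ?T (sys c)" by (rule smooth_on_subset[OF smooth_sys sub])
    \<comment> \<open>The extension \<open>B\<close> yields the equation at interior points only;
      both sides are continuous up to the boundary.\<close>
    have pd\<sigma>: "pd i \<sigma> y = sys c y (axis i 1) (\<sigma> y)" if y: "y \<in> ?T" for y i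
    proof (rule eq_on_hopen_by_interior[OF hT _ _ _ y])
      show "continuous_on ?T (pd i \<sigma>)" by (rule smooth_on_continuous[OF smooth_on_pd[OF hT sm\<sigma>]])
      have "smooth_on ?T (\<lambda>y. sys c y (axis i 1))"
        by (rule smooth_on_bilinear[OF bounded_bilinear_blinfun_apply smsys smooth_on_const])
      from smooth_on_bilinear[OF bounded_bilinear_blinfun_apply this sm\<sigma>]
      show "continuous_on ?T (\<lambda>y. sys c y (axis i 1) (\<sigma> y))" by (rule smooth_on_continuous)
      fix y assume y: "y \<in> ?T" "0 < hgt y"
      have z: "y + - y0 \<in> D" using in2[of y] y by (simp add: D_def)
      have "\<D> \<sigma> y = \<D> s (y + - y0)"
        unfolding \<sigma>_def by (rule frechet_derivative_translate[OF Cinf_on_has_derivative[OF s(1)]]) (use in2 y in blast)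
      then have "\<D> \<sigma> y (axis i 1) = sys c y (axis i 1) (\<sigma> y)"
        using ds[OF z] inS(2)[OF z] by (simp add: B'_def \<sigma>_def)
      moreover have "pd i \<sigma> y = \<D> \<sigma> y (axis i 1)"
        by (rule pd_smooth_ext[OF _ _ C\<sigma>]) (use y in auto)
      ultimately show "pd i \<sigma> y = sys c y (axis i 1) (\<sigma> y)" by simp
    qed
    define u where "u y = fst (\<sigma> y)" for y
    have Cu: "Cinf_on (ball x0 R) u" unfolding u_def by (rule Cinf_on_linear[OF bounded_linear_fst C\<sigma>])
    have smu: "smooth_on ?T u" by (rule Cinf_on_imp_smooth_on[OF Cu]) auto
    have ax: "sys c x (axis q 1) s = (snd s $ q, \<chi> j. (\<Sum>k\<in>UNIV. \<Gamma> k q j x * snd s $ k) - c * fst s * g q j x)" for q x s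
      by (simp add: sys_apply prod_eq_iff vec_eq_iff axis_def inner_vec_def if_distrib[of "\<lambda>b. b * _"] cong: if_cong)
    have pdu: "pd j u y = snd (\<sigma> y) $ j" if y: "y \<in> ?T" for y j
      using pd_linear[OF hT y bounded_linear_fst sm\<sigma>, of j] pd\<sigma>[OF y, of j] by (simp add: u_def[abs_def] ax)
    have pd2u: "pd i (pd j u) y = (\<Sum>k\<in>UNIV. \<Gamma> k i j y * pd k u y) - c * u y * g i j y" if y: "y \<in> ?T" for y i j
    proof -
      have "pd i (pd j u) y = pd i (\<lambda>y. snd (\<sigma> y) $ j) y" by (rule pd_cong[OF hT y pdu])
      also have "\<dots> = snd (pd i \<sigma> y) $ j"
        using pd_linear[OF hT y bounded_linear_snd sm\<sigma>, of i]
          pd_vec_nth[OF hT y smooth_on_linear[OF bounded_linear_snd sm\<sigma>], of i j] by simp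
      finally show ?thesis by (simp add: pd\<sigma>[OF y] ax pdu[OF y] u_def)
    qed
    have y0T: "y0 \<in> ?T" using y0 by (simp add: half_space_def)
    have "jet u y0 = s0"
      using s(2) pdu[OF y0T] by (simp add: jet_def prod_eq_iff vec_eq_iff u_def \<sigma>_def)
    then show ?thesis using Cu smu pd2u unfolding solves_def by blast
  qed
  show ?thesis using R(1) sub ex by blast
qed

lemma convex_half_ball: "convex (half_ball (x0 :: real ^ 'n) R)"
proof (intro convex_Int convex_ball)
  show "convex (half_space :: (real ^ 'n) set)"
    by (auto simp: half_space_def convex_def intro!: add_nonneg_nonneg mult_nonneg_nonneg)
qed

text \<open>Each ambient coordinate of the map is the solution with the corresponding initial jet.
  The frame condition, written as \<open>frameA\<close> after \<open>frameK\<close> being the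
  identity, consists of mixed energies of these solutions and therefore stays true away from
  \<open>y0\<close>.\<close>

lemma local_iso_extension:
  assumes c: "c \<noteq> 0" and x0: "x0 \<in> S" and flat: "\<And>y i j. y \<in> S \<Longrightarrow> WW c i j y = 0"
  shows "\<exists>R>0. half_ball x0 R \<subseteq> S \<and> (\<forall>y0\<in>ball x0 R. 0 < hgt y0 \<longrightarrow>
    (\<forall>P F0. frame c y0 P F0 \<longrightarrow> (\<exists>F. Cinf_on (ball x0 R) F \<and> iso_map c (half_ball x0 R) F \<and>
       F y0 = F0 \<and> (\<forall>i. pd i F y0 = P i))))"
proof -
  obtain R where R: "R > 0" "half_ball x0 R \<subseteq> S"
    and ex: "\<And>y0 s0. y0 \<in> ball x0 R \<Longrightarrow> 0 < hgt y0 \<Longrightarrow>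
      \<exists>u. Cinf_on (ball x0 R) u \<and> solves c (half_ball x0 R) u \<and> jet u y0 = s0"
    using local_solution[OF x0 flat] by blast
  let ?T = "half_ball x0 R"
  have hT: "hopen ?T" by (simp add: openin_open_Int)
  interpret T: metric_chart ?T G by (rule metric_chart_subset[OF hT R(2)])
  have "\<exists>F. Cinf_on (ball x0 R) F \<and> iso_map c ?T F \<and> F y0 = F0 \<and> (\<forall>i. pd i F y0 = P i)"
    if y0: "y0 \<in> ball x0 R" "0 < hgt y0" and fr: "frame c y0 P F0" for y0 P F0
  proof -
    have y0T: "y0 \<in> ?T" using y0 by (simp add: half_space_def)
    have "\<exists>u. Cinf_on (ball x0 R) u \<and> solves c ?T u \<and> jet u y0 = (F0 \<bullet> z, \<chi> i. P i \<bullet> z)" for z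
      by (rule ex[OF y0])
    then obtain u where u: "\<And>z. Cinf_on (ball x0 R) (u z)" "\<And>z. solves c ?T (u z)"
      "\<And>z. jet (u z) y0 = (F0 \<bullet> z, \<chi> i. P i \<bullet> z)" by metis
    define F where "F y = (\<Sum>z\<in>Basis. u z y *\<^sub>R z)" for y
    have CF: "Cinf_on (ball x0 R) F"
      unfolding F_def Cinf_on_def
      using u(1) by (auto simp: Cinf_on_def intro!: Ck_on_sum Ck_on_bilinear[OF bounded_bilinear_scaleR] Ck_on_const)
    have smF: "smooth_on ?T F" by (rule Cinf_on_imp_smooth_on[OF CF]) auto
    have Fw: "F y \<bullet> w = (\<Sum>z\<in>Basis. (w \<bullet> z) * u z y)" for y w
      by (simp add: F_def inner_sum_left inner_commute[of w] mult.commute)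
    have sol: "solves c ?T (\<lambda>y. F y \<bullet> w)" for w
      unfolding Fw by (rule solves_lincomb[OF hT u(2)]) simp
    have F0: "F y0 = F0"
      using u(3) by (simp add: F_def jet_def euclidean_representation)
    have P: "pd i F y0 = P i" for i
    proof (rule euclidean_eqI)
      fix z :: "(real ^ 'n) \<times> real" assume z: "z \<in> Basis"
      have "F y \<bullet> z = u z y" for y using z by (simp add: F_def)
      then have "pd i F y0 \<bullet> z = pd i (u z) y0" using T.pd_inner_const[OF y0T smF, where i = i and z = z] by simp
      then show "pd i F y0 \<bullet> z = P i \<bullet> z" using u(3)[of z] by (simp add: jet_def vec_eq_iff)
    qed
    have "frame c y (\<lambda>i. pd i F y) (F y)" if y: "y \<in> ?T" for y
      unfolding T.frame_iff[OF y c]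
    proof (intro allI, rule euclidean_eqI)
      fix z w :: "(real ^ 'n) \<times> real"
      have "frameA (\<lambda>i. pd i F y) (F y) (frameK c y (\<lambda>i. pd i F y) (F y) z) \<bullet> w =
        frameA (\<lambda>i. pd i F y0) (F y0) (frameK c y0 (\<lambda>i. pd i F y0) (F y0) z) \<bullet> w"
        using T.energy_constant[OF sol sol convex_half_ball y0T y, of z w]
        by (simp add: T.energy_frame[OF y smF] T.energy_frame[OF y0T smF])
      also have "frameA (\<lambda>i. pd i F y0) (F y0) (frameK c y0 (\<lambda>i. pd i F y0) (F y0) z) = z"
        unfolding F0 P using fr T.frame_iff[OF y0T c, of P F0] by blast
      finally show "frameA (\<lambda>i. pd i F y) (F y) (frameK c y (\<lambda>i. pd i F y) (F y) z) \<bullet> w = z \<bullet> w" .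
    qed
    then have "iso_map c ?T F" using smF by (simp add: iso_map_def frame_def)
    then show ?thesis using CF F0 P by blast
  qed
  then show ?thesis using R by blast
qed

end

section \<open>Propagation of constant curvature along the gradient\<close>

text \<open>At a positive maximum one could move a little along \<open>v\<close>, remain in
  \<open>D\<close> and increase \<open>m\<close>. Inward pointing is demanded only where
  \<open>m\<close> is positive, which leaves the rest of the edge of \<open>D\<close> free.\<close>

lemma no_positive_maximum:
  fixes m :: "'e::euclidean_space \<Rightarrow> real"
  assumes D: "compact D" and m: "\<And>y. y \<in> D \<Longrightarrow> (m has_derivative m' y) (at y)"
    and pos: "\<And>y. y \<in> D \<Longrightarrow> 0 < m y \<Longrightarrow> 0 < m' y (v y)"
    and move: "\<And>y. y \<in> D \<Longrightarrow> 0 < m y \<Longrightarrow> \<exists>e>0. \<forall>t. 0 < t \<and> t < e \<longrightarrow> y + t *\<^sub>R v y \<in> D"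
    and y: "y \<in> D"
  shows "m y \<le> 0"
proof (rule ccontr)
  assume "\<not> m y \<le> 0"
  have "continuous_on D m" using m by (intro continuous_at_imp_continuous_on ballI) (blast intro: has_derivative_continuous)
  then obtain z where z: "z \<in> D" "\<And>w. w \<in> D \<Longrightarrow> m w \<le> m z"
    using continuous_attains_sup[OF D] y by blast
  have mz: "0 < m z" using z(2)[OF y] \<open>\<not> m y \<le> 0\<close> by simp
  have "((\<lambda>s. m (z + s *\<^sub>R v z)) has_real_derivative m' z (v z)) (at 0)"
    by (rule has_real_derivative_along_line) (simp add: m[OF z(1)])
  from DERIV_pos_inc_right[OF this pos[OF z(1) mz]]
  obtain d where d: "d > 0" "\<And>h. 0 < h \<Longrightarrow> h < d \<Longrightarrow> m z < m (z + h *\<^sub>R v z)" by auto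
  obtain e where e: "e > 0" "\<And>t. 0 < t \<Longrightarrow> t < e \<Longrightarrow> z + t *\<^sub>R v z \<in> D" using move[OF z(1) mz] by blast
  have "z + (min d e / 2) *\<^sub>R v z \<in> D" "m z < m (z + (min d e / 2) *\<^sub>R v z)"
    using d e by (auto intro!: d(2) e(2))
  then show False using z(2) by fastforce
qed

context metric_chart
begin

definition Nw :: "real \<Rightarrow> real ^ 'n \<Rightarrow> real" where "Nw c x = (\<Sum>i\<in>UNIV. \<Sum>j\<in>UNIV. WW c i j x \<bullet> WW c i j x)"

lemma Nw_nonneg: "0 \<le> Nw c x" unfolding Nw_def by (intro sum_nonneg) simp

lemma norm_WW_le: "norm (WW c i j x) \<le> sqrt (Nw c x)"
proof (rule real_le_rsqrt)
  have "(norm (WW c i j x))\<^sup>2 = WW c i j x \<bullet> WW c i j x" by (simp add: dot_square_norm)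
  also have "\<dots> \<le> (\<Sum>j\<in>UNIV. WW c i j x \<bullet> WW c i j x)" by (rule member_le_sum) auto
  also have "\<dots> \<le> Nw c x" unfolding Nw_def
    by (rule member_le_sum[of i UNIV "\<lambda>i. \<Sum>j\<in>UNIV. WW c i j x \<bullet> WW c i j x"]) (auto intro!: sum_nonneg)
  finally show "(norm (WW c i j x))\<^sup>2 \<le> Nw c x" .
qed

lemma Nw_zero_iff: "Nw c x = 0 \<longleftrightarrow> (\<forall>i j. WW c i j x = 0)"
proof
  assume "Nw c x = 0" then show "\<forall>i j. WW c i j x = 0" using norm_WW_le[of c _ _ x] by simp
qed (simp add: Nw_def)

lemma smooth_Nw: "smooth_on S (Nw c)"
  unfolding Nw_def[abs_def] by (intro smooth_on_sum smooth_on_inner smooth_WW)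

text \<open>The second Bianchi identity together with \<open>W(\<cdot>, \<cdot>) \<nabla>u = 0\<close> gives
  \<open>\<nabla>\<^sub>X W = 2 c u W\<close> for \<open>X = \<nabla>u\<close>; the error term \<open>K\<close> comes from using coordinate norms.\<close>

lemma Nw_derivative_estimate:
  assumes u: "solves c S u"
  shows "\<exists>K. continuous_on S K \<and> (\<forall>x\<in>S. (\<forall>p. X u p x = 0) \<longrightarrow> K x = 0) \<and>
    (\<forall>x\<in>S. \<bar>(\<Sum>p\<in>UNIV. X u p x * pd p (Nw c) x) - 4 * c * u x * Nw c x\<bar> \<le> K x * Nw c x)"
proof -
  obtain b where b0: "b > 0 \<and> (\<forall>(A :: real ^ 'n ^ 'n) (B :: real ^ 'n ^ 'n). norm (A ** B) \<le> norm A * norm B * b)"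
    using bounded_bilinear.pos_bounded[OF bounded_bilinear_matrix_mult] by meson
  then have b: "b > 0" "norm (A ** B) \<le> norm A * norm B * b" for A B :: "real ^ 'n ^ 'n" by simp_all
  define \<kappa> where "\<kappa> x = (\<Sum>m\<in>UNIV. \<bar>X u m x\<bar>)" for x
  define g1 where "g1 x = (\<Sum>i\<in>UNIV. \<Sum>p\<in>UNIV. \<Sum>m\<in>UNIV. \<bar>\<Gamma> p i m x\<bar>)" for x
  define g2 where "g2 x = (\<Sum>p\<in>UNIV. norm (NN p x))" for x
  define L where "L x = \<kappa> x * (2 * g1 x + 2 * b * g2 x)" for x
  define K where "K x = 2 * (real CARD('n) * real CARD('n)) * L x" for x
  have su: "smooth_on S u" using u by (rule solvesD)
  have cont: "continuous_on S K"
    unfolding K_def L_def \<kappa>_def g1_def g2_def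
    by (intro continuous_intros smooth_on_continuous smooth_X smooth_christoffel smooth_NN su)
  \<comment> \<open>The error coefficient contains the size of the gradient as a factor. Its
    vanishing at critical points lets the growth term prevail near a maximum.\<close>
  have zero: "K x = 0" if "\<forall>p. X u p x = 0" for x using that by (simp add: K_def L_def \<kappa>_def)
  have est: "\<bar>(\<Sum>p\<in>UNIV. X u p x * pd p (Nw c) x) - 4 * c * u x * Nw c x\<bar> \<le> K x * Nw c x" if x: "x \<in> S" for x
  proof -
    define E where "E i j = (\<Sum>p\<in>UNIV. (\<Sum>m\<in>UNIV. \<Gamma> p i m x * X u m x) *\<^sub>R WW c j p x)
       + (\<Sum>p\<in>UNIV. (\<Sum>m\<in>UNIV. \<Gamma> p j m x * X u m x) *\<^sub>R WW c p i x)
       + (\<Sum>p\<in>UNIV. X u p x *\<^sub>R (NN p x ** WW c i j x - WW c i j x ** NN p x))" for i j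
    \<comment> \<open>Each of the two terms with a derivative of the gradient contributes
      \<open>c u\<close> times \<open>WW c i j\<close>, which gives the factor 2; the Christoffel
      corrections form \<open>E\<close>.\<close>
    have XW: "(\<Sum>p\<in>UNIV. X u p x *\<^sub>R pd p (WW c i j) x) = (2 * c * u x) *\<^sub>R WW c i j x - E i j" for i j
    proof -
      have d: "(\<Sum>p\<in>UNIV. pd i (X u p) x *\<^sub>R A p) = (- c * u x) *\<^sub>R A i - (\<Sum>p\<in>UNIV. (\<Sum>m\<in>UNIV. \<Gamma> p i m x * X u m x) *\<^sub>R A p)"
        for i and A :: "'n \<Rightarrow> real ^ 'n ^ 'n"
        unfolding pd_X[OF x u] by (simp add: scaleR_diff_left sum_subtractf if_distrib[of "\<lambda>b. _ * b"] if_distrib[of "\<lambda>b. b *\<^sub>R _"] sum_negf cong: if_cong)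
      show ?thesis
        using X_pd_WW[OF x su solvesD(2)[OF u], of i j] WW_antisym[of c j i x]
        unfolding d E_def by (simp add: algebra_simps mult_2 flip: scaleR_add_left)
    qed
    have NN: "(\<Sum>p\<in>UNIV. X u p x * pd p (Nw c) x) = (\<Sum>i\<in>UNIV. \<Sum>j\<in>UNIV. 2 * (WW c i j x \<bullet> (\<Sum>p\<in>UNIV. X u p x *\<^sub>R pd p (WW c i j) x)))"
    proof -
      have "pd p (Nw c) x = (\<Sum>i\<in>UNIV. \<Sum>j\<in>UNIV. 2 * (WW c i j x \<bullet> pd p (WW c i j) x))" for p
        unfolding Nw_def[abs_def] using hopen_S x
        by (simp add: pd_sum pd_inner smooth_on_sum smooth_on_inner smooth_WW inner_commute)
      then have "(\<Sum>p\<in>UNIV. X u p x * pd p (Nw c) x) = (\<Sum>p\<in>UNIV. \<Sum>i\<in>UNIV. \<Sum>j\<in>UNIV. X u p x * (2 * (WW c i j x \<bullet> pd p (WW c i j) x)))"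
        by (simp add: sum_distrib_left)
      also have "\<dots> = (\<Sum>i\<in>UNIV. \<Sum>j\<in>UNIV. \<Sum>p\<in>UNIV. X u p x * (2 * (WW c i j x \<bullet> pd p (WW c i j) x)))"
        by (subst sum.swap) (intro sum.cong refl sum.swap)
      finally show ?thesis by (simp add: inner_sum_right sum_distrib_left mult_ac)
    qed
    have diff: "(\<Sum>p\<in>UNIV. X u p x * pd p (Nw c) x) - 4 * c * u x * Nw c x = - (\<Sum>i\<in>UNIV. \<Sum>j\<in>UNIV. 2 * (WW c i j x \<bullet> E i j))"
      unfolding NN XW Nw_def by (simp add: inner_diff_right right_diff_distrib sum_subtractf sum_distrib_left mult_ac)
    let ?s = "sqrt (Nw c x)"
    have s0: "0 \<le> ?s" by (simp add: Nw_nonneg)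
    have Xk: "\<bar>X u m x\<bar> \<le> \<kappa> x" for m unfolding \<kappa>_def by (rule member_le_sum) auto
    have k0: "0 \<le> \<kappa> x" unfolding \<kappa>_def by (intro sum_nonneg) simp
    have G1: "(\<Sum>p\<in>UNIV. \<Sum>m\<in>UNIV. \<bar>\<Gamma> p i m x\<bar>) \<le> g1 x" for i
      unfolding g1_def by (rule member_le_sum[of i UNIV "\<lambda>i. \<Sum>p\<in>UNIV. \<Sum>m\<in>UNIV. \<bar>\<Gamma> p i m x\<bar>"]) (auto intro!: sum_nonneg)
    have t1: "norm (\<Sum>p\<in>UNIV. (\<Sum>m\<in>UNIV. \<Gamma> p i m x * X u m x) *\<^sub>R A p) \<le> g1 x * \<kappa> x * ?s"
      if A: "\<And>p. norm (A p) \<le> ?s" for i and A :: "'n \<Rightarrow> real ^ 'n ^ 'n"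
    proof -
      have "norm (\<Sum>p\<in>UNIV. (\<Sum>m\<in>UNIV. \<Gamma> p i m x * X u m x) *\<^sub>R A p) \<le> (\<Sum>p\<in>UNIV. (\<Sum>m\<in>UNIV. \<bar>\<Gamma> p i m x\<bar> * \<kappa> x) * ?s)"
      proof (rule sum_norm_le)
        fix p
        have "\<bar>\<Sum>m\<in>UNIV. \<Gamma> p i m x * X u m x\<bar> \<le> (\<Sum>m\<in>UNIV. \<bar>\<Gamma> p i m x * X u m x\<bar>)" by (rule sum_abs)
        also have "\<dots> \<le> (\<Sum>m\<in>UNIV. \<bar>\<Gamma> p i m x\<bar> * \<kappa> x)"
          by (intro sum_mono) (simp add: abs_mult mult_left_mono Xk)
        finally show "norm ((\<Sum>m\<in>UNIV. \<Gamma> p i m x * X u m x) *\<^sub>R A p) \<le> (\<Sum>m\<in>UNIV. \<bar>\<Gamma> p i m x\<bar> * \<kappa> x) * ?s"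
          using A[of p] by (simp add: mult_mono')
      qed
      also have "\<dots> = (\<Sum>p\<in>UNIV. \<Sum>m\<in>UNIV. \<bar>\<Gamma> p i m x\<bar>) * (\<kappa> x * ?s)" by (simp only: sum_distrib_right mult.assoc)
      also have "\<dots> \<le> g1 x * (\<kappa> x * ?s)" by (intro mult_right_mono G1 mult_nonneg_nonneg k0 s0)
      finally show ?thesis by (simp add: mult_ac)
    qed
    have t2: "norm (\<Sum>p\<in>UNIV. X u p x *\<^sub>R (NN p x ** WW c i j x - WW c i j x ** NN p x)) \<le> 2 * b * g2 x * \<kappa> x * ?s" for i j
    proof -
      have "norm (\<Sum>p\<in>UNIV. X u p x *\<^sub>R (NN p x ** WW c i j x - WW c i j x ** NN p x)) \<le> (\<Sum>p\<in>UNIV. \<kappa> x * (2 * b * norm (NN p x) * ?s))"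
      proof (rule sum_norm_le)
        fix p
        have "norm (NN p x ** WW c i j x - WW c i j x ** NN p x) \<le> norm (NN p x ** WW c i j x) + norm (WW c i j x ** NN p x)"
          by (rule norm_triangle_ineq4)
        also have "\<dots> \<le> norm (NN p x) * norm (WW c i j x) * b + norm (WW c i j x) * norm (NN p x) * b" by (intro add_mono b(2))
        also have "\<dots> = (2 * b * norm (NN p x)) * norm (WW c i j x)" by simp
        also have "\<dots> \<le> (2 * b * norm (NN p x)) * ?s" using b(1) by (intro mult_left_mono norm_WW_le) auto
        finally show "norm (X u p x *\<^sub>R (NN p x ** WW c i j x - WW c i j x ** NN p x)) \<le> \<kappa> x * (2 * b * norm (NN p x) * ?s)"
          using Xk[of p] by (simp add: mult_mono')
      qed
      also have "\<dots> = 2 * b * g2 x * \<kappa> x * ?s" by (simp add: g2_def sum_distrib_left sum_distrib_right mult_ac)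
      finally show ?thesis .
    qed
    have E: "norm (E i j) \<le> L x * ?s" for i j
    proof -
      have "norm (E i j) \<le> g1 x * \<kappa> x * ?s + g1 x * \<kappa> x * ?s + 2 * b * g2 x * \<kappa> x * ?s"
        unfolding E_def by (intro norm_triangle_mono t1 t2 norm_WW_le)
      then show ?thesis by (simp add: L_def algebra_simps)
    qed
    have "\<bar>\<Sum>i\<in>UNIV. \<Sum>j\<in>UNIV. 2 * (WW c i j x \<bullet> E i j)\<bar> \<le> (\<Sum>i\<in>(UNIV::'n set). \<Sum>j\<in>(UNIV::'n set). 2 * (L x * Nw c x))"
    proof (intro order_trans[OF sum_abs] sum_mono)
      fix i j
      have "\<bar>WW c i j x \<bullet> E i j\<bar> \<le> norm (WW c i j x) * norm (E i j)" by (rule Cauchy_Schwarz_ineq2)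
      also have "\<dots> \<le> ?s * (L x * ?s)" by (intro mult_mono norm_WW_le E s0) auto
      also have "\<dots> = L x * Nw c x" using Nw_nonneg[of c x] by (simp add: mult_ac)
      finally show "\<bar>2 * (WW c i j x \<bullet> E i j)\<bar> \<le> 2 * (L x * Nw c x)" by (simp add: abs_mult)
    qed
    then show ?thesis unfolding diff by (simp add: K_def mult_ac)
  qed
  show ?thesis using cont zero est by blast
qed

section \<open>Vanishing of \<open>WW\<close> near maxima and across regular points\<close>

definition Xv :: "(real ^ 'n \<Rightarrow> real) \<Rightarrow> real ^ 'n \<Rightarrow> real ^ 'n" where "Xv u x = (\<chi> p. X u p x)"

lemma smooth_Xv: "smooth_on S u \<Longrightarrow> smooth_on S (Xv u)"
  by (intro smooth_on_vec) (simp add: Xv_def smooth_X)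

lemma Xv_energy:
  assumes x: "x \<in> S" shows "(\<Sum>p\<in>UNIV. X u p x * pd p u x) = Xv u x \<bullet> (G x *v Xv u x)"
  by (simp add: inner_vec_def matrix_vector_mult_def Xv_def lower_X[OF x])

lemma Xv_zero_iff: assumes x: "x \<in> S" shows "Xv u x = 0 \<longleftrightarrow> (\<forall>i. pd i u x = 0)"
proof
  assume "Xv u x = 0"
  then have "X u p x = 0" for p by (simp add: Xv_def vec_eq_iff)
  then show "\<forall>i. pd i u x = 0" using lower_X[OF x, of _ u] by simp
qed (simp add: Xv_def X_def vec_eq_iff)

lemma interior_derivative:
  assumes x: "x \<in> S" "0 < hgt x" and u: "smooth_on S u"
  shows "(u has_derivative (\<lambda>v. dpd u x v)) (at x)"
  using smooth_has_derivative[OF hopen_S u x(1)] has_derivative_interior[OF hopen_S x] by simp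

lemma interior_ball:
  assumes x: "x \<in> S" "0 < hgt x" and V: "open V" "x \<in> V"
  shows "\<exists>r>0. cball x r \<subseteq> {y \<in> S. 0 < hgt y} \<inter> V"
proof -
  obtain T where T: "open T" "S = half_space \<inter> T" using hopen_S by (auto simp: openin_open)
  have "open (T \<inter> {y. 0 < hgt y} \<inter> V)"
    by (intro open_Int T V open_Collect_less continuous_intros)
  moreover have "x \<in> T \<inter> {y. 0 < hgt y} \<inter> V" using x T V by simp
  ultimately obtain r where "r > 0" "cball x r \<subseteq> T \<inter> {y. 0 < hgt y} \<inter> V"
    unfolding open_contains_cball by meson
  then show ?thesis using T by (intro exI[of _ r]) (auto simp: half_space_def)
qed

text \<open>Near \<open>x0\<close> the gradient is \<open>- c u(x0) (y - x0)\<close> up to higher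
  order, so it points into small balls, while along it \<open>Nw\<close> grows at a rate close to
  \<open>4 c u > 0\<close>. The maximum principle on a closed ball leaves only
  \<open>Nw = 0\<close>. The same linearisation shows that the critical point is isolated.\<close>

lemma flat_near_max:
  assumes c: "c > 0" and u: "solves c S u" and x0: "x0 \<in> S" "0 < hgt x0"
    and crit: "\<And>i. pd i u x0 = 0" and pos: "0 < u x0"
  shows "\<exists>r>0. ball x0 r \<subseteq> S \<and> (\<forall>y\<in>ball x0 r. (\<forall>i j. WW c i j y = 0) \<and> (y \<noteq> x0 \<longrightarrow> \<not> (\<forall>i. pd i u y = 0)))"
proof -
  have su: "smooth_on S u" using u by (rule solvesD)
  obtain K where K: "continuous_on S K" "\<And>x. x \<in> S \<Longrightarrow> (\<forall>p. X u p x = 0) \<Longrightarrow> K x = 0"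
    "\<And>x. x \<in> S \<Longrightarrow> \<bar>(\<Sum>p\<in>UNIV. X u p x * pd p (Nw c) x) - 4 * c * u x * Nw c x\<bar> \<le> K x * Nw c x"
    using Nw_derivative_estimate[OF u] by blast
  have X0: "Xv u x0 = 0" using crit Xv_zero_iff[OF x0(1)] by blast
  have K0: "K x0 = 0" using K(2)[OF x0(1)] X0 by (simp add: Xv_def vec_eq_iff)
  obtain r1 where r1: "r1 > 0" "cball x0 r1 \<subseteq> {y \<in> S. 0 < hgt y}"
    using interior_ball[OF x0 open_UNIV] by auto
  have "continuous_on (ball x0 r1) (\<lambda>y. 4 * c * u y - K y)"
  proof -
    have "ball x0 r1 \<subseteq> S" using r1(2) ball_subset_cball[of x0 r1] by blast
    then show ?thesis
      by (intro continuous_intros continuous_on_subset[OF K(1)] continuous_on_subset[OF smooth_on_continuous[OF su]])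
  qed
  then have "isCont (\<lambda>y. 4 * c * u y - K y) x0" using r1(1) by (simp add: continuous_on_eq_continuous_at)
  moreover have "0 < 4 * c * u x0 - K x0" using c pos K0 by simp
  ultimately obtain r2 where r2': "r2 > 0" "\<forall>y. dist y x0 < r2 \<longrightarrow> dist (4 * c * u y - K y) (4 * c * u x0 - K x0) < 4 * c * u x0 - K x0"
    unfolding continuous_at_eps_delta by meson
  have r2: "0 < 4 * c * u y - K y" if "dist y x0 < r2" for y
    using r2'(2) that unfolding dist_real_def by fastforce
  define \<mu> where "\<mu> = c * u x0"
  have \<mu>: "\<mu> > 0" using c pos by (simp add: \<mu>_def)
  have dX: "(Xv u has_derivative (\<lambda>v. - \<mu> *\<^sub>R v)) (at x0)"
  proof -
    have "pd i (Xv u) x0 = - \<mu> *\<^sub>R axis i 1" for i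
    proof -
      have "pd i (Xv u) x0 $ l = pd i (X u l) x0" for l
        using pd_vec_nth[OF hopen_S x0(1) smooth_Xv[OF su], of i l] by (simp add: Xv_def)
      moreover have "X u m x0 = 0" for m using X0 by (simp add: Xv_def vec_eq_iff)
      ultimately show ?thesis by (simp add: vec_eq_iff pd_X[OF x0(1) u] axis_def \<mu>_def)
    qed
    then have "(dpd (Xv u) x0 v) = - \<mu> *\<^sub>R (\<Sum>i\<in>UNIV. (v $ i) *\<^sub>R axis i 1)" for v
      by (simp add: scaleR_sum_right mult.commute)
    then have "(\<lambda>v. dpd (Xv u) x0 v) = (\<lambda>v. - \<mu> *\<^sub>R v)"
      by (simp only: vec_axis_expansion[symmetric])
    then show ?thesis using interior_derivative[OF x0 smooth_Xv[OF su]] by simp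
  qed
  \<comment> \<open>An error of half the linear term still leaves the gradient a strictly inward
    component.\<close>
  then obtain r3 where r3: "r3 > 0" "\<And>y. norm (y - x0) < r3 \<Longrightarrow> norm (Xv u y - Xv u x0 - - \<mu> *\<^sub>R (y - x0)) \<le> (\<mu>/2) * norm (y - x0)"
    using \<mu> unfolding has_derivative_at_alt by (meson half_gt_zero)
  have inward: "(y - x0) \<bullet> Xv u y < 0" if "norm (y - x0) < r3" "y \<noteq> x0" for y
  proof -
    have "(y - x0) \<bullet> (Xv u y + \<mu> *\<^sub>R (y - x0)) \<le> norm (y - x0) * norm (Xv u y + \<mu> *\<^sub>R (y - x0))" by (rule norm_cauchy_schwarz)
    also have "\<dots> \<le> norm (y - x0) * ((\<mu>/2) * norm (y - x0))" using r3(2)[OF that(1)] X0 by (intro mult_left_mono) auto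
    finally have "(y - x0) \<bullet> Xv u y \<le> - (\<mu>/2) * (norm (y - x0) * norm (y - x0))"
      by (simp add: inner_add_right dot_square_norm power2_eq_square)
    also have "\<dots> < 0" using \<mu> that(2) by (simp add: mult_neg_pos)
    finally show ?thesis .
  qed
  define r where "r = min r1 (min (r2/2) (r3/2))"
  have r: "r > 0" "r \<le> r1" "r < r2" "r < r3" using r1 r2'(1) r3 by (auto simp: r_def)
  have sub: "y \<in> S" "0 < hgt y" if "y \<in> cball x0 r" for y
  proof -
    have "y \<in> cball x0 r1" using that r(2) by simp
    then show "y \<in> S" "0 < hgt y" using r1(2) by blast+
  qed
  have "Nw c y \<le> 0" if y: "y \<in> cball x0 r" for y
  proof (rule no_positive_maximum[where D = "cball x0 r" and v = "Xv u" and m = "Nw c" and m' = "\<lambda>y v. dpd (Nw c) y v"])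
    fix z assume z: "z \<in> cball x0 r"
    show "(Nw c has_derivative (\<lambda>v. dpd (Nw c) z v)) (at z)"
      by (rule interior_derivative[OF sub[OF z] smooth_Nw])
    assume Nz: "0 < Nw c z"
    have "0 < (4 * c * u z - K z) * Nw c z" using r2[of z] z r(3) Nz by (intro mult_pos_pos) (auto simp: dist_commute)
    then show "0 < (dpd (Nw c) z (Xv u z))"
      using K(3)[OF sub(1)[OF z]] by (simp add: Xv_def left_diff_distrib abs_le_iff)
    show "\<exists>e>0. \<forall>t. 0 < t \<and> t < e \<longrightarrow> z + t *\<^sub>R Xv u z \<in> cball x0 r"
    proof (cases "z = x0")
      case True then show ?thesis using X0 z by (intro exI[of _ 1]) auto
    next
      case False
      have "((\<lambda>t. (z + t *\<^sub>R Xv u z - x0) \<bullet> (z + t *\<^sub>R Xv u z - x0)) has_real_derivative 2 * ((z - x0) \<bullet> Xv u z)) (at 0)"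
        unfolding has_field_derivative_def
        by (auto intro!: derivative_eq_intros simp: inner_commute)
      from DERIV_neg_dec_right[OF this] inward[of z] False z r(4)
      obtain d where d: "d > 0" "\<And>h. 0 < h \<Longrightarrow> h < d \<Longrightarrow> (z + h *\<^sub>R Xv u z - x0) \<bullet> (z + h *\<^sub>R Xv u z - x0) < (z - x0) \<bullet> (z - x0)"
        by (auto simp: dist_norm norm_minus_commute mult_less_0_iff)
      show ?thesis
      proof (intro exI[of _ d] conjI allI impI d(1))
        fix t assume "0 < t \<and> t < d"
        then have "norm (z + t *\<^sub>R Xv u z - x0) \<le> norm (z - x0)" using d(2)[of t] by (simp add: norm_le)
        then show "z + t *\<^sub>R Xv u z \<in> cball x0 r" using z by (simp add: dist_norm norm_minus_commute)
      qed
    qed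
  qed (use y in auto)
  then have "Nw c y = 0" if "y \<in> ball x0 r" for y using that Nw_nonneg[of c y] by (simp add: order_antisym)
  moreover have "ball x0 r \<subseteq> S" using sub by auto
  moreover have "\<not> (\<forall>i. pd i u y = 0)" if y: "y \<in> ball x0 r" "y \<noteq> x0" for y
  proof
    assume "\<forall>i. pd i u y = 0"
    then have "Xv u y = 0" using Xv_zero_iff[of y u] sub[of y] y(1) by simp
    moreover have "norm (y - x0) < r3" using y(1) r(4) by (simp add: dist_norm norm_minus_commute)
    ultimately show False using inward[of y] y(2) by simp
  qed
  ultimately show ?thesis using r(1) Nw_zero_iff by blast
qed

text \<open>On the lens-shaped region \<open>D\<close> around \<open>x0\<close>, the function \<open>exp (L u) |W|\<^sup>2\<close> increases along the
  gradient of \<open>u\<close>, and this gradient points into \<open>D\<close> wherever \<open>W\<close> may be nonzero; so its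
  maximum on \<open>D\<close> is zero.\<close>

lemma flat_propagates:
  assumes u: "solves c S u" and x0: "x0 \<in> S" "0 < hgt x0"
    and reg: "\<not> (\<forall>i. pd i u x0 = 0)"
    and flat: "\<And>y i j. y \<in> S \<Longrightarrow> u x0 < u y \<Longrightarrow> WW c i j y = 0"
  shows "\<exists>r>0. ball x0 r \<subseteq> S \<and> (\<forall>y\<in>ball x0 r. \<forall>i j. WW c i j y = 0)"
proof -
  have su: "smooth_on S u" using u by (rule solvesD)
  obtain K where K: "continuous_on S K"
    "\<And>x. x \<in> S \<Longrightarrow> \<bar>(\<Sum>p\<in>UNIV. X u p x * pd p (Nw c) x) - 4 * c * u x * Nw c x\<bar> \<le> K x * Nw c x"
    using Nw_derivative_estimate[OF u] by blast
  define a where "a = u x0"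
  define q where "q y = (\<Sum>p\<in>UNIV. X u p y * pd p u y)" for y
  have q0: "q x0 > 0"
    unfolding q_def Xv_energy[OF x0(1)] using pos_G[OF x0(1)] reg Xv_zero_iff[OF x0(1)] by blast
  have cq: "continuous_on S q" unfolding q_def
    by (intro continuous_intros smooth_on_continuous smooth_X smooth_on_pd hopen_S su)
  obtain r1 where r1: "r1 > 0" "cball x0 r1 \<subseteq> {y \<in> S. 0 < hgt y}"
    using interior_ball[OF x0 open_UNIV] by auto
  obtain d where d: "d > 0" "\<forall>y\<in>S. dist y x0 < d \<longrightarrow> dist (q y) (q x0) < q x0 / 2"
    using cq[unfolded continuous_on_iff, rule_format, OF x0(1), of "q x0 / 2"] q0 by auto
  define r where "r = min r1 (d/2)"
  have r: "r > 0" "r \<le> r1" "r < d" using r1(1) d(1) by (auto simp: r_def)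
  have sub: "y \<in> S" "0 < hgt y" if "y \<in> cball x0 r" for y
  proof -
    have "y \<in> cball x0 r1" using that r(2) by simp
    then show "y \<in> S" "0 < hgt y" using r1(2) by blast+
  qed
  have sub': "cball x0 r \<subseteq> S" using sub by blast
  have qpos: "q x0 / 2 < q y" if "y \<in> cball x0 r" for y
  proof -
    have "dist (q y) (q x0) < q x0 / 2" using d(2) sub(1)[OF that] that r(3) by (auto simp: dist_commute)
    then show ?thesis unfolding dist_real_def by linarith
  qed
  have bdd: "\<exists>B. \<forall>y\<in>cball x0 r. \<bar>h y\<bar> \<le> B" if "continuous_on (cball x0 r) h" for h :: "real ^ 'n \<Rightarrow> real"
    using compact_imp_bounded[OF compact_continuous_image[OF that compact_cball]] by (auto simp: bounded_iff)
  have "continuous_on (cball x0 r) (\<lambda>y. K y - 4 * c * u y)" "continuous_on (cball x0 r) (\<lambda>y. (y - x0) \<bullet> Xv u y)"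
    by (intro continuous_intros continuous_on_subset[OF K(1) sub'] continuous_on_subset[OF smooth_on_continuous[OF su] sub']
      continuous_on_subset[OF smooth_on_continuous[OF smooth_Xv[OF su]] sub'])+
  from bdd[OF this(1)] bdd[OF this(2)] obtain B1 B2 where B1: "\<forall>y\<in>cball x0 r. \<bar>K y - 4 * c * u y\<bar> \<le> B1"
    and B2: "\<forall>y\<in>cball x0 r. \<bar>(y - x0) \<bullet> Xv u y\<bar> \<le> B2" by blast
  have B2': "0 \<le> B2" using B2[rule_format, of x0] r(1) by simp
  have B1': "0 \<le> B1" using order_trans[OF abs_ge_zero B1[rule_format, of x0]] r(1) by simp
  \<comment> \<open>Small enough that along the gradient the quadratic term grows by at most
    \<open>q x0 / 4\<close>, while \<open>u\<close> grows by more than \<open>q x0 / 2\<close>.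
    Hence \<open>\<psi>\<close> increases along the gradient.\<close>
  define \<kappa> where "\<kappa> = q x0 / (8 * (B2 + 1))"
  have \<kappa>: "\<kappa> > 0" using q0 B2' by (simp add: \<kappa>_def)
  have \<kappa>B: "2 * \<kappa> * ((y - x0) \<bullet> Xv u y) < q x0 / 2" if "y \<in> cball x0 r" for y
  proof -
    have "(y - x0) \<bullet> Xv u y \<le> B2 + 1" using B2 that by fastforce
    then have "2 * \<kappa> * ((y - x0) \<bullet> Xv u y) \<le> 2 * \<kappa> * (B2 + 1)" using \<kappa> by (intro mult_left_mono) auto
    also have "\<dots> = q x0 / 4" using B2' by (simp add: \<kappa>_def field_simps)
    finally show ?thesis using q0 by simp
  qed
  \<comment> \<open>Chosen so that \<open>L * q\<close> exceeds \<open>B1\<close> on the ball: the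
    weight \<open>exp (L * u)\<close> then outgrows any decay of \<open>Nw\<close> along the
    gradient.\<close>
  define L where "L = 2 * (B1 + 1) / q x0"
  define \<psi> where "\<psi> y = u y - \<kappa> * ((y - x0) \<bullet> (y - x0))" for y
  \<comment> \<open>On the sphere of radius \<open>r\<close> a point of \<open>D\<close> has
    \<open>u \<ge> a + \<kappa> * r\<^sup>2 / 2\<close>, so it lies above level \<open>a\<close>,
    where \<open>WW\<close> is known to vanish. Points of \<open>D\<close> with nonzero
    \<open>WW\<close> are within \<open>r / sqrt 2\<close> of \<open>x0\<close>, and only the edge
    given by \<open>\<psi>\<close> matters.\<close>
  define D where "D = {y \<in> cball x0 r. a - \<kappa> * r\<^sup>2 / 2 \<le> \<psi> y}"
  have c\<psi>: "continuous_on (cball x0 r) \<psi>" unfolding \<psi>_def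
    by (intro continuous_intros continuous_on_subset[OF smooth_on_continuous[OF su] sub'])
  have D: "compact D"
  proof -
    have eq: "D = cball x0 r \<inter> \<psi> -` {a - \<kappa> * r\<^sup>2 / 2..}" by (auto simp: D_def)
    have "closed D" unfolding eq by (rule continuous_closed_preimage[OF c\<psi>]) auto
    then show ?thesis using compact_Int_closed[OF compact_cball, of D x0 r] eq by (simp add: Int_absorb1)
  qed
  have Dsub: "y \<in> cball x0 r" if "y \<in> D" for y using that by (simp add: D_def)
  define m where "m y = Nw c y * exp (L * u y)" for y
  have mD: "m y \<le> 0" if y: "y \<in> D" for y
  proof (rule no_positive_maximum[where D = D and v = "Xv u" and m = m and
        m' = "\<lambda>y v. (dpd (Nw c) y v) * exp (L * u y) + Nw c y * (exp (L * u y) * (L * (dpd u y v)))", OF D _ _ _ y])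
    fix z assume zD: "z \<in> D"
    note z = sub[OF Dsub[OF zD]]
    have "((\<lambda>y. exp (L * u y)) has_derivative (\<lambda>v. exp (L * u z) * (L * (dpd u z v)))) (at z)"
      using has_derivative_exp[OF has_derivative_mult_right[OF interior_derivative[OF z su], of L]] by (simp add: mult.commute[of "exp (L * u z)"])
    from has_derivative_mult[OF interior_derivative[OF z smooth_Nw] this]
    show "(m has_derivative (\<lambda>v. (dpd (Nw c) z v) * exp (L * u z) + Nw c z * (exp (L * u z) * (L * (dpd u z v))))) (at z)"
      unfolding m_def[abs_def] by (simp add: add.commute)
    assume "0 < m z"
    then have Nz: "0 < Nw c z" by (simp add: m_def zero_less_mult_iff)
    have qz: "(dpd u z (Xv u z)) = q z" by (simp add: q_def Xv_def)
    have Nq: "(dpd (Nw c) z (Xv u z)) \<ge> - B1 * Nw c z"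
    proof -
      have "(K z - 4 * c * u z) * Nw c z \<le> B1 * Nw c z"
        using B1 Dsub[OF zD] Nz by (intro mult_right_mono) (auto simp: abs_le_iff)
      then show ?thesis using K(2)[OF z(1)] by (simp add: Xv_def left_diff_distrib abs_le_iff)
    qed
    have "B1 < L * q z"
    proof -
      have "L * (q x0 / 2) = B1 + 1" using q0 by (simp add: L_def)
      moreover have "L * (q x0 / 2) \<le> L * q z"
        using qpos[OF Dsub[OF zD]] q0 B1' by (intro mult_left_mono) (auto simp: L_def)
      ultimately show ?thesis by linarith
    qed
    then have "B1 * Nw c z < (L * q z) * Nw c z" using Nz by (rule mult_strict_right_mono)
    then have "0 < (dpd (Nw c) z (Xv u z)) + Nw c z * (L * q z)"
      using Nq by (simp add: mult_ac)
    then have "0 < exp (L * u z) * ((dpd (Nw c) z (Xv u z)) + Nw c z * (L * q z))"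
      by (rule mult_pos_pos[OF exp_gt_zero])
    then show "0 < (dpd (Nw c) z (Xv u z)) * exp (L * u z) + Nw c z * (exp (L * u z) * (L * (dpd u z (Xv u z))))"
      unfolding qz by (simp add: algebra_simps)
    have "u z \<le> a" using flat[OF z(1)] Nz Nw_zero_iff[of c z] by (force simp: a_def)
    then have "\<kappa> * ((z - x0) \<bullet> (z - x0)) \<le> \<kappa> * (r\<^sup>2 / 2)" using zD by (simp add: D_def \<psi>_def)
    then have "(norm (z - x0))\<^sup>2 \<le> r\<^sup>2 / 2" using \<kappa> by (simp add: dot_square_norm)
    also have "\<dots> < r\<^sup>2" using r(1) by simp
    finally have zin: "z \<in> ball x0 r" using r(1) power_less_imp_less_base[of "norm (z - x0)" 2 r] by (simp add: dist_norm norm_minus_commute)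
    then obtain e1 where e1: "e1 > 0" "ball z e1 \<subseteq> ball x0 r" using open_ball openE by blast
    have "((\<lambda>y. \<psi> y) has_derivative (\<lambda>v. (dpd u z v) - \<kappa> * (2 * ((z - x0) \<bullet> v)))) (at z)"
      unfolding \<psi>_def by (auto intro!: derivative_eq_intros interior_derivative[OF z su] simp: inner_commute)
    then have dline: "((\<lambda>t. \<psi> (z + t *\<^sub>R Xv u z)) has_real_derivative ((dpd u z (Xv u z)) - \<kappa> * (2 * ((z - x0) \<bullet> Xv u z)))) (at 0)"
      by (intro has_real_derivative_along_line) simp
    have "0 < (dpd u z (Xv u z)) - \<kappa> * (2 * ((z - x0) \<bullet> Xv u z))"
      unfolding qz using qpos[OF Dsub[OF zD]] \<kappa>B[OF Dsub[OF zD]] by (simp add: mult_ac)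
    from DERIV_pos_inc_right[OF dline this]
    obtain d where d: "d > 0" "\<And>h. 0 < h \<Longrightarrow> h < d \<Longrightarrow> \<psi> z < \<psi> (z + h *\<^sub>R Xv u z)" by auto
    define e where "e = min d (e1 / (norm (Xv u z) + 1))"
    have e: "e > 0" using d(1) e1(1) by (simp add: e_def add_nonneg_pos)
    show "\<exists>e>0. \<forall>t. 0 < t \<and> t < e \<longrightarrow> z + t *\<^sub>R Xv u z \<in> D"
    proof (intro exI[of _ e] conjI e allI impI)
      fix t assume t: "0 < t \<and> t < e"
      have "t * norm (Xv u z) \<le> t * (norm (Xv u z) + 1)" using t by (intro mult_left_mono) auto
      also have "\<dots> < e1" using t by (simp add: e_def less_divide_eq add_nonneg_pos)
      finally have "z + t *\<^sub>R Xv u z \<in> ball z e1" using t by (simp add: dist_norm)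
      then have "z + t *\<^sub>R Xv u z \<in> cball x0 r" using e1(2) ball_subset_cball by blast
      moreover have "\<psi> z < \<psi> (z + t *\<^sub>R Xv u z)" using d(2)[of t] t by (simp add: e_def)
      ultimately show "z + t *\<^sub>R Xv u z \<in> D" using zD by (simp add: D_def)
    qed
  qed
  have "isCont \<psi> x0" using continuous_on_subset[OF c\<psi> ball_subset_cball] r(1) by (simp add: continuous_on_eq_continuous_at)
  moreover have "\<psi> x0 = a" by (simp add: \<psi>_def a_def)
  moreover have e0: "\<kappa> * r\<^sup>2 / 2 > 0" using \<kappa> r(1) by simp
  ultimately obtain s where s: "s > 0" "\<forall>y. dist y x0 < s \<longrightarrow> dist (\<psi> y) a < \<kappa> * r\<^sup>2 / 2"
    unfolding continuous_at_eps_delta by metis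
  define t where "t = min s r"
  have t: "t > 0" using s(1) r(1) by (simp add: t_def)
  have "Nw c y = 0" if "y \<in> ball x0 t" for y
  proof -
    have "dist (\<psi> y) a < \<kappa> * r\<^sup>2 / 2" using s(2) that by (simp add: t_def dist_commute)
    then have "a - \<kappa> * r\<^sup>2 / 2 \<le> \<psi> y" unfolding dist_real_def by linarith
    then have "y \<in> D" using that by (simp add: D_def t_def)
    then have "m y \<le> 0" by (rule mD)
    then show ?thesis using Nw_nonneg[of c y] by (simp add: m_def mult_le_0_iff order_antisym)
  qed
  moreover have "ball x0 t \<subseteq> S" using sub' by (auto simp: t_def)
  ultimately show ?thesis using t Nw_zero_iff by blast
qed

end

section \<open>Inverse functions, boundary behaviour and Gram vectors\<close>

text \<open>Gram-Schmidt for the inner product \<open>v \<bullet> (G *v w)\<close>. These vectors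
  provide the initial frame of a local isometry at a maximum.\<close>

lemma exists_gram_vectors:
  fixes G :: "real ^ 'n ^ 'n::finite"
  assumes sym: "transpose G = G" and pos: "\<And>v. v \<noteq> 0 \<Longrightarrow> 0 < v \<bullet> (G *v v)"
  shows "\<exists>P :: 'n \<Rightarrow> real ^ 'n. \<forall>i j. P i \<bullet> P j = G $ i $ j"
proof -
  define b where "b v w = v \<bullet> (G *v w)" for v w :: "real ^ 'n"
  have b_sym: "b v w = b w v" for v w
    unfolding b_def using dot_lmul_matrix[of v G w] vector_transpose_matrix[of v G] by (simp add: sym inner_commute)
  have b_add: "b (v + v') w = b v w + b v' w" "b (r *\<^sub>R v) w = r * b v w" "b (v - v') w = b v w - b v' w" for v v' w r
    by (simp_all add: b_def inner_add_left inner_diff_left)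
  have b_add2: "b w (v + v') = b w v + b w v'" "b w (r *\<^sub>R v) = r * b w v" "b w (v - v') = b w v - b w v'" for v v' w r
    using b_sym b_add by metis+
  have b_sum: "b (\<Sum>i\<in>I. f i) w = (\<Sum>i\<in>I. b (f i) w)" for f w and I :: "'n set"
    by (simp add: b_def inner_sum_left)
  have "\<exists>w :: 'n \<Rightarrow> real ^ 'n. \<forall>i\<in>I. \<forall>j\<in>I. b (w i) (w j) = (if i = j then 1 else 0)" for I :: "'n set"
  proof (induction I rule: finite_induct[OF finite])
    case 1 then show ?case by simp
  next
    case (2 k I)
    then obtain w where w: "\<And>i j. i \<in> I \<Longrightarrow> j \<in> I \<Longrightarrow> b (w i) (w j) = (if i = j then 1 else 0)" by blast
    have "dim (span (w ` I)) \<le> card (w ` I)" by (simp add: dim_le_card')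
    also have "\<dots> \<le> card I" by (rule card_image_le) simp
    also have "\<dots> < card (insert k I)" using 2 by simp
    also have "\<dots> \<le> CARD('n)" by (rule card_mono) auto
    finally have lt: "dim (span (w ` I)) < CARD('n)" .
    have "span (w ` I) \<noteq> UNIV"
    proof
      assume "span (w ` I) = UNIV"
      with lt have "dim (UNIV :: (real ^ 'n) set) < CARD('n)" by (simp only:)
      then show False by simp
    qed
    then obtain v where v: "v \<notin> span (w ` I)" by blast
    define v' where "v' = v - (\<Sum>i\<in>I. b v (w i) *\<^sub>R w i)"
    have "v' \<noteq> 0"
    proof
      assume "v' = 0"
      then have "v = (\<Sum>i\<in>I. b v (w i) *\<^sub>R w i)" by (simp add: v'_def)
      also have "\<dots> \<in> span (w ` I)" by (intro span_sum span_scale span_base imageI)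
      finally show False using v by blast
    qed
    then have bv: "b v' v' > 0" using pos by (simp add: b_def)
    have orth: "b v' (w j) = 0" if "j \<in> I" for j
    proof -
      have "(\<Sum>i\<in>I. b v (w i) * b (w i) (w j)) = (\<Sum>i\<in>I. if i = j then b v (w j) else 0)"
        by (rule sum.cong) (use w that in auto)
      then show ?thesis using that by (simp add: v'_def b_add b_sum)
    qed
    define e where "e = (1 / sqrt (b v' v')) *\<^sub>R v'"
    have "b e e = 1" using bv by (simp add: e_def b_add b_add2)
    moreover have "b e (w j) = 0" "b (w j) e = 0" if "j \<in> I" for j
      using orth[OF that] b_sym[of "w j"] by (simp_all add: e_def b_add b_add2)
    ultimately have "\<forall>i\<in>insert k I. \<forall>j\<in>insert k I. b ((w(k := e)) i) ((w(k := e)) j) = (if i = j then 1 else 0)"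
      using w 2(2) by auto
    then show ?case by blast
  qed
  from this[of UNIV] obtain w :: "'n \<Rightarrow> real ^ 'n" where "\<forall>i\<in>UNIV. \<forall>j\<in>UNIV. b (w i) (w j) = (if i = j then 1 else 0)" by (elim exE)
  then have w: "b (w i) (w j) = (if i = j then 1 else 0)" for i j by simp
  \<comment> \<open>The columns of \<open>A\<close> are orthonormal for \<open>G\<close>, so
    \<open>B\<close> inverts \<open>A\<close>. Hence \<open>transpose B ** B\<close> equals
    \<open>G ** (A ** B) = G\<close>, and the columns of \<open>B\<close> have Gram matrix
    \<open>G\<close>.\<close>
  define A where "A = (\<chi> k i. w i $ k)"
  define B where "B = transpose A ** G"
  have "(B ** A) $ i $ j = b (w i) (w j)" for i j
    by (simp add: B_def matrix_mul_assoc[symmetric])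
       (simp add: b_def A_def matrix_matrix_mult_def transpose_def inner_vec_def matrix_vector_mult_def)
  then have "B ** A = mat 1" by (simp add: vec_eq_iff w mat_def)
  then have AB: "A ** B = mat 1" by (simp add: matrix_left_right_inverse)
  have "transpose B ** B = G ** (A ** B)" by (simp add: B_def matrix_transpose_mul sym matrix_mul_assoc)
  then have "transpose B ** B = G" by (simp add: AB)
  then have "G $ i $ j = column i B \<bullet> column j B" for i j
    by (auto simp: matrix_matrix_mult_def transpose_def inner_vec_def column_def)
  then show ?thesis by (intro exI[of _ "\<lambda>i. column i B"]) simp
qed

text \<open>A product rule in which one factor is merely continuous, because the other vanishes at
  the point. It differentiates an inverse before that inverse is known to be differentiable.\<close>

lemma has_derivative_bilinear_zero:
  assumes b: "bounded_bilinear \<beta>" and f: "isCont f x" and r: "(r has_derivative r') (at x)" "r x = 0"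
  shows "((\<lambda>y. \<beta> (f y) (r y)) has_derivative (\<lambda>h. \<beta> (f x) (r' h))) (at x)"
proof -
  interpret bounded_bilinear \<beta> by (rule b)
  obtain K where K: "K > 0" "\<And>a b. norm (\<beta> a b) \<le> norm a * norm b * K" using pos_bounded by blast
  obtain B where B: "B > 0" "\<And>h. norm (r' h) \<le> norm h * B"
    using bounded_linear.pos_bounded[OF has_derivative_bounded_linear[OF r(1)]] by blast
  obtain d1 where d1: "d1 > 0" "\<And>y. norm (y - x) < d1 \<Longrightarrow> norm (r y - r x - r' (y - x)) \<le> 1 * norm (y - x)"
    using r(1) unfolding has_derivative_at_alt by (meson zero_less_one)
  define L where "L = 1 + B"
  have L: "L > 0" using B(1) by (simp add: L_def)
  have nr: "norm (r y) \<le> norm (y - x) * L" if "norm (y - x) < d1" for y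
    using norm_triangle_ineq[of "r y - r' (y - x)" "r' (y - x)"] d1(2)[OF that] B(2)[of "y - x"] r(2) by (simp add: L_def algebra_simps)
  have "((\<lambda>y. \<beta> (f y - f x) (r y)) has_derivative (\<lambda>h. 0)) (at x)"
    unfolding has_derivative_at_alt
  proof (intro conjI allI impI bounded_linear_zero)
    fix e :: real assume "e > 0"
    then have "e / (L * K) > 0" using L K(1) by simp
    then obtain d2 where d2: "d2 > 0" "\<And>y. dist y x < d2 \<Longrightarrow> dist (f y) (f x) < e / (L * K)"
      using f unfolding continuous_at_eps_delta by blast
    have "norm (\<beta> (f y - f x) (r y)) \<le> e * norm (y - x)" if y: "norm (y - x) < d1" "norm (y - x) < d2" for y
    proof -
      have "norm (f y - f x) \<le> e / (L * K)" using d2(2)[of y] y(2) by (simp add: dist_norm less_imp_le)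
      then have "norm (f y - f x) * norm (r y) * K \<le> e / (L * K) * (norm (y - x) * L) * K"
        using nr[OF y(1)] K(1) by (intro mult_right_mono mult_mono) (auto intro: order_trans[OF norm_ge_zero])
      also have "\<dots> = e * norm (y - x)" using L K(1) by simp
      finally show ?thesis using K(2)[of "f y - f x" "r y"] by simp
    qed
    then show "\<exists>d>0. \<forall>y. norm (y - x) < d \<longrightarrow>
        norm (\<beta> (f y - f x) (r y) - \<beta> (f x - f x) (r x) - 0) \<le> e * norm (y - x)"
      using d1(1) d2(1) by (intro exI[of _ "min d1 d2"]) (simp add: zero_left)
  qed
  from has_derivative_add[OF this bounded_linear.has_derivative[OF bounded_linear_right r(1), of "f x"]]
  show ?thesis by (simp add: diff_left)
qed

text \<open>Everything follows from \<open>J y - J x = - J y (A y - A x) J x\<close>: it bounds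
  \<open>J\<close> near \<open>x\<close> and gives continuity, then the derivative. That derivative
  is a product of \<open>J\<close> and derivatives of \<open>A\<close>, so the order can be raised
  inductively.\<close>

lemma Ck_on_blinfun_inverse:
  fixes A J :: "'a::euclidean_space \<Rightarrow> ('e::euclidean_space \<Rightarrow>\<^sub>L 'e)"
  assumes V: "open V" and A: "Ck_on k V A"
    and J: "\<And>y. y \<in> V \<Longrightarrow> J y o\<^sub>L A y = id_blinfun" "\<And>y. y \<in> V \<Longrightarrow> A y o\<^sub>L J y = id_blinfun"
  shows "Ck_on k V J"
proof -
  have diff: "J y - J x = - (J y o\<^sub>L ((A y - A x) o\<^sub>L J x))" if "x \<in> V" "y \<in> V" for x y
  proof (rule blinfun_eqI)
    fix v
    have 1: "J y (A y w) = w" for w using J(1)[OF that(2)] by (metis blinfun_apply_blinfun_compose id_blinfun.rep_eq)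
    have 2: "A x (J x v) = v" using J(2)[OF that(1)] by (metis blinfun_apply_blinfun_compose id_blinfun.rep_eq)
    show "(J y - J x) v = (- (J y o\<^sub>L ((A y - A x) o\<^sub>L J x))) v"
      by (simp add: blinfun.diff_left blinfun.minus_left blinfun.diff_right 1 2)
  qed
  have cont: "isCont J x" if cA: "continuous_on V A" and x: "x \<in> V" for x
  proof -
    define a where "a y = norm (A y - A x) * norm (J x)" for y
    have le: "norm (J y - J x) \<le> norm (J y) * a y" if "y \<in> V" for y
      unfolding diff[OF x that] norm_minus_cancel a_def
      by (rule order_trans[OF norm_blinfun_compose mult_left_mono[OF norm_blinfun_compose norm_ge_zero]])
    have "isCont A x" using cA V x by (simp add: continuous_on_eq_continuous_at)
    then have "isCont a x" unfolding a_def by (intro continuous_intros)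
    then have a0: "(a \<longlongrightarrow> 0) (at x)" by (simp add: isCont_def a_def)
    have "\<forall>\<^sub>F y in at x. a y < 1/2" by (rule order_tendstoD(2)[OF a0]) simp
    moreover have "\<forall>\<^sub>F y in at x. y \<in> V" using V x eventually_at_in_open' by blast
    ultimately have "\<forall>\<^sub>F y in at x. norm (J y - J x) \<le> norm (a y) * (2 * norm (J x))"
    proof eventually_elim
      case (elim y)
      have a: "0 \<le> a y" by (simp add: a_def)
      have "norm (J y) * a y \<le> norm (J y) * (1/2)" by (intro mult_left_mono) (use elim in auto)
      then have "norm (J y) \<le> 2 * norm (J x)" using le[OF elim(2)] norm_triangle_ineq2[of "J y" "J x"] by linarith
      from mult_right_mono[OF this a] le[OF elim(2)] show ?case using a by (simp add: mult.commute)
    qed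
    from tendsto_0_le[OF a0 this] have "((\<lambda>y. J y - J x) \<longlongrightarrow> 0) (at x)" .
    then show ?thesis using LIM_zero_iff unfolding isCont_def by blast
  qed
  show ?thesis using A
  proof (induction k)
    case 0 then show ?case using cont V by (simp add: continuous_on_eq_continuous_at)
  next
    case (Suc k)
    have A': "Ck_on k V A" by (rule Ck_on_Suc_imp[OF V Suc.prems])
    have Jk: "Ck_on k V J" by (rule Suc.IH[OF A'])
    have der: "(J has_derivative (\<lambda>v. - (J x o\<^sub>L (\<D> A x v o\<^sub>L J x)))) (at x)" if x: "x \<in> V" for x
    proof -
      have "((\<lambda>y. (A y - A x) o\<^sub>L J x) has_derivative (\<lambda>v. \<D> A x v o\<^sub>L J x)) (at x)"
        using bounded_linear.has_derivative[OF bounded_bilinear.bounded_linear_left[OF bounded_bilinear_blinfun_compose]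
            has_derivative_diff[OF Ck_on_SucD[OF V Suc.prems x] has_derivative_const]] by simp
      from has_derivative_bilinear_zero[OF bounded_bilinear_blinfun_compose cont[OF Ck_on_imp_continuous[OF V A'] x] this]
      have "((\<lambda>y. J y o\<^sub>L ((A y - A x) o\<^sub>L J x)) has_derivative (\<lambda>v. J x o\<^sub>L (\<D> A x v o\<^sub>L J x))) (at x)"
        by (simp add: bounded_bilinear.zero_left[OF bounded_bilinear_blinfun_compose])
      from has_derivative_diff[OF has_derivative_const this, of "J x"]
      have d1: "((\<lambda>y. J x - (J y o\<^sub>L ((A y - A x) o\<^sub>L J x))) has_derivative (\<lambda>v. - (J x o\<^sub>L (\<D> A x v o\<^sub>L J x)))) (at x)" by simp
      have "J x - (J y o\<^sub>L ((A y - A x) o\<^sub>L J x)) = J y" if "y \<in> V" for y using diff[OF x that] by (simp add: algebra_simps)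
      then show ?thesis using has_derivative_transform_within_open[OF d1 V x] by blast
    qed
    show ?case
    proof (rule Ck_on_SucI[OF V der])
      fix v
      have "Ck_on k V (\<lambda>x. J x o\<^sub>L (\<D> A x v o\<^sub>L J x))"
        by (intro Ck_on_bilinear[OF bounded_bilinear_blinfun_compose V] Jk Ck_on_Suc_derivative[OF Suc.prems])
      from Ck_on_linear[OF bounded_linear_minus[OF bounded_linear_ident] V this]
      show "Ck_on k V (\<lambda>x. - (J x o\<^sub>L (\<D> A x v o\<^sub>L J x)))" .
    qed
  qed
qed

text \<open>Bootstrapping from the continuously differentiable case: the derivative of
  \<open>g\<close> is the inverse of the derivative of \<open>f\<close> at \<open>g\<close>, so
  \<open>g\<close> gains one order each time.\<close>

lemma smooth_inverse_function:
  fixes f :: "'e::euclidean_space \<Rightarrow> 'e"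
  assumes f: "Cinf_on U f" and x0: "x0 \<in> U"
    and L: "linear L" "\<And>v. L (\<D> f x0 v) = v"
  obtains U' V g where "open U'" "U' \<subseteq> U" "x0 \<in> U'" "open V" "f x0 \<in> V" "homeomorphism U' V f g" "Cinf_on V g"
proof -
  have oU: "open U" using f Cinf_on_open by blast
  define A where "A y = (\<Sum>b\<in>Basis. blinfun_scaleR_left (\<D> f y b) o\<^sub>L blinfun_inner_left b)" for y
  have Aap: "blinfun_apply (A y) = \<D> f y" if "y \<in> U" for y
  proof
    fix v
    have lin: "linear (\<D> f y)" using Cinf_on_has_derivative[OF f that] has_derivative_linear by blast
    have "\<D> f y (\<Sum>b\<in>Basis. (v \<bullet> b) *\<^sub>R b) = (\<Sum>b\<in>Basis. (v \<bullet> b) *\<^sub>R \<D> f y b)"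
      by (simp add: linear_sum[OF lin] linear_scale[OF lin])
    then show "A y v = \<D> f y v"
      by (simp add: A_def blinfun.sum_left euclidean_representation)
  qed
  have CA: "Ck_on k U A" for k
  proof -
    have bl: "bounded_linear (\<lambda>a::'e. blinfun_scaleR_left a o\<^sub>L blinfun_inner_left b)" for b :: 'e
      by (intro bounded_linear_compose[OF bounded_bilinear.bounded_linear_left[OF bounded_bilinear_blinfun_compose]] bounded_linear_blinfun_scaleR_left)
    have "Ck_on k U (\<lambda>y. \<D> f y b)" for b
      using Cinf_on_derivative[OF f, of b] by (simp add: Cinf_on_def)
    from Ck_on_linear[OF bl oU this] show ?thesis
      unfolding A_def by (intro Ck_on_sum oU)
  qed
  have cA: "continuous_on U A" using CA[of 0] by simp
  have "bounded_linear L" using L(1) by (simp add: linear_conv_bounded_linear)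
  then have inv: "Blinfun L o\<^sub>L A x0 = id_blinfun"
    by (intro blinfun_eqI) (simp add: bounded_linear_Blinfun_apply Aap[OF x0] L(2))
  have "\<And>x. x \<in> U \<Longrightarrow> (f has_derivative blinfun_apply (A x)) (at x)"
    using Cinf_on_has_derivative[OF f] Aap by simp
  from inverse_function_theorem[OF oU this cA x0 inv]
  obtain U' V g g' where *: "open U'" "U' \<subseteq> U" "x0 \<in> U'" "open V" "f x0 \<in> V" "homeomorphism U' V f g"
    "\<And>y. y \<in> V \<Longrightarrow> (g has_derivative g' y) (at y)"
    "\<And>y. y \<in> V \<Longrightarrow> g' y = inv (blinfun_apply (A (g y)))" "\<And>y. y \<in> V \<Longrightarrow> bij (blinfun_apply (A (g y)))" by blast
  define J where "J y = Blinfun (g' y)" for y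
  have Jap: "blinfun_apply (J y) = g' y" if "y \<in> V" for y
    unfolding J_def by (rule bounded_linear_Blinfun_apply[OF has_derivative_bounded_linear[OF *(7)[OF that]]])
  have gU: "g y \<in> U'" if "y \<in> V" for y using *(6) that by (auto simp: homeomorphism_def)
  have J1: "J y o\<^sub>L A (g y) = id_blinfun" and J2: "A (g y) o\<^sub>L J y = id_blinfun" if "y \<in> V" for y
    using *(9)[OF that] by (auto intro!: blinfun_eqI simp: Jap[OF that] *(8)[OF that] bij_is_inj bij_is_surj surj_f_inv_f)
  have "Ck_on k V g" for k
  proof (induction k)
    case 0 show ?case using *(6) by (simp add: homeomorphism_def)
  next
    case (Suc k)
    have "Ck_on k V (\<lambda>y. A (g y))" by (rule Ck_on_compose[OF *(4) oU CA Suc]) (use gU *(2) in blast)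
    from Ck_on_blinfun_inverse[OF *(4) this J1 J2] have Jk: "Ck_on k V J" .
    show ?case
    proof (rule Ck_on_SucI[OF *(4) *(7)])
      fix v
      show "Ck_on k V (\<lambda>y. g' y v)"
        by (rule Ck_on_cong[OF *(4) _ Ck_on_linear[OF blinfun.bounded_linear_left *(4) Jk, of v]]) (simp add: Jap)
    qed
  qed
  then have "Cinf_on V g" using *(4) by (simp add: Cinf_on_def)
  then show ?thesis using that * by blast
qed

text \<open>By the mean value theorem in the normal direction, \<open>u y\<close> is
  \<open>hgt y\<close> times a normal derivative at an intermediate point, which is positive near
  \<open>x\<close>. The sign on the far side of the boundary is recorded too, as it recognises
  points that the extension of a map places outside the half-space.\<close>

lemma boundary_sign:
  fixes u :: "real ^ 'n::finite \<Rightarrow> real"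
  assumes u: "Cinf_on W u" and x: "x \<in> W" "hgt x = 0"
    and zero: "\<And>y. y \<in> W \<Longrightarrow> hgt y = 0 \<Longrightarrow> u y = 0"
    and pos: "\<D> u x (axis bdry_index 1) > 0"
  shows "\<exists>r>0. ball x r \<subseteq> W \<and> (\<forall>y\<in>ball x r. (0 < hgt y \<longrightarrow> 0 < u y) \<and> (hgt y < 0 \<longrightarrow> u y < 0))"
proof -
  let ?b = "axis bdry_index (1::real) :: real ^ 'n"
  have oW: "open W" using u Cinf_on_open by blast
  define D where "D y = \<D> u y ?b" for y
  have "continuous_on W D" using Cinf_on_continuous[OF Cinf_on_derivative[OF u]] by (simp add: D_def[abs_def])
  then have "isCont D x" using oW x(1) by (simp add: continuous_on_eq_continuous_at)
  then obtain d where d: "d > 0" "\<forall>y. dist y x < d \<longrightarrow> dist (D y) (D x) < D x"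
    using pos unfolding continuous_at_eps_delta D_def by meson
  obtain r0 where r0: "r0 > 0" "ball x r0 \<subseteq> W" using oW x(1) openE by blast
  define r where "r = min d r0"
  have r: "r > 0" "ball x r \<subseteq> W" using d(1) r0 by (auto simp: r_def)
  have Dpos: "D y > 0" if "y \<in> ball x r" for y
  proof -
    have "dist y x < d" using that by (simp add: r_def dist_commute)
    then have "dist (D y) (D x) < D x" using d(2) by blast
    then show ?thesis unfolding dist_real_def by linarith
  qed
  have main: "\<exists>\<xi>. D \<xi> > 0 \<and> u y = hgt y * D \<xi>" if y: "y \<in> ball x r" "hgt y \<noteq> 0" for y
  proof -
    define \<beta> where "\<beta> = hgt y"
    define y0 where "y0 = y - \<beta> *\<^sub>R ?b"
    \<comment> \<open>As \<open>x\<close> has height zero, shrinking the height of \<open>y\<close>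
      moves no coordinate further from that of \<open>x\<close>.\<close>
    have line: "y0 + (s * \<beta>) *\<^sub>R ?b \<in> ball x r" if "0 \<le> s" "s \<le> 1" for s
    proof -
      have "norm (x - (y0 + (s * \<beta>) *\<^sub>R ?b)) \<le> norm (x - y)"
      proof (rule norm_le_componentwise_cart)
        fix i
        show "norm ((x - (y0 + (s * \<beta>) *\<^sub>R ?b)) $ i) \<le> norm ((x - y) $ i)"
          using that x(2) mult_left_le_one_le[of "\<bar>\<beta>\<bar>" s]
          by (cases "i = bdry_index") (auto simp: y0_def axis_def \<beta>_def abs_mult)
      qed
      then show ?thesis using y(1) by (simp add: dist_norm)
    qed
    have "\<exists>z>0. z < 1 \<and> u (y0 + (1::real) *\<^sub>R (\<beta> *\<^sub>R ?b)) - u (y0 + (0::real) *\<^sub>R (\<beta> *\<^sub>R ?b)) = (1 - 0) * \<D> u (y0 + z *\<^sub>R (\<beta> *\<^sub>R ?b)) (\<beta> *\<^sub>R ?b)"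
    proof (rule MVT2)
      fix s :: real assume "0 \<le> s" "s \<le> 1"
      then have "y0 + s *\<^sub>R (\<beta> *\<^sub>R ?b) \<in> W" using line[of s] r(2) by auto
      then show "((\<lambda>s. u (y0 + s *\<^sub>R (\<beta> *\<^sub>R ?b))) has_real_derivative \<D> u (y0 + s *\<^sub>R (\<beta> *\<^sub>R ?b)) (\<beta> *\<^sub>R ?b)) (at s)"
        by (intro has_real_derivative_along_line Cinf_on_has_derivative[OF u])
    qed simp
    then obtain z where z: "0 < z" "z < 1"
      "u y - u y0 = \<D> u (y0 + z *\<^sub>R (\<beta> *\<^sub>R ?b)) (\<beta> *\<^sub>R ?b)"
      by (auto simp: y0_def)
    have \<xi>: "y0 + z *\<^sub>R (\<beta> *\<^sub>R ?b) \<in> ball x r" using line[of z] z(1,2) by simp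
    have "y0 \<in> W" using line[of 0] r(2) by auto
    then have "u y0 = 0" by (rule zero) (simp add: y0_def \<beta>_def axis_def)
    moreover have "linear (\<D> u (y0 + z *\<^sub>R (\<beta> *\<^sub>R ?b)))"
      using Cinf_on_has_derivative[OF u] \<xi> r(2) has_derivative_linear by blast
    ultimately have "u y = \<beta> * D (y0 + z *\<^sub>R (\<beta> *\<^sub>R ?b))"
      using z(3) linear_scale[of "\<D> u (y0 + z *\<^sub>R (\<beta> *\<^sub>R ?b))" \<beta> ?b] by (simp add: D_def)
    then show ?thesis using Dpos[OF \<xi>] unfolding \<beta>_def by blast
  qed
  have "(0 < hgt y \<longrightarrow> 0 < u y) \<and> (hgt y < 0 \<longrightarrow> u y < 0)" if "y \<in> ball x r" for y
    using main[OF that] by (auto simp: mult_neg_pos)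
  then show ?thesis using r by blast
qed

section \<open>Conformal gradients, and local inverses of isometric immersions\<close>

context metric_chart
begin

text \<open>The Lie derivative of the metric along a gradient is twice the Hessian. Derivatives of
  the gradient are obtained by differentiating \<open>lower_X\<close>, so the inverse metric is not
  differentiated.\<close>

lemma lie_metric_gradient:
  assumes x: "x \<in> S" and f: "smooth_on S f"
  shows "lie_metric (local_gradient G f) G i j x = 2 * (pd i (pd j f) x - (\<Sum>k\<in>UNIV. \<Gamma> k i j x * pd k f x))"
proof -
  have lg: "local_gradient G f y $ k = X f k y" for y k
    by (simp add: local_gradient_def X_def matrix_vector_mult_def)
  have low: "(\<Sum>k\<in>UNIV. g j k x * pd i (X f k) x) = pd i (pd j f) x - (\<Sum>k\<in>UNIV. pd i (g j k) x * X f k x)" for i j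
  proof -
    have "pd i (pd j f) x = pd i (\<lambda>y. \<Sum>k\<in>UNIV. g j k y * X f k y) x"
      by (rule pd_cong[OF hopen_S x]) (simp add: lower_X)
    then show ?thesis using hopen_S x by (simp add: pd_sum pd_mult smooth_on_mult smooth_g smooth_X f sum.distrib)
  qed
  have "lie_metric (local_gradient G f) G i j x =
    (\<Sum>k\<in>UNIV. X f k x * pd k (g i j) x) + (\<Sum>k\<in>UNIV. g j k x * pd i (X f k) x) + (\<Sum>k\<in>UNIV. g i k x * pd j (X f k) x)"
    unfolding lie_metric_def lg by (simp add: sum.distrib g_sym[OF x, of _ j])
  also have "\<dots> = 2 * pd i (pd j f) x - 2 * (\<Sum>k\<in>UNIV. X f k x * C k i j x)"
    unfolding low pd_commute[OF hopen_S f x, of j i]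
    by (simp add: C_def sum_distrib_left pd_g_sym[OF x, of _ i j] field_simps flip: sum.distrib sum_subtractf)
       (simp add: add_divide_distrib)
  also have "(\<Sum>k\<in>UNIV. X f k x * C k i j x) = (\<Sum>m\<in>UNIV. \<Gamma> m i j x * (\<Sum>k\<in>UNIV. g m k x * X f k x))"
    unfolding lower_christoffel[OF x, symmetric] sum_distrib_left
    by (subst sum.swap) (simp add: mult_ac g_sym[OF x])
  finally show ?thesis by (simp add: lower_X[OF x])
qed

lemma local_laplacian_conformal:
  assumes x: "x \<in> S"
    and hess: "\<And>i j. pd i (pd j f) x = (\<Sum>k\<in>UNIV. \<Gamma> k i j x * pd k f x) + r * g i j x"
  shows "local_laplacian G f x = real CARD('n) * r"
proof -
  have "local_laplacian G f x = (\<Sum>i\<in>UNIV. r * (\<Sum>j\<in>UNIV. gi i j x * g j i x))"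
    by (simp add: local_laplacian_def local_hessian_def hess sum_distrib_left g_sym[OF x] mult_ac)
  then show ?thesis by (simp add: inv_mult[OF x])
qed

lemma frame_inverse_left:
  assumes x: "x \<in> S" and c: "c \<noteq> 0" and fr: "frame c x P F0"
  shows "frameK c x P F0 (frameA P F0 b) = b"
proof -
  have "frameA P F0 \<circ> frameK c x P F0 = id" using fr frame_iff[OF x c] by (auto simp: fun_eq_iff)
  then have "frameK c x P F0 \<circ> frameA P F0 = id"
    using linear_inverse_left[OF linear_frameA linear_frameK] by blast
  then show ?thesis by (metis comp_apply id_apply)
qed

text \<open>The map \<open>(y, s) \<mapsto> (1 + s) F(y)\<close> is a local diffeomorphism of the ambient Euclidean space.\<close>

lemma iso_map_local_inverse:
  assumes c: "c > 0" and F: "iso_map c S F" and x: "x \<in> S" and N: "open N" "x \<in> N"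
    and bd: "0 < hgt x \<or> (hgt x = 0 \<and> (\<forall>y\<in>S. hgt y = 0 \<longrightarrow> snd (F y) = 0) \<and>
       0 < pd bdry_index (\<lambda>y. snd (F y)) x)"
  shows "\<exists>U V h. open U \<and> x \<in> U \<and> open V \<and> F x \<in> V \<and> Cinf_on V h \<and>
    (\<forall>y\<in>S \<inter> U. F y \<in> V \<and> h (F y) = y) \<and>
    (\<forall>z\<in>V. z \<bullet> z = 1 / c \<longrightarrow> 0 < snd z \<longrightarrow> h z \<in> S \<inter> N \<and> F (h z) = z)"
proof -
  have sF: "smooth_on S F" using F by (simp add: iso_map_def)
  have c0: "c \<noteq> 0" using c by simp
  obtain W0 F1 where W0: "x \<in> W0" "Cinf_on W0 F1" "half_space \<inter> W0 \<subseteq> S" "\<And>y. y \<in> half_space \<inter> W0 \<Longrightarrow> F1 y = F y"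
    using smooth_on_hopenE[OF hopen_S sF x] by blast
  define u where "u y = snd (F1 y)" for y
  have Cu: "Cinf_on W0 u" unfolding u_def by (rule Cinf_on_linear[OF bounded_linear_snd W0(2)])
  \<comment> \<open>The inverse function theorem is applied to an extension beyond the half-space.
    On \<open>W1\<close> positive height already forces a point into the half-space, which excludes
    spurious preimages.\<close>
  obtain W1 where W1: "open W1" "x \<in> W1" "W1 \<subseteq> W0" "\<And>y. y \<in> W1 \<Longrightarrow> 0 < u y \<Longrightarrow> y \<in> half_space"
  proof (cases "0 < hgt x")
    case True
    have "open (W0 \<inter> {y. 0 < hgt y})"
      by (intro open_Int Cinf_on_open[OF W0(2)] open_Collect_less continuous_intros)
    then show ?thesis using that[of "W0 \<inter> {y. 0 < hgt y}"] W0(1) True by (auto simp: half_space_def)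
  next
    case False
    then have b: "hgt x = 0" "\<And>y. y \<in> S \<Longrightarrow> hgt y = 0 \<Longrightarrow> snd (F y) = 0"
      "0 < pd bdry_index (\<lambda>y. snd (F y)) x" using bd by auto
    have z: "u y = 0" if "y \<in> W0" "hgt y = 0" for y
    proof -
      have "y \<in> half_space \<inter> W0" using that by (simp add: half_space_def)
      then show ?thesis using W0(3,4) that(2) b(2)[of y] by (auto simp: u_def)
    qed
    have p: "0 < \<D> u x (axis bdry_index 1)"
      using pd_smooth_ext[OF in_half[OF x] W0(1) Cu, of "\<lambda>y. snd (F y)" bdry_index] W0(4) b(3) by (simp add: u_def)
    obtain r where r: "r > 0" "ball x r \<subseteq> W0" "\<And>y. y \<in> ball x r \<Longrightarrow> hgt y < 0 \<Longrightarrow> u y < 0"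
      using boundary_sign[OF Cu W0(1) b(1) z p] by blast
    have "y \<in> half_space" if "y \<in> ball x r" "0 < u y" for y
      using r(3)[OF that(1)] that(2) by (force simp: half_space_def not_less[symmetric])
    then show ?thesis using that[of "ball x r"] r(1,2) by auto
  qed
  \<comment> \<open>The interval keeps \<open>1 + s\<close> positive. So \<open>(1 + s) F\<close>
    has the same sign of height as \<open>F\<close>, and it lies on the sphere only for
    \<open>s = 0\<close>.\<close>
  define U0 where "U0 = (W1 \<inter> N) \<times> {-1/2<..<1/2::real}"
  have oU0: "open U0" unfolding U0_def by (intro open_Times open_Int W1 N) auto
  define \<Psi> where "\<Psi> p = (1 + snd p) *\<^sub>R F1 (fst p)" for p
  have C\<Psi>: "Cinf_on U0 \<Psi>"
  proof -
    have 1: "Cinf_on U0 (\<lambda>p. fst p)" "Cinf_on U0 (\<lambda>p. snd p)"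
      unfolding Cinf_on_def using oU0 Ck_on_bounded_linear[OF bounded_linear_fst oU0] Ck_on_bounded_linear[OF bounded_linear_snd oU0] by auto
    have "Cinf_on U0 (\<lambda>p. F1 (fst p))" by (rule Cinf_on_compose[OF W0(2) 1(1)]) (use W1 in \<open>auto simp: U0_def\<close>)
    then show ?thesis unfolding \<Psi>_def
      by (intro Cinf_on_bilinear[OF bounded_bilinear_scaleR] Cinf_on_add Cinf_on_const oU0 1)
  qed
  have x0: "(x, 0) \<in> U0" using W1 N by (simp add: U0_def)
  note fr = iso_map_frame[OF F x]
  have D\<Psi>: "\<D> \<Psi> (x, 0) v = frameA (\<lambda>i. pd i F x) (F x) v" for v
  proof -
    have dF: "(F1 has_derivative \<D> F1 x) (at x)" by (rule Cinf_on_has_derivative[OF W0(2,1)])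
    have lin: "linear (\<D> F1 x)" using dF has_derivative_linear by blast
    have "(\<Psi> has_derivative (\<lambda>h. (1 + snd (x, 0::real)) *\<^sub>R \<D> F1 x (fst h) + (0 + snd h) *\<^sub>R F1 (fst (x, 0::real)))) (at (x, 0))"
      unfolding \<Psi>_def
      by (rule bounded_bilinear.FDERIV[OF bounded_bilinear_scaleR])
         (auto intro!: derivative_eq_intros has_derivative_compose[where g = F1, OF has_derivative_fst[OF has_derivative_ident]] simp: dF)
    from frechet_derivative_at[OF this, symmetric]
    have "\<D> \<Psi> (x, 0) v = \<D> F1 x (fst v) + snd v *\<^sub>R F1 x" by simp
    also have "\<D> F1 x (fst v) = (\<Sum>i\<in>UNIV. fst v $ i *\<^sub>R \<D> F1 x (axis i 1))"
      by (rule linear_axis_expansion[OF lin])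
    also have "\<dots> = (\<Sum>i\<in>UNIV. fst v $ i *\<^sub>R pd i F x)"
      using pd_smooth_ext[OF in_half[OF x] W0(1,2), of F] W0(4) by simp
    finally show ?thesis using W0(1,4) in_half[OF x] by (simp add: frameA_def)
  qed
  obtain U' V g where g: "open U'" "U' \<subseteq> U0" "(x, 0) \<in> U'" "open V" "\<Psi> (x, 0) \<in> V" "homeomorphism U' V \<Psi> g" "Cinf_on V g"
    using smooth_inverse_function[OF C\<Psi> x0 linear_frameK, of c x "\<lambda>i. pd i F x" "F x"] frame_inverse_left[OF x c0 fr] D\<Psi> by metis
  define U where "U = {y. (y, 0) \<in> U'}"
  define h where "h z = fst (g z)" for z
  have oU: "open U"
  proof -
    have "open ((\<lambda>y. (y, 0::real)) -` U')" by (intro open_vimage g continuous_intros)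
    then show ?thesis by (simp add: U_def vimage_def)
  qed
  have Fx: "F1 x = F x" using W0 in_half[OF x] by simp
  have "F x \<in> V" using g(5) by (simp add: \<Psi>_def Fx)
  moreover have "Cinf_on V h" unfolding h_def by (rule Cinf_on_linear[OF bounded_linear_fst g(7)])
  moreover have "F y \<in> V \<and> h (F y) = y" if y: "y \<in> S \<inter> U" for y
  proof -
    have yU: "(y, 0) \<in> U'" using y by (simp add: U_def)
    then have "y \<in> W0" using g(2) W1(3) by (auto simp: U0_def)
    then have "F1 y = F y" using W0(4) y in_half by blast
    then have "\<Psi> (y, 0) = F y" by (simp add: \<Psi>_def)
    then show ?thesis using g(6) yU unfolding homeomorphism_def h_def by (metis fst_conv imageI)
  qed
  moreover have "h z \<in> S \<inter> N \<and> F (h z) = z" if z: "z \<in> V" "z \<bullet> z = 1 / c" "0 < snd z" for z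
  proof -
    obtain y s where ys: "g z = (y, s)" by (cases "g z")
    have "(y, s) \<in> U'" "\<Psi> (y, s) = z" using g(6) z(1) ys unfolding homeomorphism_def by (metis imageI)+
    then have zy: "z = (1 + s) *\<^sub>R F1 y" and y: "y \<in> W1" "y \<in> N" and s: "-1/2 < s" "s < 1/2"
      using g(2) by (auto simp: \<Psi>_def U0_def)
    have "0 < u y" using z(3) s(1) by (simp add: zy u_def zero_less_mult_iff)
    then have yS: "y \<in> S" "F1 y = F y" using W1(3,4) W0(3,4) y(1) by blast+
    have "F y \<bullet> F y = 1 / c" using F yS(1) by (simp add: iso_map_def)
    then have "(1 + s) * (1 + s) * (1 / c) = 1 / c" using z(2) by (simp add: zy yS(2))
    then have "(1 + s)\<^sup>2 = 1" using c by (simp add: power2_eq_square)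
    then have "s = 0" using s(1) by (simp add: power2_eq_1_iff)
    then have "F y = z" using zy yS(2) by simp
    moreover have "h z = y" by (simp add: h_def ys)
    ultimately show ?thesis using yS(1) y(2) by simp
  qed
  ultimately show ?thesis using oU g(3,4) by (intro exI[of _ U] exI[of _ V] exI[of _ h]) (auto simp: U_def)
qed

end

section \<open>Local isometries into the sphere\<close>

lemma hopen_half_ball: "hopen (half_ball x r)"
  by (simp add: openin_open_Int)

locale riemannian_mfd =
  fixes M :: "('m, 'n::finite) riemannian"
  assumes rm: "riemannian_manifold M"
begin

section \<open>Charts, coordinate changes and the topology of the manifold\<close>

abbreviation "T \<equiv> space_top M"
abbreviation "Gm d \<equiv> metric_comp M d"

lemma mwb: "manifold_with_boundary M" using rm by (simp add: riemannian_manifold_def)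

lemma Hausdorff_T: "Hausdorff_space T" using mwb by (simp add: manifold_with_boundary_def)

lemma chart_cover: "p \<in> topspace T \<Longrightarrow> \<exists>d\<in>atlas M. p \<in> fst d"
  using mwb by (simp add: manifold_with_boundary_def)

lemma
  assumes "d \<in> atlas M"
  shows chart_open: "openin T (fst d)" and image_hopen: "hopen (image_of d)"
    and chart_homeo: "homeomorphic_map (subtopology T (fst d)) (top_of_set (image_of d)) (snd d)"
  using mwb assms by (auto simp: manifold_with_boundary_def)

lemma chart_subset: "d \<in> atlas M \<Longrightarrow> fst d \<subseteq> topspace T"
  using chart_open openin_subset by blast

lemma metric_chart_image: assumes "d \<in> atlas M" shows "metric_chart (image_of d) (Gm d)"
  using rm assms image_hopen by unfold_locales (auto simp: riemannian_manifold_def)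

lemma chart_inj: assumes "d \<in> atlas M" shows "inj_on (snd d) (fst d)"
  using homeomorphic_imp_injective_map[OF chart_homeo[OF assms]] chart_subset[OF assms]
  by (simp add: topspace_subtopology Int_absorb1)

lemma param_coord: "d \<in> atlas M \<Longrightarrow> p \<in> fst d \<Longrightarrow> param d (snd d p) = p"
  unfolding param_def using chart_inj by (simp add: inv_into_f_f)

lemma coord_in: "p \<in> fst d \<Longrightarrow> snd d p \<in> image_of d"
  by (simp add: image_of_def)

lemma param_in: "x \<in> image_of d \<Longrightarrow> param d x \<in> fst d"
  unfolding param_def image_of_def by (rule inv_into_into)

lemma coord_param: "x \<in> image_of d \<Longrightarrow> snd d (param d x) = x"
  unfolding param_def image_of_def by (rule f_inv_into_f)

lemma coord_image_eq: assumes "d \<in> atlas M" shows "snd d ` (fst d \<inter> U) = {x \<in> image_of d. param d x \<in> U}"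
proof
  show "snd d ` (fst d \<inter> U) \<subseteq> {x \<in> image_of d. param d x \<in> U}"
    using param_coord[OF assms] coord_in[where d = d] by auto
  show "{x \<in> image_of d. param d x \<in> U} \<subseteq> snd d ` (fst d \<inter> U)"
  proof
    fix x assume "x \<in> {x \<in> image_of d. param d x \<in> U}"
    then show "x \<in> snd d ` (fst d \<inter> U)" using coord_param[of x d] param_in[of x d] by (intro image_eqI[of _ _ "param d x"]) auto
  qed
qed

lemma coord_hopen: assumes "d \<in> atlas M" "openin T U" shows "hopen (snd d ` (fst d \<inter> U))"
proof -
  have "openin (subtopology T (fst d)) (fst d \<inter> U)"
    using assms(2) by (simp add: openin_subtopology_Int2)
  then have "openin (top_of_set (image_of d)) (snd d ` (fst d \<inter> U))"
    using homeomorphic_imp_open_map[OF chart_homeo[OF assms(1)]] unfolding open_map_def by blast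
  then show ?thesis using image_hopen[OF assms(1)] openin_trans by blast
qed

lemma param_image:
  assumes "X \<subseteq> image_of d"
  shows "q \<in> param d ` X \<Longrightarrow> q \<in> fst d" "q \<in> param d ` X \<Longrightarrow> snd d q \<in> X" "snd d ` (param d ` X) = X"
proof -
  have *: "param d y \<in> fst d" "snd d (param d y) = y" if "y \<in> X" for y
    using assms that param_in[of y d] coord_param[of y d] by auto
  show "q \<in> param d ` X \<Longrightarrow> q \<in> fst d" "q \<in> param d ` X \<Longrightarrow> snd d q \<in> X" using * by auto
  show "snd d ` (param d ` X) = X" using * by (force simp: image_image)
qed

lemma param_imageI: "d \<in> atlas M \<Longrightarrow> p \<in> fst d \<Longrightarrow> snd d p \<in> X \<Longrightarrow> p \<in> param d ` X"
  using param_coord[of d p] by (intro image_eqI[of _ _ "snd d p"]) auto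

lemma param_open: assumes d: "d \<in> atlas M" and V: "hopen V" "V \<subseteq> image_of d" shows "openin T (param d ` V)"
proof -
  have "continuous_map (subtopology T (fst d)) (top_of_set (image_of d)) (snd d)"
    using homeomorphic_imp_continuous_map[OF chart_homeo[OF d]] .
  moreover have "openin (top_of_set (image_of d)) V"
    using V image_hopen[OF d] by (meson hopen_subset openin_subset_trans)
  ultimately have "openin (subtopology T (fst d)) {p \<in> topspace (subtopology T (fst d)). snd d p \<in> V}"
    by (rule openin_continuous_map_preimage)
  moreover have "{p \<in> topspace (subtopology T (fst d)). snd d p \<in> V} = param d ` V"
  proof -
    have "topspace (subtopology T (fst d)) = fst d" using chart_subset[OF d] by (simp add: topspace_subtopology Int_absorb1)
    moreover have "{p \<in> fst d. snd d p \<in> V} = param d ` V"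
    proof
      show "{p \<in> fst d. snd d p \<in> V} \<subseteq> param d ` V"
      proof
        fix p assume "p \<in> {p \<in> fst d. snd d p \<in> V}"
        then show "p \<in> param d ` V" using param_coord[OF d, of p] by (intro image_eqI[of _ _ "snd d p"]) auto
      qed
      show "param d ` V \<subseteq> {p \<in> fst d. snd d p \<in> V}" using V(2) param_in[where d = d] coord_param[where d = d] by (auto simp: subset_iff)
    qed
    ultimately show ?thesis by simp
  qed
  ultimately show ?thesis using openin_trans_full[OF _ chart_open[OF d]] by simp
qed

lemma openin_preimage_charts:
  assumes U: "openin T U" and u: "\<And>d. d \<in> atlas M \<Longrightarrow> continuous_on (snd d ` (fst d \<inter> U)) (u \<circ> param d)" and B: "open B"
  shows "openin T {p \<in> U. u p \<in> B}"
  unfolding openin_subopen[of T "{p \<in> U. u p \<in> B}"]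
proof
  fix p assume p: "p \<in> {p \<in> U. u p \<in> B}"
  then obtain d where d: "d \<in> atlas M" "p \<in> fst d" using U openin_subset chart_cover by blast
  let ?X = "snd d ` (fst d \<inter> U)"
  have hX: "hopen ?X" by (rule coord_hopen[OF d(1) U])
  have "openin (top_of_set ?X) (?X \<inter> (u \<circ> param d) -` B)"
    by (rule continuous_openin_preimage_gen[OF u[OF d(1)] B])
  then have h: "hopen (?X \<inter> (u \<circ> param d) -` B)" using hX openin_trans by blast
  have sub: "?X \<inter> (u \<circ> param d) -` B \<subseteq> image_of d" by (auto simp: image_of_def)
  have "openin T (param d ` (?X \<inter> (u \<circ> param d) -` B))" by (rule param_open[OF d(1) h sub])
  moreover have "p \<in> param d ` (?X \<inter> (u \<circ> param d) -` B)"
    using p d param_coord[OF d] by (intro image_eqI[of _ _ "snd d p"]) auto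
  moreover have "param d ` (?X \<inter> (u \<circ> param d) -` B) \<subseteq> {p \<in> U. u p \<in> B}"
    using coord_image_eq[OF d(1), of U] by auto
  ultimately show "\<exists>S. openin T S \<and> p \<in> S \<and> S \<subseteq> {p \<in> U. u p \<in> B}" by blast
qed

lemma transition_coord: "c \<in> atlas M \<Longrightarrow> p \<in> fst c \<Longrightarrow> transition c d (snd c p) = snd d p"
  by (simp add: transition_def param_coord)

lemma smooth_transition: "c \<in> atlas M \<Longrightarrow> d \<in> atlas M \<Longrightarrow> smooth_on (snd c ` (fst c \<inter> fst d)) (transition c d)"
  using mwb by (simp add: manifold_with_boundary_def)

lemma jacobian_nth:
  "transition_jacobian c d p $ a $ i = pd i (transition c d) (snd c p) $ a"
  by (simp add: transition_jacobian_def jacobian_def matrix_def pd_def)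

lemma metric_change:
  assumes "c \<in> atlas M" "d \<in> atlas M" "p \<in> fst c" "p \<in> fst d"
  shows "Gm c (snd c p) $ i $ j = (\<Sum>a\<in>UNIV. \<Sum>b\<in>UNIV.
    pd i (transition c d) (snd c p) $ a * pd j (transition c d) (snd c p) $ b * Gm d (snd d p) $ a $ b)"
proof -
  have "Gm c (snd c p) = transpose (transition_jacobian c d p) ** Gm d (snd d p) ** transition_jacobian c d p"
    using rm assms unfolding riemannian_manifold_def by blast
  then have "Gm c (snd c p) $ i $ j = (\<Sum>b\<in>UNIV. (\<Sum>a\<in>UNIV. pd i (transition c d) (snd c p) $ a * Gm d (snd d p) $ a $ b) * pd j (transition c d) (snd c p) $ b)"
    by (simp add: matrix_matrix_mult_def transpose_def jacobian_nth)
  also have "\<dots> = (\<Sum>a\<in>UNIV. \<Sum>b\<in>UNIV. pd i (transition c d) (snd c p) $ a * pd j (transition c d) (snd c p) $ b * Gm d (snd d p) $ a $ b)"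
    unfolding sum_distrib_right by (subst sum.swap) (simp add: mult_ac)
  finally show ?thesis .
qed

lemma chart_change:
  assumes c: "c \<in> atlas M" and d: "d \<in> atlas M" and U: "openin T U" "U \<subseteq> fst c" "U \<subseteq> fst d"
    and u: "smooth_on (snd d ` U) (u \<circ> param d)"
  shows "smooth_on (snd c ` U) (u \<circ> param c)"
    and "p \<in> U \<Longrightarrow> pd i (u \<circ> param c) (snd c p) =
      (\<Sum>a\<in>UNIV. pd i (transition c d) (snd c p) $ a *\<^sub>R pd a (u \<circ> param d) (snd d p))"
proof -
  have hc: "hopen (snd c ` U)" "hopen (snd d ` U)"
    using coord_hopen[OF c U(1)] coord_hopen[OF d U(1)] U(2,3) by (simp_all add: Int_absorb1)
  have eq: "(u \<circ> param c) y = (u \<circ> param d) (transition c d y)" and into: "transition c d y \<in> snd d ` U" if y: "y \<in> snd c ` U" for y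
  proof -
    obtain q where q: "q \<in> U" "y = snd c q" using y by blast
    have qq: "q \<in> fst c" "q \<in> fst d" using q U by blast+
    have "transition c d y = snd d q" unfolding q(2) by (rule transition_coord[OF c qq(1)])
    then show "(u \<circ> param c) y = (u \<circ> param d) (transition c d y)" "transition c d y \<in> snd d ` U"
      using q param_coord[OF c qq(1)] param_coord[OF d qq(2)] by auto
  qed
  have sT: "smooth_on (snd c ` U) (transition c d)"
    by (rule smooth_on_subset[OF smooth_transition[OF c d]]) (use U in blast)
  have "smooth_on (snd c ` U) (\<lambda>y. (u \<circ> param d) (transition c d y))"
    by (rule smooth_on_compose[OF u sT into])
  then show "smooth_on (snd c ` U) (u \<circ> param c)" by (rule smooth_on_cong) (simp only: eq)
  assume p: "p \<in> U"
  then have y: "snd c p \<in> snd c ` U" by blast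
  have "pd i (u \<circ> param c) (snd c p) = pd i (\<lambda>y. (u \<circ> param d) (transition c d y)) (snd c p)"
    by (rule pd_cong[OF hc(1) y]) (rule eq)
  also have "\<dots> = (\<Sum>a\<in>UNIV. pd i (transition c d) (snd c p) $ a *\<^sub>R pd a (u \<circ> param d) (transition c d (snd c p)))"
    by (rule pd_chain[OF hc(1) sT hc(2) u y into])
  also have "transition c d (snd c p) = snd d p" by (rule transition_coord[OF c]) (use p U in blast)
  finally show "pd i (u \<circ> param c) (snd c p) =
      (\<Sum>a\<in>UNIV. pd i (transition c d) (snd c p) $ a *\<^sub>R pd a (u \<circ> param d) (snd d p))" .
qed

text \<open>Besides being isometric, the map has its last coordinate prescribed. This ties it to
  \<open>H\<close>, so that \<open>H\<close> measures the height on the sphere and later detects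
  both the pole and the equator.\<close>

definition giso :: "real \<Rightarrow> ('m \<Rightarrow> real) \<Rightarrow> 'm set \<Rightarrow> ('m \<Rightarrow> (real ^ 'n) \<times> real) \<Rightarrow> bool"
  where "giso c H U F \<longleftrightarrow> openin T U \<and>
    (\<forall>d\<in>atlas M. metric_chart.iso_map (Gm d) c (snd d ` (fst d \<inter> U)) (F \<circ> param d)) \<and>
    (\<forall>p\<in>U. snd (F p) = H p)"

text \<open>One chart near each point suffices: the transformation law of the metric is that of the
  Gram matrix of the partial derivatives.\<close>

lemma giso_localI:
  assumes U: "openin T U"
    and loc: "\<And>p. p \<in> U \<Longrightarrow> \<exists>d\<in>atlas M. \<exists>V. openin T V \<and> p \<in> V \<and> V \<subseteq> U \<and> V \<subseteq> fst d \<and>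
      metric_chart.iso_map (Gm d) c (snd d ` V) (F \<circ> param d) \<and> (\<forall>q\<in>V. snd (F q) = H q)"
  shows "giso c H U F"
  unfolding giso_def
proof (intro conjI ballI U)
  show "snd (F p) = H p" if "p \<in> U" for p using loc[OF that] by blast
  fix e assume e: "e \<in> atlas M"
  let ?X = "snd e ` (fst e \<inter> U)"
  interpret E: metric_chart "image_of e" "Gm e" by (rule metric_chart_image[OF e])
  have main: "\<exists>W. open W \<and> x \<in> W \<and> smooth_on (?X \<inter> W) (F \<circ> param e) \<and>
     (\<forall>i j. pd i (F \<circ> param e) x \<bullet> pd j (F \<circ> param e) x = Gm e x $ i $ j) \<and> (F \<circ> param e) x \<bullet> (F \<circ> param e) x = 1 / c"
    if x: "x \<in> ?X" for x
  proof -
    obtain p where p: "p \<in> fst e" "p \<in> U" "x = snd e p" using x by blast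
    obtain d V0 where d: "d \<in> atlas M" "openin T V0" "p \<in> V0" "V0 \<subseteq> U" "V0 \<subseteq> fst d"
      "metric_chart.iso_map (Gm d) c (snd d ` V0) (F \<circ> param d)" using loc[OF p(2)] by blast
    interpret D: metric_chart "image_of d" "Gm d" by (rule metric_chart_image[OF d(1)])
    define V where "V = V0 \<inter> fst e"
    have V: "openin T V" "p \<in> V" "V \<subseteq> U" "V \<subseteq> fst d" "V \<subseteq> fst e"
      using d p chart_open[OF e] by (auto simp: V_def)
    have iso: "smooth_on (snd d ` V) (F \<circ> param d)" "\<And>q i j. q \<in> V \<Longrightarrow> pd i (F \<circ> param d) (snd d q) \<bullet> pd j (F \<circ> param d) (snd d q) = Gm d (snd d q) $ i $ j"
      "\<And>q. q \<in> V \<Longrightarrow> F q \<bullet> F q = 1 / c"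
      using d(6) smooth_on_subset[of "snd d ` V0" "F \<circ> param d" "snd d ` V"] param_coord[OF d(1)] d(5)
      unfolding D.iso_map_def by (auto simp: V_def subset_iff) 
    note cc = chart_change[OF e d(1) V(1,5,4) iso(1)]
    have hV: "hopen (snd e ` V)" using coord_hopen[OF e V(1)] V(5) by (simp add: Int_absorb1)
    then obtain W where W: "open W" "snd e ` V = half_space \<inter> W" by (auto simp: openin_open)
    have "?X \<inter> W \<subseteq> snd e ` V"
      using W(2) hopen_subset[OF image_hopen[OF e]] by (auto simp: image_of_def)
    then have "smooth_on (?X \<inter> W) (F \<circ> param e)" using cc(1) smooth_on_subset by blast
    moreover have "x \<in> W" using W(2) V(2) p(3) by blast
    moreover have "pd i (F \<circ> param e) x \<bullet> pd j (F \<circ> param e) x = Gm e x $ i $ j" for i j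
      unfolding p(3) cc(2)[OF V(2)] metric_change[OF e d(1) p(1) V(4)[THEN subsetD, OF V(2)]]
      by (simp add: inner_sum_left inner_sum_right iso(2)[OF V(2)] sum_distrib_left mult_ac) (rule sum.swap)
    moreover have "(F \<circ> param e) x \<bullet> (F \<circ> param e) x = 1 / c"
      using iso(3)[OF V(2)] param_coord[OF e p(1)] by (simp add: p(3))
    ultimately show ?thesis using W(1) by blast
  qed
  have "smooth_on ?X (F \<circ> param e)" by (rule smooth_on_local) (use main in blast)
  then show "metric_chart.iso_map (Gm e) c ?X (F \<circ> param e)" using main unfolding E.iso_map_def by blast
qed

lemma gisoD:
  assumes "giso c H U F"
  shows "openin T U" "d \<in> atlas M \<Longrightarrow> metric_chart.iso_map (Gm d) c (snd d ` (fst d \<inter> U)) (F \<circ> param d)"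
    "p \<in> U \<Longrightarrow> snd (F p) = H p"
  using assms by (auto simp: giso_def)

lemma metric_chart_coord:
  assumes "d \<in> atlas M" "openin T U" shows "metric_chart (snd d ` (fst d \<inter> U)) (Gm d)"
  using metric_chart.metric_chart_subset[OF metric_chart_image[OF assms(1)] coord_hopen[OF assms]]
  by (auto simp: image_of_def)

lemma iso_map_subset: assumes "d \<in> atlas M" "metric_chart.iso_map (Gm d) c X F" "Y \<subseteq> X"
  shows "metric_chart.iso_map (Gm d) c Y F"
  using assms(2,3) smooth_on_subset[of X F Y]
  unfolding metric_chart.iso_map_def[OF metric_chart_image[OF assms(1)]] by blast

lemma iso_map_cong: assumes d: "d \<in> atlas M" and F: "metric_chart.iso_map (Gm d) c X F" and X: "hopen X" and eq: "\<And>x. x \<in> X \<Longrightarrow> F x = F' x"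
  shows "metric_chart.iso_map (Gm d) c X F'"
proof -
  note def = metric_chart.iso_map_def[OF metric_chart_image[OF d]]
  have "smooth_on X F'" using F smooth_on_cong[of X F F'] eq unfolding def by blast
  moreover have "pd i F' x = pd i F x" "F' x = F x" if "x \<in> X" for i x
    using pd_cong[OF X that eq] eq[OF that] by simp_all
  ultimately show ?thesis using F unfolding def by simp
qed

lemma giso_local:
  assumes "openin T U" "\<And>p. p \<in> U \<Longrightarrow> \<exists>V F'. openin T V \<and> p \<in> V \<and> giso c H V F' \<and> (\<forall>q\<in>V. F' q = F q)"
  shows "giso c H U F"
proof (rule giso_localI[OF assms(1)])
  fix p assume p: "p \<in> U"
  from assms(2)[OF p] obtain V0 F' where "openin T V0 \<and> p \<in> V0 \<and> giso c H V0 F' \<and> (\<forall>q\<in>V0. F' q = F q)"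
    by (elim exE)
  then have V0: "openin T V0" "p \<in> V0" "giso c H V0 F'" "q \<in> V0 \<Longrightarrow> F' q = F q" for q by auto
  obtain d where d: "d \<in> atlas M" "p \<in> fst d" using assms(1) openin_subset p chart_cover by blast
  define V where "V = V0 \<inter> U \<inter> fst d"
  have V: "openin T V" "p \<in> V" "V \<subseteq> U" "V \<subseteq> fst d" "V \<subseteq> V0" using V0 assms(1) p d chart_open[OF d(1)] by (auto simp: V_def)
  have hV: "hopen (snd d ` V)" using coord_hopen[OF d(1) V(1)] V(4) by (simp add: Int_absorb1)
  have "metric_chart.iso_map (Gm d) c (snd d ` V) (F' \<circ> param d)"
    by (rule iso_map_subset[OF d(1) gisoD(2)[OF V0(3) d(1)]]) (use V in blast)
  then have "metric_chart.iso_map (Gm d) c (snd d ` V) (F \<circ> param d)"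
  proof (rule iso_map_cong[OF d(1) _ hV])
    fix x assume "x \<in> snd d ` V"
    then obtain q where q: "q \<in> V" "x = snd d q" by blast
    then have "q \<in> fst d" "q \<in> V0" using V by blast+
    then show "(F' \<circ> param d) x = (F \<circ> param d) x" using V0(4) param_coord[OF d(1)] q(2) by simp
  qed
  moreover have "\<forall>q\<in>V. snd (F q) = H q" using V(5) V0(4) gisoD(3)[OF V0(3)] by force
  ultimately show "\<exists>d\<in>atlas M. \<exists>V. openin T V \<and> p \<in> V \<and> V \<subseteq> U \<and> V \<subseteq> fst d \<and>
      metric_chart.iso_map (Gm d) c (snd d ` V) (F \<circ> param d) \<and> (\<forall>q\<in>V. snd (F q) = H q)"
    using V d by blast
qed

lemma giso_subset: "giso c H U F \<Longrightarrow> openin T V \<Longrightarrow> V \<subseteq> U \<Longrightarrow> giso c H V F"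
  by (rule giso_local) (auto dest: gisoD(1))

lemma giso_preimage: assumes F: "giso c H U F" and B: "open B" shows "openin T {p \<in> U. F p \<in> B}"
proof (rule openin_preimage_charts[OF gisoD(1)[OF F] _ B])
  fix d assume d: "d \<in> atlas M"
  show "continuous_on (snd d ` (fst d \<inter> U)) (F \<circ> param d)"
    using gisoD(2)[OF F d] unfolding metric_chart.iso_map_def[OF metric_chart_image[OF d]] by (blast intro: smooth_on_continuous)
qed

lemma giso_norm: assumes F: "giso c H U F" and p: "p \<in> U" shows "F p \<bullet> F p = 1 / c"
proof -
  obtain d where d: "d \<in> atlas M" "p \<in> fst d" using gisoD(1)[OF F] openin_subset p chart_cover by blast
  then have "(F \<circ> param d) (snd d p) \<bullet> (F \<circ> param d) (snd d p) = 1 / c" using gisoD(2)[OF F d(1)] p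
    unfolding metric_chart.iso_map_def[OF metric_chart_image[OF d(1)]] by blast
  then show ?thesis using param_coord[OF d] by simp
qed

text \<open>Equality of germs rather than of values, so that the set is open by
  construction.\<close>

definition agree :: "('m \<Rightarrow> 'v) \<Rightarrow> ('m \<Rightarrow> 'v) \<Rightarrow> 'm set"
  where "agree F F' = \<Union>{N. openin T N \<and> (\<forall>q\<in>N. F q = F' q)}"

lemma openin_agree: "openin T (agree F F')"
  unfolding agree_def by (rule openin_Union) blast

lemma agreeI: "openin T N \<Longrightarrow> p \<in> N \<Longrightarrow> (\<And>q. q \<in> N \<Longrightarrow> F q = F' q) \<Longrightarrow> p \<in> agree F F'"
  unfolding agree_def by blast

lemma agree_eq: "p \<in> agree F F' \<Longrightarrow> F p = F' p"
  unfolding agree_def by blast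

lemma half_ball_nbhd:
  assumes d: "d \<in> atlas M" "p \<in> fst d" and U: "openin T U" "p \<in> U"
  shows "\<exists>r>0. half_ball (snd d p) r \<subseteq> snd d ` (fst d \<inter> U)"
proof -
  obtain W where W: "open W" "snd d ` (fst d \<inter> U) = half_space \<inter> W" using coord_hopen[OF d(1) U(1)] by (auto simp: openin_open)
  then have "snd d p \<in> W" using d(2) U(2) by blast
  then obtain r where "r > 0" "ball (snd d p) r \<subseteq> W" using W(1) openE by blast
  then show ?thesis using W(2) by blast
qed

text \<open>Unique continuation. Around a limit point take a convex half ball; it contains an
  interior point near which the maps coincide, and there all their coordinate functions have equal
  jets. Uniqueness of solutions spreads the equality over the half ball.\<close>

lemma agree_closed:
  assumes c: "c \<noteq> 0" and F: "giso c H U F" and F': "giso c H' U F'" and p: "p \<in> U"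
    and cl: "p \<in> T closure_of agree F F'"
  shows "p \<in> agree F F'"
proof -
  obtain d where d: "d \<in> atlas M" "p \<in> fst d" using gisoD(1)[OF F] openin_subset p chart_cover by blast
  interpret D: metric_chart "image_of d" "Gm d" by (rule metric_chart_image[OF d(1)])
  obtain r where r: "r > 0" "half_ball (snd d p) r \<subseteq> snd d ` (fst d \<inter> U)"
    using half_ball_nbhd[OF d gisoD(1)[OF F] p] by blast
  define X where "X = half_ball (snd d p) r"
  have X: "hopen X" "X \<subseteq> image_of d" "convex X" unfolding X_def using r(2) D.convex_half_ball by (auto simp: hopen_half_ball image_of_def)
  have pX: "snd d p \<in> X" using D.in_half[OF coord_in[OF d(2)]] r(1) by (simp add: X_def)
  interpret X: metric_chart X "Gm d" by (rule D.metric_chart_subset[OF X(1,2)])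
  have isoF: "D.iso_map c X (F \<circ> param d)" "D.iso_map c X (F' \<circ> param d)"
    using iso_map_subset[OF d(1) gisoD(2)[OF F d(1)]] iso_map_subset[OF d(1) gisoD(2)[OF F' d(1)]] r(2) by (auto simp: X_def)
  have oX: "openin T (param d ` X)" by (rule param_open[OF d(1) X(1,2)])
  have pin: "p \<in> param d ` X" using pX param_coord[OF d] by force
  then obtain q where q: "q \<in> agree F F'" "q \<in> param d ` X" using cl oX by (auto simp: in_closure_of)
  define Y where "Y = snd d ` (fst d \<inter> agree F F') \<inter> X"
  have hY: "hopen Y" unfolding Y_def using coord_hopen[OF d(1) openin_agree] X(1) by blast
  obtain x where x: "x \<in> X" "q = param d x" using q(2) by blast
  then have "x \<in> image_of d" using X(2) by blast
  then have "snd d q = x" "q \<in> fst d" unfolding x(2) by (rule coord_param, rule param_in)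
  then have "snd d q \<in> Y" using q(1) x(1) unfolding Y_def by blast
  then obtain y0 where y0: "y0 \<in> Y" "0 < hgt y0" using hopen_interior_dense[OF hY _ open_UNIV] by auto
  have eqY: "(F \<circ> param d) y = (F' \<circ> param d) y" if "y \<in> Y" for y
    using that agree_eq param_coord[OF d(1)] by (auto simp: Y_def)
  have eqX: "(F \<circ> param d) x = (F' \<circ> param d) x" if x: "x \<in> X" for x
  proof (rule euclidean_eqI)
    fix z :: "(real ^ 'n) \<times> real"
    let ?u = "\<lambda>x. (F \<circ> param d) x \<bullet> z" and ?w = "\<lambda>x. (F' \<circ> param d) x \<bullet> z"
    have "jet ?u y0 = jet ?w y0"
      using pd_cong[OF hY y0(1), of ?u ?w] eqY y0(1) by (simp add: jet_def)
    then show "?u x = ?w x"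
      using X.solution_unique[OF X.iso_map_solves[OF c isoF(1)] X.iso_map_solves[OF c isoF(2)] X(3) _ y0(2) _ x] y0(1)
      by (auto simp: Y_def)
  qed
  show ?thesis
    by (rule agreeI[OF oX pin]) (use eqX in auto)
qed

lemma interior_dense:
  assumes G: "openin T G" "q \<in> G" and d: "d \<in> atlas M" "q \<in> fst d"
  shows "\<exists>q'\<in>G \<inter> fst d. 0 < hgt (snd d q')"
  using hopen_interior_dense[OF coord_hopen[OF d(1) G(1)] _ open_UNIV UNIV_I, of "snd d q"] G(2) d(2) by blast

lemma pd_zero_at_interior_max:
  assumes d: "d \<in> atlas M" "p \<in> fst d" "0 < hgt (snd d p)" and u: "smooth_on (image_of d) (u \<circ> param d)"
    and N: "openin T N" "p \<in> N" and max: "\<And>q. q \<in> N \<Longrightarrow> u q \<le> (u p :: real)"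
  shows "pd i (u \<circ> param d) (snd d p) = 0"
proof -
  interpret D: metric_chart "image_of d" "Gm d" by (rule metric_chart_image[OF d(1)])
  let ?h = "u \<circ> param d" and ?x = "snd d p"
  note xi = coord_in[OF d(2)]
  obtain r' where r': "r' > 0" "half_ball ?x r' \<subseteq> snd d ` (fst d \<inter> N)" using half_ball_nbhd[OF d(1,2) N] by blast
  obtain r where r: "r > 0" "cball ?x r \<subseteq> {y \<in> image_of d. 0 < hgt y} \<inter> ball ?x r'"
    using D.interior_ball[OF xi d(3) open_ball[of ?x r']] r'(1) by auto
  have m: "?h y \<le> ?h ?x" if y: "y \<in> ball ?x r" for y
  proof -
    have "y \<in> cball ?x r" using y by simp
    then have "y \<in> half_ball ?x r'" using subsetD[OF r(2)] by (fastforce simp: half_space_def)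
    then obtain q where q: "q \<in> fst d" "q \<in> N" "y = snd d q" using r'(2) by blast
    then show ?thesis using max[OF q(2)] param_coord[OF d(1) q(1)] param_coord[OF d(1,2)] by simp
  qed
  have "\<forall>\<^sub>F y in nhds ?x. ?h y \<le> ?h ?x"
    unfolding eventually_nhds using m r(1) by (intro exI[of _ "ball ?x r"]) simp
  then have ev: "\<forall>\<^sub>F y in at ?x. ?h y \<le> ?h ?x" by (simp add: eventually_at_filter eventually_mono)
  have "(\<lambda>v. dpd ?h ?x v) = (\<lambda>v. 0)"
    by (rule has_derivative_local_max[OF D.interior_derivative[OF xi d(3) u] ev])
  then have "(\<Sum>i\<in>UNIV. (v $ i) * pd i ?h ?x) = 0" for v unfolding real_scaleR_def by (rule fun_cong)
  from this[of "axis i 1"] show ?thesis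
    by (auto simp: axis_def if_distrib[of "\<lambda>a. a * _"] cong: if_cong)
qed

lemma giso_of_chart:
  assumes d: "d \<in> atlas M" and X: "hopen X" "X \<subseteq> image_of d"
    and E: "metric_chart.iso_map (Gm d) c X E" "\<And>y. y \<in> X \<Longrightarrow> snd (E y) = (H \<circ> param d) y"
  shows "giso c H (param d ` X) (E \<circ> snd d)"
proof (rule giso_localI[OF param_open[OF d X]])
  let ?B = "param d ` X"
  fix p assume p: "p \<in> ?B"
  have "E y = (E \<circ> snd d \<circ> param d) y" if "y \<in> X" for y using coord_param[OF subsetD[OF X(2) that]] by simp
  from iso_map_cong[OF d E(1) X(1) this] have "metric_chart.iso_map (Gm d) c (snd d ` ?B) ((E \<circ> snd d) \<circ> param d)"
    unfolding param_image(3)[OF X(2)] .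
  moreover have "snd ((E \<circ> snd d) q) = H q" if "q \<in> ?B" for q
    using E(2)[of "snd d q"] param_image(1,2)[OF X(2) that] param_coord[OF d] by simp
  ultimately show "\<exists>d'\<in>atlas M. \<exists>V. openin T V \<and> p \<in> V \<and> V \<subseteq> ?B \<and> V \<subseteq> fst d' \<and>
      metric_chart.iso_map (Gm d') c (snd d' ` V) ((E \<circ> snd d) \<circ> param d') \<and> (\<forall>q\<in>V. snd ((E \<circ> snd d) q) = H q)"
    using d param_open[OF d X] p param_image(1)[OF X(2)] by blast
qed

end

section \<open>Height functions on the manifold\<close>

lemma boundary_sign_hopen:
  fixes u :: "real ^ 'n::finite \<Rightarrow> real"
  assumes S: "hopen S" and u: "smooth_on S u" and x: "x \<in> S" "hgt x = 0"
    and zero: "\<And>y. y \<in> S \<Longrightarrow> hgt y = 0 \<Longrightarrow> u y = 0" and pos: "0 < pd bdry_index u x"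
  shows "\<exists>r>0. half_ball x r \<subseteq> S \<and> (\<forall>y\<in>half_ball x r. 0 < hgt y \<longrightarrow> 0 < u y)"
proof -
  obtain W F where W: "x \<in> W" "Cinf_on W F" "half_space \<inter> W \<subseteq> S" "\<And>y. y \<in> half_space \<inter> W \<Longrightarrow> F y = u y"
    using smooth_on_hopenE[OF S u x(1)] by blast
  have xh: "x \<in> half_space" using x(2) by (simp add: half_space_def)
  have "0 < \<D> F x (axis bdry_index 1)" using pos pd_smooth_ext[OF xh W(1,2,4)] by simp
  moreover have "F y = 0" if "y \<in> W" "hgt y = 0" for y
  proof -
    have "y \<in> half_space \<inter> W" using that by (simp add: half_space_def)
    then show ?thesis using W(3,4) zero[OF _ that(2)] by auto
  qed
  ultimately obtain r where "r > 0" "ball x r \<subseteq> W" "\<And>y. y \<in> ball x r \<Longrightarrow> 0 < hgt y \<Longrightarrow> 0 < F y"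
    using boundary_sign[OF W(2,1) x(2)] by blast
  note r = this
  have "0 < u y" if "y \<in> half_ball x r" "0 < hgt y" for y
  proof -
    have "F y = u y" using W(4) that(1) r(2) by blast
    then show ?thesis using r(3)[OF _ that(2)] that(1) by simp
  qed
  then show ?thesis using W(3) r(1,2) by (intro exI[of _ r]) blast
qed

lemma pd_tangential_zero:
  fixes u :: "real ^ 'n::finite \<Rightarrow> real"
  assumes S: "hopen S" and u: "smooth_on S u" and x: "x \<in> S" "hgt x = 0"
    and zero: "\<And>y. y \<in> S \<Longrightarrow> hgt y = 0 \<Longrightarrow> u y = 0" and i: "i \<noteq> bdry_index"
  shows "pd i u x = 0"
proof -
  obtain W F where W: "x \<in> W" "Cinf_on W F" "half_space \<inter> W \<subseteq> S" "\<And>y. y \<in> half_space \<inter> W \<Longrightarrow> F y = u y"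
    using smooth_on_hopenE[OF S u x(1)] by blast
  have xh: "x \<in> half_space" using x(2) by (simp add: half_space_def)
  have "(F has_derivative \<D> F x) (at (x + 0 *\<^sub>R axis i 1))"
    using Cinf_on_has_derivative[OF W(2,1)] by simp
  then have d: "((\<lambda>s. F (x + s *\<^sub>R axis i 1)) has_real_derivative \<D> F x (axis i 1)) (at 0)"
    by (rule has_real_derivative_along_line)
  obtain e where e: "e > 0" "ball x e \<subseteq> W" using W(1) Cinf_on_open[OF W(2)] openE by blast
  have "F (x + s *\<^sub>R axis i 1) = 0" if "dist s 0 < e" for s
  proof -
    let ?y = "x + s *\<^sub>R axis i 1"
    have "?y \<in> ball x e" using that by (simp add: dist_norm)
    then have W': "?y \<in> W" using e(2) by blast
    have b: "hgt ?y = 0" using x(2) i by (simp add: axis_def)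
    then have h: "?y \<in> half_space \<inter> W" using W' by (simp add: half_space_def)
    then have "?y \<in> S" using W(3) by blast
    from zero[OF this b] W(4)[OF h] show ?thesis by simp
  qed
  then have "((\<lambda>s. F (x + s *\<^sub>R axis i 1)) has_real_derivative 0) (at 0)"
    using e(1) by (intro has_field_derivative_transform_within[OF DERIV_const[of 0]]) auto
  then show ?thesis using DERIV_unique[OF d] pd_smooth_ext[OF xh W(1,2,4)] by simp
qed

locale obata = riemannian_mfd M for M :: "('m, 'n::finite) riemannian" +
  fixes c :: real and H :: "'m \<Rightarrow> real"
  assumes c_pos: "c > 0"
    and compact_T: "compact_space T"
    and sol: "d \<in> atlas M \<Longrightarrow> metric_chart.solves (Gm d) c (image_of d) (H \<circ> param d)"
    and energy_1: "d \<in> atlas M \<Longrightarrow> x \<in> image_of d \<Longrightarrow> metric_chart.energy (Gm d) c (H \<circ> param d) (H \<circ> param d) x = 1"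
    and H_bdry: "p \<in> manifold_boundary M \<Longrightarrow> H p = 0"
begin

lemma c_nz: "c \<noteq> 0" using c_pos by simp

lemma smooth_H: "d \<in> atlas M \<Longrightarrow> smooth_on (image_of d) (H \<circ> param d)"
  using sol metric_chart.solvesD(1)[OF metric_chart_image] by blast

lemma openin_H: assumes "open B" "openin T U" shows "openin T {p \<in> U. H p \<in> B}"
proof (rule openin_preimage_charts[OF assms(2) _ assms(1)])
  fix d assume d: "d \<in> atlas M"
  have "snd d ` (fst d \<inter> U) \<subseteq> image_of d" by (auto simp: image_of_def)
  then show "continuous_on (snd d ` (fst d \<inter> U)) (H \<circ> param d)"
    using smooth_on_continuous[OF smooth_H[OF d]] continuous_on_subset by blast
qed

lemma continuous_H: "continuous_map T euclideanreal H"
  unfolding continuous_map_def using openin_H[OF _ openin_topspace] by auto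

text \<open>Both parts restate that the energy is 1 and that the squared length of the gradient is
  nonnegative, with equality only for the zero vector.\<close>

lemma crit_iff:
  assumes d: "d \<in> atlas M" and x: "x \<in> image_of d"
  shows "(\<forall>i. pd i (H \<circ> param d) x = 0) \<longleftrightarrow> c * (H (param d x))\<^sup>2 = 1" and "c * (H (param d x))\<^sup>2 \<le> 1"
proof -
  interpret D: metric_chart "image_of d" "Gm d" by (rule metric_chart_image[OF d])
  let ?h = "H \<circ> param d"
  have e: "D.Xv ?h x \<bullet> (Gm d x *v D.Xv ?h x) + c * (H (param d x))\<^sup>2 = 1"
    using energy_1[OF d x] D.Xv_energy[OF x, of ?h] by (simp add: D.energy_def power2_eq_square)
  have 1: "0 < D.Xv ?h x \<bullet> (Gm d x *v D.Xv ?h x)" if "D.Xv ?h x \<noteq> 0" using D.pos_G[OF x that] .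
  show "(\<forall>i. pd i ?h x = 0) \<longleftrightarrow> c * (H (param d x))\<^sup>2 = 1"
  proof
    assume "\<forall>i. pd i ?h x = 0"
    then have "D.Xv ?h x = 0" using D.Xv_zero_iff[OF x] by simp
    then show "c * (H (param d x))\<^sup>2 = 1" using e by simp
  next
    assume "c * (H (param d x))\<^sup>2 = 1"
    then have "D.Xv ?h x = 0" using e 1 by force
    then show "\<forall>i. pd i ?h x = 0" using D.Xv_zero_iff[OF x] by simp
  qed
  show "c * (H (param d x))\<^sup>2 \<le> 1" using e 1 by (cases "D.Xv ?h x = 0") auto
qed

lemma H_le: assumes "p \<in> topspace T" shows "c * (H p)\<^sup>2 \<le> 1"
proof -
  obtain d where d: "d \<in> atlas M" "p \<in> fst d" using chart_cover[OF assms] by blast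
  show ?thesis using crit_iff(2)[OF d(1) coord_in[OF d(2)]] param_coord[OF d] by simp
qed

lemma coord_bdry_in: "d \<in> atlas M \<Longrightarrow> p \<in> fst d \<Longrightarrow> hgt (snd d p) = 0 \<Longrightarrow> p \<in> manifold_boundary M"
  unfolding manifold_boundary_def half_space_boundary_def by blast

lemma H_coord_bdry:
  assumes "d \<in> atlas M" "x \<in> image_of d" "hgt x = 0" shows "(H \<circ> param d) x = 0"
  using coord_bdry_in[OF assms(1) param_in[OF assms(2)]] coord_param[OF assms(2)] assms(3) H_bdry by simp

text \<open>\<open>H\<close> is constant along the boundary, so only the normal derivative can
  survive; and where \<open>H\<close> is zero, energy 1 excludes a critical point.\<close>

lemma pd_bdry:
  assumes d: "d \<in> atlas M" and x: "x \<in> image_of d" "hgt x = 0"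
  shows "i \<noteq> bdry_index \<Longrightarrow> pd i (H \<circ> param d) x = 0" "pd bdry_index (H \<circ> param d) x \<noteq> 0"
proof -
  show t: "pd i (H \<circ> param d) x = 0" if "i \<noteq> bdry_index" for i
    by (rule pd_tangential_zero[OF image_hopen[OF d] smooth_H[OF d] x H_coord_bdry[OF d] that])
  show "pd bdry_index (H \<circ> param d) x \<noteq> 0"
  proof
    assume "pd bdry_index (H \<circ> param d) x = 0"
    then have "\<forall>i. pd i (H \<circ> param d) x = 0" using t by metis
    then show False using crit_iff(1)[OF d x(1)] H_coord_bdry[OF d x] by simp
  qed
qed

text \<open>The factor \<open>s\<close> treats both cases at once: boundary points from which
  \<open>H\<close> increases inwards and those from which it decreases.\<close>

lemma H_sign_bdry:
  assumes d: "d \<in> atlas M" "q \<in> fst d" "hgt (snd d q) = 0" and s: "0 < s * pd bdry_index (H \<circ> param d) (snd d q)"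
  shows "\<exists>N. openin T N \<and> q \<in> N \<and> N \<subseteq> fst d \<and>
    (\<forall>x\<in>N. if hgt (snd d x) = 0 then H x = 0 else 0 < s * H x)"
proof -
  let ?h = "H \<circ> param d" and ?q = "snd d q"
  have sm: "smooth_on (image_of d) (\<lambda>y. s * ?h y)" by (rule smooth_on_cmult[OF smooth_H[OF d(1)]])
  have "0 < pd bdry_index (\<lambda>y. s * ?h y) ?q"
    using s pd_cmult[OF image_hopen[OF d(1)] coord_in[OF d(2)] smooth_H[OF d(1)], of bdry_index s] by simp
  from boundary_sign_hopen[OF image_hopen[OF d(1)] sm coord_in[OF d(2)] d(3) _ this] obtain r where
    r: "r > 0" "half_ball ?q r \<subseteq> image_of d" "\<And>y. y \<in> half_ball ?q r \<Longrightarrow> 0 < hgt y \<Longrightarrow> 0 < s * ?h y"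
    using H_coord_bdry[OF d(1)] by auto
  define N where "N = param d ` (half_ball ?q r)"
  have "if hgt (snd d x) = 0 then H x = 0 else 0 < s * H x" if x: "x \<in> N" for x
  proof -
    note x' = param_image(1,2)[OF r(2) x[unfolded N_def]]
    have "0 \<le> hgt (snd d x)" using x'(2) by (simp add: half_space_def)
    then show ?thesis using r(3)[OF x'(2)] H_coord_bdry[OF d(1) coord_in[OF x'(1)]] param_coord[OF d(1) x'(1)] by auto
  qed
  moreover have "openin T N" unfolding N_def by (rule param_open[OF d(1) hopen_half_ball r(2)])
  moreover have "q \<in> N" unfolding N_def using r(1) d by (intro param_imageI) (auto simp: half_space_def)
  moreover have "N \<subseteq> fst d" using param_image(1)[OF r(2)] unfolding N_def by blast
  ultimately show ?thesis by blast
qed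

text \<open>\<open>H\<close> vanishes on the boundary and is not critical there, so it has a one-sided sign
  near a boundary point, which is impossible at an interior point.\<close>

lemma bdry_all_charts:
  assumes p: "p \<in> manifold_boundary M" and d: "d \<in> atlas M" "p \<in> fst d"
  shows "hgt (snd d p) = 0"
proof (rule ccontr)
  let ?h = "H \<circ> param d"
  interpret D: metric_chart "image_of d" "Gm d" by (rule metric_chart_image[OF d(1)])
  assume "hgt (snd d p) \<noteq> 0"
  then have x: "snd d p \<in> image_of d" "0 < hgt (snd d p)"
    using D.in_half[OF coord_in[OF d(2)]] coord_in[OF d(2)] by (auto simp: half_space_def)
  obtain e where e: "e \<in> atlas M" "p \<in> fst e" "hgt (snd e p) = 0"
    using p unfolding manifold_boundary_def half_space_boundary_def by blast
  define s where "s = sgn (pd bdry_index (H \<circ> param e) (snd e p))"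
  have s: "s \<noteq> 0" "0 < s * pd bdry_index (H \<circ> param e) (snd e p)"
    using pd_bdry(2)[OF e(1) coord_in[OF e(2)] e(3)] unfolding s_def by (auto simp: sgn_if)
  obtain N where N: "openin T N" "p \<in> N" "\<And>x. x \<in> N \<Longrightarrow> if hgt (snd e x) = 0 then H x = 0 else 0 < s * H x"
    using H_sign_bdry[OF e s(2)] by blast
  define u where "u q = - s * H q" for q
  have ud: "u \<circ> param d = (\<lambda>y. - s * ?h y)" by (auto simp: u_def)
  have "pd i (u \<circ> param d) (snd d p) = 0" for i
  proof (rule pd_zero_at_interior_max[OF d x(2) _ N(1,2)])
    show "smooth_on (image_of d) (u \<circ> param d)" unfolding ud by (rule smooth_on_cmult[OF smooth_H[OF d(1)]])
    show "u q \<le> u p" if "q \<in> N" for q using N(3)[OF that] H_bdry[OF p] by (auto simp: u_def split: if_splits)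
  qed
  then have "pd i ?h (snd d p) = 0" for i
    using pd_cmult[OF image_hopen[OF d(1)] x(1) smooth_H[OF d(1)], of i "- s"] s(1) by (simp add: ud)
  then show False using crit_iff(1)[OF d(1) x(1)] param_coord[OF d] H_bdry[OF p] by simp
qed

lemma interior_coord:
  assumes "H p \<noteq> 0" and d: "d \<in> atlas M" "p \<in> fst d" shows "0 < hgt (snd d p)"
proof -
  have "hgt (snd d p) \<noteq> 0" using assms(1) coord_bdry_in[OF d] H_bdry by auto
  moreover have "0 \<le> hgt (snd d p)"
    using metric_chart.in_half[OF metric_chart_image[OF d(1)] coord_in[OF d(2)]] by (simp add: half_space_def)
  ultimately show ?thesis by simp
qed

end

section \<open>Gluing local isometries along a compact set\<close>

context obata begin

lemma shrink_nbhd: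
  assumes "openin T B" "x \<in> B" shows "\<exists>A C. openin T A \<and> closedin T C \<and> x \<in> A \<and> A \<subseteq> C \<and> C \<subseteq> B"
proof -
  have "regular_space T" using compact_Hausdorff_imp_regular_space compact_T Hausdorff_T by blast
  then show ?thesis using assms unfolding neighbourhood_base_of_closedin[symmetric] neighbourhood_base_of by blast
qed

text \<open>Compatibility is assumed only at points of \<open>Z\<close>. By compactness finitely
  many shrunken pieces cover \<open>Z\<close>, and the overlaps where two of them differ form a
  closed set missing \<open>Z\<close>, which can be removed.\<close>

lemma glue:
  assumes Q: "giso c H Q F" and Z: "closedin T Z"
    and loc: "\<And>x. x \<in> Z \<Longrightarrow> giso c H (B x) (E x) \<and> x \<in> B x \<and> (\<forall>q\<in>B x \<inter> Q. E x q = F q)"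
    and compat: "\<And>x y w. x \<in> Z \<Longrightarrow> y \<in> Z \<Longrightarrow> w \<in> Z \<Longrightarrow> w \<in> B x \<Longrightarrow> w \<in> B y \<Longrightarrow> w \<in> agree (E x) (E y)"
  shows "\<exists>U F'. giso c H U F' \<and> Q \<union> Z \<subseteq> U \<and> (\<forall>q\<in>Q. F' q = F q) \<and>
    (\<forall>w\<in>Z. \<exists>x\<in>Z. w \<in> B x \<and> w \<in> agree F' (E x))"
proof -
  have "\<forall>x\<in>Z. \<exists>AC. openin T (fst AC) \<and> closedin T (snd AC) \<and> x \<in> fst AC \<and> fst AC \<subseteq> snd AC \<and> snd AC \<subseteq> B x"
  proof
    fix x assume x: "x \<in> Z"
    have "openin T (B x)" "x \<in> B x" using gisoD(1) loc[OF x] by blast+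
    from shrink_nbhd[OF this] obtain A C where "openin T A \<and> closedin T C \<and> x \<in> A \<and> A \<subseteq> C \<and> C \<subseteq> B x" by (elim exE)
    then show "\<exists>AC. openin T (fst AC) \<and> closedin T (snd AC) \<and> x \<in> fst AC \<and> fst AC \<subseteq> snd AC \<and> snd AC \<subseteq> B x"
      by (intro exI[of _ "(A, C)"]) simp
  qed
  from bchoice[OF this] obtain AC where AC: "\<forall>x\<in>Z. openin T (fst (AC x)) \<and> closedin T (snd (AC x)) \<and> x \<in> fst (AC x) \<and> fst (AC x) \<subseteq> snd (AC x) \<and> snd (AC x) \<subseteq> B x"
    by (elim exE)
  define A where "A x = fst (AC x)" for x
  define C where "C x = snd (AC x)" for x
  have A: "openin T (A x)" "closedin T (C x)" "x \<in> A x" "A x \<subseteq> C x" "C x \<subseteq> B x" if "x \<in> Z" for x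
    using bspec[OF AC that] by (simp_all add: A_def C_def)
  have "compactin T Z" using closedin_compact_space compact_T Z by blast
  then obtain \<F> where "finite \<F>" "\<F> \<subseteq> A ` Z" "Z \<subseteq> \<Union>\<F>"
    using compactinD[of T Z "A ` Z"] A(1,3) by blast
  then obtain I where I: "finite I" "I \<subseteq> Z" "Z \<subseteq> (\<Union>i\<in>I. A i)" by (metis finite_subset_image)
  \<comment> \<open>The closed sets \<open>C i\<close> are used here instead of the
    \<open>B i\<close>, so that \<open>D\<close> is closed and its removal leaves an open
    set.\<close>
  define D where "D = (\<Union>i\<in>I. \<Union>j\<in>I. C i \<inter> C j - agree (E i) (E j))"
  have D: "closedin T D" unfolding D_def
    using I A(2) openin_agree by (intro closedin_Union finite_imageI closedin_diff closedin_Int) (auto intro!: closedin_Union closedin_diff)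
  have DZ: "w \<notin> D" if w: "w \<in> Z" for w
  proof
    assume "w \<in> D"
    then obtain i j where ij: "i \<in> I" "j \<in> I" "w \<in> C i" "w \<in> C j" "w \<notin> agree (E i) (E j)" unfolding D_def by blast
    then show False using compat[of i j w] A(5)[of i] A(5)[of j] I(2) w by blast
  qed
  define U where "U = Q \<union> ((\<Union>i\<in>I. A i) - D)"
  \<comment> \<open>Outside \<open>D\<close> the chosen index does not affect the value, since any
    two pieces containing the point agree there.\<close>
  define F' where "F' q = (if q \<in> Q then F q else E (SOME i. i \<in> I \<and> q \<in> A i) q)" for q
  have oA: "openin T (A i - D)" if "i \<in> I" for i using A(1)[of i] D that I(2) by blast
  have U: "openin T U" unfolding U_def
    using gisoD(1)[OF Q] A(1) I(2) D by (intro openin_Un openin_diff openin_Union) auto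
  have eq: "F' q = E i q" if i: "i \<in> I" and q: "q \<in> A i - D" for i q
  proof (cases "q \<in> Q")
    case True
    then have "q \<in> B i \<inter> Q" using q A(4,5)[of i] i I(2) by blast
    then show ?thesis using loc[of i] i I(2) True by (auto simp: F'_def)
  next
    case False
    define j where "j = (SOME i. i \<in> I \<and> q \<in> A i)"
    have j: "j \<in> I" "q \<in> A j" using someI[of "\<lambda>i. i \<in> I \<and> q \<in> A i" i] i q by (auto simp: j_def)
    have "q \<in> agree (E j) (E i)"
    proof (rule ccontr)
      assume n: "q \<notin> agree (E j) (E i)"
      have "q \<in> C j" "q \<in> C i" using A(4)[of j] A(4)[of i] i j q I(2) by blast+
      then have "q \<in> D" unfolding D_def using n i j(1) by blast
      then show False using q by blast
    qed
    then show ?thesis using agree_eq False by (simp add: F'_def j_def)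
  qed
  have "giso c H U F'"
  proof (rule giso_local[OF U])
    fix p assume "p \<in> U"
    then consider "p \<in> Q" | i where "i \<in> I" "p \<in> A i - D" unfolding U_def by blast
    then show "\<exists>V F''. openin T V \<and> p \<in> V \<and> giso c H V F'' \<and> (\<forall>q\<in>V. F'' q = F' q)"
    proof cases
      case 1
      then show ?thesis using Q gisoD(1)[OF Q] by (intro exI[of _ Q] exI[of _ F]) (simp add: F'_def)
    next
      case 2
      have "giso c H (B i) (E i)" using loc 2(1) I(2) by blast
      then have "giso c H (A i - D) (E i)" using giso_subset oA[OF 2(1)] A(4,5)[of i] 2(1) I(2) by blast
      then show ?thesis using oA[OF 2(1)] 2 eq[OF 2(1)] by (intro exI[of _ "A i - D"] exI[of _ "E i"]) simp
    qed
  qed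
  moreover have "Q \<union> Z \<subseteq> U" using I(3) DZ unfolding U_def by blast
  moreover have "\<forall>q\<in>Q. F' q = F q" by (simp add: F'_def)
  moreover have "\<exists>x\<in>Z. w \<in> B x \<and> w \<in> agree F' (E x)" if w: "w \<in> Z" for w
  proof -
    obtain i where i: "i \<in> I" "w \<in> A i" using I(3) w by blast
    have "w \<in> agree F' (E i)" by (rule agreeI[OF oA[OF i(1)]]) (use i DZ[OF w] eq[OF i(1)] in auto)
    then show ?thesis using i A(4,5)[of i] I(2) by blast
  qed
  ultimately show ?thesis by blast
qed

lemma H_attains_max:
  assumes "closedin T K" "K \<noteq> {}" shows "\<exists>p\<in>K. \<forall>q\<in>K. H q \<le> H p"
proof -
  have "compactin T K" using closedin_compact_space compact_T assms by blast
  then have "compact (H ` K)" using image_compactin continuous_H compactin_euclidean_iff by blast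
  then show ?thesis using compact_attains_sup[of "H ` K"] assms(2) by blast
qed

text \<open>On the compact complement of \<open>U\<close> the function \<open>H\<close> attains a
  maximum, which lies below \<open>a\<close>.\<close>

lemma superlevel_shrink:
  assumes U: "openin T U" and sub: "{p \<in> topspace T. a \<le> H p} \<subseteq> U"
  shows "\<exists>a'<a. {p \<in> topspace T. a' < H p} \<subseteq> U"
proof (cases "topspace T - U = {}")
  case True
  then show ?thesis by (intro exI[of _ "a - 1"]) auto
next
  case False
  then obtain p where p: "p \<in> topspace T - U" "\<And>q. q \<in> topspace T - U \<Longrightarrow> H q \<le> H p"
    using H_attains_max[of "topspace T - U"] U by blast
  have "H p < a" using p(1) sub by force
  then show ?thesis using p(2) by (intro exI[of _ "H p"]) force
qed

end

section \<open>Extension of isometries across level sets\<close>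

context metric_chart begin

lemma increment_along_segment:
  fixes u :: "real ^ 'n \<Rightarrow> real"
  assumes u: "smooth_on S u" and t: "0 < t" and l: "\<And>s. s \<in> {0..t} \<Longrightarrow> y + s *\<^sub>R e \<in> S"
  shows "\<exists>s\<in>{0<..<t}. u (y + t *\<^sub>R e) - u y = t * (\<Sum>i\<in>UNIV. e $ i * pd i u (y + s *\<^sub>R e))"
proof -
  have "((\<lambda>s. u (y + s *\<^sub>R e)) has_derivative (\<lambda>h. dpd u (y + s *\<^sub>R e) (h *\<^sub>R e))) (at s within {0..t})"
    if s: "0 \<le> s" "s \<le> t" for s
  proof (rule has_derivative_in_compose2[where t = S and g = u])
    show "((\<lambda>s. y + s *\<^sub>R e) has_derivative (\<lambda>h. h *\<^sub>R e)) (at s within {0..t})"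
      by (auto intro!: derivative_eq_intros)
    show "(\<lambda>s. y + s *\<^sub>R e) ` {0..t} \<subseteq> S" using l by blast
    show "s \<in> {0..t}" using s by simp
    show "(u has_derivative (\<lambda>v. dpd u x v)) (at x within S)" if "x \<in> S" for x
      using smooth_has_derivative[OF hopen_S u that] by (simp add: at_within_hopen[OF hopen_S that])
  qed
  from mvt_simple[OF t this] show ?thesis
    by (auto simp: sum_distrib_left mult_ac)
qed

text \<open>Near a regular point of a solution \<open>u\<close>, every point of the superlevel set is joined to a
  fixed base point inside the superlevel set, by first moving along the Euclidean gradient \<open>e\<close>
  of \<open>u\<close> at the given point.  Hence an isometric immersion of the superlevel set whose height
  is \<open>u\<close> extends across the point.\<close>

lemma extend_iso_map:
  assumes c: "c \<noteq> 0" and flat: "\<And>y i j. y \<in> S \<Longrightarrow> WW c i j y = 0"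
    and u: "solves c S u" and x: "x \<in> S"
    and e: "e = (\<chi> i. pd i u x)" "e \<noteq> 0"
    and bd: "0 < hgt x \<or> (hgt x = 0 \<and> 0 < hgt e)"
    and Y: "Y = {y \<in> S. u x < u y}" and Ypos: "\<And>y. y \<in> Y \<Longrightarrow> 0 < hgt y"
    and F: "iso_map c Y F" and Fu: "\<And>y. y \<in> Y \<Longrightarrow> snd (F y) = u y"
  shows "\<exists>r>0. \<exists>E. half_ball x r \<subseteq> S \<and> iso_map c (half_ball x r) E \<and>
    (\<forall>y\<in>half_ball x r. snd (E y) = u y \<and> (u x < u y \<longrightarrow> E y = F y))"
proof -
  have su: "smooth_on S u" using u by (rule solvesD)
  have contu: "continuous_on S u" by (rule smooth_on_continuous[OF su])
  obtain R where R: "R > 0" "half_ball x R \<subseteq> S"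
    "\<And>y0 P F0. y0 \<in> ball x R \<Longrightarrow> 0 < hgt y0 \<Longrightarrow> frame c y0 P F0 \<Longrightarrow>
      \<exists>F. Cinf_on (ball x R) F \<and> iso_map c (half_ball x R) F \<and> F y0 = F0 \<and> (\<forall>i. pd i F y0 = P i)"
    using local_iso_extension[OF c x flat] by auto
  \<comment> \<open>Moving along \<open>e\<close> does not leave the half-space: near an interior
    point all heights are positive, and at a boundary point \<open>e\<close> has a positive normal
    component.\<close>
  have "\<exists>\<rho>0>0. \<forall>y\<in>half_space. \<forall>t\<ge>0. y + t *\<^sub>R e \<in> ball x \<rho>0 \<longrightarrow>
      0 \<le> hgt (y + t *\<^sub>R e) \<and> (0 < t \<longrightarrow> 0 < hgt (y + t *\<^sub>R e))"
  proof (cases "0 < hgt x")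
    case True
    have "0 < hgt z" if "z \<in> ball x (hgt x)" for z
      using component_le_norm_cart[of "x - z" bdry_index] that by (auto simp: dist_norm)
    from this[of "y + t *\<^sub>R e" for y t] show ?thesis using True
      by (intro exI[of _ "hgt x"]) (simp add: less_imp_le del: vector_add_component)
  next
    case False
    then show ?thesis using bd by (intro exI[of _ 1]) (auto simp: half_space_def add_nonneg_pos)
  qed
  then obtain \<rho>0 where \<rho>0: "\<rho>0 > 0" "\<And>y t. y \<in> half_space \<Longrightarrow> 0 \<le> t \<Longrightarrow> y + t *\<^sub>R e \<in> ball x \<rho>0 \<Longrightarrow> y + t *\<^sub>R e \<in> half_space"
    "\<And>y t. y \<in> half_space \<Longrightarrow> 0 < t \<Longrightarrow> y + t *\<^sub>R e \<in> ball x \<rho>0 \<Longrightarrow> 0 < hgt (y + t *\<^sub>R e)"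
    by (auto simp: half_space_def)
  define \<psi> where "\<psi> y = (\<Sum>i\<in>UNIV. e $ i * pd i u y)" for y
  have "continuous_on S \<psi>" unfolding \<psi>_def
    by (intro continuous_on_sum continuous_on_mult continuous_on_const smooth_on_continuous[OF smooth_on_pd[OF hopen_S su]])
  moreover have "\<psi> x = e \<bullet> e" by (simp add: \<psi>_def e(1) inner_vec_def)
  then have "0 < \<psi> x" using e(2) by simp
  ultimately obtain \<rho>1 where \<rho>1: "\<rho>1 > 0" "\<And>y. y \<in> S \<Longrightarrow> dist y x < \<rho>1 \<Longrightarrow> 0 < \<psi> y"
  proof -
    assume c\<psi>: "continuous_on S \<psi>" and pos: "0 < \<psi> x" and th: "\<And>\<rho>1. \<rho>1 > 0 \<Longrightarrow> (\<And>y. y \<in> S \<Longrightarrow> dist y x < \<rho>1 \<Longrightarrow> 0 < \<psi> y) \<Longrightarrow> thesis"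
    from c\<psi> x pos obtain \<rho>1 where r: "\<rho>1 > 0" "\<And>y. y \<in> S \<Longrightarrow> dist y x < \<rho>1 \<Longrightarrow> dist (\<psi> y) (\<psi> x) < \<psi> x"
      unfolding continuous_on_iff by blast
    show thesis using r(2) by (intro th[OF r(1)]) (force simp: dist_real_def)
  qed
  define \<rho> where "\<rho> = min R (min \<rho>0 \<rho>1)"
  define X where "X = half_ball x \<rho>"
  have \<rho>: "\<rho> > 0" "\<rho> \<le> R" "\<rho> \<le> \<rho>0" "\<rho> \<le> \<rho>1" using R(1) \<rho>0(1) \<rho>1(1) by (auto simp: \<rho>_def)
  have XR: "X \<subseteq> half_ball x R" using \<rho>(2) by (auto simp: X_def)
  then have XS: "X \<subseteq> S" using R(2) by blast
  have hX: "hopen X" unfolding X_def by (simp add: openin_open_Int)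
  have move: "y + t *\<^sub>R e \<in> X" "0 < t \<Longrightarrow> 0 < hgt (y + t *\<^sub>R e)"
    if "y \<in> half_space" "0 \<le> t" "y + t *\<^sub>R e \<in> ball x \<rho>" for y t
  proof -
    have "y + t *\<^sub>R e \<in> ball x \<rho>0" using that(3) \<rho>(3) by simp
    then show "y + t *\<^sub>R e \<in> X" "0 < t \<Longrightarrow> 0 < hgt (y + t *\<^sub>R e)"
      using \<rho>0(2,3)[OF that(1)] that(2,3) by (auto simp: X_def)
  qed
  have seg: "y + s *\<^sub>R e \<in> X" if y: "y \<in> X" "y + t *\<^sub>R e \<in> X" "s \<in> {0..t}" for y t s
  proof (cases "t = 0")
    case False
    then have "y + s *\<^sub>R e = (1 - s / t) *\<^sub>R y + (s / t) *\<^sub>R (y + t *\<^sub>R e)" by (simp add: algebra_simps)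
    moreover have "0 \<le> s / t" "s / t \<le> 1" using y(3) False by (auto simp: divide_simps)
    ultimately show ?thesis using convexD[OF convex_half_ball y(1,2)[unfolded X_def], of "1 - s / t" "s / t"] by (simp add: X_def)
  qed (use y in simp)
  have mono: "u y < u (y + t *\<^sub>R e)" if y: "y \<in> X" "y + t *\<^sub>R e \<in> X" "0 < t" for y t
  proof -
    have sg: "y + s *\<^sub>R e \<in> S" if "s \<in> {0..t}" for s using seg[OF y(1,2) that] XS by blast
    obtain s where s: "s \<in> {0<..<t}" "u (y + t *\<^sub>R e) - u y = t * \<psi> (y + s *\<^sub>R e)"
      using increment_along_segment[OF su y(3) sg] unfolding \<psi>_def by auto
    have "y + s *\<^sub>R e \<in> X" using seg[OF y(1,2)] s(1) by simp
    then have "0 < \<psi> (y + s *\<^sub>R e)" using \<rho>1(2) XS \<rho>(4) by (auto simp: X_def dist_commute)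
    then have "0 < t * \<psi> (y + s *\<^sub>R e)" using y(3) by simp
    then show ?thesis using s(2) by simp
  qed
  have xX: "x \<in> X" using in_half[OF x] \<rho>(1) by (simp add: X_def)
  have ne: "0 < norm e" using e(2) by simp
  \<comment> \<open>Moves the base point by half the radius, so that all of the ball of radius
    \<open>\<rho> / 2\<close> may be translated by \<open>t0 *\<^sub>R e\<close> without leaving
    \<open>ball x \<rho>\<close>.\<close>
  define t0 where "t0 = \<rho> / (2 * norm e)"
  have t0: "t0 > 0" "t0 * norm e = \<rho> / 2" using \<rho>(1) ne by (auto simp: t0_def)
  define y0 where "y0 = x + t0 *\<^sub>R e"
  have d0: "y0 \<in> ball x \<rho>" using t0 \<rho>(1) by (simp add: y0_def dist_norm)
  have xh: "x \<in> half_space" using in_half[OF x] .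
  have y0: "y0 \<in> X" "0 < hgt y0" using move[OF xh, of t0] t0(1) d0 by (auto simp: y0_def)
  have uy0: "u x < u y0" using mono[OF xX _ t0(1)] y0(1) by (simp add: y0_def)
  obtain \<delta> where \<delta>: "\<delta> > 0" "\<And>y. y \<in> S \<Longrightarrow> dist y y0 < \<delta> \<Longrightarrow> dist (u y) (u y0) < u y0 - u x"
    using contu y0(1) XS uy0 unfolding continuous_on_iff by (metis diff_gt_0_iff_gt subsetD)
  have up: "u x < u y" if "y \<in> S" "dist y y0 < \<delta>" for y using \<delta>(2)[OF that] by (auto simp: dist_real_def)
  define r where "r = min \<delta> (\<rho> / 2)"
  have r: "r > 0" "r \<le> \<delta>" "r \<le> \<rho> / 2" using \<delta>(1) \<rho>(1) by (auto simp: r_def)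
  have rX: "half_ball x r \<subseteq> X" using r(3) \<rho>(1) by (auto simp: X_def)
  have hY: "hopen Y"
  proof -
    have "openin (top_of_set S) (S \<inter> u -` {u x<..})" by (rule continuous_openin_preimage_gen[OF contu open_greaterThan])
    moreover have "S \<inter> u -` {u x<..} = Y" by (auto simp: Y)
    ultimately show ?thesis using hopen_S openin_trans by metis
  qed
  interpret Y: metric_chart Y G by (rule metric_chart_subset[OF hY]) (use Y in blast)
  have y0Y: "y0 \<in> Y" using y0(1) XS uy0 Y by blast
  have fr: "frame c y0 (\<lambda>i. pd i F y0) (F y0)" by (rule Y.iso_map_frame[OF F y0Y])
  have "y0 \<in> ball x R" using y0(1) XR by blast
  from R(3)[OF this y0(2) fr] obtain E where "Cinf_on (ball x R) E \<and> iso_map c (half_ball x R) E \<and> E y0 = F y0 \<and> (\<forall>i. pd i E y0 = pd i F y0)"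
    by (elim exE)
  then have E: "iso_map c (half_ball x R) E" "E y0 = F y0" "\<And>i. pd i E y0 = pd i F y0" by auto
  define X' where "X' = half_ball x R"
  have hX': "hopen X'" unfolding X'_def by (simp add: openin_open_Int)
  interpret X': metric_chart X' G by (rule metric_chart_subset[OF hX']) (use R(2) in \<open>simp add: X'_def\<close>)
  have y0X': "y0 \<in> X'" using y0(1) XR by (auto simp: X'_def)
  define V where "V = Y \<inter> X"
  have hV: "hopen V" unfolding V_def using hY hX by blast
  interpret V: metric_chart V G by (rule metric_chart_subset[OF hV]) (use XS in \<open>auto simp: V_def\<close>)
  have sE: "smooth_on X' E" and sF: "smooth_on Y F" using E(1) F by (auto simp: iso_map_def X'_def)
  have solE: "solves c X' (\<lambda>y. E y \<bullet> z)" for z using X'.iso_map_solves[OF c] E(1) by (simp add: X'_def)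
  have solF: "solves c Y (\<lambda>y. F y \<bullet> z)" for z using Y.iso_map_solves[OF c F] .
  have jet0: "jet (\<lambda>y. E y \<bullet> z) y0 = jet (\<lambda>y. F y \<bullet> z) y0" for z
    using X'.pd_inner_const[OF y0X' sE] Y.pd_inner_const[OF y0Y sF] E(2,3) by (simp add: jet_def)
  \<comment> \<open>The last coordinate of the new map solves the same equation as \<open>u\<close>
    and has the same jet at \<open>y0\<close>.\<close>
  have Eu: "E y \<bullet> (0, 1) = u y" if y: "y \<in> X'" for y
  proof (rule X'.solution_unique[OF solE _ _ y0X' y0(2) _ y])
    show "solves c X' u" using solves_subset[OF u] R(2) by (simp add: X'_def)
    show "convex X'" unfolding X'_def by (rule convex_half_ball)
    have "F y \<bullet> (0, 1) = u y" if "y \<in> Y" for y using Fu[OF that] by (simp add: inner_prod_def)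
    then have "jet (\<lambda>y. F y \<bullet> (0, 1)) y0 = jet u y0" using pd_cong[OF hY y0Y, of "\<lambda>y. F y \<bullet> (0,1)" u] y0Y by (simp add: jet_def)
    then show "jet (\<lambda>y. E y \<bullet> (0, 1)) y0 = jet u y0" using jet0 by simp
  qed
  have EF: "E y = F y" if y: "y \<in> half_ball x r" "u x < u y" for y
  proof (rule euclidean_eqI)
    fix z :: "(real ^ 'n) \<times> real"
    have VE: "solves c V (\<lambda>y. E y \<bullet> z)" by (rule solves_subset[OF solE]) (use XR in \<open>auto simp: V_def X'_def\<close>)
    have VF: "solves c V (\<lambda>y. F y \<bullet> z)" by (rule solves_subset[OF solF]) (auto simp: V_def)
    define y1 where "y1 = y + t0 *\<^sub>R e"
    have yX: "y \<in> X" using y(1) rX by blast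
    have yV: "y \<in> V" using yX XS y(2) by (auto simp: V_def Y)
    have yx: "norm (y - x) < r" using y(1) by (simp add: dist_norm norm_minus_commute)
    have Vpos: "0 < hgt w" if "w \<in> V" for w using that Ypos by (auto simp: V_def)
    \<comment> \<open>The path from \<open>y0\<close> to \<open>y\<close> has two segments. The
      first leads to \<open>y1\<close> and stays near \<open>y0\<close>, where \<open>u\<close>
      exceeds \<open>u x\<close>. The second descends along \<open>e\<close> to \<open>y\<close>,
      and on it \<open>u\<close> is at least \<open>u y\<close>.\<close>
    have s1: "y0 + s *\<^sub>R (y1 - y0) \<in> V" if s: "s \<in> {0..1}" for s
    proof -
      define w where "w = x + s *\<^sub>R (y - x)"
      have w: "y0 + s *\<^sub>R (y1 - y0) = w + t0 *\<^sub>R e" by (simp add: w_def y0_def y1_def algebra_simps)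
      have "w = (1 - s) *\<^sub>R x + s *\<^sub>R y" by (simp add: w_def algebra_simps)
      then have wX: "w \<in> X" using convexD[OF convex_half_ball xX[unfolded X_def] yX[unfolded X_def], of "1 - s" s] s by (simp add: X_def)
      have "norm (w - x) \<le> norm (y - x)" using s by (simp add: w_def mult_left_le_one_le)
      then have wx: "norm (w - x) < r" using yx by simp
      have "norm (w + t0 *\<^sub>R e - x) \<le> norm (w - x) + norm (t0 *\<^sub>R e)" using norm_triangle_ineq[of "w - x" "t0 *\<^sub>R e"] by (simp add: algebra_simps)
      then have "norm (w + t0 *\<^sub>R e - x) < \<rho>" using wx r(3) t0 by simp
      then have "w + t0 *\<^sub>R e \<in> ball x \<rho>" by (simp add: dist_norm norm_minus_commute)
      then have 1: "w + t0 *\<^sub>R e \<in> X" using move(1)[of w t0] wX t0(1) by (simp add: X_def)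
      have "dist (w + t0 *\<^sub>R e) y0 < \<delta>" using wx r(2) by (simp add: y0_def dist_norm)
      then have "u x < u (w + t0 *\<^sub>R e)" using up 1 XS by blast
      then show ?thesis unfolding w using 1 XS by (auto simp: V_def Y)
    qed
    from s1[of 1] have y1V: "y1 \<in> V" by simp
    then have y1X: "y1 \<in> X" by (simp add: V_def)
    have s2: "y1 + s *\<^sub>R (y - y1) \<in> V" if s: "s \<in> {0..1}" for s
    proof -
      have w: "y1 + s *\<^sub>R (y - y1) = y + ((1 - s) * t0) *\<^sub>R e" by (simp add: y1_def algebra_simps)
      have 1: "y + ((1 - s) * t0) *\<^sub>R e \<in> X"
        using seg[OF yX, of t0 "(1 - s) * t0"] y1X s t0(1) by (simp add: y1_def mult_left_le_one_le)
      have "u y \<le> u (y + ((1 - s) * t0) *\<^sub>R e)"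
      proof (cases "s = 1")
        case False
        then have "0 < (1 - s) * t0" using s t0(1) by simp
        from mono[OF yX 1 this] show ?thesis by simp
      qed simp
      then show ?thesis unfolding w using 1 XS y(2) by (auto simp: V_def Y)
    qed
    have j1: "jet (\<lambda>y. E y \<bullet> z) y1 = jet (\<lambda>y. F y \<bullet> z) y1"
      by (rule V.jet_unique_segment[OF VE VF s1 Vpos[OF s1] jet0])
    have "jet (\<lambda>y. E y \<bullet> z) y = jet (\<lambda>y. F y \<bullet> z) y"
      by (rule V.jet_unique_segment[OF VE VF s2 Vpos[OF s2] j1])
    then show "E y \<bullet> z = F y \<bullet> z" by (simp add: jet_def)
  qed
  have rX': "half_ball x r \<subseteq> X'" using rX XR by (auto simp: X'_def)
  have "iso_map c (half_ball x r) E"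
    using E(1) rX' smooth_on_subset[OF _ rX', of E] unfolding iso_map_def X'_def by blast
  moreover have "snd (E y) = u y" if "y \<in> half_ball x r" for y
    using Eu[of y] that rX' by (auto simp: inner_prod_def)
  ultimately show ?thesis using EF r(1) rX XS by (intro exI[of _ r] conjI exI[of _ E]) auto
qed

end

context obata begin

definition above :: "real \<Rightarrow> 'm set" where "above a = {p \<in> topspace T. a < H p}"

text \<open>In general smaller than the set where \<open>H\<close> is nonnegative: a boundary point
  from which \<open>H\<close> decreases inwards has \<open>H = 0\<close> but lies outside.\<close>

abbreviation "upper \<equiv> T closure_of (above 0)"

lemma openin_above: "openin T (above a)"
  using openin_H[OF open_greaterThan[of a] openin_topspace] by (simp add: above_def)

lemma above_coord:
  assumes d: "d \<in> atlas M" shows "snd d ` (fst d \<inter> above a) = {y \<in> image_of d. a < (H \<circ> param d) y}"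
  using coord_image_eq[OF d, of "above a"] param_in[where d = d] chart_subset[OF d] by (auto simp: above_def)

lemma pd_bdry_pos:
  assumes d: "d \<in> atlas M" "x \<in> fst d" "hgt (snd d x) = 0" and x: "x \<in> upper"
  shows "0 < pd bdry_index (H \<circ> param d) (snd d x)"
proof (rule ccontr)
  assume "\<not> 0 < pd bdry_index (H \<circ> param d) (snd d x)"
  then have "0 < (-1) * pd bdry_index (H \<circ> param d) (snd d x)"
    using pd_bdry(2)[OF d(1) coord_in[OF d(2)] d(3)] by linarith
  from H_sign_bdry[OF d this] obtain N where N: "openin T N" "x \<in> N"
    "\<And>q. q \<in> N \<Longrightarrow> if hgt (snd d q) = 0 then H q = 0 else 0 < (-1) * H q" by blast
  then obtain q where "q \<in> above 0" "q \<in> N" using x by (auto simp: in_closure_of)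
  then show False using N(3)[of q] by (simp add: above_def split: if_splits)
qed

lemma WW_zero_above:
  assumes F: "giso c H (above a) F" and d: "d \<in> atlas M" and y: "y \<in> image_of d" "a < (H \<circ> param d) y"
  shows "metric_chart.WW (Gm d) c i j y = 0"
proof -
  interpret D: metric_chart "image_of d" "Gm d" by (rule metric_chart_image[OF d])
  interpret Y: metric_chart "snd d ` (fst d \<inter> above a)" "Gm d" by (rule metric_chart_coord[OF d openin_above])
  show ?thesis using Y.iso_map_flat[OF c_nz gisoD(2)[OF F d]] y above_coord[OF d] by blast
qed

text \<open>Since \<open>c * a\<^sup>2 \<noteq> 1\<close>, the point is regular. Vanishing of
  \<open>WW\<close> around it comes from \<open>flat_propagates\<close> if it has positive height in
  the chart. At a boundary point, possible only for \<open>a = 0\<close>, the nearby interior points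
  already lie above level \<open>a\<close> and continuity does the rest.\<close>

lemma extend_point:
  assumes a: "0 \<le> a" "c * a\<^sup>2 \<noteq> 1" and F: "giso c H (above a) F"
    and x: "x \<in> T closure_of (above a)" "H x = a"
  shows "\<exists>B E. giso c H B E \<and> x \<in> B \<and> (\<forall>q\<in>B \<inter> above a. E q = F q)"
proof -
  have "x \<in> topspace T" using x(1) by (simp add: in_closure_of)
  then obtain d where d: "d \<in> atlas M" "x \<in> fst d" using chart_cover by blast
  interpret D: metric_chart "image_of d" "Gm d" by (rule metric_chart_image[OF d(1)])
  let ?h = "H \<circ> param d" and ?x = "snd d x"
  note xi = coord_in[OF d(2)]
  have hx: "?h ?x = a" using param_coord[OF d] x(2) by simp
  have reg: "\<not> (\<forall>i. pd i ?h ?x = 0)" using crit_iff(1)[OF d(1) xi] param_coord[OF d] a(2) x(2) by simp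
  have flatY: "metric_chart.WW (Gm d) c i j y = 0" if "y \<in> image_of d" "?h ?x < ?h y" for y i j
    using WW_zero_above[OF F d(1)] that hx by simp
  define e where "e = (\<chi> i. pd i ?h ?x)"
  have e0: "e \<noteq> 0" using reg by (auto simp: e_def vec_eq_iff)
  have bd: "0 < hgt ?x \<or> (hgt ?x = 0 \<and> 0 < hgt e)"
  proof (cases "hgt ?x = 0")
    case True
    then have "a = 0" using coord_bdry_in[OF d] H_bdry x(2) by auto
    then show ?thesis using pd_bdry_pos[OF d True] x(1) True by (simp add: e_def)
  next
    case False
    then show ?thesis using D.in_half[OF xi] by (auto simp: half_space_def)
  qed
  have "\<exists>S. hopen S \<and> S \<subseteq> image_of d \<and> ?x \<in> S \<and> (\<forall>y\<in>S. \<forall>i j. D.WW c i j y = 0)"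
  proof (cases "0 < hgt ?x")
    case True
    from D.flat_propagates[OF sol[OF d(1)] xi True reg flatY] obtain r where "r > 0" "ball ?x r \<subseteq> image_of d"
      "\<And>y i j. y \<in> ball ?x r \<Longrightarrow> D.WW c i j y = 0" by auto
    then show ?thesis using D.in_half[OF xi] by (intro exI[of _ "half_ball ?x r"]) (auto simp: hopen_half_ball)
  next
    case False
    then have b: "hgt ?x = 0" "0 < 1 * pd bdry_index ?h ?x" using bd by (auto simp: e_def)
    then have "a = 0" using coord_bdry_in[OF d] H_bdry x(2) by auto
    from H_sign_bdry[OF d b] obtain N where N: "openin T N" "x \<in> N" "N \<subseteq> fst d"
      "\<And>q. q \<in> N \<Longrightarrow> if hgt (snd d q) = 0 then H q = 0 else 0 < 1 * H q" by blast
    define S where "S = snd d ` (fst d \<inter> N)"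
    have S: "hopen S" "S \<subseteq> image_of d" "?x \<in> S" unfolding S_def using coord_hopen[OF d(1) N(1)] N(2) d(2) by (auto simp: image_of_def)
    interpret S: metric_chart S "Gm d" by (rule D.metric_chart_subset[OF S(1,2)])
    have "D.WW c i j y = 0" if y: "y \<in> S" for y i j
    proof (rule eq_on_hopen_by_interior[OF S(1) _ continuous_on_const _ y])
      show "continuous_on S (D.WW c i j)" by (rule smooth_on_continuous[OF S.smooth_WW])
      fix y assume y: "y \<in> S" "0 < hgt y"
      then obtain q where q: "q \<in> fst d" "q \<in> N" "y = snd d q" by (auto simp: S_def)
      then show "D.WW c i j y = 0" using flatY[OF subsetD[OF S(2) y(1)]] N(4)[OF q(2)] y(2) hx \<open>a = 0\<close> param_coord[OF d(1) q(1)] by auto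
    qed
    then show ?thesis using S by blast
  qed
  then obtain S where "hopen S \<and> S \<subseteq> image_of d \<and> ?x \<in> S \<and> (\<forall>y\<in>S. \<forall>i j. D.WW c i j y = 0)" by (elim exE)
  then have hS: "hopen S" and S: "S \<subseteq> image_of d" "?x \<in> S" and flatS: "\<And>y i j. y \<in> S \<Longrightarrow> D.WW c i j y = 0" by blast+
  interpret S: metric_chart S "Gm d" by (rule D.metric_chart_subset[OF hS S(1)])
  define Y where "Y = {y \<in> S. ?h ?x < ?h y}"
  have YS: "Y \<subseteq> snd d ` (fst d \<inter> above a)" using above_coord[OF d(1), of a] S(1) hx by (auto simp: Y_def)
  have Ypos: "0 < hgt y" "snd ((F \<circ> param d) y) = ?h y" if y: "y \<in> Y" for y
  proof -
    obtain q where q: "q \<in> fst d" "q \<in> above a" "y = snd d q" using YS y by blast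
    have "H q \<noteq> 0" using q(2) a(1) by (simp add: above_def)
    from interior_coord[OF this d(1) q(1)] show "0 < hgt y" using q(3) by simp
    show "snd ((F \<circ> param d) y) = ?h y" using gisoD(3)[OF F q(2)] param_coord[OF d(1) q(1)] q(3) by simp
  qed
  have isoY: "D.iso_map c Y (F \<circ> param d)" by (rule iso_map_subset[OF d(1) gisoD(2)[OF F d(1)] YS])
  have solS: "D.solves c S ?h" by (rule D.solves_subset[OF sol[OF d(1)] S(1)])
  from S.extend_iso_map[OF c_nz flatS solS S(2) e_def e0 bd Y_def Ypos(1) isoY Ypos(2)]
  obtain \<rho> E where E: "\<rho> > 0" "half_ball ?x \<rho> \<subseteq> S" "D.iso_map c (half_ball ?x \<rho>) E"
    "\<And>y. y \<in> half_ball ?x \<rho> \<Longrightarrow> snd (E y) = ?h y" "\<And>y. y \<in> half_ball ?x \<rho> \<Longrightarrow> ?h ?x < ?h y \<Longrightarrow> E y = (F \<circ> param d) y"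
    by auto
  define X where "X = half_ball ?x \<rho>"
  have X: "hopen X" "X \<subseteq> image_of d" "?x \<in> X" using hopen_half_ball E(1,2) S(1) D.in_half[OF xi] by (auto simp: X_def)
  have "giso c H (param d ` X) (E \<circ> snd d)"
    by (rule giso_of_chart[OF d(1) X(1,2)]) (use E(3,4) in \<open>simp_all add: X_def\<close>)
  moreover have "(E \<circ> snd d) q = F q" if "q \<in> param d ` X \<inter> above a" for q
    using E(5)[of "snd d q"] param_image(1,2)[OF X(2), of q] that param_coord[OF d(1), of q] hx by (simp add: X_def above_def)
  ultimately show ?thesis using param_imageI[OF d X(3)] by blast
qed

end

text \<open>A linear isometry that preserves the height and fixes only the points of the axis. It
  turns the germ of a local isometry into a different germ with the same height.\<close>

definition flip :: "('a::real_inner) \<times> real \<Rightarrow> 'a \<times> real" where "flip z = (- fst z, snd z)"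

lemma bounded_linear_flip: "bounded_linear flip"
  unfolding flip_def[abs_def]
  by (intro bounded_linear_Pair bounded_linear_minus bounded_linear_fst bounded_linear_snd)

lemma inner_flip [simp]: "flip z \<bullet> flip w = z \<bullet> w" and snd_flip [simp]: "snd (flip z) = snd z"
  by (simp_all add: flip_def inner_prod_def)

lemma (in metric_chart) iso_map_flip:
  assumes F: "iso_map c S F" shows "iso_map c S (\<lambda>x. flip (F x))"
proof -
  have sF: "smooth_on S F" using F by (simp add: iso_map_def)
  have "pd i (\<lambda>x. flip (F x)) x = flip (pd i F x)" if "x \<in> S" for i x
    using pd_linear[OF hopen_S that bounded_linear_flip sF] .
  then show ?thesis using F smooth_on_linear[OF bounded_linear_flip sF] by (simp add: iso_map_def)
qed

section \<open>Peaks, and continuation downwards from them\<close>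

context obata begin

lemma giso_flip: assumes F: "giso c H U F" shows "giso c H U (\<lambda>p. flip (F p))"
  unfolding giso_def
proof (intro conjI ballI)
  show "openin T U" by (rule gisoD(1)[OF F])
  show "snd (flip (F p)) = H p" if "p \<in> U" for p using gisoD(3)[OF F that] by simp
  fix d assume d: "d \<in> atlas M"
  interpret D: metric_chart "snd d ` (fst d \<inter> U)" "Gm d" by (rule metric_chart_coord[OF d gisoD(1)[OF F]])
  have "(\<lambda>p. flip (F p)) \<circ> param d = (\<lambda>x. flip ((F \<circ> param d) x))" by auto
  then show "D.iso_map c (snd d ` (fst d \<inter> U)) ((\<lambda>p. flip (F p)) \<circ> param d)"
    using D.iso_map_flip[OF gisoD(2)[OF F d]] by simp
qed

lemma local_max_crit:
  assumes N: "openin T N" "p \<in> N" and max: "\<And>q. q \<in> N \<Longrightarrow> H q \<le> H p" and nz: "H p \<noteq> 0"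
  shows "c * (H p)\<^sup>2 = 1"
proof -
  have "p \<in> topspace T" using N openin_subset by blast
  then obtain d where d: "d \<in> atlas M" "p \<in> fst d" using chart_cover by blast
  have "pd i (H \<circ> param d) (snd d p) = 0" for i
    by (rule pd_zero_at_interior_max[OF d interior_coord[OF nz d] smooth_H[OF d(1)] N max])
  then show ?thesis using crit_iff(1)[OF d(1) coord_in[OF d(2)]] param_coord[OF d] by simp
qed

lemma closedin_H: "closed C \<Longrightarrow> closedin T {x \<in> topspace T. H x \<in> C}"
  by (rule closedin_continuous_map_preimage[OF continuous_H]) (simp flip: closed_closedin)

text \<open>The largest value allowed by the energy, and by \<open>crit_peak\<close> the only
  critical value above zero.\<close>

definition peaks :: "'m set" where "peaks = {p \<in> topspace T. H p = 1 / sqrt c}"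

lemma sqrt_pos: "0 < 1 / sqrt c" using c_pos by simp

lemma crit_peak: assumes "0 < H p" "c * (H p)\<^sup>2 = 1" shows "H p = 1 / sqrt c"
proof -
  have "(H p)\<^sup>2 = (1 / sqrt c)\<^sup>2" using assms(2) c_pos by (simp add: power_divide field_simps)
  then show ?thesis using assms(1) sqrt_pos power2_eq_iff_nonneg[of "H p" "1 / sqrt c"] by simp
qed

lemma crit_value: "c * a\<^sup>2 = 1 \<longleftrightarrow> a\<^sup>2 = (1 / sqrt c)\<^sup>2"
  using c_pos by (auto simp: power_divide field_simps)

lemma H_le_peak: assumes "p \<in> topspace T" shows "H p \<le> 1 / sqrt c"
proof (rule power2_le_imp_le)
  show "(H p)\<^sup>2 \<le> (1 / sqrt c)\<^sup>2" using H_le[OF assms] c_pos by (simp add: power_divide field_simps)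
qed (use sqrt_pos in simp)

text \<open>The maximum of \<open>H\<close> over the closure of \<open>V\<close> lies above level
  \<open>a\<close>, hence in \<open>V\<close> itself. As \<open>V\<close> is open it is a local
  maximum of \<open>H\<close>, thus critical. This lemma takes the place of connectedness: a
  property that is open and closed above level \<open>a\<close> need only be checked at the
  peaks.\<close>

lemma clopen_has_peak:
  assumes a: "0 \<le> a" and V: "openin T V" "V \<subseteq> above a" "T closure_of V \<inter> above a \<subseteq> V" "V \<noteq> {}"
  shows "\<exists>p\<in>V. p \<in> peaks"
proof -
  have "V \<subseteq> topspace T" using V(1) openin_subset by blast
  then have sub: "V \<subseteq> T closure_of V" by (rule closure_of_subset)
  then obtain p where p: "p \<in> T closure_of V" "\<And>q. q \<in> T closure_of V \<Longrightarrow> H q \<le> H p"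
    using H_attains_max[OF closedin_closure_of, of V] V(4) by blast
  obtain v where v: "v \<in> V" using V(4) by blast
  then have "a < H v" using V(2) by (auto simp: above_def)
  also have "H v \<le> H p" using p(2) sub v by blast
  finally have ap: "a < H p" .
  have pt: "p \<in> topspace T" using p(1) by (simp add: in_closure_of)
  then have pV: "p \<in> V" using V(3) p(1) ap by (auto simp: above_def)
  have "c * (H p)\<^sup>2 = 1" by (rule local_max_crit[OF V(1) pV]) (use p(2) sub ap a in auto)
  moreover have "0 < H p" using ap a by simp
  ultimately have "p \<in> peaks" using crit_peak pt by (simp add: peaks_def)
  then show ?thesis using pV by blast
qed

text \<open>By unique continuation the part where the maps disagree is open and closed above level
  \<open>a\<close>, and it contains no peak.\<close>

lemma agree_on_above:
  assumes a: "0 \<le> a" and F: "giso c H (above a) F" "giso c H (above a) F'"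
    and pk: "\<And>p. p \<in> peaks \<Longrightarrow> p \<in> agree F F'"
  shows "above a \<subseteq> agree F F'"
proof (rule ccontr)
  assume n: "\<not> above a \<subseteq> agree F F'"
  define V where "V = above a - T closure_of agree F F'"
  have cl: "p \<in> agree F F'" if "p \<in> above a" "p \<in> T closure_of agree F F'" for p
    using agree_closed[OF c_nz F that] .
  have sub: "agree F F' \<subseteq> T closure_of (agree F F')"
    by (rule closure_of_subset[OF openin_subset[OF openin_agree]])
  have V: "openin T V" unfolding V_def by (intro openin_diff openin_above closedin_closure_of)
  have "V \<inter> agree F F' = {}" using sub unfolding V_def by blast
  then have "T closure_of V \<inter> agree F F' = {}"
    using openin_Int_closure_of_eq_empty[OF openin_agree, of F F' V] by blast
  then have c: "T closure_of V \<inter> above a \<subseteq> V" using cl unfolding V_def by blast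
  have "V \<noteq> {}" using n cl unfolding V_def by blast
  from clopen_has_peak[OF a V _ c this] obtain p where "p \<in> V" "p \<in> peaks" unfolding V_def by blast
  then show False using pk sub unfolding V_def by blast
qed

text \<open>Otherwise \<open>x\<close> would be a local maximum of \<open>H\<close> at a noncritical
  value. The case \<open>a = 0\<close> is different, because there \<open>x\<close> may be a
  boundary point.\<close>

lemma closure_above:
  assumes "x \<in> topspace T" "H x = a" "0 < a" "c * a\<^sup>2 \<noteq> 1"
  shows "x \<in> T closure_of above a"
proof (rule ccontr)
  assume n: "x \<notin> T closure_of above a"
  define N where "N = topspace T - T closure_of above a"
  have N: "openin T N" unfolding N_def by (rule openin_diff[OF openin_topspace closedin_closure_of])
  have xN: "x \<in> N" using n assms(1) by (simp add: N_def)
  have "H q \<le> H x" if "q \<in> N" for q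
  proof (rule ccontr)
    assume "\<not> H q \<le> H x"
    then have "q \<in> above a" using that assms(2) by (auto simp: above_def N_def)
    then have "q \<in> T closure_of above a" using closure_of_subset[OF openin_subset[OF openin_above]] by blast
    then show False using that by (simp add: N_def)
  qed
  from local_max_crit[OF N xN this] show False using assms(2-4) by simp
qed

text \<open>The local extensions at level \<open>a\<close> are compatible for free: each restricts
  to \<open>F\<close> above the level, every point of \<open>Z\<close> is a limit of such points,
  and agreement of germs passes to limits.\<close>

lemma extend_down:
  assumes a: "0 \<le> a" "c * a\<^sup>2 \<noteq> 1" and F: "giso c H (above a) F"
  shows "\<exists>U F'. giso c H U F' \<and> T closure_of (above a) \<subseteq> U \<and> (\<forall>q\<in>above a. F' q = F q)"
proof -
  define Z where "Z = {x \<in> T closure_of (above a). H x = a}"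
  have "closedin T {x \<in> topspace T. H x \<in> {a}}" by (rule closedin_H) simp
  moreover have "Z = T closure_of (above a) \<inter> {x \<in> topspace T. H x \<in> {a}}" by (auto simp: Z_def in_closure_of)
  ultimately have Z: "closedin T Z" by (simp add: closedin_Int)
  have "\<forall>x\<in>Z. \<exists>BE. giso c H (fst BE) (snd BE) \<and> x \<in> fst BE \<and> (\<forall>q\<in>fst BE \<inter> above a. snd BE q = F q)"
  proof
    fix x assume "x \<in> Z"
    then have "x \<in> T closure_of above a" "H x = a" by (auto simp: Z_def)
    from extend_point[OF a F this] obtain B E where "giso c H B E \<and> x \<in> B \<and> (\<forall>q\<in>B \<inter> above a. E q = F q)" by (elim exE)
    then show "\<exists>BE. giso c H (fst BE) (snd BE) \<and> x \<in> fst BE \<and> (\<forall>q\<in>fst BE \<inter> above a. snd BE q = F q)"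
      by (intro exI[of _ "(B, E)"]) simp
  qed
  from bchoice[OF this] obtain BE where
    "\<forall>x\<in>Z. giso c H (fst (BE x)) (snd (BE x)) \<and> x \<in> fst (BE x) \<and> (\<forall>q\<in>fst (BE x) \<inter> above a. snd (BE x) q = F q)" by (elim exE)
  note BE = bspec[OF this]
  have "w \<in> agree (snd (BE x)) (snd (BE y))"
    if xyw: "x \<in> Z" "y \<in> Z" "w \<in> Z" "w \<in> fst (BE x)" "w \<in> fst (BE y)" for x y w
  proof -
    have g: "giso c H (fst (BE x)) (snd (BE x))" "giso c H (fst (BE y)) (snd (BE y))" "w \<in> fst (BE x)" using BE xyw by blast+
    define N where "N = fst (BE x) \<inter> fst (BE y)"
    have N: "openin T N" unfolding N_def using gisoD(1)[OF g(1)] gisoD(1)[OF g(2)] by blast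
    have gN: "giso c H N (snd (BE x))" "giso c H N (snd (BE y))" "w \<in> N"
      using giso_subset[OF g(1) N] giso_subset[OF g(2) N] xyw(4,5) by (auto simp: N_def)
    have "w \<in> N \<inter> T closure_of above a" using xyw by (auto simp: N_def Z_def)
    then have "w \<in> T closure_of (N \<inter> above a)" using openin_Int_closure_of_subset[OF N] by blast
    moreover have "N \<inter> above a \<subseteq> agree (snd (BE x)) (snd (BE y))"
    proof
      fix q assume "q \<in> N \<inter> above a"
      then show "q \<in> agree (snd (BE x)) (snd (BE y))"
        using N openin_above[of a] BE[OF xyw(1)] BE[OF xyw(2)] by (intro agreeI[of "N \<inter> above a"]) (auto simp: N_def)
    qed
    ultimately have "w \<in> T closure_of agree (snd (BE x)) (snd (BE y))" using closure_of_mono by blast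
    then show ?thesis by (rule agree_closed[OF c_nz gN])
  qed
  from glue[OF F Z BE this] obtain U F' where U: "giso c H U F'" "above a \<union> Z \<subseteq> U" "\<forall>q\<in>above a. F' q = F q" by auto
  have "T closure_of (above a) \<subseteq> above a \<union> Z"
  proof
    fix x assume x: "x \<in> T closure_of above a"
    have "closedin T {x \<in> topspace T. H x \<in> {a..}}" by (rule closedin_H) simp
    then have "T closure_of above a \<subseteq> {x \<in> topspace T. H x \<in> {a..}}"
      by (intro closure_of_minimal) (auto simp: above_def)
    then show "x \<in> above a \<union> Z" using x by (auto simp: above_def Z_def)
  qed
  then show ?thesis using U by blast
qed

end

section \<open>Germs at the peaks and the developing map\<close>

context obata begin

text \<open>Where a germ agrees with its reflection, \<open>F = (0, H)\<close> lies on the axis, so every such point with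
  \<open>H > 0\<close> is a peak.\<close>

lemma not_agree_flip:
  assumes E: "giso c H B E" and p: "p \<in> B" "p \<in> peaks" "B \<inter> peaks \<subseteq> {p}"
  shows "p \<notin> agree E (\<lambda>q. flip (E q))"
proof
  assume ag: "p \<in> agree E (\<lambda>q. flip (E q))"
  define N where "N = B \<inter> agree E (\<lambda>q. flip (E q)) \<inter> above 0"
  have N: "openin T N" unfolding N_def by (intro openin_Int gisoD(1)[OF E] openin_agree openin_above)
  have pN: "p \<in> N" using p ag sqrt_pos by (auto simp: N_def above_def peaks_def)
  have only: "q = p" if q: "q \<in> N" for q
  proof -
    have qB: "q \<in> B" "0 < H q" "q \<in> topspace T" using q by (auto simp: N_def above_def)
    have "E q = flip (E q)" using agree_eq[of q E "\<lambda>q. flip (E q)"] q by (simp add: N_def)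
    then have "fst (E q) $ k = - fst (E q) $ k" for k by (metis flip_def fst_conv vector_uminus_component)
    then have "fst (E q) $ k = 0" for k by (metis equal_neg_zero)
    then have "fst (E q) = 0" by (simp add: vec_eq_iff)
    then have "c * (H q)\<^sup>2 = 1"
      using giso_norm[OF E qB(1)] gisoD(3)[OF E qB(1)] c_pos by (simp add: inner_prod_def power2_eq_square)
    then show "q = p" using crit_peak[OF qB(2)] qB p(3) by (auto simp: peaks_def)
  qed
  obtain d where d: "d \<in> atlas M" "p \<in> fst d" using pN openin_subset[OF N] chart_cover by blast
  obtain r where r: "r > 0" "half_ball (snd d p) r \<subseteq> snd d ` (fst d \<inter> N)" using half_ball_nbhd[OF d N pN] by blast
  define y where "y = snd d p + (r/2) *\<^sub>R axis bdry_index 1"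
  have "y \<in> half_ball (snd d p) r"
    using r(1) metric_chart.in_half[OF metric_chart_image[OF d(1)] coord_in[OF d(2)]] by (simp add: y_def half_space_def dist_norm)
  then have "y = snd d p" using r(2) only by blast
  then show False using r(1) by (simp add: y_def axis_eq_0_iff)
qed

text \<open>At a peak the differential of \<open>H\<close> vanishes, so any horizontal Gram vectors
  together with the pole form an admissible frame. The last coordinate of the resulting map has the
  same jet as \<open>H\<close> there and therefore equals \<open>H\<close>.\<close>

lemma peak_germ:
  assumes p: "p \<in> peaks"
  shows "\<exists>B E. giso c H B E \<and> p \<in> B \<and> B \<inter> peaks \<subseteq> {p}"
proof -
  have Hp: "H p = 1 / sqrt c" "p \<in> topspace T" using p by (auto simp: peaks_def)
  then obtain d where d: "d \<in> atlas M" "p \<in> fst d" using chart_cover by blast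
  interpret D: metric_chart "image_of d" "Gm d" by (rule metric_chart_image[OF d(1)])
  let ?h = "H \<circ> param d" and ?x = "snd d p"
  note xi = coord_in[OF d(2)]
  have hx: "?h ?x = 1 / sqrt c" using param_coord[OF d] Hp(1) by simp
  have x0: "0 < hgt ?x" using interior_coord[OF _ d] Hp(1) sqrt_pos by simp
  have crit: "\<forall>i. pd i ?h ?x = 0" using crit_iff(1)[OF d(1) xi] crit_value param_coord[OF d] Hp(1) by simp
  have "0 < ?h ?x" using hx sqrt_pos by simp
  from D.flat_near_max[OF c_pos sol[OF d(1)] xi x0 spec[OF crit] this] obtain r where r0: "r > 0 \<and> ball ?x r \<subseteq> image_of d \<and>
    (\<forall>y\<in>ball ?x r. (\<forall>i j. D.WW c i j y = 0) \<and> (y \<noteq> ?x \<longrightarrow> \<not> (\<forall>i. pd i ?h y = 0)))" by (elim exE)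
  then have r: "r > 0" "ball ?x r \<subseteq> image_of d"
    "\<And>y i j. y \<in> ball ?x r \<Longrightarrow> D.WW c i j y = 0" "\<And>y. y \<in> ball ?x r \<Longrightarrow> y \<noteq> ?x \<Longrightarrow> \<not> (\<forall>i. pd i ?h y = 0)" by blast+
  define S where "S = half_ball ?x r"
  have hS: "hopen S" unfolding S_def by (rule hopen_half_ball)
  have S: "S \<subseteq> image_of d" "?x \<in> S" using r(1,2) D.in_half[OF xi] by (auto simp: S_def)
  interpret S: metric_chart S "Gm d" by (rule D.metric_chart_subset[OF hS S(1)])
  obtain P0 :: "'n \<Rightarrow> real ^ 'n" where P0: "\<And>i j. P0 i \<bullet> P0 j = Gm d ?x $ i $ j"
    using exists_gram_vectors[OF D.sym_G[OF xi] D.pos_G[OF xi]] by blast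
  have "(1 / sqrt c) * (1 / sqrt c) = 1 / c" using c_pos by simp
  then have fr: "S.frame c ?x (\<lambda>i. (P0 i, 0)) (0, 1 / sqrt c)"
    by (simp add: S.frame_def inner_prod_def P0)
  have flat: "D.WW c i j y = 0" if "y \<in> S" for y i j using r(3) that by (simp add: S_def)
  from S.local_iso_extension[OF c_nz S(2) flat] obtain R where R: "R > 0" "half_ball ?x R \<subseteq> S"
    "\<And>y0 P F0. y0 \<in> ball ?x R \<Longrightarrow> 0 < hgt y0 \<Longrightarrow> S.frame c y0 P F0 \<Longrightarrow>
      \<exists>F. Cinf_on (ball ?x R) F \<and> D.iso_map c (half_ball ?x R) F \<and> F y0 = F0 \<and> (\<forall>i. pd i F y0 = P i)" by auto
  define X where "X = half_ball ?x R"
  have X: "hopen X" "X \<subseteq> image_of d" "?x \<in> X" using hopen_half_ball R(1,2) S(1) D.in_half[OF xi] by (auto simp: X_def)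
  interpret X: metric_chart X "Gm d" by (rule D.metric_chart_subset[OF X(1,2)])
  have "?x \<in> ball ?x R" using R(1) by simp
  from R(3)[OF this x0 fr] obtain E where "Cinf_on (ball ?x R) E \<and> D.iso_map c (half_ball ?x R) E \<and> E ?x = (0, 1 / sqrt c) \<and> (\<forall>i. pd i E ?x = (P0 i, 0))"
    by (elim exE)
  then have E: "D.iso_map c X E" "E ?x = (0, 1 / sqrt c)" "\<And>i. pd i E ?x = (P0 i, 0)" by (auto simp: X_def)
  have sE: "smooth_on X E" using E(1) by (simp add: X.iso_map_def)
  have sndE: "snd (E y) = ?h y" if y: "y \<in> X" for y
  proof -
    have "E y \<bullet> (0, 1) = ?h y"
    proof (rule X.solution_unique[OF X.iso_map_solves[OF c_nz E(1)] D.solves_subset[OF sol[OF d(1)] X(2)] _ X(3) x0 _ y])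
      show "convex X" unfolding X_def by (rule D.convex_half_ball)
      show "jet (\<lambda>x. E x \<bullet> (0, 1)) ?x = jet ?h ?x"
        unfolding jet_def X.pd_inner_const[OF X(3) sE] E(2,3) using crit hx by (simp add: inner_prod_def)
    qed
    then show ?thesis by (simp add: inner_prod_def)
  qed
  define B where "B = param d ` X"
  have pB: "p \<in> B" unfolding B_def by (rule param_imageI[OF d X(3)])
  have cB: "snd d q \<in> X" "q \<in> fst d" if q: "q \<in> B" for q using param_image(1,2)[OF X(2)] q by (auto simp: B_def)
  have "giso c H B (E \<circ> snd d)" unfolding B_def by (rule giso_of_chart[OF d(1) X(1,2) E(1) sndE])
  moreover have "q = p" if q: "q \<in> B" "q \<in> peaks" for q
  proof (rule ccontr)
    assume "q \<noteq> p"
    then have "snd d q \<noteq> ?x" using param_coord[OF d] param_coord[OF d(1) cB(2)[OF q(1)]] by metis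
    moreover have "snd d q \<in> ball ?x r" using cB(1)[OF q(1)] R(2) by (auto simp: X_def S_def)
    ultimately have "\<not> (\<forall>i. pd i ?h (snd d q) = 0)" using r(4) by blast
    moreover have "\<forall>i. pd i ?h (snd d q) = 0"
      using crit_iff(1)[OF d(1) coord_in[OF cB(2)[OF q(1)]]] param_coord[OF d(1) cB(2)[OF q(1)]] q(2) crit_value by (simp add: peaks_def)
    ultimately show False by blast
  qed
  ultimately show ?thesis using pB by blast
qed

text \<open>Gluing starts from the empty map. Each germ domain contains only its own peak, which
  makes compatibility trivial, and a neighbourhood of the peaks contains a superlevel set because
  \<open>H\<close> is nowhere larger than at a peak.\<close>

lemma initial_map:
  assumes g: "\<And>p. p \<in> peaks \<Longrightarrow> giso c H (B p) (E p) \<and> p \<in> B p \<and> B p \<inter> peaks \<subseteq> {p}"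
  shows "\<exists>a F. 0 \<le> a \<and> a < 1 / sqrt c \<and> giso c H (above a) F \<and> (\<forall>p\<in>peaks. p \<in> agree F (E p))"
proof -
  have "peaks = {p \<in> topspace T. H p \<in> {1 / sqrt c}}" by (auto simp: peaks_def)
  then have cl: "closedin T peaks" using closedin_H[of "{1 / sqrt c}"] by simp
  have e: "giso c H {} (\<lambda>p. undefined)" by (rule giso_localI) auto
  have "\<exists>U F'. giso c H U F' \<and> {} \<union> peaks \<subseteq> U \<and> (\<forall>q\<in>{}. F' q = (\<lambda>p. undefined) q) \<and>
    (\<forall>w\<in>peaks. \<exists>x\<in>peaks. w \<in> B x \<and> w \<in> agree F' (E x))"
  proof (rule glue[OF e cl])
    show "giso c H (B x) (E x) \<and> x \<in> B x \<and> (\<forall>q\<in>B x \<inter> {}. E x q = undefined)" if "x \<in> peaks" for x using g[OF that] by simp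
    fix x y w assume xyw: "x \<in> peaks" "y \<in> peaks" "w \<in> peaks" "w \<in> B x" "w \<in> B y"
    then have "w = x" "w = y" using g by blast+
    then show "w \<in> agree (E x) (E y)" using gisoD(1) g[OF xyw(1)] by (intro agreeI[of "B x"]) auto
  qed
  then obtain U F where U: "giso c H U F" "peaks \<subseteq> U" "\<And>w. w \<in> peaks \<Longrightarrow> \<exists>x\<in>peaks. w \<in> B x \<and> w \<in> agree F (E x)" by auto
  have "{p \<in> topspace T. 1 / sqrt c \<le> H p} \<subseteq> U" using U(2) H_le_peak by (fastforce simp: peaks_def)
  from superlevel_shrink[OF gisoD(1)[OF U(1)] this] obtain a' where a': "a' < 1 / sqrt c" "{p \<in> topspace T. a' < H p} \<subseteq> U" by blast
  define a where "a = max 0 a'"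
  have a: "0 \<le> a" "a < 1 / sqrt c" using a'(1) sqrt_pos by (auto simp: a_def)
  have "above a \<subseteq> U" using a'(2) by (auto simp: above_def a_def)
  then have "giso c H (above a) F" using giso_subset[OF U(1) openin_above] by blast
  moreover have "p \<in> agree F (E p)" if p: "p \<in> peaks" for p
  proof -
    obtain x where x: "x \<in> peaks" "p \<in> B x" "p \<in> agree F (E x)" using U(3)[OF p] by blast
    then have "p = x" using g[OF x(1)] p by blast
    then show ?thesis using x(3) by simp
  qed
  ultimately show ?thesis using a by blast
qed

lemma agree_trans: "p \<in> agree F F' \<Longrightarrow> p \<in> agree F' F'' \<Longrightarrow> p \<in> agree F F''"
  by (rule agreeI[of "agree F F' \<inter> agree F' F''"]) (auto simp: openin_Int openin_agree agree_eq)

lemma agree_sym: "p \<in> agree F F' \<Longrightarrow> p \<in> agree F' F"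
  by (rule agreeI[of "agree F F'"]) (auto simp: openin_agree agree_eq)

lemma peak_above: "p \<in> peaks \<Longrightarrow> a < 1 / sqrt c \<Longrightarrow> p \<in> above a"
  by (simp add: peaks_def above_def)

text \<open>Continuous induction on the level: the maps above the levels of \<open>A\<close> fit
  together above the infimum \<open>m\<close>, and if \<open>m\<close> were positive, extending
  across level \<open>m\<close> would produce a smaller admissible level.\<close>

lemma developing_map_above_0:
  assumes g: "\<And>p. p \<in> peaks \<Longrightarrow> giso c H (B p) (E p) \<and> p \<in> B p \<and> B p \<inter> peaks \<subseteq> {p}"
  shows "\<exists>F. giso c H (above 0) F \<and> (\<forall>p\<in>peaks. p \<in> agree F (E p))"
proof -
  define good where "good a F \<longleftrightarrow> giso c H (above a) F \<and> (\<forall>p\<in>peaks. p \<in> agree F (E p))" for a F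
  define A where "A = {a. 0 \<le> a \<and> a < 1 / sqrt c \<and> (\<exists>F. good a F)}"
  have ne: "A \<noteq> {}" using initial_map[OF g] unfolding A_def good_def by blast
  have bdd: "bdd_below A" by (rule bdd_belowI[of _ 0]) (simp add: A_def)
  define m where "m = Inf A"
  have m0: "0 \<le> m" unfolding m_def using cInf_greatest[OF ne, of 0] by (simp add: A_def)
  have mle: "m \<le> a" if "a \<in> A" for a unfolding m_def using cInf_lower[OF that bdd] .
  have m1: "m < 1 / sqrt c" using ne mle by (fastforce simp: A_def)
  have "\<forall>a\<in>A. \<exists>F. good a F" by (simp add: A_def)
  from bchoice[OF this] obtain F where F: "\<forall>a\<in>A. good a (F a)" by (elim exE)
  have Fg: "giso c H (above a) (F a)" "p \<in> peaks \<Longrightarrow> p \<in> agree (F a) (E p)" if "a \<in> A" for a p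
    using F that by (auto simp: good_def)
  have eq: "F a q = F b q" if ab: "a \<in> A" "b \<in> A" "q \<in> above a" "q \<in> above b" for a b q
  proof -
    define k where "k = max a b"
    have k: "0 \<le> k" "above k \<subseteq> above a" "above k \<subseteq> above b" "q \<in> above k" using ab by (auto simp: k_def A_def above_def)
    have "above k \<subseteq> agree (F a) (F b)"
    proof (rule agree_on_above[OF k(1)])
      show "giso c H (above k) (F a)" by (rule giso_subset[OF Fg(1)[OF ab(1)] openin_above k(2)])
      show "giso c H (above k) (F b)" by (rule giso_subset[OF Fg(1)[OF ab(2)] openin_above k(3)])
      show "p \<in> agree (F a) (F b)" if "p \<in> peaks" for p
        by (rule agree_trans[OF Fg(2)[OF ab(1) that] agree_sym[OF Fg(2)[OF ab(2) that]]])
    qed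
    then show ?thesis using agree_eq k(4) by blast
  qed
  \<comment> \<open>The union of all the maps. The choice is immaterial because
    \<open>agree_on_above\<close> makes any two of them equal above both levels.\<close>
  define F0 where "F0 q = F (SOME a. a \<in> A \<and> q \<in> above a) q" for q
  have F0: "F0 q = F a q" if "a \<in> A" "q \<in> above a" for a q
    using someI[of "\<lambda>a. a \<in> A \<and> q \<in> above a" a] that eq unfolding F0_def by blast
  have Fm: "giso c H (above m) F0"
  proof (rule giso_local[OF openin_above])
    fix p assume "p \<in> above m"
    then have "m < H p" "p \<in> topspace T" by (auto simp: above_def)
    then obtain a where a: "a \<in> A" "a < H p" using cInf_lessD[OF ne] unfolding m_def by blast
    then have "p \<in> above a" using \<open>p \<in> topspace T\<close> by (simp add: above_def)
    then show "\<exists>V F'. openin T V \<and> p \<in> V \<and> giso c H V F' \<and> (\<forall>q\<in>V. F' q = F0 q)"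
      using Fg(1)[OF a(1)] openin_above F0[OF a(1)] by (intro exI[of _ "above a"] exI[of _ "F a"]) simp
  qed
  have pk: "p \<in> agree F0 (E p)" if p: "p \<in> peaks" for p
  proof -
    obtain a where a: "a \<in> A" using ne by blast
    have "p \<in> above a" using peak_above[OF p] a by (simp add: A_def)
    then have "p \<in> agree F0 (F a)" using F0[OF a] openin_above by (intro agreeI[of "above a"]) auto
    from agree_trans[OF this Fg(2)[OF a p]] show ?thesis .
  qed
  \<comment> \<open>For a positive level, \<open>closure_above\<close> puts every point of the level
    set into the closure, so the extension covers a neighbourhood of the whole set where
    \<open>H\<close> is at least \<open>m\<close>.\<close>
  have "m = 0"
  proof (rule ccontr)
    assume "m \<noteq> 0"
    then have mpos: "0 < m" using m0 by simp
    have "m\<^sup>2 < (1 / sqrt c)\<^sup>2" using m0 m1 by (intro power_strict_mono) auto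
    then have cm: "c * m\<^sup>2 \<noteq> 1" using crit_value by simp
    from extend_down[OF m0 cm Fm] obtain U F' where U: "giso c H U F'" "T closure_of (above m) \<subseteq> U" "\<forall>q\<in>above m. F' q = F0 q"
      by auto
    have "{p \<in> topspace T. m \<le> H p} \<subseteq> U"
    proof
      fix p assume p: "p \<in> {p \<in> topspace T. m \<le> H p}"
      have "p \<in> T closure_of above m"
      proof (cases "H p = m")
        case True
        then show ?thesis using closure_above[of p m] mpos cm p by simp
      next
        case False
        then have "p \<in> above m" using p by (simp add: above_def)
        then show ?thesis using closure_of_subset[OF openin_subset[OF openin_above]] by blast
      qed
      then show "p \<in> U" using U(2) by blast
    qed
    from superlevel_shrink[OF gisoD(1)[OF U(1)] this] obtain a' where a': "a' < m" "{p \<in> topspace T. a' < H p} \<subseteq> U" by blast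
    define a where "a = max 0 a'"
    have a: "0 \<le> a" "a < m" using a'(1) mpos by (auto simp: a_def)
    have "above a \<subseteq> U" using a'(2) by (auto simp: above_def a_def)
    then have g1: "giso c H (above a) F'" using giso_subset[OF U(1) openin_above] by blast
    have "p \<in> agree F' (E p)" if p: "p \<in> peaks" for p
    proof -
      have "p \<in> agree F' F0" using U(3) peak_above[OF p m1] openin_above by (intro agreeI[of "above m"]) auto
      from agree_trans[OF this pk[OF p]] show ?thesis .
    qed
    then have "a \<in> A" using g1 a m1 by (auto simp: A_def good_def)
    then show False using mle a(2) by force
  qed
  then show ?thesis using Fm pk by blast
qed

lemma developing_map:
  assumes g: "\<And>p. p \<in> peaks \<Longrightarrow> giso c H (B p) (E p) \<and> p \<in> B p \<and> B p \<inter> peaks \<subseteq> {p}"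
  shows "\<exists>U F. giso c H U F \<and> upper \<subseteq> U \<and> (\<forall>p\<in>peaks. p \<in> agree F (E p))"
proof -
  obtain F where F: "giso c H (above 0) F" "\<And>p. p \<in> peaks \<Longrightarrow> p \<in> agree F (E p)" using developing_map_above_0[OF g] by blast
  from extend_down[OF _ _ F(1)] obtain U F' where U: "giso c H U F'" "upper \<subseteq> U" "\<forall>q\<in>above 0. F' q = F q" by auto
  have "p \<in> agree F' (E p)" if p: "p \<in> peaks" for p
  proof -
    have "p \<in> agree F' F" using U(3) peak_above[OF p sqrt_pos] openin_above by (intro agreeI[of "above 0"]) auto
    from agree_trans[OF this F(2)[OF p]] show ?thesis .
  qed
  then show ?thesis using U by blast
qed

end

section \<open>Sheets over the hemisphere\<close>

text \<open>\<open>W\<close> singles out the part of \<open>upper\<close> that belongs to the peak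
  \<open>p\<close>. This part is relatively open and also closed, which takes the place of choosing
  a connected component.\<close>

locale hemi_sheet = obata M c H for M :: "('m, 'n::finite) riemannian" and c H +
  fixes U :: "'m set" and F :: "'m \<Rightarrow> (real ^ 'n) \<times> real" and W :: "'m set" and p :: 'm
  assumes F: "giso c H U F" and closure_U: "upper \<subseteq> U"
    and W: "openin T W" and closed_D: "closedin T (W \<inter> upper)" and peak: "W \<inter> peaks = {p}"

context obata begin

text \<open>Reflecting the germs at all peaks but \<open>p\<close> gives a second developing map, and the two
  agree precisely on the part of the superlevel set that belongs to \<open>p\<close>.\<close>

lemma sheet_exists:
  assumes q: "q \<in> upper"
  shows "\<exists>U F W p. hemi_sheet M c H U F W p \<and> q \<in> W"
proof -
  have "\<forall>p\<in>peaks. \<exists>BE. giso c H (fst BE) (snd BE) \<and> p \<in> fst BE \<and> fst BE \<inter> peaks \<subseteq> {p}"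
  proof
    fix p assume "p \<in> peaks"
    from peak_germ[OF this] obtain B E where "giso c H B E \<and> p \<in> B \<and> B \<inter> peaks \<subseteq> {p}" by (elim exE)
    then show "\<exists>BE. giso c H (fst BE) (snd BE) \<and> p \<in> fst BE \<and> fst BE \<inter> peaks \<subseteq> {p}" by (intro exI[of _ "(B, E)"]) simp
  qed
  from bchoice[OF this] obtain BE where "\<forall>p\<in>peaks. giso c H (fst (BE p)) (snd (BE p)) \<and> p \<in> fst (BE p) \<and> fst (BE p) \<inter> peaks \<subseteq> {p}" by (elim exE)
  note BE = bspec[OF this]
  define B where "B p = fst (BE p)" for p
  define E where "E p = snd (BE p)" for p
  have g: "giso c H (B p) (E p) \<and> p \<in> B p \<and> B p \<inter> peaks \<subseteq> {p}" if "p \<in> peaks" for p using BE[OF that] by (simp add: B_def E_def)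
  have "closedin T peaks" using closedin_H[of "{1 / sqrt c}"] by (simp add: peaks_def)
  then have "compactin T peaks" using closedin_compact_space compact_T by blast
  moreover have "openin T V" if "V \<in> B ` peaks" for V using g gisoD(1) that by blast
  moreover have "peaks \<subseteq> \<Union>(B ` peaks)" using g by blast
  ultimately obtain \<F> where "finite \<F>" "\<F> \<subseteq> B ` peaks" "peaks \<subseteq> \<Union>\<F>" using compactinD[of T peaks "B ` peaks"] by blast
  then obtain I where I: "finite I" "I \<subseteq> peaks" "peaks \<subseteq> (\<Union>i\<in>I. B i)" by (metis finite_subset_image)
  have "peaks \<subseteq> I"
  proof
    fix x assume x: "x \<in> peaks"
    then obtain i where i: "i \<in> I" "x \<in> B i" using I(3) by blast
    then have "i \<in> peaks" using I(2) by blast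
    then have "x = i" using g[of i] x i(2) by blast
    then show "x \<in> I" using i(1) by simp
  qed
  \<comment> \<open>Peaks are isolated and form a compact set. Finiteness is what makes the union
    \<open>C\<close> of closures closed.\<close>
  then have fin: "finite peaks" using I(1) finite_subset by blast
  obtain U F where F: "giso c H U F" "upper \<subseteq> U" "\<And>p. p \<in> peaks \<Longrightarrow> p \<in> agree F (E p)"
    using developing_map[OF g] by blast
  define E' where "E' p x = (if x = p then E x else (\<lambda>q. flip (E x q)))" for p x
  have g': "giso c H (B x) (E' p x) \<and> x \<in> B x \<and> B x \<inter> peaks \<subseteq> {x}" if "x \<in> peaks" for p x
    using g[OF that] giso_flip unfolding E'_def by auto
  have "\<forall>p. \<exists>UF. giso c H (fst UF) (snd UF) \<and> upper \<subseteq> fst UF \<and> (\<forall>x\<in>peaks. x \<in> agree (snd UF) (E' p x))"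
  proof
    fix p
    have "\<exists>U' F'. giso c H U' F' \<and> upper \<subseteq> U' \<and> (\<forall>x\<in>peaks. x \<in> agree F' (E' p x))"
      by (rule developing_map) (rule g')
    then obtain U' F' where "giso c H U' F' \<and> upper \<subseteq> U' \<and> (\<forall>x\<in>peaks. x \<in> agree F' (E' p x))" by (elim exE)
    then show "\<exists>UF. giso c H (fst UF) (snd UF) \<and> upper \<subseteq> fst UF \<and> (\<forall>x\<in>peaks. x \<in> agree (snd UF) (E' p x))"
      by (intro exI[of _ "(U', F')"]) simp
  qed
  from choice[OF this] obtain UF where
    UF: "\<forall>p. giso c H (fst (UF p)) (snd (UF p)) \<and> upper \<subseteq> fst (UF p) \<and> (\<forall>x\<in>peaks. x \<in> agree (snd (UF p)) (E' p x))" by (elim exE)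
  define F' where "F' p = snd (UF p)" for p
  define W where "W p = agree F (F' p)" for p
  have F': "giso c H (fst (UF p)) (F' p)" "upper \<subseteq> fst (UF p)" "x \<in> peaks \<Longrightarrow> x \<in> agree (F' p) (E' p x)" for p x
    using spec[OF UF, of p] by (simp_all add: F'_def)
  have cl: "x \<in> W p" if x: "x \<in> upper" "x \<in> T closure_of W p" for x p
  proof -
    define N where "N = U \<inter> fst (UF p)"
    have N: "openin T N" unfolding N_def using gisoD(1)[OF F(1)] gisoD(1)[OF F'(1)] by (rule openin_Int)
    have "giso c H N F" "giso c H N (F' p)" using giso_subset[OF F(1) N] giso_subset[OF F'(1) N] by (auto simp: N_def)
    moreover have "x \<in> N" using x(1) F(2) F'(2) by (auto simp: N_def)
    ultimately show ?thesis using agree_closed[OF c_nz] x(2) unfolding W_def by blast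
  qed
  have oW: "openin T (W p)" for p unfolding W_def by (rule openin_agree)
  have subW: "W p \<subseteq> T closure_of W p" for p by (rule closure_of_subset[OF openin_subset[OF oW]])
  have sub0: "above 0 \<subseteq> upper" by (rule closure_of_subset[OF openin_subset[OF openin_above]])
  have pW: "p \<in> W p" if "p \<in> peaks" for p
    using agree_trans[OF F(3)[OF that] agree_sym[OF F'(3)[OF that, of p, unfolded E'_def, simplified]]] by (simp add: W_def)
  have peak: "x = p" if x: "x \<in> W p" "x \<in> peaks" for x p
  proof (rule ccontr)
    assume "x \<noteq> p"
    then have "x \<in> agree (F' p) (\<lambda>q. flip (E x q))" using F'(3)[OF x(2), of p] by (simp add: E'_def)
    from agree_trans[OF agree_trans[OF agree_sym[OF F(3)[OF x(2)]] x(1)[unfolded W_def]] this]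
    show False using not_agree_flip[of "B x" "E x" x] g[OF x(2)] x(2) by simp
  qed
  \<comment> \<open>What \<open>C\<close> leaves of \<open>above 0\<close> is open and closed there
    and contains no peak, so it is empty.\<close>
  define C where "C = (\<Union>p\<in>peaks. T closure_of W p)"
  have C: "closedin T C" unfolding C_def using fin by (intro closedin_Union) auto
  have sub: "above 0 \<subseteq> C"
  proof (rule ccontr)
    assume n: "\<not> above 0 \<subseteq> C"
    define V where "V = above 0 - C"
    have V: "openin T V" unfolding V_def by (rule openin_diff[OF openin_above C])
    have "T closure_of V \<inter> W p = {}" if "p \<in> peaks" for p
    proof -
      have "V \<inter> W p = {}" using subW that unfolding V_def C_def by blast
      then show ?thesis using openin_Int_closure_of_eq_empty[OF oW, of p V] by blast
    qed
    then have "T closure_of V \<inter> above 0 \<subseteq> V" using cl sub0 unfolding V_def C_def by blast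
    from clopen_has_peak[OF order_refl V _ this] n obtain p where "p \<in> V" "p \<in> peaks" unfolding V_def by blast
    then show False using pW subW unfolding V_def C_def by blast
  qed
  then have "upper \<subseteq> C" using C by (intro closure_of_minimal)
  then obtain p where p: "p \<in> peaks" "q \<in> T closure_of W p" using q unfolding C_def by blast
  have "W p \<inter> upper = T closure_of W p \<inter> upper" using cl subW by blast
  then have "closedin T (W p \<inter> upper)" by (simp add: closedin_Int)
  moreover have "W p \<inter> peaks = {p}" using peak pW p(1) by blast
  ultimately have "hemi_sheet M c H U F (W p) p" by unfold_locales (use F oW in auto)
  then show ?thesis using cl[OF q p(2)] by blast
qed

text \<open>By \<open>bdry_all_charts\<close> one chart decides whether a point is a boundary point,
  so the points of positive height in a chart form an open set off the boundary.\<close>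

lemma closed_bdry: "closedin T (manifold_boundary M)"
proof -
  have sub: "manifold_boundary M \<subseteq> topspace T" using chart_subset unfolding manifold_boundary_def by blast
  have "openin T (topspace T - manifold_boundary M)"
    unfolding openin_subopen[of T "topspace T - manifold_boundary M"]
  proof
    fix x assume x: "x \<in> topspace T - manifold_boundary M"
    then obtain d where d: "d \<in> atlas M" "x \<in> fst d" using chart_cover by blast
    interpret D: metric_chart "image_of d" "Gm d" by (rule metric_chart_image[OF d(1)])
    have "hgt (snd d x) \<noteq> 0" using coord_bdry_in[OF d] x by blast
    then have x0: "0 < hgt (snd d x)" using D.in_half[OF coord_in[OF d(2)]] by (simp add: half_space_def)
    define X where "X = image_of d \<inter> {y. 0 < hgt y}"
    have X: "hopen X" "X \<subseteq> image_of d" unfolding X_def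
      using image_hopen[OF d(1)] open_halfspace_component_gt_cart[of 0 bdry_index] by (auto intro!: openin_Int_open)
    have "x \<in> param d ` X" using x0 coord_in[OF d(2)] by (intro param_imageI d) (simp add: X_def)
    moreover have "param d ` X \<subseteq> topspace T - manifold_boundary M"
    proof
      fix q assume q: "q \<in> param d ` X"
      note qd = param_image(1,2)[OF X(2) q]
      have "q \<notin> manifold_boundary M" using bdry_all_charts[OF _ d(1) qd(1)] qd(2) by (auto simp: X_def)
      then show "q \<in> topspace T - manifold_boundary M" using chart_subset[OF d(1)] qd(1) by blast
    qed
    ultimately show "\<exists>V. openin T V \<and> x \<in> V \<and> V \<subseteq> topspace T - manifold_boundary M" using param_open[OF d(1) X] by blast
  qed
  then show ?thesis using sub by (simp add: closedin_def)
qed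

lemma inward_nbhd:
  assumes d: "d \<in> atlas M" "x \<in> fst d" "hgt (snd d x) = 0" and pos: "0 < pd bdry_index (H \<circ> param d) (snd d x)"
  shows "\<exists>N. openin T N \<and> x \<in> N \<and> N \<subseteq> upper \<and> (\<forall>q\<in>N. H q = 0 \<longrightarrow> q \<in> manifold_boundary M)"
proof -
  have "0 < 1 * pd bdry_index (H \<circ> param d) (snd d x)" using pos by simp
  from H_sign_bdry[OF d this] obtain N where N: "openin T N" "x \<in> N" "N \<subseteq> fst d"
    "\<And>q. q \<in> N \<Longrightarrow> if hgt (snd d q) = 0 then H q = 0 else 0 < 1 * H q" by blast
  have "q \<in> manifold_boundary M" if q: "q \<in> N" "H q = 0" for q
    using N(4)[OF q(1)] coord_bdry_in[OF d(1), of q] N(3) q by (auto split: if_splits)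
  moreover have "q \<in> upper" if q: "q \<in> N" for q
    unfolding in_closure_of
  proof (intro conjI allI impI)
    show "q \<in> topspace T" using q openin_subset[OF N(1)] by blast
    fix G assume "q \<in> G \<and> openin T G"
    then have "openin T (G \<inter> N)" "q \<in> G \<inter> N" using N(1) q by auto
    from interior_dense[OF this d(1)] N(3) q obtain q' where "q' \<in> G" "q' \<in> N" "0 < hgt (snd d q')" by blast
    then show "\<exists>y. y \<in> above 0 \<and> y \<in> G" using N(4)[of q'] openin_subset[OF N(1)] by (intro exI[of _ q']) (auto simp: above_def)
  qed
  ultimately show ?thesis using N(1,2) by blast
qed

lemma bdry_nbhd:
  assumes x: "x \<in> manifold_boundary M" "x \<in> upper"
  shows "\<exists>N. openin T N \<and> x \<in> N \<and> N \<subseteq> upper \<and> (\<forall>q\<in>N. H q = 0 \<longrightarrow> q \<in> manifold_boundary M)"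
proof -
  obtain d where d: "d \<in> atlas M" "x \<in> fst d" "hgt (snd d x) = 0"
    using x(1) unfolding manifold_boundary_def half_space_boundary_def by blast
  from inward_nbhd[OF d pd_bdry_pos[OF d x(2)]] show ?thesis .
qed

end

text \<open>Move along the meridian through \<open>w\<close> towards the pole; the curve
  \<open>\<gamma>\<close> parametrises it by height.\<close>

lemma sphere_raise:
  fixes w :: "('a::euclidean_space) \<times> real"
  assumes w: "w \<bullet> w = 1 / c" "0 \<le> snd w" "fst w \<noteq> 0" and V: "open V" "w \<in> V"
  shows "\<exists>z\<in>V. z \<bullet> z = 1 / c \<and> snd w < snd z"
proof -
  have ww: "fst w \<bullet> fst w + (snd w)\<^sup>2 = 1 / c" using w(1) by (simp add: inner_prod_def power2_eq_square)
  define k where "k = norm (fst w)"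
  have k: "0 < k" "k\<^sup>2 = 1 / c - (snd w)\<^sup>2" using w(3) ww by (auto simp: k_def power2_norm_eq_inner)
  define \<gamma> where "\<gamma> t = ((sqrt (1 / c - t\<^sup>2) / k) *\<^sub>R fst w, t)" for t
  have "isCont \<gamma> (snd w)" unfolding \<gamma>_def using k(1) by (intro continuous_intros) auto
  moreover have "\<gamma> (snd w) = w" using k by (simp add: \<gamma>_def flip: k(2))
  ultimately obtain \<delta> where \<delta>: "\<delta> > 0" "\<And>t. \<bar>t - snd w\<bar> < \<delta> \<Longrightarrow> \<gamma> t \<in> V"
    using V unfolding continuous_at_open by (metis (no_types, lifting) dist_real_def mem_ball openE subset_iff dist_commute)
  have "(snd w)\<^sup>2 < 1 / c" using k by (metis diff_gt_0_iff_gt zero_less_power)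
  then have sw: "snd w < sqrt (1 / c)" using w(2) by (simp add: real_less_rsqrt)
  define t where "t = min (snd w + \<delta> / 2) (sqrt (1 / c))"
  have t: "snd w < t" "\<bar>t - snd w\<bar> < \<delta>" "t \<le> sqrt (1 / c)" using \<delta>(1) sw by (auto simp: t_def min_def)
  have c0: "0 \<le> 1 / c" using w(1) by (metis inner_ge_zero)
  have "t\<^sup>2 \<le> (sqrt (1 / c))\<^sup>2" using t w(2) by (intro power_mono) auto
  then have t2: "t\<^sup>2 \<le> 1 / c" using c0 by simp
  have kk: "fst w \<bullet> fst w = k\<^sup>2" by (simp add: k_def power2_norm_eq_inner)
  have "\<gamma> t \<bullet> \<gamma> t = (sqrt (1 / c - t\<^sup>2) / k)\<^sup>2 * k\<^sup>2 + t\<^sup>2"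
    by (simp add: \<gamma>_def inner_prod_def kk power2_eq_square mult.assoc)
  also have "\<dots> = 1 / c" using k(1) t2 by (simp add: power_divide)
  finally have "\<gamma> t \<bullet> \<gamma> t = 1 / c" .
  moreover have "snd (\<gamma> t) = t" by (simp add: \<gamma>_def)
  ultimately show ?thesis using t \<delta>(2)[OF t(2)] by metis
qed

text \<open>The radial projection of a convex open half-space.\<close>

lemma connected_open_hemisphere:
  assumes c: "c > 0"
  shows "connected {z :: ('a::euclidean_space) \<times> real. z \<bullet> z = 1 / c \<and> 0 < snd z}"
proof -
  define \<phi> where "\<phi> z = (1 / (sqrt c * norm z)) *\<^sub>R z" for z :: "'a \<times> real"
  let ?P = "{z :: 'a \<times> real. 0 < snd z}"
  have n0: "0 < norm z" if "z \<in> ?P" for z using that by auto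
  have "continuous_on ?P \<phi>" unfolding \<phi>_def using n0 c by (intro continuous_intros) auto
  moreover have "?P = UNIV \<times> {0<..}" by auto
  then have "convex ?P" by (simp add: convex_Times)
  ultimately have "connected (\<phi> ` ?P)" by (intro connected_continuous_image convex_connected)
  moreover have into: "\<phi> z \<bullet> \<phi> z = 1 / c \<and> 0 < snd (\<phi> z)" if z: "z \<in> ?P" for z
  proof -
    have "norm (\<phi> z) = 1 / sqrt c" using n0[OF z] c by (simp add: \<phi>_def)
    then have "\<phi> z \<bullet> \<phi> z = (1 / sqrt c)\<^sup>2" by (metis power2_norm_eq_inner)
    then show ?thesis using n0[OF z] z c by (simp add: \<phi>_def power_divide)
  qed
  moreover have fixed: "\<phi> z = z" if "z \<bullet> z = 1 / c" for z
    using that c by (simp add: \<phi>_def norm_eq_sqrt_inner real_sqrt_divide)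
  have "\<phi> ` ?P = {z. z \<bullet> z = 1 / c \<and> 0 < snd z}"
  proof
    show "\<phi> ` ?P \<subseteq> {z. z \<bullet> z = 1 / c \<and> 0 < snd z}" using into by blast
    show "{z. z \<bullet> z = 1 / c \<and> 0 < snd z} \<subseteq> \<phi> ` ?P"
    proof
      fix z :: "'a \<times> real" assume "z \<in> {z. z \<bullet> z = 1 / c \<and> 0 < snd z}"
      then show "z \<in> \<phi> ` ?P" using fixed[of z] by (intro image_eqI[of _ _ z]) auto
    qed
  qed
  ultimately show ?thesis by simp
qed

text \<open>The dimension bound is essential: for dimension 1 the equator consists of two
  points.\<close>

lemma connected_equator:
  assumes c: "c > 0" and n: "2 \<le> DIM('a::euclidean_space)"
  shows "connected {z :: 'a \<times> real. z \<bullet> z = 1 / c \<and> snd z = 0}"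
proof -
  have "{z :: 'a \<times> real. z \<bullet> z = 1 / c \<and> snd z = 0} = (\<lambda>v. (v, 0)) ` sphere 0 (sqrt (1 / c))"
  proof
    show "{z :: 'a \<times> real. z \<bullet> z = 1 / c \<and> snd z = 0} \<subseteq> (\<lambda>v. (v, 0)) ` sphere 0 (sqrt (1 / c))"
      by (auto simp: inner_prod_def norm_eq_sqrt_inner)
    show "(\<lambda>v. (v, 0)) ` sphere 0 (sqrt (1 / c)) \<subseteq> {z :: 'a \<times> real. z \<bullet> z = 1 / c \<and> snd z = 0}"
    proof clarify
      fix v :: 'a assume "v \<in> sphere 0 (sqrt (1 / c))"
      then have "norm v = sqrt (1 / c)" by simp
      then have "v \<bullet> v = (sqrt (1 / c))\<^sup>2" by (metis power2_norm_eq_inner)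
      then show "(v, 0::real) \<bullet> (v, 0) = 1 / c \<and> snd (v, 0::real) = 0" using c by (simp add: inner_prod_def)
    qed
  qed
  moreover have "connected (sphere (0::'a) (sqrt (1 / c)))" by (rule connected_sphere[OF n])
  ultimately show ?thesis by (simp only:) (rule connected_continuous_image, intro continuous_intros)
qed

lemma hemisphere_iff:
  assumes "c > 0" shows "(z :: (real ^ 'n) \<times> real) \<in> hemisphere c \<longleftrightarrow> z \<bullet> z = 1 / c \<and> 0 \<le> snd z"
proof -
  have "norm z = 1 / sqrt c \<longleftrightarrow> z \<bullet> z = 1 / c"
    using assms by (simp add: norm_eq_sqrt_inner flip: real_sqrt_inverse)
      (metis inverse_eq_divide real_sqrt_eq_iff real_sqrt_inverse)
  then show ?thesis by (simp add: hemisphere_def)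
qed

section \<open>One sheet is mapped bijectively onto the closed hemisphere\<close>

context hemi_sheet begin

definition D where "D = W \<inter> upper"

lemma D_U: "D \<subseteq> U" and D_W: "D \<subseteq> W" and D_closure: "D \<subseteq> upper" and D_top: "D \<subseteq> topspace T"
  using closure_U closure_of_subset_topspace[of T "above 0"] by (auto simp: D_def)

lemma above_closure: "above 0 \<subseteq> upper"
  by (rule closure_of_subset[OF openin_subset[OF openin_above]])

lemma above_D: "W \<inter> above 0 \<subseteq> D"
  using above_closure by (auto simp: D_def)

lemma H_nonneg: assumes "x \<in> upper" shows "0 \<le> H x"
proof -
  have "upper \<subseteq> {x \<in> topspace T. H x \<in> {0..}}"
    by (intro closure_of_minimal closedin_H) (auto simp: above_def)
  then show ?thesis using assms by auto
qed

lemma F_D: "x \<in> D \<Longrightarrow> F x \<bullet> F x = 1 / c" "x \<in> D \<Longrightarrow> snd (F x) = H x"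
  using giso_norm[OF F] gisoD(3)[OF F] D_U by blast+

lemma peaks_D: "D \<inter> peaks = {p}"
proof -
  have "p \<in> W \<inter> above 0" using peak peak_above[OF _ sqrt_pos] by blast
  then show ?thesis using peak above_D D_W by blast
qed

text \<open>Preimages near \<open>x\<close> are promised only for points of the sphere above the
  equator, since below it the manifold may have ended. The set \<open>N\<close> serves to keep these
  preimages close to \<open>x\<close>.\<close>

lemma local_inverse:
  assumes x: "x \<in> D" and d: "d \<in> atlas M" "x \<in> fst d" and N: "openin T N" "x \<in> N"
  shows "\<exists>Q V h. openin T Q \<and> x \<in> Q \<and> Q \<subseteq> fst d \<and> open V \<and> F x \<in> V \<and> Cinf_on V h \<and>
    (\<forall>q\<in>Q. F q \<in> V \<and> h (F q) = snd d q) \<and>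
    (\<forall>z\<in>V. z \<bullet> z = 1 / c \<longrightarrow> 0 < snd z \<longrightarrow> param d (h z) \<in> N \<inter> above 0 \<and> F (param d (h z)) = z)"
proof -
  define N' where "N' = U \<inter> N"
  have N': "openin T N'" "x \<in> N'" using N gisoD(1)[OF F] x D_U by (auto simp: N'_def)
  define S where "S = snd d ` (fst d \<inter> N')"
  interpret S: metric_chart S "Gm d" unfolding S_def by (rule metric_chart_coord[OF d(1) N'(1)])
  have Simg: "S \<subseteq> image_of d" by (auto simp: S_def image_of_def)
  have "S \<subseteq> snd d ` (fst d \<inter> U)" unfolding S_def N'_def by (intro image_mono) blast
  from iso_map_subset[OF d(1) gisoD(2)[OF F d(1)] this] have iso: "S.iso_map c S (F \<circ> param d)" .
  have xS: "snd d x \<in> S" using d(2) N'(2) by (simp add: S_def)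
  have cS: "param d y \<in> fst d" "param d y \<in> N'" "snd d (param d y) = y" if y: "y \<in> S" for y
  proof -
    obtain q where q: "q \<in> fst d" "q \<in> N'" "y = snd d q" using y by (auto simp: S_def)
    then show "param d y \<in> fst d" "param d y \<in> N'" "snd d (param d y) = y" using param_coord[OF d(1) q(1)] by auto
  qed
  have sndF: "snd ((F \<circ> param d) y) = (H \<circ> param d) y" if "y \<in> S" for y
    using gisoD(3)[OF F, of "param d y"] cS(2)[OF that] by (simp add: N'_def)
  have bd: "0 < hgt (snd d x) \<or> (hgt (snd d x) = 0 \<and> (\<forall>y\<in>S. hgt y = 0 \<longrightarrow> snd ((F \<circ> param d) y) = 0) \<and>
     0 < pd bdry_index (\<lambda>y. snd ((F \<circ> param d) y)) (snd d x))"
  proof (cases "hgt (snd d x) = 0")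
    case True
    have "pd bdry_index (\<lambda>y. snd ((F \<circ> param d) y)) (snd d x) = pd bdry_index (H \<circ> param d) (snd d x)"
      by (rule pd_cong[OF S.hopen_S xS sndF])
    moreover have "0 < pd bdry_index (H \<circ> param d) (snd d x)" using pd_bdry_pos[OF d True] x D_closure by blast
    moreover have "snd ((F \<circ> param d) y) = 0" if "y \<in> S" "hgt y = 0" for y
      using sndF[OF that(1)] H_coord_bdry[OF d(1) _ that(2)] Simg that(1) by auto
    ultimately show ?thesis using True by simp
  next
    case False
    then show ?thesis using S.in_half[OF xS] by (simp add: half_space_def)
  qed
  from S.iso_map_local_inverse[OF c_pos iso xS open_UNIV UNIV_I bd] obtain U' V h where
    h: "open U'" "snd d x \<in> U'" "open V" "(F \<circ> param d) (snd d x) \<in> V" "Cinf_on V h"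
      "\<And>y. y \<in> S \<inter> U' \<Longrightarrow> (F \<circ> param d) y \<in> V \<and> h ((F \<circ> param d) y) = y"
      "\<And>z. z \<in> V \<Longrightarrow> z \<bullet> z = 1 / c \<Longrightarrow> 0 < snd z \<Longrightarrow> h z \<in> S \<and> (F \<circ> param d) (h z) = z" by auto
  define Q where "Q = param d ` (S \<inter> U')"
  have hSU: "hopen (S \<inter> U')" using S.hopen_S h(1) by (rule openin_Int_open)
  have Q: "openin T Q" unfolding Q_def by (rule param_open[OF d(1) hSU]) (use Simg in blast)
  have "x \<in> Q" unfolding Q_def using xS h(2) by (intro param_imageI d) simp
  moreover have "Q \<subseteq> fst d" using cS(1) unfolding Q_def by blast
  moreover have "F x \<in> V" using h(4) param_coord[OF d] by simp
  moreover have "F q \<in> V \<and> h (F q) = snd d q" if q: "q \<in> Q" for q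
  proof -
    obtain y where y: "y \<in> S \<inter> U'" "q = param d y" using q unfolding Q_def by blast
    show ?thesis using h(6)[OF y(1)] cS(3)[of y] y by auto
  qed
  moreover have "param d (h z) \<in> N \<inter> above 0 \<and> F (param d (h z)) = z" if z: "z \<in> V" "z \<bullet> z = 1 / c" "0 < snd z" for z
  proof -
    have hz: "h z \<in> S" "F (param d (h z)) = z" using h(7)[OF z] by auto
    have "param d (h z) \<in> N" "param d (h z) \<in> U" using cS(2)[OF hz(1)] by (auto simp: N'_def)
    moreover from this have "H (param d (h z)) = snd z" using gisoD(3)[OF F, of "param d (h z)"] hz(2) by simp
    ultimately show ?thesis using hz(2) z(3) gisoD(1)[OF F] openin_subset by (fastforce simp: above_def)
  qed
  ultimately show ?thesis using Q h(3,5) by blast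
qed

lemma locally_injective: assumes x: "x \<in> D" shows "\<exists>Q. openin T Q \<and> x \<in> Q \<and> inj_on F Q"
proof -
  have xT: "x \<in> topspace T" using x D_top by blast
  then obtain d where d: "d \<in> atlas M" "x \<in> fst d" using chart_cover by blast
  from local_inverse[OF x d openin_topspace xT] obtain Q V h where
    "openin T Q \<and> x \<in> Q \<and> Q \<subseteq> fst d \<and> open V \<and> F x \<in> V \<and> Cinf_on V h \<and> (\<forall>q\<in>Q. F q \<in> V \<and> h (F q) = snd d q) \<and>
    (\<forall>z\<in>V. z \<bullet> z = 1 / c \<longrightarrow> 0 < snd z \<longrightarrow> param d (h z) \<in> topspace T \<inter> above 0 \<and> F (param d (h z)) = z)" by (elim exE)
  then have Q: "openin T Q" "x \<in> Q" "Q \<subseteq> fst d" "\<And>q. q \<in> Q \<Longrightarrow> h (F q) = snd d q" by blast+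
  have "inj_on F Q"
  proof (rule inj_onI)
    fix q y assume qy: "q \<in> Q" "y \<in> Q" "F q = F y"
    have "q \<in> fst d" "y \<in> fst d" using qy Q(3) by blast+
    moreover have "snd d q = snd d y" using Q(4)[OF qy(1)] Q(4)[OF qy(2)] qy(3) by simp
    ultimately show "q = y" using param_coord[OF d(1)] by metis
  qed
  then show ?thesis using Q(1,2) by blast
qed

lemma lift_point:
  assumes x: "x \<in> D" and N: "openin T N" "x \<in> N"
  shows "\<exists>V k. open V \<and> F x \<in> V \<and> (\<forall>z\<in>V. z \<bullet> z = 1 / c \<longrightarrow> 0 < snd z \<longrightarrow> k z \<in> N \<inter> above 0 \<and> F (k z) = z)"
proof -
  obtain d where d: "d \<in> atlas M" "x \<in> fst d" using chart_cover x D_top by blast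
  from local_inverse[OF x d N] obtain Q V h where
    "openin T Q \<and> x \<in> Q \<and> Q \<subseteq> fst d \<and> open V \<and> F x \<in> V \<and> Cinf_on V h \<and> (\<forall>q\<in>Q. F q \<in> V \<and> h (F q) = snd d q) \<and>
    (\<forall>z\<in>V. z \<bullet> z = 1 / c \<longrightarrow> 0 < snd z \<longrightarrow> param d (h z) \<in> N \<inter> above 0 \<and> F (param d (h z)) = z)" by (elim exE)
  then show ?thesis by (intro exI[of _ V] exI[of _ "\<lambda>z. param d (h z)"]) blast
qed

lemma continuous_F: "continuous_map (subtopology T D) euclidean F"
  unfolding continuous_map_def
proof (intro conjI allI impI)
  fix V :: "((real ^ 'n) \<times> real) set" assume "openin euclidean V"
  then have "openin T {x \<in> U. F x \<in> V}" using giso_preimage[OF F] by simp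
  then have "openin (subtopology T D) (D \<inter> {x \<in> U. F x \<in> V})" by (rule openin_subtopology_Int2)
  moreover have "D \<inter> {x \<in> U. F x \<in> V} = {x \<in> topspace (subtopology T D). F x \<in> V}" using D_U D_top by auto
  ultimately show "openin (subtopology T D) {x \<in> topspace (subtopology T D). F x \<in> V}" by simp
qed simp

lemma compact_image: assumes "closedin T C" "C \<subseteq> D" shows "compact (F ` C)"
proof -
  have "compactin (subtopology T D) C"
    using closedin_compact_space[OF compact_T assms(1)] assms(2) by (simp add: compactin_subtopology)
  then show ?thesis using image_compactin continuous_F compactin_euclidean_iff by blast
qed

lemma closed_D': "closedin T D" using closed_D by (simp add: D_def)

text \<open>The points of \<open>D\<close> sharing their image with another point form a closed set.
  At one where \<open>H\<close> is largest the common image can be raised slightly and lifted near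
  both points, giving such a pair with larger \<open>H\<close>. Raising is impossible only at the
  pole, but \<open>D\<close> has a single peak.\<close>

lemma inj_F: "inj_on F D"
proof (rule ccontr)
  define K where "K = {x \<in> D. \<exists>y\<in>D. y \<noteq> x \<and> F y = F x}"
  assume "\<not> inj_on F D"
  then have ne: "K \<noteq> {}" unfolding inj_on_def K_def by force
  have "openin T (topspace T - K)"
    unfolding openin_subopen[of T "topspace T - K"]
  proof
    fix x assume x: "x \<in> topspace T - K"
    show "\<exists>G. openin T G \<and> x \<in> G \<and> G \<subseteq> topspace T - K"
    proof (cases "x \<in> D")
      case False
      then show ?thesis using closed_D' x by (intro exI[of _ "topspace T - D"]) (auto simp: K_def)
    next
      case True
      obtain Q where Q: "openin T Q" "x \<in> Q" "inj_on F Q" using locally_injective[OF True] by blast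
      have "closedin T (D - Q)" using closed_D' Q(1) by (rule closedin_diff)
      then have "closed (F ` (D - Q))" using compact_image compact_imp_closed by blast
      then have o: "openin T {q \<in> U. F q \<in> - F ` (D - Q)}" by (intro giso_preimage[OF F]) auto
      \<comment> \<open>On \<open>G\<close> a second preimage could be neither in \<open>Q\<close>,
        where \<open>F\<close> is injective, nor outside \<open>Q\<close>, whose image is
        avoided.\<close>
      define G where "G = Q \<inter> {q \<in> U. F q \<in> - F ` (D - Q)}"
      have "openin T G" unfolding G_def using Q(1) o by (rule openin_Int)
      moreover have "F x \<notin> F ` (D - Q)" using x True Q(2) unfolding K_def by force
      then have "x \<in> G" using Q(2) D_U True by (auto simp: G_def)
      moreover have "G \<inter> K = {}"
      proof (rule ccontr)
        assume "G \<inter> K \<noteq> {}"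
        then obtain q y where q: "q \<in> G" "q \<in> D" "y \<in> D" "y \<noteq> q" "F y = F q" unfolding K_def by blast
        have "y \<in> Q"
        proof (rule ccontr)
          assume "y \<notin> Q"
          then have "F q \<in> F ` (D - Q)" using q(3,5) by (metis DiffI imageI)
          then show False using q(1) by (simp add: G_def)
        qed
        moreover have "q \<in> Q" using q by (simp add: G_def)
        ultimately show False using Q(3) q(4,5) unfolding inj_on_def by blast
      qed
      moreover have "G \<subseteq> topspace T" using \<open>openin T G\<close> by (rule openin_subset)
      ultimately show ?thesis by blast
    qed
  qed
  then have "closedin T K" using D_top by (auto simp: closedin_def K_def)
  from H_attains_max[OF this ne] obtain x where x: "x \<in> K" "\<And>q. q \<in> K \<Longrightarrow> H q \<le> H x" by blast
  obtain y where y: "y \<in> D" "y \<noteq> x" "F y = F x" and xD: "x \<in> D" using x(1) by (auto simp: K_def)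
  have Hxy: "H y = H x" using F_D(2)[OF y(1)] F_D(2)[OF xD] y(3) by simp
  have Hx: "0 \<le> H x" using H_nonneg xD D_closure by blast
  have "fst (F x) \<noteq> 0"
  proof
    assume "fst (F x) = 0"
    then have "c * (H x)\<^sup>2 = 1" using F_D[OF xD] c_pos by (simp add: inner_prod_def power2_eq_square)
    moreover from this have "0 < H x" using Hx by (cases "H x = 0") auto
    ultimately have "x \<in> peaks" "y \<in> peaks" using crit_peak Hxy xD y(1) D_top by (auto simp: peaks_def)
    then have "x \<in> D \<inter> peaks" "y \<in> D \<inter> peaks" using xD y(1) by simp_all
    then show False unfolding peaks_D using y(2) by simp
  qed
  have xyt: "x \<in> topspace T" "y \<in> topspace T" using xD y(1) D_top by auto
  then obtain Nx Ny where N: "openin T Nx" "openin T Ny" "x \<in> Nx" "y \<in> Ny" "disjnt Nx Ny"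
    using Hausdorff_T y(2) unfolding Hausdorff_space_def by metis
  \<comment> \<open>Intersecting with \<open>W\<close> ensures that the lifted points, which lie
    above level 0, belong to \<open>D\<close> again.\<close>
  have oN: "openin T (Nx \<inter> W)" "x \<in> Nx \<inter> W" "openin T (Ny \<inter> W)" "y \<in> Ny \<inter> W" using N W xD y(1) D_W by auto
  from lift_point[OF xD oN(1,2)] obtain V k where "open V \<and> F x \<in> V \<and>
    (\<forall>z\<in>V. z \<bullet> z = 1 / c \<longrightarrow> 0 < snd z \<longrightarrow> k z \<in> Nx \<inter> W \<inter> above 0 \<and> F (k z) = z)" by (elim exE)
  then have h: "open V" "F x \<in> V" "\<And>z. z \<in> V \<Longrightarrow> z \<bullet> z = 1 / c \<Longrightarrow> 0 < snd z \<Longrightarrow> k z \<in> Nx \<inter> W \<inter> above 0 \<and> F (k z) = z" by blast+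
  from lift_point[OF y(1) oN(3,4)] obtain V' k' where "open V' \<and> F y \<in> V' \<and>
    (\<forall>z\<in>V'. z \<bullet> z = 1 / c \<longrightarrow> 0 < snd z \<longrightarrow> k' z \<in> Ny \<inter> W \<inter> above 0 \<and> F (k' z) = z)" by (elim exE)
  then have h': "open V'" "F y \<in> V'" "\<And>z. z \<in> V' \<Longrightarrow> z \<bullet> z = 1 / c \<Longrightarrow> 0 < snd z \<Longrightarrow> k' z \<in> Ny \<inter> W \<inter> above 0 \<and> F (k' z) = z" by blast+
  have "open (V \<inter> V')" "F x \<in> V \<inter> V'" using h h' y(3) by auto
  from sphere_raise[OF F_D(1)[OF xD] _ \<open>fst (F x) \<noteq> 0\<close> this] obtain z where z: "z \<in> V" "z \<in> V'" "z \<bullet> z = 1 / c" "H x < snd z"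
    using Hx F_D(2)[OF xD] by auto
  then have "0 < snd z" using Hx by simp
  note hz = h(3)[OF z(1,3) this] h'(3)[OF z(2,3) this]
  have "k z \<noteq> k' z" using hz N(5) unfolding disjnt_def by auto
  moreover have "k z \<in> D" "k' z \<in> D" using hz above_D by auto
  ultimately have "k z \<in> K" using hz unfolding K_def by (intro CollectI conjI bexI[of _ "k' z"]) auto
  then have "H (k z) \<le> H x" by (rule x(2))
  moreover have "H (k z) = snd z" using F_D(2)[OF \<open>k z \<in> D\<close>] hz by simp
  ultimately show False using z(4) by simp
qed

text \<open>In the open hemisphere, which is connected, the image is closed by compactness and open
  because points can be lifted; it contains the pole. The equator then belongs to the closed image,
  being approached from above.\<close>

lemma image_F: "F ` D = hemisphere c"
proof
  show "F ` D \<subseteq> hemisphere c"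
    using F_D H_nonneg D_closure by (force simp: hemisphere_iff[OF c_pos])
  define Q where "Q = {z :: (real ^ 'n) \<times> real. z \<bullet> z = 1 / c \<and> 0 < snd z}"
  have cl: "closed (F ` D)" by (rule compact_imp_closed[OF compact_image[OF closed_D' order_refl]])
  have "openin (top_of_set Q) (Q \<inter> F ` D)"
    unfolding openin_subopen[of "top_of_set Q" "Q \<inter> F ` D"]
  proof
    fix z0 assume z0: "z0 \<in> Q \<inter> F ` D"
    then obtain x where x: "x \<in> D" "z0 = F x" by blast
    have "x \<in> W" using x(1) D_W by blast
    from lift_point[OF x(1) W this] obtain V k where "open V \<and> F x \<in> V \<and>
      (\<forall>z\<in>V. z \<bullet> z = 1 / c \<longrightarrow> 0 < snd z \<longrightarrow> k z \<in> W \<inter> above 0 \<and> F (k z) = z)" by (elim exE)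
    then have V: "open V" "F x \<in> V" "\<And>z. z \<in> V \<Longrightarrow> z \<bullet> z = 1 / c \<Longrightarrow> 0 < snd z \<Longrightarrow> k z \<in> W \<inter> above 0 \<and> F (k z) = z" by blast+
    have "Q \<inter> V \<subseteq> Q \<inter> F ` D"
    proof
      fix z assume z: "z \<in> Q \<inter> V"
      then have "k z \<in> D" "F (k z) = z" using V(3)[of z] above_D by (auto simp: Q_def)
      then show "z \<in> Q \<inter> F ` D" using z by (metis IntD1 IntI image_eqI)
    qed
    then show "\<exists>G. openin (top_of_set Q) G \<and> z0 \<in> G \<and> G \<subseteq> Q \<inter> F ` D"
      using V(1,2) z0 x(2) by (intro exI[of _ "Q \<inter> V"]) auto
  qed
  moreover have "closedin (top_of_set Q) (Q \<inter> F ` D)" using cl by (simp add: closedin_closed_Int)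
  moreover have "p \<in> D" "p \<in> peaks" using peaks_D by blast+
  then have "F p \<in> Q \<inter> F ` D" using F_D[of p] c_pos by (auto simp: Q_def peaks_def)
  moreover have "connected Q" unfolding Q_def by (rule connected_open_hemisphere[OF c_pos])
  ultimately have "Q \<inter> F ` D = Q" unfolding connected_clopen by blast
  then have QF: "Q \<subseteq> F ` D" by blast
  show "hemisphere c \<subseteq> F ` D"
  proof
    fix w :: "(real ^ 'n) \<times> real" assume "w \<in> hemisphere c"
    then have w: "w \<bullet> w = 1 / c" "0 \<le> snd w" using hemisphere_iff[OF c_pos, of w] by blast+
    show "w \<in> F ` D"
    proof (cases "snd w = 0")
      case False
      then show ?thesis using w QF by (auto simp: Q_def)
    next
      case True
      have f0: "fst w \<noteq> 0" using w(1) True c_pos by (auto simp: inner_prod_def)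
      show ?thesis
      proof (rule ccontr)
        assume "w \<notin> F ` D"
        then have "w \<in> - F ` D" by blast
        moreover have "open (- F ` D)" using cl by (rule open_Compl)
        ultimately obtain z where "z \<in> - F ` D" "z \<bullet> z = 1 / c" "snd w < snd z" using sphere_raise[OF w f0] by blast
        then show False using QF True by (auto simp: Q_def)
      qed
    qed
  qed
qed

text \<open>\<open>F\<close> maps the zero set of \<open>H\<close> in \<open>D\<close> bijectively
  onto the equator. The boundary points in it form a closed set, and so do the others, since by
  \<open>bdry_nbhd\<close> zeros of \<open>H\<close> near such a boundary point are boundary points.
  The images are disjoint closed sets covering a connected equator.\<close>

lemma equator_in_boundary:
  assumes n: "2 \<le> CARD('n)" and q: "q \<in> W" "q \<in> manifold_boundary M" "q \<in> upper"
    and x: "x \<in> D" "H x = 0"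
  shows "x \<in> manifold_boundary M"
proof (rule ccontr)
  assume nx: "x \<notin> manifold_boundary M"
  define Z where "Z = D \<inter> {x \<in> topspace T. H x \<in> {0}}"
  define Eq where "Eq = {z :: (real ^ 'n) \<times> real. z \<bullet> z = 1 / c \<and> snd z = 0}"
  have Z: "closedin T Z" unfolding Z_def using closed_D' closedin_H[of "{0}"] by (simp add: closedin_Int)
  have C1: "closedin T (Z \<inter> manifold_boundary M)" using Z closed_bdry by (rule closedin_Int)
  have "\<forall>y\<in>Z \<inter> manifold_boundary M. \<exists>N. openin T N \<and> y \<in> N \<and> (\<forall>q\<in>N. H q = 0 \<longrightarrow> q \<in> manifold_boundary M)"
  proof
    fix y assume "y \<in> Z \<inter> manifold_boundary M"
    then have "y \<in> manifold_boundary M" "y \<in> upper" using D_closure by (auto simp: Z_def)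
    from bdry_nbhd[OF this] show "\<exists>N. openin T N \<and> y \<in> N \<and> (\<forall>q\<in>N. H q = 0 \<longrightarrow> q \<in> manifold_boundary M)" by blast
  qed
  from bchoice[OF this] obtain N where N: "\<forall>y\<in>Z \<inter> manifold_boundary M. openin T (N y) \<and> y \<in> N y \<and> (\<forall>q\<in>N y. H q = 0 \<longrightarrow> q \<in> manifold_boundary M)" by (elim exE)
  define G where "G = (\<Union>y\<in>Z \<inter> manifold_boundary M. N y)"
  have "openin T G" unfolding G_def using N by (intro openin_Union) auto
  then have "closedin T (Z - G)" using Z by (intro closedin_diff)
  moreover have ZG: "Z - manifold_boundary M = Z - G"
  proof -
    have "y \<in> G" if "y \<in> Z" "y \<in> manifold_boundary M" for y using N that unfolding G_def by blast
    moreover have "y \<in> manifold_boundary M" if y: "y \<in> Z" "y \<in> G" for y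
    proof -
      obtain y' where "y' \<in> Z \<inter> manifold_boundary M" "y \<in> N y'" using y(2) unfolding G_def by blast
      moreover have "H y = 0" using y(1) by (simp add: Z_def)
      ultimately show ?thesis using bspec[OF N] by blast
    qed
    ultimately show ?thesis by blast
  qed
  ultimately have C2: "closedin T (Z - manifold_boundary M)" by simp
  have ZD: "Z \<subseteq> D" by (auto simp: Z_def)
  have cl: "closed (F ` (Z \<inter> manifold_boundary M))" "closed (F ` (Z - manifold_boundary M))"
    using compact_image[OF C1] compact_image[OF C2] ZD compact_imp_closed by blast+
  have FZ: "F ` Z = Eq"
  proof
    show "F ` Z \<subseteq> Eq" using F_D by (force simp: Z_def Eq_def)
    show "Eq \<subseteq> F ` Z"
    proof
      fix z assume z: "z \<in> Eq"
      then have "z \<in> hemisphere c" using hemisphere_iff[OF c_pos, of z] by (simp add: Eq_def)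
      then obtain y where y: "y \<in> D" "z = F y" using image_F by (metis imageE)
      then have "y \<in> Z" using F_D(2)[OF y(1)] D_top z by (auto simp: Z_def Eq_def)
      then show "z \<in> F ` Z" using y(2) by blast
    qed
  qed
  have "2 \<le> DIM(real ^ 'n)" using n by simp
  from connected_equator[OF c_pos this] have conn: "connected Eq" by (simp add: Eq_def)
  have qZ: "q \<in> Z \<inter> manifold_boundary M" using q H_bdry[OF q(2)] D_top by (auto simp: Z_def D_def in_closure_of)
  have xZ: "x \<in> Z - manifold_boundary M" using x nx D_top by (auto simp: Z_def)
  have disj: "F ` (Z \<inter> manifold_boundary M) \<inter> F ` (Z - manifold_boundary M) \<inter> Eq = {}"
    using inj_F ZD unfolding inj_on_def by blast
  have cov: "Eq \<subseteq> F ` (Z \<inter> manifold_boundary M) \<union> F ` (Z - manifold_boundary M)" using FZ by blast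
  have "F ` (Z \<inter> manifold_boundary M) \<inter> Eq \<noteq> {}" "F ` (Z - manifold_boundary M) \<inter> Eq \<noteq> {}" using qZ xZ FZ by blast+
  then show False using conn cl disj cov unfolding connected_closed by blast
qed

text \<open>Openness of \<open>D\<close> is clear above level 0. At level 0 all points are boundary
  points by the previous lemma, and there a whole neighbourhood lies in
  \<open>upper\<close>.\<close>

lemma D_topspace:
  assumes n: "2 \<le> CARD('n)" and conn: "connected_space T"
    and q: "q \<in> W" "q \<in> manifold_boundary M" "q \<in> upper"
  shows "D = topspace T"
proof -
  have "openin T D"
    unfolding openin_subopen[of T D]
  proof
    fix x assume x: "x \<in> D"
    show "\<exists>G. openin T G \<and> x \<in> G \<and> G \<subseteq> D"
    proof (cases "H x = 0")
      case True
      have "x \<in> upper" using x D_closure by blast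
      from bdry_nbhd[OF equator_in_boundary[OF n q x True] this] obtain N where "openin T N" "x \<in> N" "N \<subseteq> upper" by blast
      then show ?thesis using W x D_W by (intro exI[of _ "N \<inter> W"]) (auto simp: D_def)
    next
      case False
      moreover have "0 \<le> H x" using H_nonneg x D_closure by blast
      ultimately have "x \<in> W \<inter> above 0" using x D_W D_top by (auto simp: above_def)
      then show ?thesis using above_D W openin_above by (intro exI[of _ "W \<inter> above 0"]) auto
    qed
  qed
  moreover have "D \<noteq> {}" using peaks_D by blast
  ultimately show ?thesis using closed_D' conn unfolding connected_space_clopen_in by blast
qed

lemma isometric_hemisphere:
  assumes n: "2 \<le> CARD('n)" and conn: "connected_space T"
    and q: "q \<in> W" "q \<in> manifold_boundary M" "q \<in> upper"
  shows "isometric_to_submanifold M (hemisphere c :: ((real ^ 'n) \<times> real) set)"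
proof -
  have D: "D = topspace T" by (rule D_topspace[OF n conn q])
  have im: "F ` topspace T = hemisphere c" and inj: "inj_on F (topspace T)" using image_F inj_F by (simp_all add: D)
  have cont: "continuous_map T (top_of_set (hemisphere c)) F"
    using continuous_F im by (auto simp: D continuous_map_in_subtopology)
  \<comment> \<open>A continuous bijection from a compact space onto a Hausdorff space.\<close>
  have homeo: "homeomorphic_map T (top_of_set (hemisphere c)) F"
    by (rule continuous_imp_homeomorphic_map[OF cont compact_T]) (use im inj in \<open>auto simp: Hausdorff_space_subtopology\<close>)
  have U: "U = topspace T" using D_U D gisoD(1)[OF F] openin_subset by blast
  have "smooth_on (image_of d) (F \<circ> param d)" "\<forall>x\<in>image_of d. \<forall>i j. pd i (F \<circ> param d) x \<bullet> pd j (F \<circ> param d) x = Gm d x $ i $ j"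
    if d: "d \<in> atlas M" for d
  proof -
    have "snd d ` (fst d \<inter> U) = image_of d" using chart_subset[OF d] by (simp add: U image_of_def Int_absorb2)
    then have "metric_chart.iso_map (Gm d) c (image_of d) (F \<circ> param d)" using gisoD(2)[OF F d] by simp
    then show "smooth_on (image_of d) (F \<circ> param d)" "\<forall>x\<in>image_of d. \<forall>i j. pd i (F \<circ> param d) x \<bullet> pd j (F \<circ> param d) x = Gm d x $ i $ j"
      unfolding metric_chart.iso_map_def[OF metric_chart_image[OF d]] by blast+
  qed
  \<comment> \<open>Locally the inverse is the restriction of the ambient smooth map
    \<open>h\<close>; openness of \<open>F\<close> provides the neighbourhood on which the two
    coincide.\<close>
  moreover have "smooth_on (F ` fst d) (snd d \<circ> inv_into (topspace T) F)" if d: "d \<in> atlas M" for d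
    unfolding smooth_on_altdef
  proof
    fix z assume "z \<in> F ` fst d"
    then obtain x where x: "x \<in> fst d" "z = F x" by blast
    have xD: "x \<in> D" using x(1) chart_subset[OF d] D by blast
    then have xT: "x \<in> topspace T" using D by simp
    from local_inverse[OF xD d x(1) openin_topspace xT] obtain Q V h where
      "openin T Q \<and> x \<in> Q \<and> Q \<subseteq> fst d \<and> open V \<and> F x \<in> V \<and> Cinf_on V h \<and> (\<forall>q\<in>Q. F q \<in> V \<and> h (F q) = snd d q) \<and>
      (\<forall>z\<in>V. z \<bullet> z = 1 / c \<longrightarrow> 0 < snd z \<longrightarrow> param d (h z) \<in> topspace T \<inter> above 0 \<and> F (param d (h z)) = z)" by (elim exE)
    then have Q: "openin T Q" "x \<in> Q" "open V" "F x \<in> V" "Cinf_on V h" "\<And>q. q \<in> Q \<Longrightarrow> h (F q) = snd d q" by blast+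
    have "openin (top_of_set (hemisphere c)) (F ` Q)" using homeomorphic_imp_open_map[OF homeo] Q(1) unfolding open_map_def by blast
    then obtain V2 where V2: "open V2" "F ` Q = hemisphere c \<inter> V2" by (auto simp: openin_open)
    have "(snd d \<circ> inv_into (topspace T) F) y = h y" if y: "y \<in> F ` fst d" "y \<in> V2" for y
    proof -
      have "F ` fst d \<subseteq> hemisphere c" using chart_subset[OF d] im by blast
      then obtain q where qq: "q \<in> Q" "y = F q" using y V2(2) by blast
      then have "q \<in> topspace T" using Q(1) openin_subset by blast
      then have "inv_into (topspace T) F y = q" using inv_into_f_f[OF inj] qq(2) by simp
      then show ?thesis using Q(6)[OF qq(1)] qq(2) by simp
    qed
    moreover have "Cinf_on (V \<inter> V2) h" by (rule Cinf_on_Int(1)[OF Q(5) V2(1)])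
    moreover have "z \<in> V \<inter> V2" using Q(2,4) V2(2) x(2) by blast
    ultimately show "\<exists>W F'. z \<in> W \<and> Cinf_on W F' \<and> (\<forall>y\<in>F ` fst d \<inter> W. F' y = (snd d \<circ> inv_into (topspace T) F) y)"
      by (intro exI[of _ "V \<inter> V2"] exI[of _ h]) auto
  qed
  ultimately show ?thesis using homeo unfolding isometric_to_submanifold_def by blast
qed

end

section \<open>The conformal factor\<close>

context riemannian_mfd begin

lemma det_transition_jacobian:
  assumes "c \<in> atlas M" "d \<in> atlas M" "p \<in> fst c" "p \<in> fst d"
  shows "det (transition_jacobian c d p) \<noteq> 0"
proof -
  interpret D: metric_chart "image_of c" "Gm c" by (rule metric_chart_image[OF assms(1)])
  have "Gm c (snd c p) = transpose (transition_jacobian c d p) ** Gm d (snd d p) ** transition_jacobian c d p"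
    using rm assms unfolding riemannian_manifold_def by blast
  then show ?thesis using D.det_G[OF coord_in[OF assms(3)]] by (auto simp: det_mul)
qed

text \<open>In either chart the gradient is the unique solution of \<open>Gm *v v = du\<close>.
  Comparing the two equations shows that the Jacobian carries one gradient to the other, while
  differentials are carried by its transpose.\<close>

lemma gradient_norm_invariant:
  assumes e: "e \<in> atlas M" "p \<in> fst e" and d: "d \<in> atlas M" "p \<in> fst d" and u: "smooth_on (image_of d) (u \<circ> param d)"
  shows "(\<Sum>i\<in>UNIV. metric_chart.X (Gm e) (u \<circ> param e) i (snd e p) * pd i (u \<circ> param e) (snd e p)) =
    (\<Sum>i\<in>UNIV. metric_chart.X (Gm d) (u \<circ> param d) i (snd d p) * pd i (u \<circ> param d) (snd d p))"
proof -
  interpret D: metric_chart "image_of d" "Gm d" by (rule metric_chart_image[OF d(1)])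
  interpret E: metric_chart "image_of e" "Gm e" by (rule metric_chart_image[OF e(1)])
  define J where "J = transition_jacobian e d p"
  define a where "a = (\<chi> i. pd i (u \<circ> param d) (snd d p))"
  define b where "b = (\<chi> i. pd i (u \<circ> param e) (snd e p))"
  define v where "v = E.Xv (u \<circ> param e) (snd e p)"
  define w where "w = D.Xv (u \<circ> param d) (snd d p)"
  have Av: "Gm e (snd e p) *v v = b" "Gm d (snd d p) *v w = a"
    using E.lower_X[OF coord_in[OF e(2)]] D.lower_X[OF coord_in[OF d(2)]]
    by (simp_all add: v_def w_def a_def b_def E.Xv_def D.Xv_def matrix_vector_mult_def vec_eq_iff)
  have U: "openin T (fst e \<inter> fst d)" "p \<in> fst e \<inter> fst d" using chart_open[OF e(1)] chart_open[OF d(1)] e(2) d(2) by (auto intro: openin_Int)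
  have "smooth_on (snd d ` (fst e \<inter> fst d)) (u \<circ> param d)"
    by (rule smooth_on_subset[OF u]) (auto simp: image_of_def)
  from chart_change(2)[OF e(1) d(1) U(1) _ _ this U(2)] have b: "b = transpose J *v a"
    by (simp add: b_def a_def J_def matrix_vector_mult_def transpose_def jacobian_nth vec_eq_iff)
  have "Gm e (snd e p) = transpose J ** Gm d (snd d p) ** J"
    using rm e d unfolding riemannian_manifold_def J_def by blast
  then have eq: "transpose J *v (Gm d (snd d p) *v (J *v v)) = transpose J *v a"
    using Av(1) b by (simp add: matrix_vector_mul_assoc matrix_mul_assoc)
  have "invertible (transpose J)"
    using det_transition_jacobian[OF e(1) d(1) e(2) d(2)] by (simp add: invertible_det_nz J_def)
  then have "inj ((*v) (transpose J))" by (simp add: invertible_eq_bij bij_is_inj)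
  from injD[OF this eq] have eq2: "Gm d (snd d p) *v (J *v v) = Gm d (snd d p) *v w" using Av(2) by simp
  have "invertible (Gm d (snd d p))" using D.det_G[OF coord_in[OF d(2)]] by (simp add: invertible_det_nz)
  then have "inj ((*v) (Gm d (snd d p)))" by (simp add: invertible_eq_bij bij_is_inj)
  from injD[OF this eq2] have Jv: "J *v v = w" .
  have "b \<bullet> v = a \<bullet> w" unfolding b Jv[symmetric] by (simp add: transpose_matrix_vector dot_lmul_matrix)
  then show ?thesis by (simp add: inner_vec_def v_def w_def a_def b_def E.Xv_def D.Xv_def mult.commute)
qed

lemma locally_constant:
  assumes conn: "connected_space T" and u: "\<And>d. d \<in> atlas M \<Longrightarrow> smooth_on (image_of d) (u \<circ> param d)"
    and z: "\<And>d x i. d \<in> atlas M \<Longrightarrow> x \<in> image_of d \<Longrightarrow> pd i (u \<circ> param d) x = (0::real)"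
    and p: "p \<in> topspace T" "q \<in> topspace T"
  shows "u p = u q"
proof -
  have nb: "\<exists>N. openin T N \<and> x \<in> N \<and> (\<forall>y\<in>N. u y = u x)" if x: "x \<in> topspace T" for x
  proof -
    obtain d where d: "d \<in> atlas M" "x \<in> fst d" using chart_cover[OF x] by blast
    interpret D: metric_chart "image_of d" "Gm d" by (rule metric_chart_image[OF d(1)])
    obtain r where r: "r > 0" "half_ball (snd d x) r \<subseteq> snd d ` (fst d \<inter> fst d)"
      using half_ball_nbhd[OF d chart_open[OF d(1)] d(2)] by blast
    define X where "X = half_ball (snd d x) r"
    have X: "hopen X" "X \<subseteq> image_of d" "convex X" "snd d x \<in> X"
      using r D.in_half[OF coord_in[OF d(2)]] D.convex_half_ball by (auto simp: X_def hopen_half_ball image_of_def)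
    have "((u \<circ> param d) has_derivative (\<lambda>h. 0)) (at y within X)" if y: "y \<in> X" for y
      using smooth_has_derivative[OF image_hopen[OF d(1)] u[OF d(1)] subsetD[OF X(2) y]]
      by (simp add: at_within_hopen[OF X(1) y] z[OF d(1) subsetD[OF X(2) y]])
    from has_derivative_zero_constant[OF X(3) this] obtain k where "\<And>y. y \<in> X \<Longrightarrow> (u \<circ> param d) y = k" by blast
    then have k: "(u \<circ> param d) y = (u \<circ> param d) (snd d x)" if "y \<in> X" for y using X(4) that by simp
    have "openin T (param d ` X)" by (rule param_open[OF d(1) X(1,2)])
    moreover have "x \<in> param d ` X" by (rule param_imageI[OF d X(4)])
    moreover have "\<forall>y\<in>param d ` X. u y = u x" using k param_coord[OF d] by auto
    ultimately show ?thesis by blast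
  qed
  have op: "openin T {x \<in> topspace T. P (u x)}" for P
    unfolding openin_subopen[of T "{x \<in> topspace T. P (u x)}"]
  proof
    fix x assume x: "x \<in> {x \<in> topspace T. P (u x)}"
    then obtain N where N: "openin T N" "x \<in> N" "\<forall>y\<in>N. u y = u x" using nb by blast
    have "N \<subseteq> {x \<in> topspace T. P (u x)}"
    proof
      fix y assume "y \<in> N"
      then have "u y = u x" "y \<in> topspace T" using N(3) openin_subset[OF N(1)] by blast+
      then show "y \<in> {x \<in> topspace T. P (u x)}" using x by simp
    qed
    then show "\<exists>N. openin T N \<and> x \<in> N \<and> N \<subseteq> {x \<in> topspace T. P (u x)}" using N(1,2) by blast
  qed
  define A where "A = {x \<in> topspace T. u x = u q}"
  have "openin T A" unfolding A_def by (rule op)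
  moreover have "topspace T - A = {x \<in> topspace T. u x \<noteq> u q}" by (auto simp: A_def)
  then have "closedin T A" using op[of "\<lambda>z. z \<noteq> u q"] by (simp add: closedin_def A_def)
  ultimately have "A = {} \<or> A = topspace T" using conn unfolding connected_space_clopen_in by blast
  then show ?thesis using p by (auto simp: A_def)
qed

end

text \<open>For \<open>c = 0\<close> the Obata equation only says that the Hessian of
  \<open>\<rho>\<close> vanishes and does not make \<open>\<rho>\<close> constant; the stronger
  \<open>d\<rho> = 0\<close> is therefore recorded separately.\<close>

locale einstein_conformal = riemannian_mfd M for M :: "('m, 'n::finite) riemannian" +
  fixes c :: real and \<rho> :: "'m \<Rightarrow> real"
  assumes comp: "compact_space T" and conn: "connected_space T" and bdry: "manifold_boundary M \<noteq> {}"
    and \<rho>_solves: "d \<in> atlas M \<Longrightarrow> metric_chart.solves (Gm d) c (image_of d) (\<rho> \<circ> param d)"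
    and \<rho>_bdry: "q \<in> manifold_boundary M \<Longrightarrow> \<rho> q = 0"
    and \<rho>_const: "c = 0 \<Longrightarrow> d \<in> atlas M \<Longrightarrow> x \<in> image_of d \<Longrightarrow> pd i (\<rho> \<circ> param d) x = 0"
    and \<rho>_nz: "\<exists>p\<in>topspace T. \<rho> p \<noteq> 0"
begin

lemma smooth_\<rho>: "d \<in> atlas M \<Longrightarrow> smooth_on (image_of d) (\<rho> \<circ> param d)"
  using \<rho>_solves metric_chart.solvesD(1)[OF metric_chart_image] by blast

lemma energy_invariant:
  assumes e: "e \<in> atlas M" "p \<in> fst e" and d: "d \<in> atlas M" "p \<in> fst d"
  shows "metric_chart.energy (Gm e) c (\<rho> \<circ> param e) (\<rho> \<circ> param e) (snd e p) = metric_chart.energy (Gm d) c (\<rho> \<circ> param d) (\<rho> \<circ> param d) (snd d p)"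
  unfolding metric_chart.energy_def[OF metric_chart_image[OF e(1)]] metric_chart.energy_def[OF metric_chart_image[OF d(1)]]
    gradient_norm_invariant[OF e d smooth_\<rho>[OF d(1)]] by (simp add: param_coord[OF e] param_coord[OF d])

lemma energy_const:
  "\<exists>E. \<forall>d\<in>atlas M. \<forall>x\<in>image_of d. metric_chart.energy (Gm d) c (\<rho> \<circ> param d) (\<rho> \<circ> param d) x = E"
proof -
  define en where "en d = metric_chart.energy (Gm d) c (\<rho> \<circ> param d) (\<rho> \<circ> param d)" for d
  \<comment> \<open>Chart-wise energies are made into one function on \<open>M\<close> by choosing a
    chart at each point; \<open>energy_invariant\<close> removes the dependence on the
    choice.\<close>
  define ch where "ch p = (SOME d. d \<in> atlas M \<and> p \<in> fst d)" for p
  define u where "u p = en (ch p) (snd (ch p) p)" for p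
  have eq: "(u \<circ> param d) x = en d x" if d: "d \<in> atlas M" and x: "x \<in> image_of d" for d x
  proof -
    have pd: "param d x \<in> fst d" by (rule param_in[OF x])
    have "ch (param d x) \<in> atlas M \<and> param d x \<in> fst (ch (param d x))" unfolding ch_def
      by (rule someI_ex) (use d pd in blast)
    then have "u (param d x) = en d (snd d (param d x))" unfolding u_def en_def using energy_invariant d pd by blast
    then show ?thesis using coord_param[OF x] by simp
  qed
  have su: "smooth_on (image_of d) (u \<circ> param d)" if d: "d \<in> atlas M" for d
  proof -
    interpret D: metric_chart "image_of d" "Gm d" by (rule metric_chart_image[OF d])
    show ?thesis by (rule smooth_on_cong[OF D.smooth_energy[OF smooth_\<rho>[OF d] smooth_\<rho>[OF d], of c]]) (simp only: eq[OF d] en_def)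
  qed
  have "pd i (u \<circ> param d) x = 0" if d: "d \<in> atlas M" and x: "x \<in> image_of d" for d x i
  proof -
    interpret D: metric_chart "image_of d" "Gm d" by (rule metric_chart_image[OF d])
    have "pd i (u \<circ> param d) x = pd i (en d) x" by (rule pd_cong[OF image_hopen[OF d] x eq[OF d]])
    then show ?thesis using D.pd_energy[OF x \<rho>_solves[OF d] \<rho>_solves[OF d]] by (simp add: en_def)
  qed
  note lc = locally_constant[OF conn su this]
  obtain p0 where p0: "p0 \<in> topspace T" using \<rho>_nz by blast
  have "en d x = u p0" if d: "d \<in> atlas M" and x: "x \<in> image_of d" for d x
    using lc[of "param d x" p0] p0 param_in[OF x] chart_subset[OF d] eq[OF d x] by auto
  then show ?thesis unfolding en_def by blast
qed

lemma energy_ge: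
  assumes "d \<in> atlas M" "x \<in> image_of d"
  shows "c * (\<rho> (param d x))\<^sup>2 \<le> metric_chart.energy (Gm d) c (\<rho> \<circ> param d) (\<rho> \<circ> param d) x"
proof -
  interpret D: metric_chart "image_of d" "Gm d" by (rule metric_chart_image[OF assms(1)])
  have "0 \<le> D.Xv (\<rho> \<circ> param d) x \<bullet> (Gm d x *v D.Xv (\<rho> \<circ> param d) x)"
    using D.pos_G[OF assms(2), of "D.Xv (\<rho> \<circ> param d) x"] by (cases "D.Xv (\<rho> \<circ> param d) x = 0") auto
  then show ?thesis using D.Xv_energy[OF assms(2), of "\<rho> \<circ> param d"] by (simp add: D.energy_def power2_eq_square)
qed

lemma continuous_\<rho>: "continuous_map T euclideanreal \<rho>"
  unfolding continuous_map_def
  using openin_preimage_charts[OF openin_topspace, of \<rho>] smooth_on_continuous[OF smooth_\<rho>] chart_subset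
  by (auto simp: image_of_def Int_absorb2)

text \<open>The maximum of \<open>\<rho>\<^sup>2\<close> is attained at an interior critical point, where the energy has the
  sign of \<open>c\<close>, whereas the energy is nonnegative on the boundary.\<close>

lemma c_positive: "0 < c"
proof (rule ccontr)
  assume "\<not> 0 < c"
  then consider "c = 0" | "c < 0" by linarith
  then show False
  proof cases
    case 1
    obtain p q where "p \<in> topspace T" "\<rho> p \<noteq> 0" "q \<in> manifold_boundary M" using \<rho>_nz bdry by blast
    moreover from this have "q \<in> topspace T" using chart_subset unfolding manifold_boundary_def by blast
    ultimately show False using locally_constant[OF conn smooth_\<rho> \<rho>_const[OF 1], of p q] \<rho>_bdry by simp
  next
    case 2
    obtain E where E: "\<And>d x. d \<in> atlas M \<Longrightarrow> x \<in> image_of d \<Longrightarrow> metric_chart.energy (Gm d) c (\<rho> \<circ> param d) (\<rho> \<circ> param d) x = E"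
      using energy_const by blast
    obtain q e where e: "e \<in> atlas M" "q \<in> fst e" "q \<in> manifold_boundary M"
      using bdry unfolding manifold_boundary_def by blast
    have E0: "0 \<le> E" using energy_ge[OF e(1) coord_in[OF e(2)]] E[OF e(1) coord_in[OF e(2)]] \<rho>_bdry[OF e(3)] param_coord[OF e(1,2)] by simp
    define u where "u p = (\<rho> p)\<^sup>2" for p
    have "continuous_map T euclideanreal u" unfolding u_def using continuous_\<rho> by (intro continuous_intros)
    then have "compact (u ` topspace T)" using image_compactin comp compactin_euclidean_iff unfolding compact_space_def by blast
    then obtain p where p: "p \<in> topspace T" "\<And>y. y \<in> topspace T \<Longrightarrow> u y \<le> u p"
      using compact_attains_sup[of "u ` topspace T"] \<rho>_nz by blast
    obtain z where "z \<in> topspace T" "\<rho> z \<noteq> 0" using \<rho>_nz by blast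
    then have "0 < u p" using p(2)[of z] by (simp add: u_def) (metis less_le_trans zero_less_power2)
    then have nz: "\<rho> p \<noteq> 0" by (simp add: u_def)
    obtain d where d: "d \<in> atlas M" "p \<in> fst d" using chart_cover[OF p(1)] by blast
    interpret D: metric_chart "image_of d" "Gm d" by (rule metric_chart_image[OF d(1)])
    note xi = coord_in[OF d(2)]
    have "p \<notin> manifold_boundary M" using nz \<rho>_bdry by blast
    then have "hgt (snd d p) \<noteq> 0" using d unfolding manifold_boundary_def half_space_boundary_def by blast
    then have pos: "0 < hgt (snd d p)" using D.in_half[OF xi] by (simp add: half_space_def)
    have ud: "u \<circ> param d = (\<lambda>x. (\<rho> \<circ> param d) x * (\<rho> \<circ> param d) x)" by (auto simp: u_def power2_eq_square)
    have su: "smooth_on (image_of d) (u \<circ> param d)" unfolding ud by (intro smooth_on_mult smooth_\<rho> d)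
    have "pd i (\<rho> \<circ> param d) (snd d p) = 0" for i
    proof -
      have "pd i (u \<circ> param d) (snd d p) = 0"
        by (rule pd_zero_at_interior_max[OF d pos su openin_topspace p(1,2)])
      then have "2 * \<rho> p * pd i (\<rho> \<circ> param d) (snd d p) = 0"
        using pd_mult[OF image_hopen[OF d(1)] xi smooth_\<rho>[OF d(1)] smooth_\<rho>[OF d(1)], where i = i] param_coord[OF d] by (simp add: ud)
      then show ?thesis using nz by simp
    qed
    then have "E = c * (\<rho> p)\<^sup>2" using E[OF d(1) xi] param_coord[OF d] by (simp add: D.energy_def power2_eq_square)
    then have "E < 0" using 2 nz by (simp add: mult_neg_pos)
    then show False using E0 by simp
  qed
qed

text \<open>Scaling by \<open>1 / sqrt E\<close> normalises the energy and leaves the sign free. The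
  sign is chosen so that \<open>H\<close> increases inwards at some boundary point, which puts this
  point into the closure of the set where \<open>H\<close> is positive.\<close>

lemma obata_exists:
  "\<exists>H q. obata M c H \<and> q \<in> manifold_boundary M \<and> q \<in> T closure_of (obata.above M H 0)"
proof -
  obtain E where E: "\<And>d x. d \<in> atlas M \<Longrightarrow> x \<in> image_of d \<Longrightarrow> metric_chart.energy (Gm d) c (\<rho> \<circ> param d) (\<rho> \<circ> param d) x = E"
    using energy_const by blast
  obtain p where p: "p \<in> topspace T" "\<rho> p \<noteq> 0" using \<rho>_nz by blast
  obtain d where d: "d \<in> atlas M" "p \<in> fst d" using chart_cover[OF p(1)] by blast
  have "c * (\<rho> p)\<^sup>2 \<le> E" using energy_ge[OF d(1) coord_in[OF d(2)]] E[OF d(1) coord_in[OF d(2)]] param_coord[OF d] by simp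
  moreover have "0 < c * (\<rho> p)\<^sup>2" using c_positive p(2) by simp
  ultimately have E0: "0 < E" by linarith
  have ob: "obata M c (\<lambda>p. k * \<rho> p)" if k: "k\<^sup>2 * E = 1" for k
  proof unfold_locales
    show "0 < c" by (rule c_positive)
    show "compact_space T" by (rule comp)
    show "k * \<rho> p = 0" if "p \<in> manifold_boundary M" for p using \<rho>_bdry[OF that] by simp
    fix d assume d: "d \<in> atlas M"
    interpret D: metric_chart "image_of d" "Gm d" by (rule metric_chart_image[OF d])
    have f: "(\<lambda>p. k * \<rho> p) \<circ> param d = (\<lambda>x. k * (\<rho> \<circ> param d) x)" by auto
    have pk: "pd i (\<lambda>x. k * (\<rho> \<circ> param d) x) x = k * pd i (\<rho> \<circ> param d) x" if "x \<in> image_of d" for x i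
      by (rule pd_cmult[OF image_hopen[OF d] that smooth_\<rho>[OF d]])
    have pk2: "pd i (pd j (\<lambda>x. k * (\<rho> \<circ> param d) x)) x = k * pd i (pd j (\<rho> \<circ> param d)) x" if x: "x \<in> image_of d" for x i j
      using pd_cong[OF image_hopen[OF d] x pk, where i = i] pd_cmult[OF image_hopen[OF d] x smooth_on_pd[OF image_hopen[OF d] smooth_\<rho>[OF d]]] by simp
    show "D.solves c (image_of d) ((\<lambda>p. k * \<rho> p) \<circ> param d)"
      unfolding f D.solves_def
    proof (intro conjI ballI allI)
      fix y i j assume y: "y \<in> image_of d"
      show "pd i (pd j (\<lambda>x. k * (\<rho> \<circ> param d) x)) y =
        (\<Sum>m\<in>UNIV. christoffel (Gm d) m i j y * pd m (\<lambda>x. k * (\<rho> \<circ> param d) x) y) - c * (k * (\<rho> \<circ> param d) y) * Gm d y $ i $ j"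
        unfolding pk[OF y] pk2[OF y] D.solvesD(2)[OF \<rho>_solves[OF d] y]
        by (simp add: right_diff_distrib sum_distrib_left mult_ac)
    qed (rule smooth_on_cmult[OF smooth_\<rho>[OF d]])
    fix x assume x: "x \<in> image_of d"
    have "D.energy c (\<lambda>x. k * (\<rho> \<circ> param d) x) (\<lambda>x. k * (\<rho> \<circ> param d) x) x = k\<^sup>2 * D.energy c (\<rho> \<circ> param d) (\<rho> \<circ> param d) x"
      unfolding D.energy_def D.X_def pk[OF x]
      by (simp add: sum_distrib_left sum_distrib_right distrib_left power2_eq_square mult_ac)
    then show "D.energy c ((\<lambda>p. k * \<rho> p) \<circ> param d) ((\<lambda>p. k * \<rho> p) \<circ> param d) x = 1"
      unfolding f E[OF d x] using k by simp
  qed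
  obtain q e where q: "q \<in> manifold_boundary M" "e \<in> atlas M" "q \<in> fst e" "hgt (snd e q) = 0"
    using bdry unfolding manifold_boundary_def half_space_boundary_def by blast
  define k0 where "k0 = 1 / sqrt E"
  have k0: "0 < k0" "k0\<^sup>2 * E = 1" "(- k0)\<^sup>2 * E = 1" using E0 by (auto simp: k0_def power_divide)
  define g where "g = pd bdry_index (\<rho> \<circ> param e) (snd e q)"
  have pk: "pd bdry_index ((\<lambda>p. k * \<rho> p) \<circ> param e) (snd e q) = k * g" for k
  proof -
    have "(\<lambda>p. k * \<rho> p) \<circ> param e = (\<lambda>x. k * (\<rho> \<circ> param e) x)" by auto
    then show ?thesis using pd_cmult[OF image_hopen[OF q(2)] coord_in[OF q(3)] smooth_\<rho>[OF q(2)]] by (simp add: g_def)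
  qed
  have "k0 * g \<noteq> 0" using obata.pd_bdry(2)[OF ob[OF k0(2)] q(2) coord_in[OF q(3)] q(4)] pk by simp
  then obtain k where k: "k\<^sup>2 * E = 1" "0 < k * g" using k0 by (metis linorder_neqE_linordered_idom mult_minus_left neg_0_less_iff_less)
  have "q \<in> T closure_of (obata.above M (\<lambda>p. k * \<rho> p) 0)"
    using obata.inward_nbhd[OF ob[OF k(1)] q(2,3,4)] k(2) pk by auto
  then show ?thesis using ob[OF k(1)] q(1) by blast
qed

lemma isometric: assumes n: "2 \<le> CARD('n)" shows "isometric_to_submanifold M (hemisphere c :: ((real ^ 'n) \<times> real) set)"
proof -
  obtain H q where "obata M c H \<and> q \<in> manifold_boundary M \<and> q \<in> T closure_of (obata.above M H 0)" using obata_exists by (elim exE)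
  then have H: "obata M c H" "q \<in> manifold_boundary M" "q \<in> T closure_of (obata.above M H 0)" by blast+
  from obata.sheet_exists[OF H(1,3)] obtain U F W p where "hemi_sheet M c H U F W p \<and> q \<in> W" by (elim exE)
  then have S: "hemi_sheet M c H U F W p" "q \<in> W" by blast+
  show ?thesis by (rule hemi_sheet.isometric_hemisphere[OF S(1) n conn S(2) H(2,3)])
qed

end

theorem theorem1p3:
  fixes M :: "('m, 'n::finite) riemannian" and c :: real and f :: "'m \<Rightarrow> real"
  assumes "2 \<le> CARD('n)"
    and "riemannian_manifold M"
    and "compact_space (space_top M)"
    and "connected_space (space_top M)"
    and "oriented M"
    and "manifold_boundary M \<noteq> {}"
    and "einstein M ((real CARD('n) - 1) * c)"
    and "smooth_function M f"
    and "nonzero_vector_field M (gradient M f)"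
    and "conformal_vector_field M (gradient M f)"
    and "\<not> laplacian M f constant_on topspace (space_top M)"
    and "\<forall>p\<in>manifold_boundary M. laplacian M f p = 0"
  shows "c > 0 \<and> isometric_to_submanifold M (hemisphere c :: ((real ^ 'n) \<times> real) set)"
proof -
  interpret riemannian_mfd M by unfold_locales (rule assms(2))
  have sf: "smooth_on (image_of d) (f \<circ> param d)" if "d \<in> atlas M" for d using assms(8) that by (simp add: smooth_function_def)
  obtain \<rho> where \<rho>: "smooth_function M \<rho>" "\<And>d x i j. d \<in> atlas M \<Longrightarrow> x \<in> image_of d \<Longrightarrow>
      lie_metric (gradient M f d) (Gm d) i j x = 2 * \<rho> (param d x) * Gm d x $ i $ j"
    using assms(10) unfolding conformal_vector_field_def by blast
  have s\<rho>: "smooth_on (image_of d) (\<rho> \<circ> param d)" if "d \<in> atlas M" for d using \<rho>(1) that by (simp add: smooth_function_def)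
  have hess: "pd i (pd j (f \<circ> param d)) x = (\<Sum>k\<in>UNIV. christoffel (Gm d) k i j x * pd k (f \<circ> param d) x) + (\<rho> \<circ> param d) x * Gm d x $ i $ j"
    if d: "d \<in> atlas M" and x: "x \<in> image_of d" for d x i j
    using \<rho>(2)[OF that, of i j] metric_chart.lie_metric_gradient[OF metric_chart_image[OF d] x sf[OF d], of i j]
    by (simp add: gradient_def)
  have lap: "laplacian M f p = real CARD('n) * \<rho> p" if p: "p \<in> topspace T" for p
  proof -
    \<comment> \<open>The same choice of chart as in \<open>laplacian_def\<close>; the trace formula
      then yields a value that no longer depends on it.\<close>
    define d where "d = (SOME d. d \<in> atlas M \<and> p \<in> fst d)"
    have d: "d \<in> atlas M \<and> p \<in> fst d" unfolding d_def by (rule someI_ex) (use chart_cover[OF p] in blast)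
    then have d: "d \<in> atlas M" "p \<in> fst d" by auto
    have "laplacian M f p = local_laplacian (Gm d) (f \<circ> param d) (snd d p)" by (simp add: laplacian_def d_def Let_def)
    also have "\<dots> = real CARD('n) * (\<rho> \<circ> param d) (snd d p)"
      by (rule metric_chart.local_laplacian_conformal[OF metric_chart_image[OF d(1)] coord_in[OF d(2)] hess[OF d(1) coord_in[OF d(2)]]])
    finally show ?thesis using param_coord[OF d] by simp
  qed
  have bd: "manifold_boundary M \<subseteq> topspace T" using chart_subset unfolding manifold_boundary_def by blast
  have d\<rho>: "pd i (\<rho> \<circ> param d) x = - c * pd i (f \<circ> param d) x" if d: "d \<in> atlas M" and x: "x \<in> image_of d" for d x i
  proof (rule metric_chart.einstein_conformal_factor[OF metric_chart_image[OF d] x assms(1) sf[OF d] s\<rho>[OF d]])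
    show "ricci (Gm d) i j x = (real CARD('n) - 1) * c * Gm d x $ i $ j" for i j
      using assms(7) d x by (simp add: einstein_def)
  qed (rule hess[OF d])
  interpret einstein_conformal M c \<rho>
  proof unfold_locales
    show "compact_space T" "connected_space T" "manifold_boundary M \<noteq> {}" by (rule assms)+
    show "\<rho> q = 0" if "q \<in> manifold_boundary M" for q
      using lap[of q] assms(12) bd that by auto
    show "pd i (\<rho> \<circ> param d) x = 0" if "c = 0" "d \<in> atlas M" "x \<in> image_of d" for d x i
      using d\<rho>[OF that(2,3)] that(1) by simp
    show "\<exists>p\<in>topspace T. \<rho> p \<noteq> 0"
    proof (rule ccontr)
      assume "\<not> (\<exists>p\<in>topspace T. \<rho> p \<noteq> 0)"
      then have "\<forall>p\<in>topspace T. laplacian M f p = 0" using lap by simp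
      then show False using assms(11) unfolding constant_on_def by blast
    qed
    fix d assume d: "d \<in> atlas M"
    note solves_def = metric_chart.solves_def[OF metric_chart_image[OF d]]
    show "metric_chart.solves (Gm d) c (image_of d) (\<rho> \<circ> param d)"
      unfolding solves_def
    proof (intro conjI ballI allI)
      fix y i j assume y: "y \<in> image_of d"
      have "pd i (pd j (\<rho> \<circ> param d)) y = pd i (\<lambda>x. - c * pd j (f \<circ> param d) x) y"
        by (rule pd_cong[OF image_hopen[OF d] y]) (rule d\<rho>[OF d])
      also have "\<dots> = - c * pd i (pd j (f \<circ> param d)) y"
        by (rule pd_cmult[OF image_hopen[OF d] y smooth_on_pd[OF image_hopen[OF d] sf[OF d]]])
      also have "\<dots> = (\<Sum>k\<in>UNIV. christoffel (Gm d) k i j y * pd k (\<rho> \<circ> param d) y) - c * (\<rho> \<circ> param d) y * Gm d y $ i $ j"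
        by (simp add: hess[OF d y] d\<rho>[OF d y] distrib_left sum_distrib_left sum_negf mult_ac)
      finally show "pd i (pd j (\<rho> \<circ> param d)) y = (\<Sum>k\<in>UNIV. christoffel (Gm d) k i j y * pd k (\<rho> \<circ> param d) y) - c * (\<rho> \<circ> param d) y * Gm d y $ i $ j" .
    qed (rule s\<rho>[OF d])
  qed
  show ?thesis using c_positive isometric[OF assms(1)] by blast
qed

end
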